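(* Let $\beta=1/\nu$ with $\nu\in\{2,3,4,\ldots\}$ and let $f:\mathbb{R}^d\to\mathbb{R}$ be such that all its derivatives of order $2\nu-2$ are bounded and Hölder continuous with exponent $0<\alpha\le1$. Assume that, for every $j\in\mathbb{N}_n=\{1,\ldots,n\}$, a function $u:\mathbb{R}_+^n\times\mathbb{R}^d\to\mathbb{R}$ satisfies $$(\mathrm{I})\qquad \partial_{t_j}^{k\otimes\beta}u\Big|_{t_j=0}=\frac{\Gamma\left(\frac{k}{\nu}\right)E\left(\frac1\nu,k\right)^n\Delta_x^kf(x)\prod_{i\in\mathbb{N}_n\setminus\{j\}}t_i^{k/\nu}}{\nu\,2^k\,(k-1)!},\qquad k=1,\ldots,\nu-1.$$ Let $\mathscr U_\nu^{(j)},\mathscr V^{(j)}$ be real functions on $\mathbb{R}_+^n\times\mathbb{R}^d$, and let the systems $(\mathrm{P}_j)$ (order $2\nu$), $(\mathrm{R}_j)$ (fractional) and the condition $(\mathrm{C}_j)$ be as defined in the context. (1) If the pair $\{\mathscr U_\nu^{(j^* )},\mathscr V^{(j^* )}\}$ satisfies $(\mathrm{C}_{j^*})$ for some $j^*\in\mathbb{N}_n$ (all the derivatives exist and are continuous), then $\{u,\mathscr V^{(j^* )}\}$ satisfies $(\mathrm{R}_{j^*})$ if and only if $\{u,\mathscr U_\nu^{(j^* )}\}$ satisfies $(\mathrm{P}_{j^*})$. (2) Conversely, if $(\mathrm{I})$, $(\mathrm{R}_{j^*})$ and $(\mathrm{P}_{j^*})$ are satisfied by $\{u,\mathscr V^{(j^*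 )}\}$ and $\{u,\mathscr U_\nu^{(j^* )}\}$ for $j^*\in\mathbb{N}_n$, then $(\mathrm{C}_{j^*})$ holds. (3) In particular, under $(\mathrm{I})$, the high order system $\{(\mathrm{P}_j)\}_{j\in\mathbb{N}_n}$ and the fractional system $\{(\mathrm{R}_j)\}_{j\in\mathbb{N}_n}$ are equivalent iff $\{\mathscr U_\nu^{(j)},\mathscr V^{(j)}\}_{j\in\mathbb{N}_n}$ satisfies $(\mathrm{C}_j)$ for all $j\in\mathbb{N}_n$, in the following sense: if $(\mathrm{C}_j)$ holds for all $j$, then $\{u,\mathscr U_\nu^{(j)}\}_j$ solves $\{(\mathrm{P}_j)\}_j$ iff $\{u,\mathscr V^{(j)}\}_j$ solves $\{(\mathrm{R}_j)\}_j$; and if both families, with the common $u$, solve the respective systems, then $(\mathrm{C}_j)$ holds for all $j$. (4) If $u,\mathscr U_\nu^{(j)},\mathscr V^{(j)}$ are the inverse-stable-Lévy-time Brownian sheet functionals $$u=\mathbb{E}\big[f(\mathbb{W}^x_\Lambda(\mathbf t))\big],\quad \mathscr U_\nu^{(j)}=\mathbb{E}\Big[\Big(\prod_{i\neq j}\Lambda^{(i)}(t_i)\Big)^\nu f(\mathbb{W}^x_\Lambda(\mathbf t))\Big],\quad \mathscr V^{(j)}=\mathbb{E}\Big[\Big(\prod_{i\neq j}\Lambda^{(i)}(t_i)\Big) f(\mathbb{W}^x_\Lambda(\mathbf t))\Big],$$ then $(\mathrm{C}_j)$ and $(\mathrm{I})$ are satisfied for every $j\in\mathbb{N}_n$. (5)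 If $n=1$, then $u=\mathscr U_\nu^{(1)}=\mathscr V^{(1)}$, the one-parameter versions of $(\mathrm{C}_1)$ and $(\mathrm{I})$ are satisfied, and the equivalence between $(\mathrm{R}_1)$ and $(\mathrm{P}_1)$ holds.
   Context: $\mathbb{R}_+=[0,\infty)$, $\mathbf t=(t_1,\ldots,t_n)$, $\partial\mathbb{R}_+^n$ is the set of $\mathbf t\in\mathbb{R}_+^n$ with at least one zero coordinate; empty products equal $1$; products over $i\ne j$ run over $i\in\mathbb{N}_n\setminus\{j\}$. $\Delta_x$ is the Laplacian in $x\in\mathbb{R}^d$. All equations below hold for every $x\in\mathbb{R}^d$. Caputo derivative of order $0<\beta<1$ in a time variable $t$ (other variables fixed), for functions $C^1$ in that variable: $\partial_t^\beta u(t)=\frac1{\Gamma(1-\beta)}\int_0^t\partial_su(s)\frac{ds}{(t-s)^\beta}$. $\partial_t^{k\otimes\beta}$ denotes the $k$-fold iteration of $\partial_t^\beta$. $\beta$-inverse Lévy motion: $L$ is the $\beta$-stable subordinator with $\mathbb{E}[e^{-sL(t)}]=e^{-ts^\beta}$, $\Lambda(t)=\inf\{x:L(x)>t\}$, and $E(\beta,\gamma)=\mathbb{E}[\Lambda(1)^\gamma]=\mathbb{E}[L(1)^{-\gamma\beta}]$ for $\gamma>-1$. Inverse-stable-Lévy-time Brownian sheet: $W^0$ is an $n$-parameter $\mathbb{R}^d$-valued Brownian sheet with independent coordinates vanishing on $\partial\mathbb{R}_+^n$, $W^x=W^0+x$; $\Lambda^{(1)},\ldots,\Lambda^{(n)}$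 are independent copies of $\Lambda$, independent of $W^0$; $\mathbb{W}^x_\Lambda(\mathbf t)=W^x(\Lambda^{(1)}(t_1),\ldots,\Lambda^{(n)}(t_n))$. Put $N_\nu^{(j)}(\mathbf t)=E(1/\nu,\nu)^{n-1}\prod_{i\ne j}t_i$ and $M_\kappa^{(j)}(\mathbf t)=\frac{E(1/\nu,\kappa)^n}{\kappa!}\prod_{i\in\mathbb{N}_n}t_i^{\kappa/\nu}$. System $(\mathrm{R}_j)$ for $\{u,\mathscr V^{(j)}\}$: (a) $\partial_{t_j}^\beta u=\frac12\Delta_x\mathscr V^{(j)}$ for $\mathbf t\in(0,\infty)^n$; (b) $u(\mathbf t,x)=f(x)$ for $\mathbf t\in\partial\mathbb{R}_+^n$; (c) $\mathscr V^{(j)}(\mathbf t,x)=0$ if $t_i=0$ for some $i\ne j$; (d) $\mathscr V^{(j)}(\mathbf t,x)=\big[\prod_{i\ne j}E(\beta,1)t_i^\beta\big]f(x)$ if $t_j=0$. System $(\mathrm{P}_j)$ for $\{u,\mathscr U_\nu^{(j)}\}$: (a) $\partial_{t_j}u=\sum_{\kappa=1}^{\nu-1}\frac{\Delta_x^\kappa f}{2^\kappa}\partial_{t_j}M_\kappa^{(j)}+\frac1{2^\nu}\Delta_x^\nu\mathscr U_\nu^{(j)}$ for $\mathbf t\in(0,\infty)^n$; (b) $u(\mathbf t,x)=f(x)$ for $\mathbf t\in\partial\mathbb{R}_+^n$; (c) $\mathscr U_\nu^{(j)}(\mathbf t,x)=0$ if $t_i=0$ for some $i\ne j$; (d) $\mathscr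 U_\nu^{(j)}(\mathbf t,x)=f(x)N_\nu^{(j)}(\mathbf t)$ if $t_j=0$. Condition $(\mathrm{C}_j)$ on $\{\mathscr U_\nu^{(j)},\mathscr V^{(j)}\}$: (a) $2^{\nu-1}\Delta_x\big(\partial_{t_j}^{(\nu-1)\otimes\beta}\mathscr V^{(j)}\big)=\Delta_x^\nu\mathscr U_\nu^{(j)}$ for $\mathbf t\in(0,\infty)^n$; (b) $\mathscr U_\nu^{(j)}(\mathbf t,x)=f(x)N_\nu^{(j)}(\mathbf t)$ if $t_j=0$; (c) $\mathscr V^{(j)}(\mathbf t,x)=f(x)\prod_{i\ne j}E(1/\nu,1)t_i^\beta$ if $t_j=0$; (d) $\mathscr V^{(j)}(\mathbf t,x)=\mathscr U_\nu^{(j)}(\mathbf t,x)=0$ if $t_i=0$ for some $i\ne j$.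
   Formalization: In (1),(3), (P)⇒(R) also assumes, for 1≤k≤ν−2, that ½Δ_x∂^{k⊗β}V at t_j=0 equals the right side of (I) with k+1 (false otherwise: f=u=U=0, V=t^{1/ν}x²); the regularity "all derivatives exist and are continuous" for V (mixed, Δ_xV up to the boundary) is assumed in (1)–(3). *)

theory Defs
  imports "HOL-Probability.Probability"
begin

text \<open>
  Times are vectors \<open>t :: real^'n\<close> and space points are vectors \<open>x :: real^'d\<close>, so that
  \<open>n = CARD('n)\<close>, \<open>d = CARD('d)\<close>, and the index \<open>j\<close> ranges over \<open>'n\<close>.  Space-time functions are
  curried, \<open>u t x\<close>; their values at times outside the closed orthant are never used.
\<close>

section \<open>Derivatives in space\<close>

definition pdx :: "'d::finite \<Rightarrow> (real^'d \<Rightarrow> real) \<Rightarrow> real^'d \<Rightarrow> real" where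
  "pdx i g x = deriv (\<lambda>h. g (x + h *\<^sub>R axis i 1)) 0"

definition pdxs :: "'d::finite list \<Rightarrow> (real^'d \<Rightarrow> real) \<Rightarrow> real^'d \<Rightarrow> real" where
  "pdxs is g = foldr pdx is g"

definition laplacian :: "(real^'d::finite \<Rightarrow> real) \<Rightarrow> real^'d \<Rightarrow> real" where
  "laplacian g x = (\<Sum>i\<in>UNIV. pdx i (pdx i g) x)"

definition pdx_exist :: "nat \<Rightarrow> (real^'d::finite \<Rightarrow> real) \<Rightarrow> bool" where
  "pdx_exist m g \<longleftrightarrow>
     (\<forall>is i x. length is < m \<longrightarrow>
        (\<lambda>h. pdxs is g (x + h *\<^sub>R axis i 1)) field_differentiable at 0)"

definition bounded_holder_derivs :: "nat \<Rightarrow> real \<Rightarrow> (real^'d::finite \<Rightarrow> real) \<Rightarrow> bool" where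
  "bounded_holder_derivs m \<alpha> g \<longleftrightarrow>
     pdx_exist m g \<and>
     (\<forall>is. length is = m \<longrightarrow>
        bounded (range (pdxs is g)) \<and>
        (\<exists>C. \<forall>x y. \<bar>pdxs is g x - pdxs is g y\<bar> \<le> C * dist x y powr \<alpha>))"

section \<open>Time domain and derivatives in time\<close>

definition orthant :: "(real^'n::finite) set" where
  "orthant = {t. \<forall>i. 0 \<le> t $ i}"

definition open_orthant :: "(real^'n::finite) set" where
  "open_orthant = {t. \<forall>i. 0 < t $ i}"

definition orthant_boundary :: "(real^'n::finite) set" where
  "orthant_boundary = {t \<in> orthant. \<exists>i. t $ i = 0}"

definition upd :: "real^'n::finite \<Rightarrow> 'n \<Rightarrow> real \<Rightarrow> real^'n" where
  "upd t j s = (\<chi> i. if i = j then s else t $ i)"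

definition dt ::
  "'n::finite \<Rightarrow> (real^'n \<Rightarrow> real^'d::finite \<Rightarrow> real) \<Rightarrow> real^'n \<Rightarrow> real^'d \<Rightarrow> real" where
  "dt j g t x = deriv (\<lambda>s. g (upd t j s) x) (t $ j)"

definition caputo :: "real \<Rightarrow> (real \<Rightarrow> real) \<Rightarrow> real \<Rightarrow> real" where
  "caputo \<beta> g t =
     1 / Gamma (1 - \<beta>) * (LINT s:{0<..<t}|lborel. deriv g s / (t - s) powr \<beta>)"

text \<open>
  The functions of interest behave like \<open>t powr \<beta>\<close> at the origin, so \<open>C\<^sup>1\<close> can only be
  required on \<open>(0,\<infinity>)\<close>; the derivative has to be integrable near \<open>0\<close> against the kernel.
\<close>

definition caputo_diff :: "real \<Rightarrow> (real \<Rightarrow> real) \<Rightarrow> bool" where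
  "caputo_diff \<beta> g \<longleftrightarrow>
     (\<forall>t>0. g field_differentiable at t) \<and>
     continuous_on {0<..} (deriv g) \<and>
     (\<forall>t>0. set_integrable lborel {0<..<t} (\<lambda>s. deriv g s / (t - s) powr \<beta>))"

definition caputo_diff_iter :: "real \<Rightarrow> nat \<Rightarrow> (real \<Rightarrow> real) \<Rightarrow> bool" where
  "caputo_diff_iter \<beta> k g \<longleftrightarrow> (\<forall>m<k. caputo_diff \<beta> ((caputo \<beta> ^^ m) g))"

definition caputo_dt ::
  "real \<Rightarrow> 'n::finite \<Rightarrow> (real^'n \<Rightarrow> real^'d::finite \<Rightarrow> real) \<Rightarrow> real^'n \<Rightarrow> real^'d \<Rightarrow> real" where
  "caputo_dt \<beta> j g t x = caputo \<beta> (\<lambda>s. g (upd t j s) x) (t $ j)"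

section \<open>Regularity in space and time\<close>

definition jointly_continuous ::
  "(real^'n::finite) set \<Rightarrow> (real^'n \<Rightarrow> real^'d::finite \<Rightarrow> real) \<Rightarrow> bool" where
  "jointly_continuous S g \<longleftrightarrow> continuous_on (S \<times> UNIV) (\<lambda>(t, x). g t x)"

definition space_C ::
  "nat \<Rightarrow> (real^'n::finite) set \<Rightarrow> (real^'n \<Rightarrow> real^'d::finite \<Rightarrow> real) \<Rightarrow> bool" where
  "space_C m S g \<longleftrightarrow>
     (\<forall>t\<in>S. pdx_exist m (g t)) \<and>
     (\<forall>is. length is \<le> m \<longrightarrow> jointly_continuous S (\<lambda>t. pdxs is (g t)))"

text \<open>
  ``All the derivatives exist and are continuous'' for \<open>V\<close>: the space derivatives of order at
  most \<open>2\<close> are continuous up to the boundary of the time domain, and all mixed derivatives,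
  in either order, of order at most \<open>2\<close> in space and at most \<open>(\<nu> - 1)\<otimes>\<beta>\<close> in \<open>t\<^sub>j\<close> (as well as the
  ordinary \<open>t\<^sub>j\<close>-derivatives that enter the Caputo integrals) are continuous at interior times.
\<close>

definition mixed_C ::
  "real \<Rightarrow> nat \<Rightarrow> 'n::finite \<Rightarrow> (real^'n \<Rightarrow> real^'d::finite \<Rightarrow> real) \<Rightarrow> bool" where
  "mixed_C \<beta> \<nu> j V \<longleftrightarrow>
     space_C 2 orthant V \<and>
     (\<forall>k\<le>\<nu> - 1. space_C 2 open_orthant ((caputo_dt \<beta> j ^^ k) V)) \<and>
     (\<forall>is. length is \<le> 2 \<longrightarrow>
        (\<forall>t\<in>open_orthant. \<forall>x.
           caputo_diff_iter \<beta> (\<nu> - 1) (\<lambda>s. pdxs is (V (upd t j s)) x)) \<and>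
        (\<forall>k\<le>\<nu> - 1.
           jointly_continuous open_orthant ((caputo_dt \<beta> j ^^ k) (\<lambda>t. pdxs is (V t)))) \<and>
        (\<forall>k<\<nu> - 1.
           jointly_continuous open_orthant (dt j ((caputo_dt \<beta> j ^^ k) (\<lambda>t. pdxs is (V t))))))"

section \<open>Stable subordinators, their inverses, and the time-changed Brownian sheet\<close>

text \<open>
  The path properties are imposed for every \<open>\<omega>\<close>, not just almost surely, because expectations of
  functions of the inverse process (and of the sheet evaluated at it) need measurability and
  \<open>M\<close> is not assumed complete.
\<close>

definition stable_subordinator :: "'w measure \<Rightarrow> real \<Rightarrow> (real \<Rightarrow> 'w \<Rightarrow> real) \<Rightarrow> bool" where
  "stable_subordinator M \<beta> L \<longleftrightarrow>
     (\<forall>t\<ge>0. L t \<in> borel_measurable M) \<and>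
     (\<forall>\<omega>\<in>space M.
        L 0 \<omega> = 0 \<and>
        mono_on {0..} (\<lambda>t. L t \<omega>) \<and>
        (\<forall>t\<ge>0. continuous (at_right t) (\<lambda>s. L s \<omega>)) \<and>
        filterlim (\<lambda>t. L t \<omega>) at_top at_top) \<and>
     (\<forall>(\<tau>::nat \<Rightarrow> real) m. 0 \<le> \<tau> 0 \<and> mono \<tau> \<longrightarrow>
        prob_space.indep_vars M (\<lambda>_. borel) (\<lambda>k \<omega>. L (\<tau> (Suc k)) \<omega> - L (\<tau> k) \<omega>) {..<m}) \<and>
     (\<forall>s\<ge>0. \<forall>t\<ge>0. distr M borel (\<lambda>\<omega>. L (s + t) \<omega> - L s \<omega>) = distr M borel (L t)) \<and>
     (\<forall>s\<ge>0. \<forall>t\<ge>0. (LINT \<omega>|M. exp (- s * L t \<omega>)) = exp (- t * s powr \<beta>))"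

definition inverse_process :: "(real \<Rightarrow> 'w \<Rightarrow> real) \<Rightarrow> real \<Rightarrow> 'w \<Rightarrow> real" where
  "inverse_process L t \<omega> = Inf {x. 0 \<le> x \<and> L x \<omega> > t}"

text \<open>For a \<open>\<beta>\<close>-stable subordinator \<open>L\<close> this is the moment \<open>E(\<beta>,\<gamma>)\<close>.\<close>

definition inverse_moment :: "'w measure \<Rightarrow> (real \<Rightarrow> 'w \<Rightarrow> real) \<Rightarrow> real \<Rightarrow> real" where
  "inverse_moment M L \<gamma> = (LINT \<omega>|M. inverse_process L 1 \<omega> powr \<gamma>)"

definition centered_gaussian :: "'w measure \<Rightarrow> ('w \<Rightarrow> real) \<Rightarrow> real \<Rightarrow> bool" where
  "centered_gaussian M X v \<longleftrightarrow>
     (if v = 0 then AE \<omega> in M. X \<omega> = 0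
      else distributed M lborel X (normal_density 0 (sqrt v)))"

definition brownian_sheet :: "'w measure \<Rightarrow> (real^'n::finite \<Rightarrow> 'w \<Rightarrow> real) \<Rightarrow> bool" where
  "brownian_sheet M B \<longleftrightarrow>
     (\<forall>t\<in>orthant. B t \<in> borel_measurable M) \<and>
     (\<forall>\<omega>\<in>space M.
        continuous_on orthant (\<lambda>t. B t \<omega>) \<and> (\<forall>t\<in>orthant_boundary. B t \<omega> = 0)) \<and>
     (\<forall>F c. finite F \<and> F \<subseteq> orthant \<longrightarrow>
        centered_gaussian M (\<lambda>\<omega>. \<Sum>t\<in>F. c t * B t \<omega>)
          (\<Sum>s\<in>F. \<Sum>t\<in>F. c s * c t * (\<Prod>i\<in>UNIV. min (s $ i) (t $ i))))"

definition process_events ::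
  "'w measure \<Rightarrow> 't set \<Rightarrow> ('t \<Rightarrow> 'w \<Rightarrow> 'b::topological_space) \<Rightarrow> 'w set set" where
  "process_events M T X =
     sigma_sets (space M) {X t -` A \<inter> space M | t A. t \<in> T \<and> A \<in> sets borel}"

definition brownian_sheet_vec ::
  "'w measure \<Rightarrow> (real^'n::finite \<Rightarrow> 'w \<Rightarrow> real^'d::finite) \<Rightarrow> bool" where
  "brownian_sheet_vec M W \<longleftrightarrow>
     (\<forall>k. brownian_sheet M (\<lambda>t \<omega>. W t \<omega> $ k)) \<and>
     prob_space.indep_sets M (\<lambda>k. process_events M orthant (\<lambda>t \<omega>. W t \<omega> $ k)) UNIV"

definition isl_sheet ::
  "'w measure \<Rightarrow> real \<Rightarrow> (real^'n::finite \<Rightarrow> 'w \<Rightarrow> real^'d::finite) \<Rightarrow>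
    ('n \<Rightarrow> real \<Rightarrow> 'w \<Rightarrow> real) \<Rightarrow> bool" where
  "isl_sheet M \<beta> W Ls \<longleftrightarrow>
     brownian_sheet_vec M W \<and>
     (\<forall>i. stable_subordinator M \<beta> (Ls i)) \<and>
     prob_space.indep_sets M
       (\<lambda>c. case c of
           None \<Rightarrow> process_events M orthant W
         | Some i \<Rightarrow> process_events M {0..} (inverse_process (Ls i))) UNIV"

definition levy_time_sheet ::
  "(real^'n::finite \<Rightarrow> 'w \<Rightarrow> real^'d::finite) \<Rightarrow> ('n \<Rightarrow> real \<Rightarrow> 'w \<Rightarrow> real) \<Rightarrow>
    real^'d \<Rightarrow> real^'n \<Rightarrow> 'w \<Rightarrow> real^'d" where
  "levy_time_sheet W Ls x t \<omega> = W (\<chi> i. inverse_process (Ls i) (t $ i) \<omega>) \<omega> + x"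

definition isl_u ::
  "'w measure \<Rightarrow> (real^'n::finite \<Rightarrow> 'w \<Rightarrow> real^'d::finite) \<Rightarrow> ('n \<Rightarrow> real \<Rightarrow> 'w \<Rightarrow> real) \<Rightarrow>
    (real^'d \<Rightarrow> real) \<Rightarrow> real^'n \<Rightarrow> real^'d \<Rightarrow> real" where
  "isl_u M W Ls f t x = (LINT \<omega>|M. f (levy_time_sheet W Ls x t \<omega>))"

definition isl_U ::
  "'w measure \<Rightarrow> (real^'n::finite \<Rightarrow> 'w \<Rightarrow> real^'d::finite) \<Rightarrow> ('n \<Rightarrow> real \<Rightarrow> 'w \<Rightarrow> real) \<Rightarrow>
    (real^'d \<Rightarrow> real) \<Rightarrow> nat \<Rightarrow> 'n \<Rightarrow> real^'n \<Rightarrow> real^'d \<Rightarrow> real" where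
  "isl_U M W Ls f \<nu> j t x =
     (LINT \<omega>|M. (\<Prod>i\<in>UNIV - {j}. inverse_process (Ls i) (t $ i) \<omega>) ^ \<nu> *
        f (levy_time_sheet W Ls x t \<omega>))"

definition isl_V ::
  "'w measure \<Rightarrow> (real^'n::finite \<Rightarrow> 'w \<Rightarrow> real^'d::finite) \<Rightarrow> ('n \<Rightarrow> real \<Rightarrow> 'w \<Rightarrow> real) \<Rightarrow>
    (real^'d \<Rightarrow> real) \<Rightarrow> 'n \<Rightarrow> real^'n \<Rightarrow> real^'d \<Rightarrow> real" where
  "isl_V M W Ls f j t x =
     (LINT \<omega>|M. (\<Prod>i\<in>UNIV - {j}. inverse_process (Ls i) (t $ i) \<omega>) *
        f (levy_time_sheet W Ls x t \<omega>))"

section \<open>The initial condition, the two systems, and the linking condition\<close>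

text \<open>The argument \<open>E\<close> below stands for the moment function \<open>E(1/\<nu>, \<cdot>)\<close>.\<close>

definition N_fun :: "(real \<Rightarrow> real) \<Rightarrow> nat \<Rightarrow> 'n::finite \<Rightarrow> real^'n \<Rightarrow> real" where
  "N_fun E \<nu> j t = E (real \<nu>) ^ (CARD('n) - 1) * (\<Prod>i\<in>UNIV - {j}. t $ i)"

definition M_fun :: "(real \<Rightarrow> real) \<Rightarrow> nat \<Rightarrow> nat \<Rightarrow> real^'n::finite \<Rightarrow> real" where
  "M_fun E \<nu> \<kappa> t =
     E (real \<kappa>) ^ CARD('n) / fact \<kappa> * (\<Prod>i\<in>UNIV. t $ i powr (real \<kappa> / real \<nu>))"

definition initial_datum ::
  "(real \<Rightarrow> real) \<Rightarrow> nat \<Rightarrow> (real^'d::finite \<Rightarrow> real) \<Rightarrow> 'n::finite \<Rightarrow> nat \<Rightarrow>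
    real^'n \<Rightarrow> real^'d \<Rightarrow> real" where
  "initial_datum E \<nu> f j k t x =
     Gamma (real k / real \<nu>) * E (real k) ^ CARD('n) * (laplacian ^^ k) f x *
       (\<Prod>i\<in>UNIV - {j}. t $ i powr (real k / real \<nu>)) /
     (real \<nu> * 2 ^ k * fact (k - 1))"

text \<open>
  The value at \<open>t\<^sub>j = 0\<close> of a Caputo derivative is its limit as \<open>t\<^sub>j\<close> decreases to \<open>0\<close> (the integral
  itself is over an empty interval at \<open>t\<^sub>j = 0\<close>).
\<close>

definition cond_I ::
  "real \<Rightarrow> (real \<Rightarrow> real) \<Rightarrow> nat \<Rightarrow> (real^'d::finite \<Rightarrow> real) \<Rightarrow> 'n::finite \<Rightarrow>
    (real^'n \<Rightarrow> real^'d \<Rightarrow> real) \<Rightarrow> bool" where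
  "cond_I \<beta> E \<nu> f j u \<longleftrightarrow>
     (\<forall>k\<in>{1..\<nu> - 1}. \<forall>t\<in>orthant. \<forall>x.
        caputo_diff_iter \<beta> k (\<lambda>s. u (upd t j s) x) \<and>
        ((\<lambda>s. (caputo_dt \<beta> j ^^ k) u (upd t j s) x) \<longlongrightarrow> initial_datum E \<nu> f j k t x)
          (at_right 0))"

definition system_R ::
  "real \<Rightarrow> (real \<Rightarrow> real) \<Rightarrow> (real^'d::finite \<Rightarrow> real) \<Rightarrow> 'n::finite \<Rightarrow>
    (real^'n \<Rightarrow> real^'d \<Rightarrow> real) \<Rightarrow> (real^'n \<Rightarrow> real^'d \<Rightarrow> real) \<Rightarrow> bool" where
  "system_R \<beta> E f j u V \<longleftrightarrow>
     space_C 2 open_orthant V \<and>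
     (\<forall>t\<in>open_orthant. \<forall>x.
        caputo_diff \<beta> (\<lambda>s. u (upd t j s) x) \<and>
        caputo_dt \<beta> j u t x = 1/2 * laplacian (V t) x) \<and>
     (\<forall>t\<in>orthant_boundary. \<forall>x. u t x = f x) \<and>
     (\<forall>t\<in>orthant. \<forall>x. (\<exists>i. i \<noteq> j \<and> t $ i = 0) \<longrightarrow> V t x = 0) \<and>
     (\<forall>t\<in>orthant. \<forall>x. t $ j = 0 \<longrightarrow>
        V t x = (\<Prod>i\<in>UNIV - {j}. E 1 * t $ i powr \<beta>) * f x)"

definition system_P ::
  "(real \<Rightarrow> real) \<Rightarrow> nat \<Rightarrow> (real^'d::finite \<Rightarrow> real) \<Rightarrow> 'n::finite \<Rightarrow>
    (real^'n \<Rightarrow> real^'d \<Rightarrow> real) \<Rightarrow> (real^'n \<Rightarrow> real^'d \<Rightarrow> real) \<Rightarrow> bool" where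
  "system_P E \<nu> f j u U \<longleftrightarrow>
     space_C (2 * \<nu>) open_orthant U \<and>
     (\<forall>t\<in>open_orthant. \<forall>x.
        (\<lambda>s. u (upd t j s) x) field_differentiable at (t $ j) \<and>
        dt j u t x =
          (\<Sum>\<kappa>=1..\<nu> - 1. (laplacian ^^ \<kappa>) f x / 2 ^ \<kappa> * dt j (\<lambda>t _. M_fun E \<nu> \<kappa> t) t x) +
          1 / 2 ^ \<nu> * (laplacian ^^ \<nu>) (U t) x) \<and>
     (\<forall>t\<in>orthant_boundary. \<forall>x. u t x = f x) \<and>
     (\<forall>t\<in>orthant. \<forall>x. (\<exists>i. i \<noteq> j \<and> t $ i = 0) \<longrightarrow> U t x = 0) \<and>
     (\<forall>t\<in>orthant. \<forall>x. t $ j = 0 \<longrightarrow> U t x = f x * N_fun E \<nu> j t)"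

definition cond_C ::
  "real \<Rightarrow> (real \<Rightarrow> real) \<Rightarrow> nat \<Rightarrow> (real^'d::finite \<Rightarrow> real) \<Rightarrow> 'n::finite \<Rightarrow>
    (real^'n \<Rightarrow> real^'d \<Rightarrow> real) \<Rightarrow> (real^'n \<Rightarrow> real^'d \<Rightarrow> real) \<Rightarrow> bool" where
  "cond_C \<beta> E \<nu> f j U V \<longleftrightarrow>
     space_C (2 * \<nu>) open_orthant U \<and>
     space_C 2 open_orthant ((caputo_dt \<beta> j ^^ (\<nu> - 1)) V) \<and>
     (\<forall>t\<in>open_orthant. \<forall>x.
        caputo_diff_iter \<beta> (\<nu> - 1) (\<lambda>s. V (upd t j s) x) \<and>
        2 ^ (\<nu> - 1) * laplacian ((caputo_dt \<beta> j ^^ (\<nu> - 1)) V t) x =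
          (laplacian ^^ \<nu>) (U t) x) \<and>
     (\<forall>t\<in>orthant. \<forall>x. t $ j = 0 \<longrightarrow> U t x = f x * N_fun E \<nu> j t) \<and>
     (\<forall>t\<in>orthant. \<forall>x. t $ j = 0 \<longrightarrow>
        V t x = f x * (\<Prod>i\<in>UNIV - {j}. E 1 * t $ i powr \<beta>)) \<and>
     (\<forall>t\<in>orthant. \<forall>x. (\<exists>i. i \<noteq> j \<and> t $ i = 0) \<longrightarrow> V t x = 0 \<and> U t x = 0)"

text \<open>
  Initial values of the intermediate Caputo derivatives of \<open>V\<close>.  If \<open>u\<close> satisfies \<open>cond_I\<close> and
  \<open>system_R\<close> holds, these values are forced; \<open>cond_C\<close> prescribes only \<open>V\<close> itself at \<open>t\<^sub>j = 0\<close>.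
  For \<open>\<nu> = 2\<close> there is no such \<open>k\<close>.  For \<open>\<nu> \<ge> 3\<close> one cannot return from \<open>system_P\<close> to \<open>system_R\<close>
  without them: take \<open>n = d = 1\<close>, \<open>f = u = U = 0\<close> and \<open>V t x = t powr (1/\<nu>) * x\<^sup>2\<close>, whose second
  iterated Caputo derivative vanishes.
\<close>

definition caputo_traces ::
  "real \<Rightarrow> (real \<Rightarrow> real) \<Rightarrow> nat \<Rightarrow> (real^'d::finite \<Rightarrow> real) \<Rightarrow> 'n::finite \<Rightarrow>
    (real^'n \<Rightarrow> real^'d \<Rightarrow> real) \<Rightarrow> bool" where
  "caputo_traces \<beta> E \<nu> f j V \<longleftrightarrow>
     (\<forall>k. 1 \<le> k \<and> k + 2 \<le> \<nu> \<longrightarrow> (\<forall>t\<in>open_orthant. \<forall>x.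
        ((\<lambda>s. 1/2 * laplacian ((caputo_dt \<beta> j ^^ k) V (upd t j s)) x) \<longlongrightarrow>
           initial_datum E \<nu> f j (k + 1) t x) (at_right 0)))"

end

theory Submission
  imports Defs
begin

text \<open>
  Deterministic part: since \<open>\<nu>\<beta> = 1\<close>, Taylor expansion of \<open>v = \<partial>\<^sup>\<beta> u\<close> to order \<open>\<nu> - 1\<close> in iterated
  Caputo derivatives and injectivity of the Riemann-Liouville integral turn \<open>\<partial>\<^sup>\<beta> u = v\<close> into an
  ordinary equation for \<open>\<partial>u\<close>, whose singular terms carry the traces of \<open>v\<close>; \<open>\<Delta>\<close> passes through the
  Caputo derivatives.  Probabilistic part: given the clocks, the sheet is Gaussian, so the functionals
  are averages of the heat flow of \<open>f\<close>.  As \<open>\<partial>\<^sup>\<beta> E[\<phi>(\<Lambda>(t))] = E[\<phi>'(\<Lambda>(t))]\<close>, each Caputo derivative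
  becomes \<open>\<Delta>/2\<close> times one more clock factor, and Hoelder continuity makes the last one integrable.
\<close>

section \<open>Fractional calculus\<close>

text \<open>By self-similarity each clock at time t is t^\<beta> times a variable of law
  \<open>inverse_law\<close>. Hence every sheet functional is an integral of (\<theta> w)^k
  G(\<theta> \<tau> w y) over variables w, y of fixed law, and time enters only through \<theta>
  (the coordinates other than j) and \<tau> = t_j^\<beta>. A Caputo derivative in t_j differentiates
  G along \<tau>: it sends (k, G) to (k + 1, G'), and G' is \<Delta>/2 applied to G for the heat
  flow. Taking \<nu> - 1 derivatives of the functional with one clock factor and then \<Delta>/2
  therefore lands on the same average as (\<Delta>/2)^\<nu> of the functional with \<nu> factors;
  this is where the linking condition comes from. The obstacle is that f has only 2\<nu> - 2
  derivatives while 2\<nu> are taken. The last two fall on the Gaussian kernel at the price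
  \<sigma>^(-1), which the inverse stable law just fails to integrate: its moments are finite for
  orders above -1. Subtracting f's derivative at the centre gains \<sigma>^(\<alpha>/2), which
  suffices. In the deterministic part the linking condition fixes only the lowest trace of
  \<Delta>V/2 at t_j = 0; the higher ones come from (I) and (R) in one direction and from
  \<open>caputo_traces\<close> in the other.\<close>

lemma integral_tendsto_within:
  fixes F :: "'b::first_countable_topology \<Rightarrow> 'a \<Rightarrow> real"
  assumes m: "\<And>y. y \<in> S \<Longrightarrow> F y \<in> borel_measurable M" and fm: "f \<in> borel_measurable M"
    and w: "integrable M w"
    and b: "\<And>y. y \<in> S \<Longrightarrow> AE x in M. \<bar>F y x\<bar> \<le> w x"
    and lim: "AE x in M. ((\<lambda>y. F y x) \<longlongrightarrow> f x) (at a within S)"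
  shows "((\<lambda>y. integral\<^sup>L M (F y)) \<longlongrightarrow> integral\<^sup>L M f) (at a within S)"
  unfolding tendsto_at_iff_sequentially
proof (intro allI impI)
  fix X :: "nat \<Rightarrow> 'b" assume X: "\<forall>i. X i \<in> S - {a}" "X \<longlonglongrightarrow> a"
  show "((\<lambda>y. integral\<^sup>L M (F y)) \<circ> X) \<longlonglongrightarrow> integral\<^sup>L M f"
    unfolding comp_def
  proof (rule integral_dominated_convergence[OF fm _ w])
    show "AE x in M. (\<lambda>i. F (X i) x) \<longlonglongrightarrow> f x"
      using lim
    proof eventually_elim
      case (elim x)
      thus ?case using X unfolding tendsto_at_iff_sequentially comp_def by blast
    qed
    show "AE x in M. norm (F (X i) x) \<le> w x" for i
      using b[of "X i"] X by auto
  qed (use X m in auto)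
qed

lemma DERIV_cong_pos:
  assumes "(f has_real_derivative D) (at r)" "0 < r" "\<And>s. 0 < s \<Longrightarrow> f s = g s"
  shows "(g has_real_derivative D) (at r)"
  by (rule has_field_derivative_transform_within_open[OF assms(1), of "{0<..}"]) (simp_all add: assms)

section \<open>Riemann-Liouville integrals\<close>

definition rl_kernel :: "real \<Rightarrow> real \<Rightarrow> real" where
  "rl_kernel a x = (if 0 < x then x powr (a - 1) / Gamma a else 0)"

text \<open>Written as a convolution over the whole line: the kernel vanishes for s >= t and the
  indicator cuts at 0. Fubini and affine substitutions then need no interval bookkeeping, and the
  value at t <= 0 is 0.\<close>

definition rl_integral :: "real \<Rightarrow> (real \<Rightarrow> real) \<Rightarrow> real \<Rightarrow> real" where
  "rl_integral a h t = (LINT s|lborel. indicator {0<..} s * h s * rl_kernel a (t - s))"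

text \<open>Integrability is required up to the origin, where the derivatives of interest blow up.
  Measurability is stated for the restriction to positive arguments because values elsewhere are
  arbitrary.\<close>

definition locally_integrable :: "(real \<Rightarrow> real) \<Rightarrow> bool" where
  "locally_integrable h \<longleftrightarrow>
     (\<lambda>s. indicator {0<..} s * h s) \<in> borel_measurable borel \<and>
     (\<forall>t>0. set_integrable lborel {0<..<t} h)"

lemma rl_kernel_measurable [measurable]: "rl_kernel a \<in> borel_measurable borel"
  unfolding rl_kernel_def by measurable

lemma rl_kernel_nonneg: "0 < a \<Longrightarrow> 0 \<le> rl_kernel a x"
  by (auto simp: rl_kernel_def intro!: divide_nonneg_pos Gamma_real_pos)

lemma rl_kernel_one: "rl_kernel 1 x = indicator {0<..} x"
  by (auto simp: rl_kernel_def)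

text \<open>The substitution s = r + (t - r) x turns the convolution into the Beta integral of
  x^(b-1) (1-x)^(a-1), and B(b, a) = Gamma(a) Gamma(b) / Gamma(a+b) produces the normalisation of
  the kernel of order a + b.\<close>

lemma rl_kernel_convolution:
  assumes a: "0 < a" and b: "0 < b"
  shows "has_bochner_integral lborel (\<lambda>s. rl_kernel a (t - s) * rl_kernel b (s - r))
           (rl_kernel (a + b) (t - r))"
proof (cases "r < t")
  case False
  have "(\<lambda>s. rl_kernel a (t - s) * rl_kernel b (s - r)) = (\<lambda>_. 0)"
    using False by (auto simp: rl_kernel_def fun_eq_iff)
  moreover have "rl_kernel (a + b) (t - r) = 0" using False by (simp add: rl_kernel_def)
  ultimately show ?thesis by (simp only: has_bochner_integral_zero)
next
  case True
  have G: "Gamma a > 0" "Gamma b > 0" "Gamma (a + b) > 0"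
    using a b by (auto intro!: Gamma_real_pos)
  have "(LINT x:{0..1}|lborel. x powr (b - 1) * (1 - x) powr (a - 1)) = Beta b a"
    using set_borel_integral_eq_integral(2)[OF integrable_Beta[OF b a]]
      has_integral_Beta_real[OF b a] by (simp add: integral_unique)
  hence B: "has_bochner_integral lborel
      (\<lambda>x. indicator {0..1} x * (x powr (b - 1) * (1 - x) powr (a - 1))) (Beta b a)"
    using integrable_Beta[OF b a]
    by (simp add: has_bochner_integral_iff set_integrable_def set_lebesgue_integral_def)
  \<comment> \<open>The powers of t - r extracted from the two kernels, without the Jacobian of the
    substitution; the latter supplies the missing power below.\<close>
  define c where "c = (t - r) powr (a + b - 2) / (Gamma a * Gamma b)"
  have eq: "rl_kernel a (t - (r + (t - r) * x)) * rl_kernel b (r + (t - r) * x - r)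
      = c * (indicator {0..1} x * (x powr (b - 1) * (1 - x) powr (a - 1)))" for x
  proof (cases "0 < x \<and> x < 1")
    case x: True
    have 1: "t - (r + (t - r) * x) = (t - r) * (1 - x)" by (simp add: algebra_simps)
    have p: "0 < (t - r) * (1 - x)" "0 < (t - r) * x" using x True by auto
    have 2: "(t - r) powr (a + b - 2) = (t - r) powr (a - 1) * (t - r) powr (b - 1)"
      by (simp add: powr_add[symmetric])
    have 3: "r + (t - r) * x - r = (t - r) * x" by simp
    show ?thesis
      unfolding 1 3 rl_kernel_def if_P[OF p(1)] if_P[OF p(2)] using x True
      by (simp add: powr_mult 2 c_def)
  next
    case False
    have "x < 0 \<or> x = 0 \<or> x = 1 \<or> x > 1" using False by auto
    moreover have "rl_kernel b ((t - r) * x) = 0" if "x \<le> 0"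
      using that True by (auto simp: rl_kernel_def mult_less_0_iff zero_less_mult_iff)
    moreover have "rl_kernel a (t - (r + (t - r) * x)) = 0" if "x \<ge> 1"
    proof -
      have "t - (r + (t - r) * x) = (t - r) * (1 - x)" by (simp add: algebra_simps)
      thus ?thesis using that True by (auto simp: rl_kernel_def mult_less_0_iff zero_less_mult_iff)
    qed
    ultimately show ?thesis by (auto simp: indicator_def)
  qed
  have "has_bochner_integral lborel
      (\<lambda>x. rl_kernel a (t - (r + (t - r) * x)) * rl_kernel b (r + (t - r) * x - r)) (c * Beta b a)"
    unfolding eq using has_bochner_integral_mult_right[OF B, of c] by simp
  moreover have "c * Beta b a = rl_kernel (a + b) (t - r) /\<^sub>R \<bar>t - r\<bar>"
  proof -
    have "(t - r) powr (a + b - 1) = (t - r) powr (a + b - 2) * (t - r)"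
      using True powr_add[of "t - r" "a + b - 2" 1] by simp
    thus ?thesis
      using True G by (simp add: c_def Beta_def rl_kernel_def add.commute)
  qed
  ultimately show ?thesis
    using lborel_has_bochner_integral_real_affine_iff[of "t - r"
        "\<lambda>s. rl_kernel a (t - s) * rl_kernel b (s - r)" "rl_kernel (a + b) (t - r)" r] True
    by simp
qed

lemma rl_integral_nonpos: "t \<le> 0 \<Longrightarrow> rl_integral a h t = 0"
proof -
  assume "t \<le> 0"
  hence "(\<lambda>s. indicator {0<..} s * h s * rl_kernel a (t - s)) = (\<lambda>_. 0)"
    by (auto simp: fun_eq_iff indicator_def rl_kernel_def)
  thus ?thesis unfolding rl_integral_def by (simp only: Bochner_Integration.integral_zero)
qed

lemma rl_integral_cong:
  assumes "\<And>s. 0 < s \<Longrightarrow> s < t \<Longrightarrow> h s = k s"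
  shows "rl_integral a h t = rl_integral a k t"
  unfolding rl_integral_def
  by (intro Bochner_Integration.integral_cong) (auto simp: indicator_def rl_kernel_def assms)

lemma rl_integral_measurable:
  assumes [measurable]: "(\<lambda>s. indicator {0<..} s * h s) \<in> borel_measurable borel"
  shows "rl_integral a h \<in> borel_measurable borel"
  unfolding rl_integral_def[abs_def] by measurable

text \<open>Fubini on 0 < r < s < t combined with \<open>rl_kernel_convolution\<close>. Absolute
  integrability is the same computation with |h| for h, since the kernels are nonnegative.\<close>

lemma rl_integral_semigroup:
  assumes a: "0 < a" and b: "0 < b"
    and [measurable]: "(\<lambda>s. indicator {0<..} s * h s) \<in> borel_measurable borel"
    and int: "integrable lborel (\<lambda>s. indicator {0<..} s * h s * rl_kernel (a + b) (t - s))"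
  shows "integrable lborel (\<lambda>s. indicator {0<..} s * rl_integral b h s * rl_kernel a (t - s))" (is ?A)
    and "rl_integral a (rl_integral b h) t = rl_integral (a + b) h t" (is ?B)
proof -
  define f where "f = (\<lambda>r s. (indicator {0<..} r * h r) * (rl_kernel a (t - s) * rl_kernel b (s - r)))"
  have [measurable]: "(\<lambda>(r, s). f r s) \<in> borel_measurable (lborel \<Otimes>\<^sub>M lborel)"
    unfolding f_def by measurable
  note conv = rl_kernel_convolution[OF a b, of t, unfolded has_bochner_integral_iff]
  have fs: "integrable lborel (\<lambda>s. f r s)" "(\<integral>s. f r s \<partial>lborel) = indicator {0<..} r * h r * rl_kernel (a + b) (t - r)"
    for r unfolding f_def using conv[of r] by auto
  have "norm (f r s) = \<bar>indicator {0<..} r * h r\<bar> * (rl_kernel a (t - s) * rl_kernel b (s - r))" for r s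
    using rl_kernel_nonneg[OF a] rl_kernel_nonneg[OF b] by (simp add: f_def abs_mult)
  hence "(\<integral>s. norm (f r s) \<partial>lborel) = norm (indicator {0<..} r * h r * rl_kernel (a + b) (t - r))" for r
    using conv[of r] rl_kernel_nonneg[of "a + b"] a b by (simp add: abs_mult)
  hence "integrable lborel (\<lambda>r. \<integral>s. norm (f r s) \<partial>lborel)"
    using integrable_norm[OF int] by simp
  hence F: "integrable (lborel \<Otimes>\<^sub>M lborel) (\<lambda>(r, s). f r s)"
    using fs(1) by (intro lborel_pair.Fubini_integrable) auto
  have eq: "(\<integral>r. f r s \<partial>lborel) = indicator {0<..} s * rl_integral b h s * rl_kernel a (t - s)" for s
  proof -
    have "(\<integral>r. f r s \<partial>lborel) = rl_kernel a (t - s) * rl_integral b h s"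
      unfolding f_def rl_integral_def integral_mult_right_zero[symmetric]
      by (simp add: algebra_simps)
    thus ?thesis using rl_integral_nonpos[of s b h] by (auto simp: indicator_def)
  qed
  have "integrable lborel (\<lambda>s. \<integral>r. f r s \<partial>lborel)"
    by (rule lborel_pair.integrable_snd[OF F])
  thus ?A by (simp add: eq)
  show ?B
    using lborel_pair.Fubini_integral[OF F] by (simp add: eq fs(2) rl_integral_def)
qed

lemma locally_integrable_iff_kernel_one:
  "0 < t \<Longrightarrow> set_integrable lborel {0<..<t} h \<longleftrightarrow>
     integrable lborel (\<lambda>s. indicator {0<..} s * h s * rl_kernel 1 (t - s))"
  unfolding set_integrable_def rl_kernel_one
  by (intro Bochner_Integration.integrable_cong) (auto simp: indicator_def)

text \<open>The kernel may be singular at s = t and h at s = 0. Cutting at t/2 separates the two: on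
  (0, t/2] the kernel is bounded and h integrable, on [t/2, t] the roles are exchanged.\<close>

lemma locally_integrable_kernel:
  assumes h: "locally_integrable h" and c: "continuous_on {0<..} h" and a: "0 < a"
  shows "integrable lborel (\<lambda>s. indicator {0<..} s * h s * rl_kernel a (t - s))"
proof (cases "0 < t")
  case False
  hence "(\<lambda>s. indicator {0<..} s * h s * rl_kernel a (t - s)) = (\<lambda>_. 0)"
    by (auto simp: fun_eq_iff indicator_def rl_kernel_def)
  thus ?thesis by simp
next
  case True
  have [measurable]: "(\<lambda>s. indicator {0<..} s * h s) \<in> borel_measurable borel"
    using h by (simp add: locally_integrable_def)
  have "compact (h ` {t/2..t})"
    using True by (intro compact_continuous_image continuous_on_subset[OF c]) auto
  then obtain C where C: "\<And>s. s \<in> {t/2..t} \<Longrightarrow> \<bar>h s\<bar> \<le> C"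
    by (force dest!: compact_imp_bounded simp: bounded_iff)
  \<comment> \<open>On (0, t/2] the kernel is largest at s = t/2 if a < 1 and towards s = 0 if a >=
    1; the maximum covers both cases.\<close>
  define K where "K = (max ((t/2) powr (a - 1)) (t powr (a - 1))) / Gamma a"
  have Ga: "Gamma a > 0" using a by (rule Gamma_real_pos)
  have K0: "K \<ge> 0" using Ga unfolding K_def by (intro divide_nonneg_pos) (auto simp: le_max_iff_disj)
  have K: "rl_kernel a (t - s) \<le> K" if "0 < s" "s \<le> t/2" for s
  proof -
    have "(t - s) powr (a - 1) \<le> max ((t/2) powr (a - 1)) (t powr (a - 1))"
    proof (cases "a \<ge> 1")
      case True
      thus ?thesis using that by (intro max.coboundedI2 powr_mono2) auto
    next
      case False
      thus ?thesis using that by (intro max.coboundedI1 powr_mono2') auto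
    qed
    thus ?thesis using Ga that True by (auto simp: rl_kernel_def K_def divide_right_mono)
  qed
  \<comment> \<open>\<open>rl_kernel 1 (s - 0)\<close> is the indicator of s > 0, so this is
    integrability of the kernel itself over (0, t).\<close>
  have I1: "integrable lborel (\<lambda>s. rl_kernel a (t - s) * rl_kernel 1 (s - 0))"
    using rl_kernel_convolution[OF a, of 1 t 0] by (simp add: has_bochner_integral_iff)
  have I2: "integrable lborel (\<lambda>s. indicator {0<..} s * h s * rl_kernel 1 (t - s))"
    using h True by (simp add: locally_integrable_def locally_integrable_iff_kernel_one)
  have "integrable lborel (\<lambda>s. C * (rl_kernel a (t - s) * rl_kernel 1 (s - 0))
      + K * norm (indicator {0<..} s * h s * rl_kernel 1 (t - s)))"
    by (intro Bochner_Integration.integrable_add integrable_mult_right I1 integrable_norm I2)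
  thus ?thesis
  proof (rule Bochner_Integration.integrable_bound)
    show "(\<lambda>s. indicator {0<..} s * h s * rl_kernel a (t - s)) \<in> borel_measurable lborel"
      by measurable
    have C0: "C \<ge> 0" using C[of t] True by (auto intro: order_trans[OF abs_ge_zero])
    show "AE s in lborel. norm (indicator {0<..} s * h s * rl_kernel a (t - s)) \<le>
      norm (C * (rl_kernel a (t - s) * rl_kernel 1 (s - 0))
        + K * norm (indicator {0<..} s * h s * rl_kernel 1 (t - s)))"
    proof (rule AE_I2)
      fix s
      have nn: "0 \<le> rl_kernel a (t - s)" by (rule rl_kernel_nonneg[OF a])
      consider "s \<le> 0 \<or> s \<ge> t" | "0 < s" "s \<le> t/2" | "t/2 < s" "s < t" by linarith
      thus "norm (indicator {0<..} s * h s * rl_kernel a (t - s)) \<le>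
      norm (C * (rl_kernel a (t - s) * rl_kernel 1 (s - 0))
        + K * norm (indicator {0<..} s * h s * rl_kernel 1 (t - s)))"
      proof cases
        case 1
        thus ?thesis by (auto simp: rl_kernel_def)
      next
        case 2
        have "\<bar>h s\<bar> * rl_kernel a (t - s) \<le> K * \<bar>h s\<bar>"
          using mult_left_mono[OF K[OF 2], of "\<bar>h s\<bar>"] by (simp add: mult.commute)
        moreover have "0 \<le> C * rl_kernel a (t - s)" using C0 nn by simp
        ultimately have "\<bar>h s\<bar> * rl_kernel a (t - s) \<le> \<bar>C * rl_kernel a (t - s) + K * \<bar>h s\<bar>\<bar>"
          by linarith
        thus ?thesis using 2 True nn by (simp add: rl_kernel_one abs_mult)
      next
        case 3
        hence s: "0 < s" using True by simp
        have "\<bar>h s\<bar> * rl_kernel a (t - s) \<le> C * rl_kernel a (t - s)"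
          using 3 nn by (intro mult_right_mono C) auto
        moreover have "0 \<le> K * \<bar>h s\<bar>" using K0 by simp
        ultimately have "\<bar>h s\<bar> * rl_kernel a (t - s) \<le> \<bar>C * rl_kernel a (t - s) + K * \<bar>h s\<bar>\<bar>"
          by linarith
        thus ?thesis using 3 s nn by (simp add: rl_kernel_one abs_mult)
      qed
    qed
  qed
qed

text \<open>Integrating over (0, t) is the fractional integral of order 1, because
  \<open>rl_kernel 1\<close> is an indicator; the semigroup law with outer order 1 therefore gives
  the claim.\<close>

lemma locally_integrable_rl:
  assumes h: "locally_integrable h" and c: "continuous_on {0<..} h" and a: "0 < a"
  shows "locally_integrable (rl_integral a h)"
  unfolding locally_integrable_def
proof (intro conjI allI impI)
  have m: "(\<lambda>s. indicator {0<..} s * h s) \<in> borel_measurable borel"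
    using h by (simp add: locally_integrable_def)
  have [measurable]: "rl_integral a h \<in> borel_measurable borel"
    by (rule rl_integral_measurable[OF m])
  show "(\<lambda>s. indicator {0<..} s * rl_integral a h s) \<in> borel_measurable borel" by measurable
  fix t :: real assume t: "t > 0"
  have "integrable lborel (\<lambda>s. indicator {0<..} s * h s * rl_kernel (1 + a) (t - s))"
    using a by (intro locally_integrable_kernel h c) auto
  from rl_integral_semigroup(1)[OF _ a m this] t
  show "set_integrable lborel {0<..<t} (rl_integral a h)"
    by (simp add: locally_integrable_iff_kernel_one)
qed

lemma rl_integral_rl_integral:
  assumes h: "locally_integrable h" and c: "continuous_on {0<..} h" and a: "0 < a" and b: "0 < b"
  shows "rl_integral a (rl_integral b h) t = rl_integral (a + b) h t"
  using a b h
  by (intro rl_integral_semigroup(2) locally_integrable_kernel h c)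
    (auto simp: locally_integrable_def)

text \<open>The normalised power is \<open>rl_kernel b (s - 0)\<close> on s > 0, so this is the
  convolution of kernels with r = 0.\<close>

lemma rl_integral_powr:
  assumes a: "0 < a" and b: "0 < b"
  shows "integrable lborel (\<lambda>s. indicator {0<..} s * (s powr (b - 1) / Gamma b) * rl_kernel a (t - s))"
    and "0 < t \<Longrightarrow> rl_integral a (\<lambda>s. s powr (b - 1) / Gamma b) t = t powr (a + b - 1) / Gamma (a + b)"
proof -
  have eq: "(\<lambda>s. indicator {0<..} s * (s powr (b - 1) / Gamma b) * rl_kernel a (t - s))
    = (\<lambda>s. rl_kernel a (t - s) * rl_kernel b (s - 0))"
    by (auto simp: fun_eq_iff rl_kernel_def)
  note conv = rl_kernel_convolution[OF a b, of t 0, unfolded has_bochner_integral_iff]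
  show "integrable lborel (\<lambda>s. indicator {0<..} s * (s powr (b - 1) / Gamma b) * rl_kernel a (t - s))"
    unfolding eq using conv by simp
  show "rl_integral a (\<lambda>s. s powr (b - 1) / Gamma b) t = t powr (a + b - 1) / Gamma (a + b)" if "0 < t"
    unfolding rl_integral_def eq using conv that by (simp add: rl_kernel_def)
qed

lemma rl_integral_add:
  assumes "integrable lborel (\<lambda>s. indicator {0<..} s * h s * rl_kernel a (t - s))"
    and "integrable lborel (\<lambda>s. indicator {0<..} s * k s * rl_kernel a (t - s))"
  shows "integrable lborel (\<lambda>s. indicator {0<..} s * (h s + k s) * rl_kernel a (t - s))"
    and "rl_integral a (\<lambda>s. h s + k s) t = rl_integral a h t + rl_integral a k t"
  using Bochner_Integration.integral_add[OF assms] Bochner_Integration.integrable_add[OF assms]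
  unfolding rl_integral_def
  by (simp_all add: algebra_simps)

lemma rl_integral_sum:
  assumes "finite I" and
    "\<And>i. i \<in> I \<Longrightarrow> integrable lborel (\<lambda>s. indicator {0<..} s * h i s * rl_kernel a (t - s))"
  shows "integrable lborel (\<lambda>s. indicator {0<..} s * (\<Sum>i\<in>I. h i s) * rl_kernel a (t - s))
    \<and> rl_integral a (\<lambda>s. \<Sum>i\<in>I. h i s) t = (\<Sum>i\<in>I. rl_integral a (h i) t)"
  using assms
proof (induction I rule: finite_induct)
  case empty
  show ?case by (simp add: rl_integral_def)
next
  case (insert i I)
  show ?case
    using rl_integral_add[of "h i" a t "\<lambda>s. \<Sum>i\<in>I. h i s"] insert by simp
qed

lemma rl_integral_cmult: "rl_integral a (\<lambda>s. c * h s) t = c * rl_integral a h t"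
  unfolding rl_integral_def by (simp add: mult.left_commute mult.assoc)

lemma rl_integral_one:
  assumes h: "locally_integrable h" and t: "0 < t"
  shows "rl_integral 1 h t = (LINT s:{0<..<t}|lborel. h s)"
  unfolding rl_integral_def set_lebesgue_integral_def rl_kernel_one
  by (intro Bochner_Integration.integral_cong) (auto simp: indicator_def)

lemma rl_integral_one_diff:
  assumes h: "locally_integrable h" and c: "continuous_on {0<..} h" and st: "0 < s" "s \<le> t"
  shows "rl_integral 1 h t - rl_integral 1 h s = integral {s..t} h"
proof -
  have t: "0 < t" using st by simp
  have it: "set_integrable lborel {0<..<t} h" and is1: "set_integrable lborel {0<..<s} h"
    using h st by (auto simp: locally_integrable_def)
  have ist: "set_integrable lborel {s..t} h"
    using st by (intro borel_integrable_atLeastAtMost' continuous_on_subset[OF c]) auto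
  have "(LINT r:{0<..<s} \<union> {s..t}|lborel. h r) = (LINT r:{0<..<s}|lborel. h r) + (LINT r:{s..t}|lborel. h r)"
    by (intro set_integral_Un is1 ist) auto
  moreover have "(LINT r:{0<..<s} \<union> {s..t}|lborel. h r) = (LINT r:{0<..<t}|lborel. h r)"
  proof (rule set_integral_cong_set)
    show "set_borel_measurable lborel ({0<..<s} \<union> {s..t}) h"
      using set_integrable_Un[OF is1 ist] by (auto simp: set_integrable_def set_borel_measurable_def)
    show "set_borel_measurable lborel {0<..<t} h"
      using it by (auto simp: set_integrable_def set_borel_measurable_def)
    have "AE x in lborel. x \<noteq> t" by (rule AE_lborel_singleton)
    thus "AE x in lborel. (x \<in> {0<..<t}) = (x \<in> {0<..<s} \<union> {s..t})"
      by eventually_elim (use st in auto)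
  qed
  moreover have "(LINT r:{s..t}|lborel. h r) = integral {s..t} h"
    by (rule set_borel_integral_eq_integral(2)[OF ist])
  ultimately show ?thesis by (simp add: rl_integral_one[OF h] st t)
qed

text \<open>The fundamental theorem is applied from the base point t/2, which keeps away from the
  possible singularity of h at 0; the part before t/2 is a constant.\<close>

lemma rl_integral_one_deriv:
  assumes h: "locally_integrable h" and c: "continuous_on {0<..} h" and t: "0 < t"
  shows "(rl_integral 1 h has_real_derivative h t) (at t)"
proof -
  have "((\<lambda>r. integral {t/2..r} h) has_real_derivative h t) (at t within {t/2..t+1})"
    using t by (intro integral_has_real_derivative continuous_on_subset[OF c]) auto
  hence "((\<lambda>r. integral {t/2..r} h) has_real_derivative h t) (at t)"
    using t by (simp add: at_within_interior[of t "{t/2..t+1}"])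
  hence "((\<lambda>r. rl_integral 1 h (t/2) + integral {t/2..r} h) has_real_derivative h t) (at t)"
    by (auto intro!: derivative_eq_intros)
  moreover have "eventually (\<lambda>r. rl_integral 1 h (t/2) + integral {t/2..r} h = rl_integral 1 h r) (nhds t)"
  proof -
    have "eventually (\<lambda>r. r \<in> {t/2<..}) (nhds t)"
      using t by (intro eventually_nhds_in_open) auto
    thus ?thesis
    proof eventually_elim
      case (elim r)
      thus ?case using rl_integral_one_diff[OF h c, of "t/2" r] t by auto
    qed
  qed
  ultimately show ?thesis by (subst (asm) DERIV_cong_ev[OF refl _ refl]) auto
qed

text \<open>Dominated convergence with bound |h| on (0, 1): for each s > 0 the integrand vanishes as
  soon as t < s.\<close>

lemma rl_integral_one_at_0:
  assumes h: "locally_integrable h"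
  shows "(rl_integral 1 h \<longlongrightarrow> 0) (at_right 0)"
proof -
  have i1: "integrable lborel (\<lambda>s. indicator {0<..<1} s * h s)"
    using h by (auto simp: locally_integrable_def set_integrable_def)
  have [measurable]: "(\<lambda>s. indicator {0<..} s * h s) \<in> borel_measurable borel"
    using h by (simp add: locally_integrable_def)
  have "(rl_integral 1 h \<longlongrightarrow> (LINT (s::real)|lborel. (0::real))) (at 0 within {0<..<1})"
    unfolding rl_integral_def[abs_def]
  proof (rule integral_tendsto_within[where w = "\<lambda>s. \<bar>indicator {0<..<1} s * h s\<bar>"])
    show "integrable lborel (\<lambda>s. \<bar>indicator {0<..<1} s * h s\<bar>)" by (rule integrable_abs[OF i1])
    show "AE s in lborel. \<bar>indicator {0<..} s * h s * rl_kernel 1 (t - s)\<bar> \<le> \<bar>indicator {0<..<1} s * h s\<bar>"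
      if "t \<in> {0<..<1}" for t :: real
      using that by (auto simp: indicator_def rl_kernel_one)
    show "AE s in lborel. ((\<lambda>t. indicator {0<..} s * h s * rl_kernel 1 (t - s)) \<longlongrightarrow> 0) (at 0 within {0<..<1})"
    proof (rule AE_I2)
      fix s :: real
      show "((\<lambda>t. indicator {0<..} s * h s * rl_kernel 1 (t - s)) \<longlongrightarrow> 0) (at 0 within {0<..<1})"
      proof (cases "s \<le> 0")
        case True
        thus ?thesis by simp
      next
        case False
        hence "eventually (\<lambda>t. t < s) (at 0 within {0<..<1})"
          by (intro order_tendstoD(2)[OF tendsto_ident_at]) auto
        hence "eventually (\<lambda>t. indicator {0<..} s * h s * rl_kernel 1 (t - s) = 0) (at 0 within {0<..<1})"
          by eventually_elim (auto simp: rl_kernel_one)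
        thus ?thesis by (rule tendsto_eventually)
      qed
    qed
  qed simp_all
  moreover have "at (0::real) within {0<..<1} = at_right 0"
    by (rule at_within_nhd[where S = "{..<1}"]) auto
  ultimately show ?thesis by simp
qed

text \<open>Applying the complementary integral of order 1 - a leaves ordinary integrals of h and k,
  which can be differentiated pointwise thanks to continuity.\<close>

lemma rl_integral_inject:
  assumes a: "0 < a" "a < 1"
    and h: "locally_integrable h" "continuous_on {0<..} h"
    and k: "locally_integrable k" "continuous_on {0<..} k"
    and eq: "\<And>t. 0 < t \<Longrightarrow> rl_integral a h t = rl_integral a k t" and t: "0 < t"
  shows "h t = k t"
proof -
  have eq1: "rl_integral 1 h t = rl_integral 1 k t" for t
    using rl_integral_rl_integral[OF h, of "1 - a" a t] rl_integral_rl_integral[OF k, of "1 - a" a t] a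
      rl_integral_cong[of t "rl_integral a h" "rl_integral a k" "1 - a"] eq by simp
  have "rl_integral 1 h = rl_integral 1 k" using eq1 by auto
  thus ?thesis
    using rl_integral_one_deriv[OF h t] rl_integral_one_deriv[OF k t] by (auto dest: DERIV_unique)
qed

section \<open>Caputo derivatives, fractional Taylor expansion and the equivalence on a
  half-line\<close>

lemma caputo_eq_rl_integral: "caputo \<beta> g t = rl_integral (1 - \<beta>) (deriv g) t"
proof -
  have "rl_integral (1 - \<beta>) (deriv g) t
      = (LINT s|lborel. 1 / Gamma (1 - \<beta>) * (indicator {0<..<t} s * (deriv g s / (t - s) powr \<beta>)))"
    unfolding rl_integral_def
    by (intro Bochner_Integration.integral_cong)
      (auto simp: rl_kernel_def indicator_def powr_minus_divide)
  thus ?thesis by (simp only: caputo_def set_lebesgue_integral_def real_scaleR_def integral_mult_right_zero)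
qed

lemma caputo_eq_rl_integral': "caputo \<beta> g = rl_integral (1 - \<beta>) (deriv g)"
  by (rule ext) (rule caputo_eq_rl_integral)

lemma deriv_cong_pos:
  assumes "\<And>s. 0 < s \<Longrightarrow> g s = k s" and "0 < (s::real)"
  shows "deriv g s = deriv k s"
proof (rule deriv_cong_ev)
  have "eventually (\<lambda>x. x \<in> {0<..}) (nhds s)" using assms(2) by (intro eventually_nhds_in_open) auto
  thus "eventually (\<lambda>x. g x = k x) (nhds s)" by eventually_elim (use assms in auto)
qed simp

lemma caputo_cong:
  assumes "\<And>s. 0 < s \<Longrightarrow> g s = k s"
  shows "caputo \<beta> g = caputo \<beta> k"
  unfolding caputo_eq_rl_integral' using deriv_cong_pos[OF assms]
  by (intro ext rl_integral_cong) auto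

lemma caputo_diff_cong:
  assumes eq: "\<And>s. 0 < s \<Longrightarrow> g s = k s"
  shows "caputo_diff \<beta> g \<longleftrightarrow> caputo_diff \<beta> k"
proof -
  have "caputo_diff \<beta> k" if eq: "\<And>s. 0 < s \<Longrightarrow> g s = k s" and g: "caputo_diff \<beta> g" for g k
    unfolding caputo_diff_def
  proof (intro conjI allI impI)
    note d = deriv_cong_pos[OF eq]
    show "k field_differentiable at t" if t: "0 < t" for t
    proof -
      obtain D where D: "(g has_field_derivative D) (at t)"
        using g t by (auto simp: caputo_diff_def field_differentiable_def)
      have "eventually (\<lambda>x. x \<in> {0<..}) (nhds t)" using t by (intro eventually_nhds_in_open) auto
      hence "eventually (\<lambda>x. g x = k x) (nhds t)" by eventually_elim (use eq in auto)
      hence "(k has_field_derivative D) (at t)" using D DERIV_cong_ev[of t t g k D D] by simp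
      thus ?thesis by (auto simp: field_differentiable_def)
    qed
    show "continuous_on {0<..} (deriv k)"
      using g d unfolding caputo_diff_def by (subst continuous_on_cong[OF refl, of _ _ "deriv g"]) auto
    show "set_integrable lborel {0<..<t} (\<lambda>s. deriv k s / (t - s) powr \<beta>)" if t: "0 < t" for t
    proof -
      have "set_integrable lborel {0<..<t} (\<lambda>s. deriv g s / (t - s) powr \<beta>)"
        using g t unfolding caputo_diff_def by blast
      thus ?thesis by (rule back_subst[where P = "\<lambda>x. x"], intro set_integrable_cong) (auto simp: d)
    qed
  qed
  from this[of g k] this[of k g] eq show ?thesis by auto
qed

text \<open>A single application of \<open>caputo\<close> forgets what happens at nonpositive
  arguments, which is why equality of functions holds exactly from m = 1 on.\<close>

lemma caputo_iter_cong:
  assumes eq: "\<And>s. 0 < s \<Longrightarrow> g s = k s" and "0 < m"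
  shows "(caputo \<beta> ^^ m) g = (caputo \<beta> ^^ m) k"
proof -
  obtain m' where m: "m = Suc m'" using assms(2) by (cases m) auto
  have "caputo \<beta> g = caputo \<beta> k" by (rule caputo_cong) (rule eq)
  thus ?thesis by (simp only: m funpow_Suc_right comp_def)
qed

lemma caputo_iter_cong_pos:
  assumes eq: "\<And>s. 0 < s \<Longrightarrow> g s = k s" and "0 < s"
  shows "(caputo \<beta> ^^ m) g s = (caputo \<beta> ^^ m) k s"
proof (cases "m = 0")
  case False
  have "(caputo \<beta> ^^ m) g = (caputo \<beta> ^^ m) k" by (rule caputo_iter_cong) (use eq False in auto)
  thus ?thesis by (rule fun_cong)
qed (use assms in auto)

lemma caputo_diff_iter_cong:
  assumes eq: "\<And>s. 0 < s \<Longrightarrow> g s = k s"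
  shows "caputo_diff_iter \<beta> m g \<longleftrightarrow> caputo_diff_iter \<beta> m k"
proof -
  have "caputo_diff \<beta> ((caputo \<beta> ^^ i) g) = caputo_diff \<beta> ((caputo \<beta> ^^ i) k)" for i
    by (intro caputo_diff_cong caputo_iter_cong_pos eq)
  thus ?thesis by (simp add: caputo_diff_iter_def)
qed

lemma caputo_diff_kernel:
  assumes "\<beta> < 1" "caputo_diff \<beta> g" "0 < t"
  shows "integrable lborel (\<lambda>s. indicator {0<..} s * deriv g s * rl_kernel (1 - \<beta>) (t - s))"
proof -
  have "integrable lborel (\<lambda>s. 1 / Gamma (1 - \<beta>) * (indicator {0<..<t} s * (deriv g s / (t - s) powr \<beta>)))"
    using assms unfolding caputo_diff_def set_integrable_def by (intro integrable_mult_right) simp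
  thus ?thesis
    by (rule back_subst[where P = "\<lambda>x. x"], intro Bochner_Integration.integrable_cong)
      (auto simp: rl_kernel_def indicator_def powr_minus_divide)
qed

text \<open>On (0, t) the kernel (t - s)^(-\<beta>) is at least t^(-\<beta>), so integrability
  against it implies plain integrability.\<close>

lemma caputo_diff_locally_integrable:
  assumes \<beta>: "0 < \<beta>" and g: "caputo_diff \<beta> g"
  shows "locally_integrable (deriv g)"
  unfolding locally_integrable_def
proof (intro conjI allI impI)
  have c: "continuous_on {0<..} (deriv g)" using g by (simp add: caputo_diff_def)
  have "(\<lambda>s. indicator {0<..} s *\<^sub>R deriv g s) \<in> borel_measurable borel"
    by (rule borel_measurable_continuous_on_indicator[OF _ c]) simp
  thus m: "(\<lambda>s. indicator {0<..} s * deriv g s) \<in> borel_measurable borel" by simp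
  fix t :: real assume t: "t > 0"
  have "set_integrable lborel {0<..<t} (\<lambda>s. deriv g s / (t - s) powr \<beta>)"
    using g t by (simp add: caputo_diff_def)
  hence "integrable lborel (\<lambda>s. t powr \<beta> * (indicator {0<..<t} s * (deriv g s / (t - s) powr \<beta>)))"
    by (intro integrable_mult_right) (simp add: set_integrable_def)
  moreover have "(\<lambda>s. indicator {0<..<t} s * deriv g s) \<in> borel_measurable lborel"
  proof -
    have "(\<lambda>s. indicator {0<..<t} s * deriv g s) = (\<lambda>s. indicator {0<..<t} s * (indicator {0<..} s * deriv g s))"
      by (auto simp: indicator_def)
    thus ?thesis using m by simp
  qed
  moreover have "norm (indicator {0<..<t} s * deriv g s)
      \<le> norm (t powr \<beta> * (indicator {0<..<t} s * (deriv g s / (t - s) powr \<beta>)))" for s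
  proof (cases "s \<in> {0<..<t}")
    case True
    have "(t - s) powr \<beta> \<le> t powr \<beta>" using True \<beta> by (intro powr_mono2) auto
    moreover have "0 < (t - s) powr \<beta>" using True by simp
    ultimately have "\<bar>deriv g s\<bar> * 1 \<le> \<bar>deriv g s\<bar> * (t powr \<beta> / (t - s) powr \<beta>)"
      by (intro mult_left_mono) auto
    thus ?thesis using True by (simp add: abs_mult mult.commute)
  qed auto
  ultimately have "integrable lborel (\<lambda>s. indicator {0<..<t} s * deriv g s)"
    by (rule Bochner_Integration.integrable_bound[OF _ _ AE_I2])
  thus "set_integrable lborel {0<..<t} (deriv g)"
    by (simp add: set_integrable_def)
qed

lemma caputo_diff_continuous: "caputo_diff \<beta> g \<Longrightarrow> continuous_on {0<..} (deriv g)"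
  by (simp add: caputo_diff_def)

lemma caputo_diff_has_derivative:
  "caputo_diff \<beta> g \<Longrightarrow> 0 < t \<Longrightarrow> (g has_real_derivative deriv g t) (at t)"
  by (simp add: caputo_diff_def DERIV_deriv_iff_field_differentiable)

lemma locally_integrable_caputo:
  assumes "0 < \<beta>" "\<beta> < 1" "caputo_diff \<beta> g"
  shows "locally_integrable (caputo \<beta> g)"
  unfolding caputo_eq_rl_integral' using assms
  by (intro locally_integrable_rl caputo_diff_locally_integrable caputo_diff_continuous) auto

text \<open>The orders \<beta> and 1 - \<beta> add up to 1, so the left side is the ordinary
  integral of g' over (0, t). As g is differentiable only at positive times, the limit c at 0
  replaces the initial value.\<close>

lemma rl_integral_caputo:
  assumes \<beta>: "0 < \<beta>" "\<beta> < 1" and g: "caputo_diff \<beta> g"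
    and c: "(g \<longlongrightarrow> c) (at_right 0)" and t: "0 < t"
  shows "rl_integral \<beta> (caputo \<beta> g) t = g t - c"
proof -
  note li = caputo_diff_locally_integrable[OF \<beta>(1) g] caputo_diff_continuous[OF g]
  have "rl_integral \<beta> (rl_integral (1 - \<beta>) (deriv g)) t = rl_integral (\<beta> + (1 - \<beta>)) (deriv g) t"
    by (rule rl_integral_rl_integral[OF li]) (use \<beta> in auto)
  hence I: "rl_integral \<beta> (caputo \<beta> g) t = rl_integral 1 (deriv g) t"
    unfolding caputo_eq_rl_integral'[symmetric] by simp
  have "rl_integral 1 (deriv g) t - rl_integral 1 (deriv g) s = g t - g s"
    if "0 < s" "s \<le> t" for s
  proof -
    have "(deriv g has_integral (g t - g s)) {s..t}"
    proof (rule fundamental_theorem_of_calculus)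
      fix x assume "x \<in> {s..t}"
      hence "(g has_real_derivative deriv g x) (at x within {s..t})"
        using that by (intro has_field_derivative_at_within[OF caputo_diff_has_derivative[OF g]]) auto
      thus "(g has_vector_derivative deriv g x) (at x within {s..t})"
        by (simp add: has_real_derivative_iff_has_vector_derivative)
    qed (use that in simp)
    thus ?thesis using rl_integral_one_diff[OF li that] by (simp add: integral_unique)
  qed
  \<comment> \<open>The integral of g' minus g is constant on (0, t]; the constant is read off from
    its limit at 0.\<close>
  hence "eventually (\<lambda>s. rl_integral 1 (deriv g) t - g t = rl_integral 1 (deriv g) s - g s) (at_right 0)"
    unfolding eventually_at_right[OF zero_less_one] using t by (intro exI[of _ t]) (auto simp: algebra_simps)
  moreover have "((\<lambda>s. rl_integral 1 (deriv g) s - g s) \<longlongrightarrow> 0 - c) (at_right 0)"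
    by (intro tendsto_diff rl_integral_one_at_0 li c)
  ultimately have "((\<lambda>s. rl_integral 1 (deriv g) t - g t) \<longlongrightarrow> 0 - c) (at_right (0::real))"
    by (simp add: tendsto_cong)
  hence "rl_integral 1 (deriv g) t - g t = 0 - c"
    by (subst (asm) tendsto_const_iff) auto
  with I show ?thesis by simp
qed

text \<open>Taylor's formula for the fractional integral: the expansion of
  \<open>caputo \<beta> v\<close> to order N is integrated once with order \<beta>. Powers go to
  powers one step higher, the remainder gains order \<beta>, and the integration constant is the
  trace c 0.\<close>

lemma caputo_taylor:
  assumes \<beta>: "0 < \<beta>" "\<beta> < 1" and "1 \<le> N"
    and "caputo_diff_iter \<beta> N v"
    and "\<And>k. k < N \<Longrightarrow> ((caputo \<beta> ^^ k) v \<longlongrightarrow> c k) (at_right 0)"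
    and "continuous_on {0<..} ((caputo \<beta> ^^ N) v)" and "0 < t"
  shows "v t = (\<Sum>k<N. c k * (t powr (real k * \<beta>) / Gamma (1 + real k * \<beta>)))
             + rl_integral (real N * \<beta>) ((caputo \<beta> ^^ N) v) t"
  using assms(3-)
proof (induction N arbitrary: v c t rule: nat_induct_at_least)
  case base
  have "caputo_diff \<beta> v" using base(1) by (simp add: caputo_diff_iter_def)
  from rl_integral_caputo[OF \<beta> this _ base(4), of "c 0"] base(2)[of 0] base(4)
  show ?case by simp
next
  case (Suc N)
  let ?w = "caputo \<beta> v" and ?H = "(caputo \<beta> ^^ Suc N) v"
  have Sw: "(caputo \<beta> ^^ Suc k) v = (caputo \<beta> ^^ k) ?w" for k
    by (simp only: funpow_Suc_right comp_def)
  have it: "caputo_diff_iter \<beta> N ?w"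
    unfolding caputo_diff_iter_def
  proof (intro allI impI)
    fix m assume "m < N"
    hence "caputo_diff \<beta> ((caputo \<beta> ^^ Suc m) v)"
      using Suc.prems(1)[unfolded caputo_diff_iter_def, rule_format, of "Suc m"] by simp
    thus "caputo_diff \<beta> ((caputo \<beta> ^^ m) ?w)" by (simp only: Sw)
  qed
  have w: "?w s = (\<Sum>k<N. c (Suc k) * (s powr (real k * \<beta>) / Gamma (1 + real k * \<beta>)))
             + rl_integral (real N * \<beta>) ?H s" if "0 < s" for s
    unfolding Sw[of N]
  proof (rule Suc.IH[OF it _ _ that])
    show "((caputo \<beta> ^^ k) ?w \<longlongrightarrow> c (Suc k)) (at_right 0)" if "k < N" for k
      using Suc.prems(2)[of "Suc k"] that by (simp only: Sw Suc_less_eq)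
  qed (use Suc.prems(3) in \<open>simp only: Sw[symmetric]\<close>)
  have v: "caputo_diff \<beta> v" and vN: "caputo_diff \<beta> ((caputo \<beta> ^^ N) v)"
    using Suc.prems(1) unfolding caputo_diff_iter_def by (metis funpow_0 zero_less_Suc, blast)
  have H: "locally_integrable ?H" using locally_integrable_caputo[OF \<beta> vN] by simp
  note Hc = Suc.prems(3)
  have "v t = c 0 + rl_integral \<beta> ?w t"
    using rl_integral_caputo[OF \<beta> v _ Suc.prems(4), of "c 0"] Suc.prems(2)[of 0] by simp
  also have "rl_integral \<beta> ?w t
     = rl_integral \<beta> (\<lambda>s. (\<Sum>k<N. c (Suc k) * (s powr (real k * \<beta>) / Gamma (1 + real k * \<beta>)))
             + rl_integral (real N * \<beta>) ?H s) t"
    by (rule rl_integral_cong) (use w in auto)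
  also have "\<dots> = (\<Sum>k<N. c (Suc k) * (t powr (real (Suc k) * \<beta>) / Gamma (1 + real (Suc k) * \<beta>)))
      + rl_integral (real (Suc N) * \<beta>) ?H t"
  proof -
    have pw: "integrable lborel (\<lambda>s. indicator {0<..} s * (s powr (real k * \<beta>) / Gamma (1 + real k * \<beta>)) * rl_kernel \<beta> (t - s))"
      "rl_integral \<beta> (\<lambda>s. s powr (real k * \<beta>) / Gamma (1 + real k * \<beta>)) t
        = t powr (real (Suc k) * \<beta>) / Gamma (1 + real (Suc k) * \<beta>)" for k
    proof -
      have 1: "0 < 1 + real k * \<beta>" using \<beta> by (intro add_pos_nonneg) auto
      have 2: "1 + real k * \<beta> - 1 = real k * \<beta>" "1 + real (Suc k) * \<beta> - 1 = real (Suc k) * \<beta>"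
        "\<beta> + (1 + real k * \<beta>) = 1 + real (Suc k) * \<beta>" by (simp_all add: algebra_simps)
      show "integrable lborel (\<lambda>s. indicator {0<..} s * (s powr (real k * \<beta>) / Gamma (1 + real k * \<beta>)) * rl_kernel \<beta> (t - s))"
        "rl_integral \<beta> (\<lambda>s. s powr (real k * \<beta>) / Gamma (1 + real k * \<beta>)) t
          = t powr (real (Suc k) * \<beta>) / Gamma (1 + real (Suc k) * \<beta>)"
        by (rule rl_integral_powr(1)[OF \<beta>(1) 1, of t, unfolded 2])
          (rule rl_integral_powr(2)[OF \<beta>(1) 1 Suc.prems(4), unfolded 2])
    qed
    have I1: "integrable lborel (\<lambda>s. indicator {0<..} s * (c (Suc k) * (s powr (real k * \<beta>) / Gamma (1 + real k * \<beta>))) * rl_kernel \<beta> (t - s))" for k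
      using integrable_mult_right[OF pw(1)[of k], of "c (Suc k)"] by (simp add: mult_ac)
    have "integrable lborel (\<lambda>s. indicator {0<..} s * (rl_integral (real N * \<beta>) ?H) s * rl_kernel \<beta> (t - s))"
      using \<beta> Suc.hyps H by (intro rl_integral_semigroup(1) locally_integrable_kernel Hc)
       (auto simp: locally_integrable_def intro!: add_pos_nonneg)
    moreover have "rl_integral \<beta> (rl_integral (real N * \<beta>) ?H) t = rl_integral (real (Suc N) * \<beta>) ?H t"
      using rl_integral_rl_integral[OF H Hc \<beta>(1), of "real N * \<beta>" t] \<beta> Suc.hyps
      by (simp add: algebra_simps)
    ultimately show ?thesis
      using rl_integral_sum[of "{..<N}" "\<lambda>k s. c (Suc k) * (s powr (real k * \<beta>) / Gamma (1 + real k * \<beta>))" \<beta> t, OF _ I1]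
      by (subst rl_integral_add(2)) (simp_all only: rl_integral_cmult pw(2) finite_lessThan simp_thms)
  qed
  finally show ?case
    using Suc.prems(4) unfolding sum.lessThan_Suc_shift by simp
qed

text \<open>Because N \<beta> = 1 - \<beta>, both the remainder and the monomials of the Taylor
  expansion of v lie in the range of the integral of order 1 - \<beta>: v is that integral of R + H,
  where H is the last derivative. The Caputo derivative of u is the same integral of u', and
  injectivity cancels it.\<close>

lemma caputo_eq_iff_deriv_eq:
  assumes \<beta>: "0 < \<beta>" "\<beta> < 1" and N: "1 \<le> N" "real N * \<beta> = 1 - \<beta>"
    and u: "caputo_diff \<beta> u" and v: "caputo_diff_iter \<beta> N v"
    and lim: "\<And>k. k < N \<Longrightarrow> ((caputo \<beta> ^^ k) v \<longlongrightarrow> c k) (at_right 0)"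
    and cont: "continuous_on {0<..} ((caputo \<beta> ^^ N) v)"
  shows "(\<forall>t>0. caputo \<beta> u t = v t) \<longleftrightarrow>
    (\<forall>t>0. deriv u t = (\<Sum>k<N. c k * (t powr (real (Suc k) * \<beta> - 1) / Gamma (real (Suc k) * \<beta>)))
        + (caputo \<beta> ^^ N) v t)"
proof -
  let ?H = "(caputo \<beta> ^^ N) v"
  \<comment> \<open>The functions whose integral of order 1 - \<beta> are the Taylor monomials; all
    exponents are negative but above -1, so R blows up at 0 and is still integrable.\<close>
  define R where "R = (\<lambda>t. (\<Sum>k<N. c k * (t powr (real (Suc k) * \<beta> - 1) / Gamma (real (Suc k) * \<beta>))))"
  obtain N' where N': "N = Suc N'" using N by (cases N) auto
  have "caputo_diff \<beta> ((caputo \<beta> ^^ N') v)" using v by (simp add: caputo_diff_iter_def N')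
  hence H: "locally_integrable ?H" using locally_integrable_caputo[OF \<beta>] by (simp add: N')
  note li = caputo_diff_locally_integrable[OF \<beta>(1) u] caputo_diff_continuous[OF u]
  have trm: "integrable lborel (\<lambda>s. indicator {0<..} s * (c k * (s powr (real (Suc k) * \<beta> - 1) / Gamma (real (Suc k) * \<beta>))) * rl_kernel a (t - s))"
    if "0 < a" for k t a
    using integrable_mult_right[OF rl_integral_powr(1)[OF that, of "real (Suc k) * \<beta>" t], of "c k"] \<beta>
    by (simp add: mult_ac)
  have RH: "integrable lborel (\<lambda>s. indicator {0<..} s * (R s + ?H s) * rl_kernel a (t - s))"
    "rl_integral a (\<lambda>s. R s + ?H s) t = rl_integral a R t + rl_integral a ?H t" if a: "0 < a" for a t
  proof -
    have 1: "integrable lborel (\<lambda>s. indicator {0<..} s * R s * rl_kernel a (t - s))"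
      unfolding R_def by (rule conjunct1[OF rl_integral_sum]) (use trm a in auto)
    have 2: "integrable lborel (\<lambda>s. indicator {0<..} s * ?H s * rl_kernel a (t - s))"
      by (rule locally_integrable_kernel[OF H cont a])
    show "integrable lborel (\<lambda>s. indicator {0<..} s * (R s + ?H s) * rl_kernel a (t - s))"
      "rl_integral a (\<lambda>s. R s + ?H s) t = rl_integral a R t + rl_integral a ?H t"
      by (rule rl_integral_add[OF 1 2])+
  qed
  have meas: "(\<lambda>s. indicator {0<..} s * (R s + ?H s)) \<in> borel_measurable borel"
  proof -
    have [measurable]: "(\<lambda>s. indicator {0<..} s * ?H s) \<in> borel_measurable borel"
      using H by (simp add: locally_integrable_def)
    have "(\<lambda>s. indicator {0<..} s * R s + indicator {0<..} s * ?H s) \<in> borel_measurable borel"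
      unfolding R_def by measurable
    thus ?thesis by (simp add: algebra_simps)
  qed
  have RHl: "locally_integrable (\<lambda>s. R s + ?H s)"
    unfolding locally_integrable_def using meas RH(1)[of 1] by (auto simp: locally_integrable_iff_kernel_one)
  have RHc: "continuous_on {0<..} (\<lambda>s. R s + ?H s)"
  proof -
    have "Gamma (real (Suc k) * \<beta>) \<noteq> 0" for k
    proof -
      have "0 < real (Suc k) * \<beta>" using \<beta> by simp
      from Gamma_real_pos[OF this] show ?thesis by linarith
    qed
    thus ?thesis unfolding R_def by (intro continuous_intros cont) auto
  qed
  have rlR: "rl_integral (1 - \<beta>) R t = (\<Sum>k<N. c k * (t powr (real k * \<beta>) / Gamma (1 + real k * \<beta>)))"
    if "0 < t" for t
  proof -
    have "rl_integral (1 - \<beta>) (\<lambda>s. s powr (real (Suc k) * \<beta> - 1) / Gamma (real (Suc k) * \<beta>)) t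
       = t powr (real k * \<beta>) / Gamma (1 + real k * \<beta>)" for k
    proof -
      have 2: "1 + real k * \<beta> - 1 = real k * \<beta>" "1 - \<beta> + real (Suc k) * \<beta> = 1 + real k * \<beta>"
        by (simp_all add: algebra_simps)
      show ?thesis
        by (rule rl_integral_powr(2)[of "1 - \<beta>" "real (Suc k) * \<beta>" t, unfolded 2])
          (use \<beta> that in auto)
    qed
    moreover have "rl_integral (1 - \<beta>) R t = (\<Sum>k<N. rl_integral (1 - \<beta>)
        (\<lambda>s. c k * (s powr (real (Suc k) * \<beta> - 1) / Gamma (real (Suc k) * \<beta>))) t)"
      unfolding R_def by (rule conjunct2[OF rl_integral_sum]) (use trm \<beta> in auto)
    ultimately show ?thesis by (simp only: rl_integral_cmult)
  qed
  have v_eq: "v t = rl_integral (1 - \<beta>) (\<lambda>s. R s + ?H s) t" if "0 < t" for t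
    using caputo_taylor[OF \<beta> N(1) v lim cont that] rlR[OF that] RH(2)[of "1 - \<beta>" t] \<beta>
    by (simp add: N(2))
  show ?thesis
  proof
    assume eq: "\<forall>t>0. caputo \<beta> u t = v t"
    have "deriv u t = R t + ?H t" if "0 < t" for t
      by (rule rl_integral_inject[OF _ _ li RHl RHc _ that, of "1 - \<beta>"])
        (use \<beta> eq v_eq in \<open>auto simp: caputo_eq_rl_integral\<close>)
    thus "\<forall>t>0. deriv u t = (\<Sum>k<N. c k * (t powr (real (Suc k) * \<beta> - 1) / Gamma (real (Suc k) * \<beta>))) + ?H t"
      by (simp add: R_def)
  next
    assume "\<forall>t>0. deriv u t = (\<Sum>k<N. c k * (t powr (real (Suc k) * \<beta> - 1) / Gamma (real (Suc k) * \<beta>))) + ?H t"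
    hence "caputo \<beta> u t = rl_integral (1 - \<beta>) (\<lambda>s. R s + ?H s) t" for t
      unfolding caputo_eq_rl_integral by (intro rl_integral_cong) (simp add: R_def)
    thus "\<forall>t>0. caputo \<beta> u t = v t" using v_eq by simp
  qed
qed

section \<open>Exchanging derivatives with integrals\<close>

lemma has_derivative_integral_AE:
  fixes f f' :: "real \<Rightarrow> 'a \<Rightarrow> real"
  assumes ab: "a < x0" "x0 < b"
    and int: "\<And>x. a < x \<Longrightarrow> x < b \<Longrightarrow> integrable M (f x)"
    and meas: "f' x0 \<in> borel_measurable M"
    and w: "integrable M w"
    and der: "AE \<omega> in M. \<forall>x. a < x \<longrightarrow> x < b \<longrightarrow>
      ((\<lambda>x. f x \<omega>) has_real_derivative f' x \<omega>) (at x) \<and> \<bar>f' x \<omega>\<bar> \<le> w \<omega>"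
  shows "((\<lambda>x. integral\<^sup>L M (f x)) has_real_derivative integral\<^sup>L M (f' x0)) (at x0)"
proof -
  define S where "S = {a<..<b} - {x0}"
  have "((\<lambda>x. \<integral>\<omega>. (f x \<omega> - f x0 \<omega>) / (x - x0) \<partial>M) \<longlongrightarrow> (\<integral>\<omega>. f' x0 \<omega> \<partial>M)) (at x0 within S)"
  proof (rule integral_tendsto_within[OF _ meas w])
    show "(\<lambda>\<omega>. (f x \<omega> - f x0 \<omega>) / (x - x0)) \<in> borel_measurable M" if "x \<in> S" for x
      using int[of x] int[of x0] that ab by (auto simp: S_def)
    show "AE \<omega> in M. \<bar>(f x \<omega> - f x0 \<omega>) / (x - x0)\<bar> \<le> w \<omega>" if x: "x \<in> S" for x
      using der
    proof eventually_elim
      case (elim \<omega>)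
      have *: "((\<lambda>x. f x \<omega>) has_real_derivative f' y \<omega>) (at y within closed_segment x0 x)"
        "norm (f' y \<omega>) \<le> w \<omega>" if "y \<in> closed_segment x0 x" for y
      proof -
        have "a < y \<and> y < b" using that x ab by (auto simp: S_def closed_segment_eq_real_ivl split: if_splits)
        thus "((\<lambda>x. f x \<omega>) has_real_derivative f' y \<omega>) (at y within closed_segment x0 x)"
          "norm (f' y \<omega>) \<le> w \<omega>"
          using elim by (auto intro: has_field_derivative_at_within)
      qed
      \<comment> \<open>The mean value inequality on the segment between x0 and x turns the bound on
        the derivative into a bound on the difference quotients, which is what dominated convergence
        asks for.\<close>
      have "norm (f x \<omega> - f x0 \<omega>) \<le> w \<omega> * norm (x - x0)"
        by (rule field_differentiable_bound[OF convex_closed_segment, where f' = "\<lambda>y. f' y \<omega>"]) (use * in auto)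
      thus ?case using x by (auto simp: S_def divide_simps mult.commute)
    qed
    show "AE \<omega> in M. ((\<lambda>x. (f x \<omega> - f x0 \<omega>) / (x - x0)) \<longlongrightarrow> f' x0 \<omega>) (at x0 within S)"
      using der
    proof eventually_elim
      case (elim \<omega>)
      hence "((\<lambda>x. f x \<omega>) has_real_derivative f' x0 \<omega>) (at x0)" using ab by blast
      thus ?case
        unfolding has_field_derivative_iff by (rule tendsto_within_subset) simp
    qed
  qed
  moreover have "eventually (\<lambda>x. (\<integral>\<omega>. (f x \<omega> - f x0 \<omega>) / (x - x0) \<partial>M)
      = (integral\<^sup>L M (f x) - integral\<^sup>L M (f x0)) / (x - x0)) (at x0 within S)"
    unfolding eventually_at_filter
  proof (intro always_eventually allI impI)
    fix x assume "x \<in> S"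
    thus "(\<integral>\<omega>. (f x \<omega> - f x0 \<omega>) / (x - x0) \<partial>M) = (integral\<^sup>L M (f x) - integral\<^sup>L M (f x0)) / (x - x0)"
      using int[of x] int[of x0] ab by (simp add: S_def)
  qed
  ultimately have "((\<lambda>x. (integral\<^sup>L M (f x) - integral\<^sup>L M (f x0)) / (x - x0)) \<longlongrightarrow> (\<integral>\<omega>. f' x0 \<omega> \<partial>M)) (at x0 within S)"
    by (rule Lim_transform_eventually)
  moreover have "at x0 within S = at x0"
    using ab unfolding S_def by (intro at_within_nhd[of _ "{a<..<b}"]) auto
  ultimately show ?thesis by (simp add: has_field_derivative_iff)
qed

text \<open>The integrated form of the exchange: Fubini in (s, y) over the interval from y1 to y2.
  The constant K makes the double integral absolutely convergent, and the inner integral over y is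
  gs(s, y2) - gs(s, y1).\<close>

lemma rl_integral_deriv_commute_on_interval:
  fixes g gx gs gxs :: "real \<Rightarrow> real \<Rightarrow> real"
  assumes a: "0 < a" and ab: "y1 \<le> y2"
    and d1: "\<And>s y. 0 < s \<Longrightarrow> (g s has_real_derivative gx s y) (at y)"
    and c1: "\<And>s. 0 < s \<Longrightarrow> continuous_on UNIV (gx s)"
    and d2: "\<And>s y. 0 < s \<Longrightarrow> ((\<lambda>s. g s y) has_real_derivative gs s y) (at s)"
    and d3: "\<And>s y. 0 < s \<Longrightarrow> ((\<lambda>s. gx s y) has_real_derivative gxs s y) (at s)"
    and c3: "continuous_on ({0<..} \<times> UNIV) (\<lambda>(s, y). gxs s y)"
    and i1: "\<And>y. integrable lborel (\<lambda>s. indicator {0<..} s * gs s y * rl_kernel a (t - s))"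
    and i2: "\<And>y. integrable lborel (\<lambda>s. indicator {0<..} s * gxs s y * rl_kernel a (t - s))"
    and bound: "\<And>y. y1 \<le> y \<Longrightarrow> y \<le> y2 \<Longrightarrow>
      (\<integral>s. \<bar>indicator {0<..} s * gxs s y * rl_kernel a (t - s)\<bar> \<partial>lborel) \<le> K"
    and cH: "continuous_on UNIV (\<lambda>y. rl_integral a (\<lambda>s. gxs s y) t)"
  shows "rl_integral a (\<lambda>s. gs s y2) t - rl_integral a (\<lambda>s. gs s y1) t
     = integral {y1..y2} (\<lambda>y. rl_integral a (\<lambda>s. gxs s y) t)"
proof -
  define k where "k = (\<lambda>p. indicator ({0<..} \<times> UNIV) p * (case p of (s, y) \<Rightarrow> gxs s y))"
  have k1: "k \<in> borel_measurable borel"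
    using borel_measurable_continuous_on_indicator[OF _ c3] unfolding k_def
    by (simp add: open_Times borel_open)
  have k: "indicator {0<..} s * gxs s y = k (s, y)" for s y by (auto simp: k_def indicator_def)
  have [measurable]: "k \<in> borel_measurable (borel \<Otimes>\<^sub>M borel)" using k1 by (simp add: borel_prod)
  define f where "f = (\<lambda>y s. indicator {y1..y2} y * (k (s, y) * rl_kernel a (t - s)))"
  have [measurable]: "(\<lambda>(y, s). f y s) \<in> borel_measurable (lborel \<Otimes>\<^sub>M lborel)"
    unfolding f_def by measurable
  have if1: "integrable lborel (\<lambda>s. f y s)" for y
    unfolding f_def using i2[of y] by (simp add: k)
  have "integrable lborel (\<lambda>y. \<integral>s. norm (f y s) \<partial>lborel)"
  proof (rule Bochner_Integration.integrable_bound[where f = "\<lambda>y. indicator {y1..y2} y * K"])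
    show "integrable lborel (\<lambda>y. indicator {y1..y2} y * K)"
      by (intro integrable_mult_left integrable_real_indicator) (auto simp: emeasure_lborel_Icc_eq)
    show "(\<lambda>y. \<integral>s. norm (f y s) \<partial>lborel) \<in> borel_measurable lborel" by measurable
    show "AE y in lborel. norm (\<integral>s. norm (f y s) \<partial>lborel) \<le> norm (indicator {y1..y2} y * K)"
    proof (rule AE_I2)
      fix y
      have "norm (f y s) = indicator {y1..y2} y * \<bar>indicator {0<..} s * gxs s y * rl_kernel a (t - s)\<bar>" for s
        unfolding f_def k by (auto simp: abs_mult)
      thus "norm (\<integral>s. norm (f y s) \<partial>lborel) \<le> norm (indicator {y1..y2} y * K)"
        using bound[of y] by (auto simp: indicator_def)
    qed
  qed
  hence F: "integrable (lborel \<Otimes>\<^sub>M lborel) (\<lambda>(y, s). f y s)"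
    using if1 by (intro lborel_pair.Fubini_integrable) auto
  have inner: "(\<integral>y. f y s \<partial>lborel) = indicator {0<..} s * (gs s y2 - gs s y1) * rl_kernel a (t - s)" for s
  proof (cases "0 < s")
    case False
    thus ?thesis by (simp add: f_def k_def)
  next
    case s: True
    have cs: "continuous_on UNIV (gxs s)"
      using s by (intro continuous_on_compose2[OF c3, of UNIV "\<lambda>y. (s, y)", simplified] continuous_intros) auto
    have "(\<integral>y. f y s \<partial>lborel) = (\<integral>y. rl_kernel a (t - s) * (indicator {y1..y2} y * gxs s y) \<partial>lborel)"
      using s by (intro Bochner_Integration.integral_cong) (auto simp: f_def k_def)
    also have "\<dots> = rl_kernel a (t - s) * (LINT y:{y1..y2}|lborel. gxs s y)"
      by (simp add: set_lebesgue_integral_def)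
    also have "(LINT y:{y1..y2}|lborel. gxs s y) = integral {y1..y2} (gxs s)"
      by (intro set_borel_integral_eq_integral borel_integrable_atLeastAtMost' continuous_on_subset[OF cs]) auto
    also have "\<dots> = gs s y2 - gs s y1"
    proof -
      \<comment> \<open>The mixed derivative is available only as "first y, then s". So the
        fundamental theorem is used for gx in y, and the resulting identity is differentiated in s
        under the integral over the compact interval.\<close>
      have ftc: "integral {y1..y2} (gx r) = g r y2 - g r y1" if "0 < r" for r
      proof (rule integral_unique, rule fundamental_theorem_of_calculus[OF ab])
        fix x assume "x \<in> {y1..y2}"
        have "(g r has_real_derivative gx r x) (at x within {y1..y2})"
          by (rule has_field_derivative_at_within[OF d1[OF that]])
        thus "(g r has_vector_derivative gx r x) (at x within {y1..y2})"
          by (simp add: has_real_derivative_iff_has_vector_derivative)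
      qed
      have "((\<lambda>r. integral (cbox y1 y2) (gx r)) has_field_derivative integral (cbox y1 y2) (gxs s)) (at s within {0<..})"
      proof (rule leibniz_rule_field_derivative)
        show "((\<lambda>x. gx x y) has_real_derivative gxs r y) (at r within {0<..})" if "r \<in> {0<..}" for r y
          using that by (intro has_field_derivative_at_within[OF d3]) auto
        show "gx r integrable_on cbox y1 y2" if "r \<in> {0<..}" for r
          using that by (intro integrable_continuous continuous_on_subset[OF c1]) auto
        show "continuous_on ({0<..} \<times> cbox y1 y2) (\<lambda>(x, t). gxs x t)"
          by (rule continuous_on_subset[OF c3]) auto
      qed (use s in auto)
      hence "((\<lambda>r. integral {y1..y2} (gx r)) has_field_derivative integral {y1..y2} (gxs s)) (at s)"
        using s by (simp add: at_within_open[of s "{0<..}"])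
      hence "((\<lambda>r. g r y2 - g r y1) has_field_derivative integral {y1..y2} (gxs s)) (at s)"
        by (rule DERIV_cong_pos[OF _ s]) (use ftc in auto)
      moreover have "((\<lambda>r. g r y2 - g r y1) has_field_derivative gs s y2 - gs s y1) (at s)"
        by (intro DERIV_diff d2 s)
      ultimately show ?thesis by (rule DERIV_unique)
    qed
    finally show ?thesis using s by simp
  qed
  have "(\<integral>s. (\<integral>y. f y s \<partial>lborel) \<partial>lborel)
     = rl_integral a (\<lambda>s. gs s y2) t - rl_integral a (\<lambda>s. gs s y1) t"
    unfolding inner rl_integral_def
    by (subst Bochner_Integration.integral_diff[symmetric, OF i1 i1]) (simp add: algebra_simps)
  moreover have "(\<integral>y. (\<integral>s. f y s \<partial>lborel) \<partial>lborel)
     = (LINT y:{y1..y2}|lborel. rl_integral a (\<lambda>s. gxs s y) t)"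
    unfolding f_def set_lebesgue_integral_def rl_integral_def by (simp add: k)
  moreover have "\<dots> = integral {y1..y2} (\<lambda>y. rl_integral a (\<lambda>s. gxs s y) t)"
    by (intro set_borel_integral_eq_integral borel_integrable_atLeastAtMost' continuous_on_subset[OF cH]) auto
  ultimately show ?thesis
    using lborel_pair.Fubini_integral[OF F] by simp
qed

text \<open>No uniform integrability in \<open>y\<close> is assumed.  The kernel integral of \<open>\<bar>gxs\<bar>\<close> is a finite
  lower semicontinuous function of \<open>y\<close>, so by Baire it is bounded on some interval near any point;
  Fubini applies there, and continuity of both sides does the rest.\<close>

lemma rl_integral_deriv_commute:
  fixes g gx gs gxs :: "real \<Rightarrow> real \<Rightarrow> real"
  assumes a: "0 < a"
    and d1: "\<And>s y. 0 < s \<Longrightarrow> (g s has_real_derivative gx s y) (at y)"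
    and c1: "\<And>s. 0 < s \<Longrightarrow> continuous_on UNIV (gx s)"
    and d2: "\<And>s y. 0 < s \<Longrightarrow> ((\<lambda>s. g s y) has_real_derivative gs s y) (at s)"
    and d3: "\<And>s y. 0 < s \<Longrightarrow> ((\<lambda>s. gx s y) has_real_derivative gxs s y) (at s)"
    and c3: "continuous_on ({0<..} \<times> UNIV) (\<lambda>(s, y). gxs s y)"
    and i1: "\<And>y. integrable lborel (\<lambda>s. indicator {0<..} s * gs s y * rl_kernel a (t - s))"
    and i2: "\<And>y. integrable lborel (\<lambda>s. indicator {0<..} s * gxs s y * rl_kernel a (t - s))"
    and cH: "continuous_on UNIV (\<lambda>y. rl_integral a (\<lambda>s. gxs s y) t)"
    and dG: "\<And>y. ((\<lambda>y. rl_integral a (\<lambda>s. gs s y) t) has_real_derivative D y) (at y)"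
    and cD: "continuous_on UNIV D"
  shows "D y = rl_integral a (\<lambda>s. gxs s y) t"
proof (rule ccontr)
  define H where "H = (\<lambda>y. rl_integral a (\<lambda>s. gxs s y) t)"
  define q where "q = (\<lambda>y s. \<bar>indicator {0<..} s * gxs s y * rl_kernel a (t - s)\<bar>)"
  define J where "J = (\<lambda>y. \<integral>\<^sup>+s. ennreal (q y s) \<partial>lborel)"
  have qm[measurable]: "q y \<in> borel_measurable lborel" for y using i2[of y] unfolding q_def by auto
  have q_cont: "((\<lambda>k. q (z k) s) \<longlonglongrightarrow> q y s)" if "z \<longlonglongrightarrow> y" for z y s
  proof (cases "0 < s")
    case True
    have "continuous_on UNIV (gxs s)"
      using True by (intro continuous_on_compose2[OF c3, of UNIV "\<lambda>y. (s, y)", simplified] continuous_intros) auto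
    hence "isCont (gxs s) y" by (simp add: continuous_on_eq_continuous_at)
    hence "(\<lambda>k. gxs s (z k)) \<longlonglongrightarrow> gxs s y" using that by (rule isCont_tendsto_compose)
    thus ?thesis unfolding q_def by (intro tendsto_intros)
  qed (simp add: q_def)
  \<comment> \<open>Sublevel sets of the kernel integral of the absolute value; Fatou's lemma makes
    them closed, finiteness of the integral makes them cover the line.\<close>
  define F where "F = (\<lambda>n::nat. {y. J y \<le> ennreal (real n)})"
  have closedF: "closed (F n)" for n
    unfolding closed_sequential_limits
  proof (intro allI impI)
    fix z l assume z: "(\<forall>k. z k \<in> F n) \<and> z \<longlonglongrightarrow> l"
    have "J l = (\<integral>\<^sup>+s. liminf (\<lambda>k. ennreal (q (z k) s)) \<partial>lborel)"
      unfolding J_def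
    proof (intro nn_integral_cong)
      fix s
      have "(\<lambda>k. ennreal (q (z k) s)) \<longlonglongrightarrow> ennreal (q l s)"
        using q_cont[of z l s] z by (intro tendsto_ennrealI) auto
      thus "ennreal (q l s) = liminf (\<lambda>k. ennreal (q (z k) s))"
        by (simp add: lim_imp_Liminf)
    qed
    also have "\<dots> \<le> liminf (\<lambda>k. J (z k))"
      unfolding J_def by (intro nn_integral_liminf) measurable
    also have "\<dots> \<le> ennreal (real n)"
      using z by (intro Liminf_le) (auto simp: F_def)
    finally show "l \<in> F n" by (simp add: F_def)
  qed
  have Jint: "J y = ennreal (\<integral>s. q y s \<partial>lborel)" for y
    unfolding J_def using i2[of y] by (intro nn_integral_eq_integral) (auto simp: q_def)
  have cover: "\<exists>n. y \<in> F n" for y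
  proof -
    obtain n :: nat where "(\<integral>s. q y s \<partial>lborel) \<le> real n" using real_arch_simple by blast
    thus ?thesis by (auto simp: F_def Jint intro!: exI[of _ n] ennreal_leI)
  qed
  assume ne: "D y \<noteq> rl_integral a (\<lambda>s. gxs s y) t"
  have "open {z. D z \<noteq> H z}"
    using open_Collect_neq[OF cD cH] by (simp add: H_def)
  moreover have "y \<in> {z. D z \<noteq> H z}" using ne by (simp add: H_def)
  ultimately obtain r where r: "0 < r" "cball y r \<subseteq> {z. D z \<noteq> H z}"
    using open_contains_cball by blast
  define S where "S = cball y r"
  \<comment> \<open>Baire's theorem inside the closed ball S: if every S - F n were dense in S, so
    would be their intersection, which is empty because the sets F n cover.\<close>
  have "\<exists>n. \<not> S \<subseteq> closure (S - F n)"
  proof (rule ccontr)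
    assume "\<nexists>n. \<not> S \<subseteq> closure (S - F n)"
    hence cl: "S \<subseteq> closure (S - F n)" for n by blast
    have "S \<subseteq> closure (\<Inter>(range (\<lambda>n. S - F n)))"
    proof (rule Baire)
      show "closed S" by (simp add: S_def)
      show "openin (top_of_set S) T \<and> S \<subseteq> closure T" if T: "T \<in> range (\<lambda>n. S - F n)" for T
      proof -
        obtain n where T: "T = S - F n" using T by blast
        have "openin (top_of_set S) (S \<inter> - F n)"
          using closedF by (intro openin_open_Int) auto
        thus ?thesis using cl by (simp add: T Diff_eq)
      qed
    qed simp
    moreover have "\<Inter>(range (\<lambda>n. S - F n)) = {}" using cover by auto
    ultimately have "S \<subseteq> {}" by (simp only: closure_empty)
    thus False using r by (simp add: S_def)
  qed
  then obtain n z where z: "z \<in> S" "z \<notin> closure (S - F n)" by blast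
  then obtain e where e: "0 < e" "\<And>w. w \<in> S - F n \<Longrightarrow> e \<le> dist w z"
    unfolding closure_approachable by (meson not_le)
  \<comment> \<open>The interval is kept strictly inside the e-ball around z, where every point of S
    belongs to F n, and inside S, where D and H differ everywhere. One interior point at which they
    agree is then a contradiction.\<close>
  define p1 where "p1 = max (z - e/2) (y - r)"
  define p2 where "p2 = min (z + e/2) (y + r)"
  have p: "p1 < p2" using z e r by (auto simp: p1_def p2_def S_def dist_real_def)
  have sub: "w \<in> S \<and> w \<in> F n" if "p1 \<le> w" "w \<le> p2" for w
  proof -
    have "w \<in> S" using that by (auto simp: p1_def p2_def S_def dist_real_def)
    moreover have "dist w z < e" using that e by (auto simp: p1_def p2_def dist_real_def)
    ultimately show ?thesis using e(2)[of w] by force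
  qed
  have int: "rl_integral a (\<lambda>s. gs s w) t - rl_integral a (\<lambda>s. gs s p1) t = integral {p1..w} H"
    if "p1 \<le> w" "w \<le> p2" for w
    unfolding H_def
  proof (rule rl_integral_deriv_commute_on_interval[OF a that(1) d1 c1 d2 d3 c3 i1 i2 _ cH])
    fix v assume "p1 \<le> v" "v \<le> w"
    hence "v \<in> F n" using sub that by auto
    thus "(\<integral>s. \<bar>indicator {0<..} s * gxs s v * rl_kernel a (t - s)\<bar> \<partial>lborel) \<le> real n"
      by (simp add: F_def Jint q_def)
  qed
  define w where "w = (p1 + p2) / 2"
  have w: "p1 < w" "w < p2" using p by (auto simp: w_def)
  have "((\<lambda>x. integral {p1..x} H) has_real_derivative H w) (at w within {p1..p2})"
    using w unfolding H_def by (intro integral_has_real_derivative continuous_on_subset[OF cH]) auto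
  hence "((\<lambda>x. integral {p1..x} H) has_real_derivative H w) (at w)"
    using w by (simp add: at_within_interior[of w "{p1..p2}"])
  hence "((\<lambda>x. rl_integral a (\<lambda>s. gs s p1) t + integral {p1..x} H) has_real_derivative H w) (at w)"
    by (auto intro!: derivative_eq_intros)
  moreover have "eventually (\<lambda>x. rl_integral a (\<lambda>s. gs s p1) t + integral {p1..x} H = rl_integral a (\<lambda>s. gs s x) t) (nhds w)"
  proof -
    have "eventually (\<lambda>x. x \<in> {p1<..<p2}) (nhds w)" using w by (intro eventually_nhds_in_open) auto
    thus ?thesis
    proof eventually_elim
      case (elim x)
      thus ?case using int[of x] by auto
    qed
  qed
  ultimately have "((\<lambda>x. rl_integral a (\<lambda>s. gs s x) t) has_real_derivative H w) (at w)"
    by (subst (asm) DERIV_cong_ev[OF refl _ refl]) auto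
  hence "D w = H w" using dG[of w] by (rule DERIV_unique[OF _, rotated])
  moreover have "w \<in> S" using sub[of w] w by auto
  ultimately show False using r by (auto simp: S_def)
qed

lemma (in prob_space) integrable_bounded_AE:
  fixes f :: "'a \<Rightarrow> real"
  assumes "f \<in> borel_measurable M" "AE x in M. \<bar>f x\<bar> \<le> B"
  shows "integrable M f"
  by (rule integrable_const_bound[where B = B]) (use assms in auto)

section \<open>The inverse stable law\<close>

text \<open>With z = exp(-y) in [0, 1], the values at integers are the moments of z. Polynomial
  approximation extends the equality from polynomials to continuous functions of z, and continuous
  ramps approximate the indicator of y <= a, giving equal distribution functions.\<close>

lemma laplace_transform_unique:
  assumes "real_distribution M1" "real_distribution M2"
    and pos1: "AE y in M1. 0 \<le> y" and pos2: "AE y in M2. 0 \<le> y"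
    and eq: "\<And>n::nat. (\<integral>y. exp (- (real n * y)) \<partial>M1) = (\<integral>y. exp (- (real n * y)) \<partial>M2)"
  shows "M1 = M2"
proof -
  interpret M1: real_distribution M1 by fact
  interpret M2: real_distribution M2 by fact
  have exp_in_unit: "exp (- y) \<in> {0..1}" if "0 \<le> y" for y :: real using that by simp
  have ie: "integrable M (\<lambda>y. exp (- (real n * y)))" if "real_distribution M" "AE y in M. 0 \<le> y" for n M
  proof -
    interpret real_distribution M by fact
    show ?thesis
      by (rule integrable_bounded_AE[where B = 1]) (use that(2) in auto)
  qed
  have poly: "integrable M (\<lambda>y. p (exp (- y))) \<and> (\<integral>y. p (exp (- y)) \<partial>M)
      = (\<Sum>i\<le>n. a i * (\<integral>y. exp (- (real i * y)) \<partial>M))"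
    if "real_distribution M" "AE y in M. 0 \<le> y" "p = (\<lambda>x. \<Sum>i\<le>n. a i * x ^ i)" for M p a n
  proof -
    have "(\<lambda>y. p (exp (- y))) = (\<lambda>y. \<Sum>i\<le>n. a i * exp (- (real i * y)))"
      by (simp add: that(3) exp_of_nat_mult[symmetric])
    thus ?thesis using ie[OF that(1,2)] by simp
  qed
  have cont: "(\<integral>y. h (exp (- y)) \<partial>M1) = (\<integral>y. h (exp (- y)) \<partial>M2)" if h: "continuous_on UNIV h" for h :: "real \<Rightarrow> real"
  proof -
    have hm: "h \<in> borel_measurable borel" using h by (rule borel_measurable_continuous_onI)
    obtain B where B: "\<bar>h x\<bar> \<le> B" if "x \<in> {0..1}" for x
    proof -
      have "compact (h ` {0..1})" by (intro compact_continuous_image continuous_on_subset[OF h]) auto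
      thus ?thesis using that by (force dest!: compact_imp_bounded simp: bounded_iff)
    qed
    have ih: "integrable M (\<lambda>y. h (exp (- y)))" if "real_distribution M" "AE y in M. 0 \<le> y" for M
    proof -
      interpret real_distribution M by fact
      show ?thesis
        by (rule integrable_bounded_AE[where B = B]) (use that(2) B hm in auto)
    qed
    have "\<bar>(\<integral>y. h (exp (- y)) \<partial>M1) - (\<integral>y. h (exp (- y)) \<partial>M2)\<bar> \<le> e" if "0 < e" for e
    proof -
      obtain p where p: "real_polynomial_function p" "\<And>x. x \<in> {0..1} \<Longrightarrow> \<bar>h x - p x\<bar> < e / 2"
        using Stone_Weierstrass_real_polynomial_function[of "{0..1::real}" h "e / 2"]
          continuous_on_subset[OF h] \<open>0 < e\<close> by (metis compact_Icc half_gt_zero top_greatest)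
      obtain a n where pa: "p = (\<lambda>x. \<Sum>i\<le>n. a i * x ^ i)"
        using p(1) by (auto simp: real_polynomial_function_iff_sum)
      have d: "\<bar>(\<integral>y. h (exp (- y)) \<partial>M) - (\<integral>y. p (exp (- y)) \<partial>M)\<bar> \<le> e / 2"
        if M: "real_distribution M" "AE y in M. 0 \<le> y" for M
      proof -
        interpret real_distribution M by fact
        have "\<bar>\<integral>y. h (exp (- y)) - p (exp (- y)) \<partial>M\<bar> \<le> (\<integral>y. e / 2 \<partial>M)"
        proof (rule integral_abs_bound[THEN order_trans], rule integral_mono_AE)
          show "AE y in M. \<bar>h (exp (- y)) - p (exp (- y))\<bar> \<le> e / 2"
            using M(2) by eventually_elim (use p(2)[OF exp_in_unit] in \<open>auto intro: less_imp_le\<close>)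
        qed (use ih[OF M] poly[OF M pa] in auto)
        thus ?thesis using ih[OF M] poly[OF M pa] prob_space by simp
      qed
      have "(\<integral>y. p (exp (- y)) \<partial>M1) = (\<integral>y. p (exp (- y)) \<partial>M2)"
        using poly[OF assms(1,3) pa] poly[OF assms(2,4) pa] eq by simp
      thus ?thesis using d[OF assms(1,3)] d[OF assms(2,4)] by linarith
    qed
    hence "\<bar>(\<integral>y. h (exp (- y)) \<partial>M1) - (\<integral>y. h (exp (- y)) \<partial>M2)\<bar> \<le> 0"
      by (rule field_le_epsilon) auto
    thus ?thesis by simp
  qed
  have "cdf M1 a = cdf M2 a" for a
  proof -
    \<comment> \<open>A ramp in x = exp(-y): it equals 1 for y <= a and falls to 0 over a window of
      length 1/m below exp(-a), so the limit is the indicator of {..a}, including the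
      endpoint.\<close>
    define h where "h = (\<lambda>m x. min 1 (max 0 (1 + real m * (x - exp (- a)))) :: real)"
    have hc: "continuous_on UNIV (h m)" for m unfolding h_def by (intro continuous_intros)
    have hm[measurable]: "h m \<in> borel_measurable borel" for m
      using hc by (rule borel_measurable_continuous_onI)
    have lim: "(\<lambda>m. \<integral>y. h m (exp (- y)) \<partial>M) \<longlonglongrightarrow> cdf M a" if M: "real_distribution M" for M
    proof -
      interpret real_distribution M by fact
      have "(\<lambda>m. \<integral>y. h m (exp (- y)) \<partial>M) \<longlonglongrightarrow> (\<integral>y. indicator {..a} y \<partial>M)"
      proof (rule integral_dominated_convergence[where w = "\<lambda>_. 1"])
        show "AE y in M. (\<lambda>m. h m (exp (- y))) \<longlonglongrightarrow> indicator {..a} y"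
        proof (rule AE_I2)
          fix y :: real
          show "(\<lambda>m. h m (exp (- y))) \<longlonglongrightarrow> indicator {..a} y"
          proof (cases "y \<le> a")
            case True
            hence "h m (exp (- y)) = 1" for m by (simp add: h_def)
            thus ?thesis using True by simp
          next
            case False
            define d where "d = exp (- a) - exp (- y)"
            have d: "0 < d" using False by (simp add: d_def)
            obtain N :: nat where N: "1 / d < real N" using reals_Archimedean2 by blast
            have "h m (exp (- y)) = 0" if "N \<le> m" for m
            proof -
              have "1 / d < real m" using N that by (simp add: order_less_le_trans)
              hence "1 + real m * (exp (- y) - exp (- a)) \<le> 0"
                using d by (simp add: d_def field_simps)
              thus ?thesis by (simp add: h_def)
            qed
            hence "eventually (\<lambda>m. h m (exp (- y)) = 0) sequentially"
              unfolding eventually_sequentially by blast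
            thus ?thesis using False by (simp add: tendsto_eventually)
          qed
        qed
        show "AE y in M. norm (h m (exp (- y))) \<le> 1" for m by (auto simp: h_def)
      qed auto
      thus ?thesis by (simp add: cdf_def)
    qed
    from lim[OF assms(1)] lim[OF assms(2)] show ?thesis
      using cont[OF hc] by (auto intro: LIMSEQ_unique)
  qed
  thus ?thesis using cdf_unique[OF assms(1,2)] by auto
qed

text \<open>The summability condition lets the exponential series be integrated term by term, so the
  Laplace transform at every integer is a series in the moments. Since y >= 0, the norm of the k-th
  term integrates to the k-th term of the assumed series.\<close>

lemma stieltjes_moments_unique:
  assumes "real_distribution M1" "real_distribution M2"
    and pos1: "AE y in M1. 0 \<le> y" and pos2: "AE y in M2. 0 \<le> y"
    and m1: "\<And>k::nat. has_bochner_integral M1 (\<lambda>y. y ^ k) (m k)"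
    and m2: "\<And>k::nat. has_bochner_integral M2 (\<lambda>y. y ^ k) (m k)"
    and summ: "\<And>x::real. 0 \<le> x \<Longrightarrow> summable (\<lambda>k. x ^ k * m k / fact k)"
  shows "M1 = M2"
proof (rule laplace_transform_unique[OF assms(1-4)])
  fix n :: nat
  have "(\<integral>y. exp (- (real n * y)) \<partial>M) = (\<Sum>k. (- real n) ^ k * m k / fact k)"
    if M: "real_distribution M" "AE y in M. 0 \<le> y" "\<And>k::nat. has_bochner_integral M (\<lambda>y. y ^ k) (m k)" for M
  proof -
    interpret real_distribution M by fact
    have int: "integrable M (\<lambda>y. y ^ k)" "(\<integral>y. y ^ k \<partial>M) = m k" for k
      using M(3)[of k] by (auto simp: has_bochner_integral_iff)
    let ?f = "\<lambda>k y. (- (real n * y)) ^ k / fact k :: real"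
    have f_eq: "?f k = (\<lambda>y. (- real n) ^ k / fact k * y ^ k)" for k
      by (auto simp: fun_eq_iff power_mult_distrib power_minus[of "real n * _"] power_minus[of "real n"])
    have exp_eq: "exp (- (real n * y)) = (\<Sum>k. ?f k y)" for y
      by (simp add: exp_def divide_inverse mult.commute)
    have "(\<integral>y. (\<Sum>k. ?f k y) \<partial>M) = (\<Sum>k. integral\<^sup>L M (?f k))"
    proof (rule integral_suminf)
      show "integrable M (?f k)" for k unfolding f_eq using int by (intro integrable_mult_right)
      show "AE y in M. summable (\<lambda>k. norm (?f k y))"
      proof (rule AE_I2)
        fix y
        have "summable (\<lambda>k. norm ((- (real n * y)) ^ k /\<^sub>R fact k))" by (rule summable_norm_exp)
        thus "summable (\<lambda>k. norm (?f k y))" by (simp add: divide_inverse abs_mult mult.commute)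
      qed
      have "(\<integral>y. norm (?f k y) \<partial>M) = real n ^ k * m k / fact k" for k
      proof -
        have "(\<integral>y. norm (?f k y) \<partial>M) = (\<integral>y. real n ^ k / fact k * y ^ k \<partial>M)"
        proof (rule integral_cong_AE)
          show "AE y in M. norm (?f k y) = real n ^ k / fact k * y ^ k"
            using M(2) by eventually_elim (simp add: power_abs abs_mult power_mult_distrib)
        qed measurable
        thus ?thesis by (simp add: int)
      qed
      thus "summable (\<lambda>k. \<integral>y. norm (?f k y) \<partial>M)" using summ[of "real n"] by simp
    qed
    also have "\<dots> = (\<Sum>k. (- real n) ^ k * m k / fact k)"
      unfolding f_eq by (simp add: int)
    finally show ?thesis by (simp only: exp_eq)
  qed
  from this[OF assms(1,3) m1] this[OF assms(2,4) m2]
  show "(\<integral>y. exp (- (real n * y)) \<partial>M1) = (\<integral>y. exp (- (real n * y)) \<partial>M2)" by simp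
qed

text \<open>A Mittag-Leffler series. Consecutive terms have no simple ratio, but terms at distance
  \<nu> do, since the argument of Gamma then grows by exactly 1. The ratio test is applied in each
  residue class modulo \<nu>, and the classes are regrouped.\<close>

lemma summable_power_over_Gamma:
  fixes x :: real
  assumes \<nu>: "0 < \<nu>" and x: "0 \<le> x"
  shows "summable (\<lambda>k. x ^ k / Gamma (1 + real k / real \<nu>))"
proof -
  define a where "a = (\<lambda>k. x ^ k / Gamma (1 + real k / real \<nu>))"
  have G: "0 < Gamma (1 + real k / real \<nu>)" for k using \<nu> by (intro Gamma_real_pos) (simp add: add_pos_nonneg)
  have a0: "0 \<le> a k" for k unfolding a_def using x G[of k] by simp
  have rec: "a (k + \<nu>) = x ^ \<nu> / (1 + real k / real \<nu>) * a k" for k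
  proof -
    have "Gamma (1 + real (k + \<nu>) / real \<nu>) = Gamma ((1 + real k / real \<nu>) + 1)"
      using \<nu> by (simp add: add_divide_distrib add_ac)
    also have "\<dots> = (1 + real k / real \<nu>) * Gamma (1 + real k / real \<nu>)"
    proof (rule Gamma_plus1)
      have "0 < 1 + real k / real \<nu>" by (simp add: add_pos_nonneg)
      thus "1 + real k / real \<nu> \<notin> \<int>\<^sub>\<le>\<^sub>0" by (auto elim!: nonpos_Ints_cases)
    qed
    finally show ?thesis by (simp add: a_def power_add)
  qed
  \<comment> \<open>From q >= 2 x^\<nu> on, the ratio x^\<nu> / (1 + q + r/\<nu>) is at most
    1/2.\<close>
  have sr: "summable (\<lambda>q. a (q * \<nu> + r))" for r
  proof (rule summable_ratio_test[where c = "1/2" and N = "nat \<lceil>2 * x ^ \<nu>\<rceil>"])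
    fix q assume "nat \<lceil>2 * x ^ \<nu>\<rceil> \<le> q"
    hence q: "2 * x ^ \<nu> \<le> real q" by linarith
    have "real q \<le> 1 + real (q * \<nu> + r) / real \<nu>" using \<nu> by (simp add: field_simps)
    hence "x ^ \<nu> / (1 + real (q * \<nu> + r) / real \<nu>) \<le> 1/2" using q \<nu>
      by (subst pos_divide_le_eq) (auto simp: add_pos_nonneg)
    hence "x ^ \<nu> / (1 + real (q * \<nu> + r) / real \<nu>) * a (q * \<nu> + r) \<le> 1/2 * a (q * \<nu> + r)"
      by (intro mult_right_mono a0)
    moreover have e: "Suc q * \<nu> + r = (q * \<nu> + r) + \<nu>" by simp
    ultimately have "a (Suc q * \<nu> + r) \<le> 1/2 * a (q * \<nu> + r)"
      unfolding e rec[of "q * \<nu> + r"] by blast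
    thus "norm (a (Suc q * \<nu> + r)) \<le> 1/2 * norm (a (q * \<nu> + r))"
      by (simp only: real_norm_def abs_of_nonneg[OF a0])
  qed simp
  show ?thesis
    unfolding a_def[symmetric]
  proof (rule summableI_nonneg_bounded[where x = "\<Sum>q. \<Sum>r<\<nu>. a (q * \<nu> + r)"])
    fix n
    have s: "summable (\<lambda>q. \<Sum>r<\<nu>. a (q * \<nu> + r))" by (intro summable_sum sr)
    have "sum a {..<n} \<le> sum a {..<n * \<nu>}" using \<nu> a0 by (intro sum_mono2) auto
    also have "\<dots> = (\<Sum>q<n. sum a {q * \<nu>..<q * \<nu> + \<nu>})" by (rule sum.nat_group[symmetric])
    also have "\<dots> = (\<Sum>q<n. \<Sum>r<\<nu>. a (q * \<nu> + r))"
    proof (rule sum.cong)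
      fix q
      show "sum a {q * \<nu>..<q * \<nu> + \<nu>} = (\<Sum>r<\<nu>. a (q * \<nu> + r))"
        using sum.shift_bounds_nat_ivl[of a 0 "q * \<nu>" \<nu>] by (simp add: lessThan_atLeast0 add.commute)
    qed simp
    also have "\<dots> \<le> (\<Sum>q. \<Sum>r<\<nu>. a (q * \<nu> + r))"
      by (rule sum_le_suminf[OF s]) (auto intro: sum_nonneg a0)
    finally show "sum a {..<n} \<le> (\<Sum>q. \<Sum>r<\<nu>. a (q * \<nu> + r))" .
  qed (rule a0)
qed

text \<open>The Gamma integral after t = x s. It writes x^(-p) as a mixture of exponentials, which
  is how negative moments of a subordinator are reached from its Laplace transform.\<close>

lemma nn_integral_exp_powr:
  assumes p: "0 < p" and x: "0 < (x::real)"
  shows "(\<integral>\<^sup>+s. ennreal (indicator {0<..} s * s powr (p - 1) * exp (- (s * x))) \<partial>lborel)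
     = ennreal (Gamma p * x powr - p)"
proof -
  let ?f = "\<lambda>t::real. ennreal (indicator {0..} t * t powr (p - 1) / exp t)"
  have "ennreal (Gamma p) = (\<integral>\<^sup>+t. ?f t \<partial>lborel)" by (rule Gamma_conv_nn_integral_real[OF p])
  also have "\<dots> = ennreal \<bar>x\<bar> * (\<integral>\<^sup>+s. ?f (0 + x * s) \<partial>lborel)"
    using x by (intro nn_integral_real_affine) auto
  also have "(\<integral>\<^sup>+s. ?f (0 + x * s) \<partial>lborel)
      = (\<integral>\<^sup>+s. ennreal (x powr (p - 1)) * ennreal (indicator {0<..} s * s powr (p - 1) * exp (- (s * x))) \<partial>lborel)"
  proof (intro nn_integral_cong)
    fix s :: real
    have "indicator {0..} (x * s) * (x * s) powr (p - 1) / exp (x * s)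
        = x powr (p - 1) * (indicator {0<..} s * s powr (p - 1) * exp (- (s * x)))"
    proof (cases "0 < s")
      case True
      thus ?thesis using x by (simp add: powr_mult exp_minus divide_inverse mult_ac)
    next
      case False
      hence "s = 0 \<or> (s < 0 \<and> x * s < 0)" using x by (auto simp: mult_less_0_iff)
      thus ?thesis by auto
    qed
    thus "?f (0 + x * s) = ennreal (x powr (p - 1)) * ennreal (indicator {0<..} s * s powr (p - 1) * exp (- (s * x)))"
      by (simp add: ennreal_mult'[symmetric])
  qed
  also have "\<dots> = ennreal (x powr (p - 1)) * (\<integral>\<^sup>+s. ennreal (indicator {0<..} s * s powr (p - 1) * exp (- (s * x))) \<partial>lborel)"
    by (rule nn_integral_cmult) measurable
  finally have "ennreal (Gamma p) = ennreal \<bar>x\<bar> * (ennreal (x powr (p - 1)) *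
      (\<integral>\<^sup>+s. ennreal (indicator {0<..} s * s powr (p - 1) * exp (- (s * x))) \<partial>lborel))" .
  also have "\<dots> = ennreal (x powr p) * (\<integral>\<^sup>+s. ennreal (indicator {0<..} s * s powr (p - 1) * exp (- (s * x))) \<partial>lborel)"
    using x by (simp add: mult.assoc[symmetric] ennreal_mult'[symmetric] powr_diff)
  finally have *: "ennreal (Gamma p) = ennreal (x powr p) *
     (\<integral>\<^sup>+s. ennreal (indicator {0<..} s * s powr (p - 1) * exp (- (s * x))) \<partial>lborel)" .
  have "ennreal (x powr - p) * ennreal (Gamma p) = (ennreal (x powr - p) * ennreal (x powr p)) *
     (\<integral>\<^sup>+s. ennreal (indicator {0<..} s * s powr (p - 1) * exp (- (s * x))) \<partial>lborel)"
    unfolding * by (simp only: mult.assoc)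
  moreover have "ennreal (x powr - p) * ennreal (x powr p) = 1"
    using x by (simp add: ennreal_mult'[symmetric] powr_add[symmetric])
  ultimately show ?thesis using Gamma_real_pos[OF p]
    by (simp add: ennreal_mult'[symmetric] mult.commute)
qed

text \<open>The substitution s = r^\<nu> gives the Gamma integral. The exponential is the Laplace
  transform at s of the subordinator at time 1.\<close>

lemma nn_integral_stretched_exp:
  assumes \<nu>: "0 < \<nu>" and k: "0 < k"
  shows "(\<integral>\<^sup>+s. ennreal (indicator {0<..} s * s powr (real k / real \<nu> - 1) * exp (- (s powr (1 / real \<nu>)))) \<partial>lborel)
     = ennreal (real \<nu> * Gamma (real k))"
proof -
  define f where "f = (\<lambda>s::real. s powr (real k / real \<nu> - 1) * exp (- (s powr (1 / real \<nu>))))"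
  have "((\<lambda>t. t powr (real k - 1) / exp t) has_integral Gamma (real k)) {0..}"
    using k by (intro Gamma_integral_real) simp
  hence "((\<lambda>t. t powr (real k - 1) / exp t) has_integral Gamma (real k)) {0<..}"
    by (subst (asm) has_integral_spike_set_eq[of _ "{0<..}"])
      (auto intro!: negligible_subset[OF negligible_sing[of 0]])
  hence I: "((\<lambda>t. real \<nu> * (t powr (real k - 1) / exp t)) has_integral real \<nu> * Gamma (real k)) {0<..}"
    by (rule has_integral_mult_right)
  have eq: "\<bar>real \<nu> * r ^ (\<nu> - 1)\<bar> * f (r ^ \<nu>) = real \<nu> * (r powr (real k - 1) / exp r)" if "r \<in> {0<..}" for r
  proof -
    have r: "0 < r" using that by simp
    have "r ^ \<nu> = r powr real \<nu>" "r ^ (\<nu> - 1) = r powr (real \<nu> - 1)"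
      using r \<nu> by (simp_all add: powr_realpow[symmetric] of_nat_diff)
    moreover have "r powr (real \<nu> - 1) * r powr (real k - real \<nu>) = r powr (real k - 1)"
      by (simp add: powr_add[symmetric])
    moreover have "real \<nu> * (real k / real \<nu> - 1) = real k - real \<nu>" using \<nu> by (simp add: field_simps)
    ultimately show ?thesis
      using r \<nu> by (simp add: f_def powr_powr exp_minus divide_inverse mult.assoc[symmetric])
  qed
  have "((\<lambda>r. \<bar>real \<nu> * r ^ (\<nu> - 1)\<bar> * f (r ^ \<nu>)) has_integral real \<nu> * Gamma (real k)) {0<..}"
    by (rule has_integral_cong[THEN iffD2, OF _ I]) (rule eq)
  moreover from this have "(\<lambda>r. \<bar>real \<nu> * r ^ (\<nu> - 1)\<bar> * f (r ^ \<nu>)) absolutely_integrable_on {0<..}"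
    by (intro nonnegative_absolutely_integrable_1) (auto simp: f_def has_integral_integrable)
  moreover have "(\<lambda>r. \<bar>real \<nu> * r ^ (\<nu> - 1)\<bar> * f (r ^ \<nu>)) absolutely_integrable_on {0<..} \<and>
      integral {0<..} (\<lambda>r. \<bar>real \<nu> * r ^ (\<nu> - 1)\<bar> * f (r ^ \<nu>)) = real \<nu> * Gamma (real k)
     \<longleftrightarrow> f absolutely_integrable_on ((\<lambda>r. r ^ \<nu>) ` {0<..}) \<and> integral ((\<lambda>r. r ^ \<nu>) ` {0<..}) f = real \<nu> * Gamma (real k)"
  proof (rule has_absolute_integral_change_of_variables_1')
    show "((\<lambda>r. r ^ \<nu>) has_real_derivative real \<nu> * x ^ (\<nu> - 1)) (at x within {0<..})" for x :: real
      by (auto intro!: derivative_eq_intros)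
    show "inj_on (\<lambda>r::real. r ^ \<nu>) {0<..}"
      using \<nu> by (intro inj_onI) (auto dest!: power_eq_imp_eq_base)
  qed simp
  ultimately have "f absolutely_integrable_on ((\<lambda>r. r ^ \<nu>) ` {0<..}) \<and> integral ((\<lambda>r. r ^ \<nu>) ` {0<..}) f = real \<nu> * Gamma (real k)"
    by (auto simp: integral_unique)
  moreover have "(\<lambda>r::real. r ^ \<nu>) ` {0<..} = {0<..}"
  proof (intro equalityI subsetI)
    fix s :: real assume "s \<in> {0<..}"
    thus "s \<in> (\<lambda>r. r ^ \<nu>) ` {0<..}"
      using \<nu> by (intro image_eqI[where x = "root \<nu> s"]) auto
  qed auto
  ultimately have "(f has_integral real \<nu> * Gamma (real k)) {0<..}"
    by (simp add: has_integral_iff set_lebesgue_integral_eq_integral(1))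
  from nn_integral_has_integral_lebesgue[OF _ this]
  show ?thesis by (simp add: f_def mult.assoc)
qed

section \<open>The stable subordinator, its inverse, and their laws\<close>

locale subordinator = prob_space M for M :: "'w measure" +
  fixes \<nu> :: nat and \<beta> :: real and L :: "real \<Rightarrow> 'w \<Rightarrow> real"
  assumes nu: "2 \<le> \<nu>" and beta: "\<beta> = 1 / real \<nu>" and stable: "stable_subordinator M \<beta> L"
begin

lemma beta_pos: "0 < \<beta>" and beta_less_1: "\<beta> < 1" using nu by (auto simp: beta)

lemma L_measurable: "0 \<le> t \<Longrightarrow> L t \<in> borel_measurable M"
  using stable by (simp add: stable_subordinator_def)

lemma L_mono: "\<omega> \<in> space M \<Longrightarrow> 0 \<le> s \<Longrightarrow> s \<le> t \<Longrightarrow> L s \<omega> \<le> L t \<omega>"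
  using stable by (auto simp: stable_subordinator_def mono_on_def)

lemma L_zero: "\<omega> \<in> space M \<Longrightarrow> L 0 \<omega> = 0"
  using stable by (auto simp: stable_subordinator_def)

lemma L_nonneg: "\<omega> \<in> space M \<Longrightarrow> 0 \<le> t \<Longrightarrow> 0 \<le> L t \<omega>"
  using L_mono[of \<omega> 0 t] L_zero by simp

lemma L_laplace: "0 \<le> s \<Longrightarrow> 0 \<le> t \<Longrightarrow> (\<integral>\<omega>. exp (- (s * L t \<omega>)) \<partial>M) = exp (- (t * s powr \<beta>))"
  using stable by (simp add: stable_subordinator_def)

lemma L_exp_integrable:
  assumes "0 \<le> s" "0 \<le> t"
  shows "integrable M (\<lambda>\<omega>. exp (- (s * L t \<omega>)))"
  by (rule integrable_bounded_AE[where B = 1])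
    (use assms L_nonneg L_measurable[of t] in \<open>auto intro!: AE_I2 mult_nonneg_nonneg\<close>)

text \<open>The event L(t) <= 0 has probability at most the Laplace transform exp(-t s^\<beta>) at
  every s >= 0, and this tends to 0 as s grows.\<close>

lemma L_positive:
  assumes t: "0 < t"
  shows "AE \<omega> in M. 0 < L t \<omega>"
proof -
  define p where "p = prob {\<omega> \<in> space M. L t \<omega> \<le> 0}"
  have [measurable]: "L t \<in> borel_measurable M" using t by (intro L_measurable) simp
  have le: "p \<le> exp (- (t * s powr \<beta>))" if s: "0 \<le> s" for s
  proof -
    have "p = (\<integral>\<omega>. indicator {\<omega> \<in> space M. L t \<omega> \<le> 0} \<omega> \<partial>M)" by (simp add: p_def)
    also have "\<dots> \<le> (\<integral>\<omega>. exp (- (s * L t \<omega>)) \<partial>M)"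
    proof (rule integral_mono)
      show "integrable M (\<lambda>\<omega>. exp (- (s * L t \<omega>)))"
        using s t by (intro L_exp_integrable) auto
      show "indicator {\<omega> \<in> space M. L t \<omega> \<le> 0} \<omega> \<le> exp (- (s * L t \<omega>))" if "\<omega> \<in> space M" for \<omega>
        using s that by (auto simp: indicator_def mult_le_0_iff)
    qed (auto simp: less_top[symmetric])
    also have "\<dots> = exp (- (t * s powr \<beta>))" using s t by (intro L_laplace) auto
    finally show ?thesis .
  qed
  have "p = 0"
  proof (rule ccontr)
    assume "p \<noteq> 0"
    hence p: "0 < p" "p \<le> 1" by (auto simp: p_def zero_less_measure_iff)
    \<comment> \<open>Chosen so that t s^\<beta> = 1 - ln p, which makes the bound equal to p/e <
      p.\<close>
    define s where "s = ((1 - ln p) / t) powr (1 / \<beta>)"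
    have "ln p \<le> 0" using p by simp
    hence l: "0 < 1 - ln p" by simp
    have "s powr \<beta> = (1 - ln p) / t" using l t beta_pos by (simp add: s_def powr_powr)
    hence "exp (- (t * s powr \<beta>)) = exp (ln p - 1)" using t by simp
    hence "p \<le> exp (ln p - 1)" using le[of s] by (simp add: s_def)
    also have "\<dots> < exp (ln p)" by simp
    finally show False using p by simp
  qed
  hence "AE \<omega> in M. \<not> L t \<omega> \<le> 0"
    unfolding p_def by (subst (asm) prob_Collect_eq_0) auto
  thus ?thesis by eventually_elim simp
qed

lemma distr_L_real: "0 \<le> t \<Longrightarrow> real_distribution (distr M borel (L t))"
  by (intro real_distribution_distr L_measurable)

lemma distr_L_unique:
  assumes Y: "Y \<in> borel_measurable M" "AE \<omega> in M. 0 \<le> Y \<omega>" and t: "0 \<le> t"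
    and eq: "\<And>n::nat. (\<integral>\<omega>. exp (- (real n * Y \<omega>)) \<partial>M) = exp (- (t * real n powr \<beta>))"
  shows "distr M borel Y = distr M borel (L t)"
proof (rule laplace_transform_unique)
  note [measurable] = L_measurable[OF t] Y(1)
  show "real_distribution (distr M borel Y)" using Y by (intro real_distribution_distr)
  show "real_distribution (distr M borel (L t))" by (rule distr_L_real[OF t])
  show "AE y in distr M borel Y. 0 \<le> y" using Y by (subst AE_distr_iff) auto
  show "AE y in distr M borel (L t). 0 \<le> y"
    using L_nonneg t by (subst AE_distr_iff) (auto intro!: AE_I2)
  show "(\<integral>y. exp (- (real n * y)) \<partial>distr M borel Y) = (\<integral>y. exp (- (real n * y)) \<partial>distr M borel (L t))" for n
    using eq[of n] L_laplace[of "real n" t] t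
    by (simp add: integral_distr)
qed

lemma distr_L_scale:
  assumes t: "0 < t"
  shows "distr M borel (\<lambda>\<omega>. t powr (1 / \<beta>) * L 1 \<omega>) = distr M borel (L t)"
proof (rule distr_L_unique)
  show "(\<lambda>\<omega>. t powr (1 / \<beta>) * L 1 \<omega>) \<in> borel_measurable M" using L_measurable[of 1] by simp
  show "AE \<omega> in M. 0 \<le> t powr (1 / \<beta>) * L 1 \<omega>" using L_nonneg by (auto intro!: AE_I2)
  fix n :: nat
  have "(\<integral>\<omega>. exp (- (real n * (t powr (1 / \<beta>) * L 1 \<omega>))) \<partial>M) = (\<integral>\<omega>. exp (- ((real n * t powr (1 / \<beta>)) * L 1 \<omega>)) \<partial>M)"
    by (simp add: mult.assoc)
  also have "\<dots> = exp (- (1 * (real n * t powr (1 / \<beta>)) powr \<beta>))" by (rule L_laplace) auto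
  also have "(real n * t powr (1 / \<beta>)) powr \<beta> = real n powr \<beta> * t"
    using t beta_pos by (simp add: powr_mult powr_powr)
  finally show "(\<integral>\<omega>. exp (- (real n * (t powr (1 / \<beta>) * L 1 \<omega>))) \<partial>M) = exp (- (t * real n powr \<beta>))"
    by (simp add: mult.commute)
qed (use t in simp)

text \<open>The law of the inverse process at time 1, represented through L(1)^(-\<beta>) because
  the moments of that variable follow from the Laplace transform of L(1);
  \<open>distr_inverse\<close> makes the identification.\<close>

definition inverse_law :: "real measure" where
  "inverse_law = distr M borel (\<lambda>\<omega>. L 1 \<omega> powr - \<beta>)"

lemma inverse_nonempty:
  assumes "\<omega> \<in> space M"
  shows "{x. 0 \<le> x \<and> L x \<omega> > t} \<noteq> {}"
proof -
  have "filterlim (\<lambda>t. L t \<omega>) at_top at_top"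
    using stable assms by (auto simp: stable_subordinator_def)
  hence "eventually (\<lambda>x. t < L x \<omega>) at_top" by (simp add: filterlim_at_top_dense)
  hence "eventually (\<lambda>x. 0 \<le> x \<and> t < L x \<omega>) at_top"
    using eventually_ge_at_top[of 0] by eventually_elim auto
  thus ?thesis using eventually_happens'[OF trivial_limit_at_top_linorder] by blast
qed

lemma inverse_nonneg: "\<omega> \<in> space M \<Longrightarrow> 0 \<le> inverse_process L t \<omega>"
  unfolding inverse_process_def by (intro cInf_greatest inverse_nonempty) auto

lemma inverse_le: "\<omega> \<in> space M \<Longrightarrow> 0 \<le> a \<Longrightarrow> t < L a \<omega> \<Longrightarrow> inverse_process L t \<omega> \<le> a"
  unfolding inverse_process_def by (intro cInf_lower) (auto intro!: bdd_belowI[of _ 0])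

lemma inverse_lessD:
  assumes "\<omega> \<in> space M" "inverse_process L t \<omega> < a"
  obtains x where "0 \<le> x" "x < a" "t < L x \<omega>"
  using assms cInf_lessD[OF inverse_nonempty[OF assms(1)], of t a]
  unfolding inverse_process_def by auto

text \<open>By monotonicity of the paths the first passage is below a exactly when L already exceeds
  t at some rational time in [0, a).\<close>

lemma inverse_measurable: "inverse_process L t \<in> borel_measurable M"
proof (rule borel_measurable_iff_less[THEN iffD2], rule allI)
  fix a
  have "{\<omega> \<in> space M. inverse_process L t \<omega> < a} = (\<Union>q\<in>\<rat> \<inter> {0..<a}. {\<omega> \<in> space M. t < L q \<omega>})"
  proof (intro equalityI subsetI)
    fix \<omega> assume \<omega>: "\<omega> \<in> {\<omega> \<in> space M. inverse_process L t \<omega> < a}"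
    then obtain x where x: "0 \<le> x" "x < a" "t < L x \<omega>" using inverse_lessD[of \<omega> t a] by blast
    obtain q where q: "q \<in> \<rat>" "x < q" "q < a" using Rats_dense_in_real[OF x(2)] by blast
    have "t < L q \<omega>" using L_mono[of \<omega> x q] x q \<omega> by auto
    thus "\<omega> \<in> (\<Union>q\<in>\<rat> \<inter> {0..<a}. {\<omega> \<in> space M. t < L q \<omega>})" using q x \<omega> by auto
  next
    fix \<omega> assume "\<omega> \<in> (\<Union>q\<in>\<rat> \<inter> {0..<a}. {\<omega> \<in> space M. t < L q \<omega>})"
    then obtain q where "q \<in> {0..<a}" "\<omega> \<in> space M" "t < L q \<omega>" by blast
    thus "\<omega> \<in> {\<omega> \<in> space M. inverse_process L t \<omega> < a}" using inverse_le[of \<omega> q t] by auto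
  qed
  also have "\<dots> \<in> sets M"
  proof (intro sets.countable_UN')
    show "countable (\<rat> \<inter> {0..<a})" using countable_rat by blast
    have "{\<omega> \<in> space M. t < L q \<omega>} \<in> sets M" if "0 \<le> q" for q
    proof -
      have [measurable]: "L q \<in> borel_measurable M" by (rule L_measurable[OF that])
      show ?thesis by measurable
    qed
    thus "(\<lambda>q. {\<omega> \<in> space M. t < L q \<omega>}) ` (\<rat> \<inter> {0..<a}) \<subseteq> sets M" by auto
  qed
  finally show "{\<omega> \<in> space M. inverse_process L t \<omega> < a} \<in> sets M" .
qed

text \<open>For a first passage time Z only the inclusions {Z < a} in {t < L(a)} in {Z <= a} are at
  hand. The resulting inequalities determine the distribution function because it is
  right-continuous.\<close>

lemma cdf_sandwich:
  fixes Y Z :: "'w \<Rightarrow> real"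
  assumes Y[measurable]: "Y \<in> borel_measurable M" and Z[measurable]: "Z \<in> borel_measurable M"
    and pos: "AE \<omega> in M. 0 \<le> Y \<omega>" "AE \<omega> in M. 0 \<le> Z \<omega>"
    and s1: "\<And>a. 0 < a \<Longrightarrow> \<P>(\<omega> in M. Z \<omega> < a) \<le> \<P>(\<omega> in M. Y \<omega> < a)"
    and s2: "\<And>a. 0 < a \<Longrightarrow> \<P>(\<omega> in M. Y \<omega> < a) \<le> \<P>(\<omega> in M. Z \<omega> \<le> a)"
  shows "distr M borel Z = distr M borel Y"
proof -
  have Yr: "real_distribution (distr M borel Y)" and Zr: "real_distribution (distr M borel Z)"
    using Y Z by (auto intro: real_distribution_distr)
  have cX: "cdf (distr M borel X) a = \<P>(\<omega> in M. X \<omega> \<le> a)" if [measurable]: "X \<in> borel_measurable M" for a X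
    unfolding cdf_def by (subst measure_distr) (auto simp: vimage_def Int_def conj_commute)
  have neg: "\<P>(\<omega> in M. X \<omega> \<le> a) = 0"
    if [measurable]: "X \<in> borel_measurable M" and "AE \<omega> in M. 0 \<le> X \<omega>" "a < 0" for a :: real and X
    using that(2) by (subst prob_Collect_eq_0) (use \<open>a < 0\<close> in \<open>auto elim!: eventually_mono\<close>)
  have "cdf (distr M borel Z) a = cdf (distr M borel Y) a" for a
  proof (cases "a < 0")
    case True
    thus ?thesis using neg[OF Y pos(1)] neg[OF Z pos(2)] by (simp add: cX)
  next
    case False
    have mono: "\<P>(\<omega> in M. X \<omega> \<le> a) \<le> \<P>(\<omega> in M. X \<omega> < b)"
      if "a < b" and [measurable]: "X \<in> borel_measurable M" for a b :: real and X
      using that(1) by (intro finite_measure_mono) auto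
    have mono': "\<P>(\<omega> in M. X \<omega> < b) \<le> \<P>(\<omega> in M. X \<omega> \<le> b)" if [measurable]: "X \<in> borel_measurable M" for b :: real and X
      by (intro finite_measure_mono) auto
    have rc: "((\<lambda>b. cdf (distr M borel X) b) \<longlongrightarrow> cdf (distr M borel X) a) (at_right a)"
      if "real_distribution (distr M borel X)" for X
      using finite_borel_measure.cdf_is_right_cont[OF real_distribution.finite_borel_measure_M[OF that]]
      by (simp add: continuous_within)
    have "cdf (distr M borel Z) a \<le> cdf (distr M borel Y) a"
    proof (rule tendsto_lowerbound[OF rc[OF Yr]])
      show "\<forall>\<^sub>F b in at_right a. cdf (distr M borel Z) a \<le> cdf (distr M borel Y) b"
        unfolding eventually_at_filter cX[OF Y] cX[OF Z]
      proof (intro always_eventually allI impI)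
        fix b assume b: "b \<noteq> a" "b \<in> {a<..}"
        show "\<P>(\<omega> in M. Z \<omega> \<le> a) \<le> \<P>(\<omega> in M. Y \<omega> \<le> b)"
          using mono[of a b Z, OF _ Z] s1[of b] mono'[OF Y, of b] b False by auto
      qed
    qed simp
    moreover have "cdf (distr M borel Y) a \<le> cdf (distr M borel Z) a"
    proof (rule tendsto_lowerbound[OF rc[OF Zr]])
      show "\<forall>\<^sub>F b in at_right a. cdf (distr M borel Y) a \<le> cdf (distr M borel Z) b"
        unfolding eventually_at_filter cX[OF Y] cX[OF Z]
      proof (intro always_eventually allI impI)
        fix b assume b: "b \<noteq> a" "b \<in> {a<..}"
        show "\<P>(\<omega> in M. Y \<omega> \<le> a) \<le> \<P>(\<omega> in M. Z \<omega> \<le> b)"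
          using mono[of a b Y, OF _ Y] s2[of b] b False by auto
      qed
    qed simp
    ultimately show ?thesis by simp
  qed
  thus ?thesis by (intro cdf_unique Yr Zr) auto
qed

text \<open>L(a) has the law of a^(1/\<beta>) L(1), and t < a^(1/\<beta>) L(1) is the same event as
  t^\<beta> L(1)^(-\<beta>) < a almost surely. So Y has the distribution that passage-time duality
  prescribes for the inverse.\<close>

lemma distr_inverse:
  assumes t: "0 \<le> t"
  shows "distr M borel (inverse_process L t) = distr inverse_law borel (\<lambda>y. t powr \<beta> * y)"
proof -
  define Y where "Y = (\<lambda>\<omega>. t powr \<beta> * L 1 \<omega> powr - \<beta>)"
  have L1[measurable]: "L 1 \<in> borel_measurable M" by (rule L_measurable) simp
  have Ym[measurable]: "Y \<in> borel_measurable M" unfolding Y_def by measurable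
  note Zm[measurable] = inverse_measurable[of t]
  have key: "\<P>(\<omega> in M. Y \<omega> < a) = \<P>(\<omega> in M. t < L a \<omega>)" if a: "0 < a" for a
  proof -
    have [measurable]: "L a \<in> borel_measurable M" using a by (intro L_measurable) simp
    have eqv: "t < a powr (1 / \<beta>) * l \<longleftrightarrow> t powr \<beta> * l powr - \<beta> < a" if l: "0 < l" for l
    proof -
      have p: "0 < a powr (1 / \<beta>) * l" using a l by simp
      have "t < a powr (1 / \<beta>) * l \<longleftrightarrow> t powr \<beta> < (a powr (1 / \<beta>) * l) powr \<beta>"
        using powr_less_mono2[OF beta_pos t, of "a powr (1 / \<beta>) * l"]
          powr_mono2[OF less_imp_le[OF beta_pos] less_imp_le[OF p], of t] by force
      also have "(a powr (1 / \<beta>) * l) powr \<beta> = a * l powr \<beta>"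
        using a l beta_pos by (simp add: powr_mult powr_powr)
      finally show ?thesis using l by (simp add: powr_minus field_simps)
    qed
    have "\<P>(\<omega> in M. Y \<omega> < a) = \<P>(\<omega> in M. t < a powr (1 / \<beta>) * L 1 \<omega>)"
    proof (rule measure_eq_AE)
      show "AE \<omega> in M. (\<omega> \<in> {\<omega> \<in> space M. Y \<omega> < a}) = (\<omega> \<in> {\<omega> \<in> space M. t < a powr (1 / \<beta>) * L 1 \<omega>})"
        using L_positive[OF zero_less_one] by eventually_elim (simp add: eqv Y_def)
    qed measurable
    also have "\<dots> = measure (distr M borel (\<lambda>\<omega>. a powr (1 / \<beta>) * L 1 \<omega>)) {t<..}"
      by (subst measure_distr) (auto simp: vimage_def Int_def conj_commute)
    also have "\<dots> = measure (distr M borel (L a)) {t<..}" by (simp only: distr_L_scale[OF a])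
    also have "\<dots> = \<P>(\<omega> in M. t < L a \<omega>)"
      by (subst measure_distr) (auto simp: vimage_def Int_def conj_commute)
    finally show ?thesis .
  qed
  have "distr M borel (inverse_process L t) = distr M borel Y"
  proof (rule cdf_sandwich[OF Ym Zm])
    show "AE \<omega> in M. 0 \<le> Y \<omega>" by (auto simp: Y_def)
    show "AE \<omega> in M. 0 \<le> inverse_process L t \<omega>" by (auto intro!: AE_I2 inverse_nonneg)
    fix a :: real assume a: "0 < a"
    have [measurable]: "L a \<in> borel_measurable M" using a by (intro L_measurable) simp
    show "\<P>(\<omega> in M. inverse_process L t \<omega> < a) \<le> \<P>(\<omega> in M. Y \<omega> < a)"
      unfolding key[OF a]
    proof (rule finite_measure_mono)
      show "{\<omega> \<in> space M. inverse_process L t \<omega> < a} \<subseteq> {\<omega> \<in> space M. t < L a \<omega>}"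
      proof safe
        fix \<omega> assume \<omega>: "\<omega> \<in> space M" "inverse_process L t \<omega> < a"
        then obtain x where x: "0 \<le> x" "x < a" "t < L x \<omega>" by (rule inverse_lessD)
        thus "t < L a \<omega>" using L_mono[of \<omega> x a] \<omega> by auto
      qed
    qed measurable
    show "\<P>(\<omega> in M. Y \<omega> < a) \<le> \<P>(\<omega> in M. inverse_process L t \<omega> \<le> a)"
      unfolding key[OF a] using inverse_le a by (intro finite_measure_mono) auto
  qed
  also have "\<dots> = distr inverse_law borel (\<lambda>y. t powr \<beta> * y)"
    unfolding inverse_law_def Y_def by (subst distr_distr) (auto simp: comp_def)
  finally show ?thesis .
qed

lemma real_distribution_inverse_law: "real_distribution inverse_law"
  unfolding inverse_law_def using L_measurable[of 1] by (intro real_distribution_distr) simp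

sublocale I: real_distribution inverse_law by (rule real_distribution_inverse_law)

lemma inverse_law_pos: "AE y in inverse_law. 0 < y"
  unfolding inverse_law_def using L_measurable[of 1] L_positive[of 1]
  by (subst AE_distr_iff) (auto elim!: eventually_mono)

text \<open>The k-th moment is E[L(1)^(-p)] with p = k/\<nu>. Writing the power as a mixture of
  exp(-s L(1)), Fubini brings in the Laplace transform exp(-s^(1/\<nu>)) and leaves a Gamma
  integral.\<close>

lemma nn_inverse_law_moment:
  "(\<integral>\<^sup>+y. ennreal (y ^ k) \<partial>inverse_law) = ennreal (fact k / Gamma (1 + real k * \<beta>))"
proof (cases "k = 0")
  case True
  show ?thesis using True I.emeasure_space_1 by simp
next
  case False
  define p where "p = real k / real \<nu>"
  have p: "0 < p" using False nu by (simp add: p_def)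
  have Gp: "0 < Gamma p" by (rule Gamma_real_pos[OF p])
  have L1[measurable]: "L 1 \<in> borel_measurable M" by (rule L_measurable) simp
  interpret P: pair_sigma_finite M "lborel :: real measure" by unfold_locales
  let ?h = "\<lambda>s. indicator {0<..} s * s powr (p - 1) :: real"
  have "(\<integral>\<^sup>+y. ennreal (y ^ k) \<partial>inverse_law) = (\<integral>\<^sup>+\<omega>. ennreal ((L 1 \<omega> powr - \<beta>) ^ k) \<partial>M)"
    unfolding inverse_law_def by (subst nn_integral_distr) auto
  also have "\<dots> = (\<integral>\<^sup>+\<omega>. ennreal (L 1 \<omega> powr - p) \<partial>M)"
  proof (rule nn_integral_cong_AE)
    show "AE \<omega> in M. ennreal ((L 1 \<omega> powr - \<beta>) ^ k) = ennreal (L 1 \<omega> powr - p)"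
      using L_positive[OF zero_less_one]
    proof eventually_elim
      case (elim \<omega>)
      have "(L 1 \<omega> powr - \<beta>) ^ k = (L 1 \<omega> powr - \<beta>) powr real k"
        using elim by (simp add: powr_realpow)
      also have "\<dots> = L 1 \<omega> powr (- \<beta> * real k)" by (rule powr_powr)
      also have "- \<beta> * real k = - p" by (simp add: beta p_def)
      finally show ?case by simp
    qed
  qed
  also have "\<dots> = (\<integral>\<^sup>+\<omega>. ennreal (1 / Gamma p) * (\<integral>\<^sup>+s. ennreal (?h s * exp (- (s * L 1 \<omega>))) \<partial>lborel) \<partial>M)"
  proof (rule nn_integral_cong_AE)
    show "AE \<omega> in M. ennreal (L 1 \<omega> powr - p)
        = ennreal (1 / Gamma p) * (\<integral>\<^sup>+s. ennreal (?h s * exp (- (s * L 1 \<omega>))) \<partial>lborel)"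
      using L_positive[OF zero_less_one]
    proof eventually_elim
      case (elim \<omega>)
      thus ?case using Gp nn_integral_exp_powr[OF p elim] by (simp add: ennreal_mult'[symmetric])
    qed
  qed
  also have "\<dots> = ennreal (1 / Gamma p) * (\<integral>\<^sup>+\<omega>. (\<integral>\<^sup>+s. ennreal (?h s * exp (- (s * L 1 \<omega>))) \<partial>lborel) \<partial>M)"
    by (rule nn_integral_cmult) measurable
  also have "(\<integral>\<^sup>+\<omega>. (\<integral>\<^sup>+s. ennreal (?h s * exp (- (s * L 1 \<omega>))) \<partial>lborel) \<partial>M)
      = (\<integral>\<^sup>+s. (\<integral>\<^sup>+\<omega>. ennreal (?h s * exp (- (s * L 1 \<omega>))) \<partial>M) \<partial>lborel)"
    by (rule P.Fubini'[symmetric]) measurable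
  also have "\<dots> = (\<integral>\<^sup>+s. ennreal (?h s * exp (- (s powr (1 / real \<nu>)))) \<partial>lborel)"
  proof (intro nn_integral_cong)
    fix s :: real
    show "(\<integral>\<^sup>+\<omega>. ennreal (?h s * exp (- (s * L 1 \<omega>))) \<partial>M) = ennreal (?h s * exp (- (s powr (1 / real \<nu>))))"
    proof (cases "0 < s")
      case True
      have "integrable M (\<lambda>\<omega>. exp (- (s * L 1 \<omega>)))"
        using True by (intro L_exp_integrable) auto
      hence "(\<integral>\<^sup>+\<omega>. ennreal (exp (- (s * L 1 \<omega>))) \<partial>M) = ennreal (exp (- (s powr (1 / real \<nu>))))"
        using True L_laplace[of s 1] by (subst nn_integral_eq_integral) (auto simp: beta)
      moreover have "(\<integral>\<^sup>+\<omega>. ennreal (?h s * exp (- (s * L 1 \<omega>))) \<partial>M)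
          = (\<integral>\<^sup>+\<omega>. ennreal (?h s) * ennreal (exp (- (s * L 1 \<omega>))) \<partial>M)"
        by (intro nn_integral_cong) (simp add: ennreal_mult')
      ultimately show ?thesis by (simp add: nn_integral_cmult ennreal_mult')
    qed simp
  qed
  also have "\<dots> = ennreal (real \<nu> * Gamma (real k))"
    unfolding p_def using nu False by (intro nn_integral_stretched_exp) auto
  also have "ennreal (1 / Gamma p) * ennreal (real \<nu> * Gamma (real k)) = ennreal (real \<nu> * Gamma (real k) / Gamma p)"
    using Gp by (simp add: ennreal_mult'[symmetric])
  also have "real \<nu> * Gamma (real k) / Gamma p = fact k / Gamma (1 + real k * \<beta>)"
  proof -
    have "Gamma (1 + real k * \<beta>) = p * Gamma p"
    proof -
      have "p \<notin> \<int>\<^sub>\<le>\<^sub>0" using p by (auto dest: nonpos_Ints_nonpos)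
      from Gamma_plus1[OF this] show ?thesis by (simp add: p_def beta add.commute)
    qed
    moreover have "Gamma (real k) * real k = fact k"
      using False Gamma_fact[of "k - 1", where ?'a = real] by (simp add: fact_reduce of_nat_diff)
    moreover have "real \<nu> = real k / p" using nu False by (simp add: p_def)
    ultimately show ?thesis by (simp add: mult.commute)
  qed
  finally show ?thesis .
qed

end

context subordinator
begin

section \<open>The fractional identity for the inverse stable law\<close>

lemma inverse_law_moment:
  "has_bochner_integral inverse_law (\<lambda>y. y ^ k) (fact k / Gamma (1 + real k * \<beta>))"
proof -
  have "0 < Gamma (1 + real k * \<beta>)" using beta_pos by (intro Gamma_real_pos add_pos_nonneg) auto
  moreover have "AE y in inverse_law. 0 \<le> y ^ k" using inverse_law_pos by eventually_elim simp
  ultimately show ?thesis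
    by (intro has_bochner_integral_nn_integral nn_inverse_law_moment) auto
qed

lemma inverse_law_moment_integrable: "integrable inverse_law (\<lambda>y. y ^ k)"
  using inverse_law_moment[of k] by (simp add: has_bochner_integral_iff)

lemma Gamma_one_plus_beta: "Gamma (1 + \<beta>) = \<beta> * Gamma \<beta>"
proof -
  have "\<beta> \<notin> \<int>\<^sub>\<le>\<^sub>0" using beta_pos by (auto dest: nonpos_Ints_nonpos)
  from Gamma_plus1[OF this] show ?thesis by (simp add: add.commute)
qed

text \<open>For s > 0 this is \<beta> s^(\<beta>-1) times the Caputo kernel of order 1 - \<beta>:
  the factor produced by differentiating \<phi>(s^\<beta> y) in s inside a Caputo integral, with y
  left out. The constant Gamma(1 + \<beta>) = \<beta> Gamma(\<beta>) undoes the normalisation of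
  \<open>rl_kernel \<beta>\<close>.\<close>

definition frac_weight :: "real \<Rightarrow> real \<Rightarrow> real" where
  "frac_weight t s = Gamma (1 + \<beta>) * (rl_kernel \<beta> s * rl_kernel (1 - \<beta>) (t - s))"

lemma frac_weight_measurable [measurable]: "frac_weight t \<in> borel_measurable borel"
  unfolding frac_weight_def by measurable

lemma frac_weight_nonneg: "0 \<le> frac_weight t s"
  unfolding frac_weight_def using beta_pos beta_less_1
  by (intro mult_nonneg_nonneg rl_kernel_nonneg less_imp_le[OF Gamma_real_pos]) auto

text \<open>The factor s^c changes the kernel of order \<beta> into a multiple of the kernel of
  order \<beta> + c, so the integral is again a convolution of kernels.\<close>

lemma frac_weight_powr:
  assumes c: "0 < \<beta> + c"
  shows "has_bochner_integral lborel (\<lambda>s. s powr c * frac_weight t s)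
     (\<beta> * Gamma (\<beta> + c) * rl_kernel (1 + c) t)"
proof -
  have G: "0 < Gamma \<beta>" "0 < Gamma (\<beta> + c)" using beta_pos c by (auto intro: Gamma_real_pos)
  have "has_bochner_integral lborel (\<lambda>s. rl_kernel (1 - \<beta>) (t - s) * rl_kernel (\<beta> + c) (s - 0))
     (rl_kernel (1 - \<beta> + (\<beta> + c)) (t - 0))"
    using beta_less_1 c by (intro rl_kernel_convolution) auto
  hence "has_bochner_integral lborel (\<lambda>s. \<beta> * Gamma (\<beta> + c) * (rl_kernel (1 - \<beta>) (t - s) * rl_kernel (\<beta> + c) s))
     (\<beta> * Gamma (\<beta> + c) * rl_kernel (1 + c) t)"
    by (intro has_bochner_integral_mult_right) simp
  moreover have "\<beta> * Gamma (\<beta> + c) * (rl_kernel (1 - \<beta>) (t - s) * rl_kernel (\<beta> + c) s)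
      = s powr c * frac_weight t s" for s
  proof (cases "0 < s")
    case True
    have "s powr (\<beta> + c - 1) = s powr c * s powr (\<beta> - 1)" by (simp add: powr_add[symmetric] algebra_simps)
    hence "rl_kernel (\<beta> + c) s = s powr c * rl_kernel \<beta> s * (Gamma \<beta> / Gamma (\<beta> + c))"
      using True G by (simp add: rl_kernel_def)
    thus ?thesis using G by (simp add: frac_weight_def Gamma_one_plus_beta)
  qed (simp add: frac_weight_def rl_kernel_def)
  ultimately show ?thesis by simp
qed

text \<open>The weight with the factor y restored, as a measure in (y, s). Its image under s^\<beta>
  y is to be compared with the law of t^\<beta> y. The maximum with 0 makes the density nonnegative
  off the almost sure set y > 0.\<close>

definition frac_measure :: "real \<Rightarrow> (real \<times> real) measure" where
  "frac_measure t = density (inverse_law \<Otimes>\<^sub>M lborel) (\<lambda>p. ennreal (max 0 (fst p) * frac_weight t (snd p)))"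

lemma nn_integral_frac_measure:
  assumes [measurable]: "h \<in> borel_measurable borel"
  shows "(\<integral>\<^sup>+z. h z \<partial>distr (frac_measure t) borel (\<lambda>p. snd p powr \<beta> * fst p))
    = (\<integral>\<^sup>+y. (\<integral>\<^sup>+s. ennreal (max 0 y * frac_weight t s) * h (s powr \<beta> * y) \<partial>lborel) \<partial>inverse_law)"
proof -
  interpret P: pair_sigma_finite inverse_law "lborel :: real measure" by unfold_locales
  have "(\<integral>\<^sup>+z. h z \<partial>distr (frac_measure t) borel (\<lambda>p. snd p powr \<beta> * fst p))
     = (\<integral>\<^sup>+p. ennreal (max 0 (fst p) * frac_weight t (snd p)) * h (snd p powr \<beta> * fst p) \<partial>(inverse_law \<Otimes>\<^sub>M lborel))"
    unfolding frac_measure_def by (subst nn_integral_distr) (simp_all add: nn_integral_density)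
  also have "\<dots> = (\<integral>\<^sup>+y. (\<integral>\<^sup>+s. ennreal (max 0 y * frac_weight t s) * h (s powr \<beta> * y) \<partial>lborel) \<partial>inverse_law)"
    by (subst lborel.nn_integral_fst[symmetric]) simp_all
  finally show ?thesis .
qed

text \<open>This is \<open>\<partial>\<^sub>t\<^sup>\<beta> E[\<phi>(\<Lambda>\<^sub>t)] = E[\<phi>'(\<Lambda>\<^sub>t)]\<close> in disguise, with \<open>\<Lambda>\<^sub>t\<close> replaced by \<open>t\<^sup>\<beta> \<Lambda>\<^sub>1\<close>.  Both sides have the
  moments \<open>t\<^sup>k\<^sup>\<beta> k! / \<Gamma>(1 + k\<beta>)\<close>, which grow slowly enough to determine them.\<close>

lemma distr_frac_measure:
  assumes t: "0 < t"
  shows "distr (frac_measure t) borel (\<lambda>p. snd p powr \<beta> * fst p)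
     = distr inverse_law borel (\<lambda>y. t powr \<beta> * y)" (is "?A = ?B")
proof -
  interpret P: pair_sigma_finite inverse_law "lborel :: real measure" by unfold_locales
  define m where "m = (\<lambda>k. (t powr \<beta>) ^ k * (fact k / Gamma (1 + real k * \<beta>)))"
  have G: "0 < Gamma (1 + real k * \<beta>)" for k using beta_pos by (intro Gamma_real_pos add_pos_nonneg) auto
  have m0: "0 \<le> m k" for k unfolding m_def using G[of k] by simp
  have nnA: "(\<integral>\<^sup>+z. ennreal (z ^ k) \<partial>?A) = ennreal (m k)" for k
  proof -
    define c where "c = \<beta> * Gamma (\<beta> + real k * \<beta>) * rl_kernel (1 + real k * \<beta>) t"
    have kb: "0 < \<beta> + real k * \<beta>" using beta_pos by (intro add_pos_nonneg) auto
    have cw: "has_bochner_integral lborel (\<lambda>s. s powr (real k * \<beta>) * frac_weight t s) c"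
      unfolding c_def by (rule frac_weight_powr[OF kb])
    have c0: "0 \<le> c" unfolding c_def using kb beta_pos
      by (intro mult_nonneg_nonneg rl_kernel_nonneg less_imp_le[OF Gamma_real_pos]) (auto intro: add_pos_nonneg)
    have "(\<integral>\<^sup>+z. ennreal (z ^ k) \<partial>?A)
        = (\<integral>\<^sup>+y. (\<integral>\<^sup>+s. ennreal (max 0 y * frac_weight t s) * ennreal ((s powr \<beta> * y) ^ k) \<partial>lborel) \<partial>inverse_law)"
      by (rule nn_integral_frac_measure) measurable
    also have "\<dots> = (\<integral>\<^sup>+y. ennreal (y ^ Suc k) * ennreal c \<partial>inverse_law)"
    proof (rule nn_integral_cong_AE)
      show "AE y in inverse_law. (\<integral>\<^sup>+s. ennreal (max 0 y * frac_weight t s) * ennreal ((s powr \<beta> * y) ^ k) \<partial>lborel)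
          = ennreal (y ^ Suc k) * ennreal c"
        using inverse_law_pos
      proof eventually_elim
        case (elim y)
        have "(\<integral>\<^sup>+s. ennreal (max 0 y * frac_weight t s) * ennreal ((s powr \<beta> * y) ^ k) \<partial>lborel)
            = (\<integral>\<^sup>+s. ennreal (y ^ Suc k) * ennreal (s powr (real k * \<beta>) * frac_weight t s) \<partial>lborel)"
        proof (intro nn_integral_cong)
          fix s
          have "frac_weight t s * (s powr \<beta>) ^ k = s powr (real k * \<beta>) * frac_weight t s"
          proof (cases "0 < s")
            case True
            have "(s powr \<beta>) ^ k = (s powr \<beta>) powr real k" using True by (simp add: powr_realpow)
            thus ?thesis by (simp add: powr_powr mult.commute)
          qed (simp add: frac_weight_def rl_kernel_def)
          hence "max 0 y * frac_weight t s * (s powr \<beta> * y) ^ k = y ^ Suc k * (s powr (real k * \<beta>) * frac_weight t s)"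
            using elim by (simp add: power_mult_distrib mult_ac)
          thus "ennreal (max 0 y * frac_weight t s) * ennreal ((s powr \<beta> * y) ^ k)
             = ennreal (y ^ Suc k) * ennreal (s powr (real k * \<beta>) * frac_weight t s)"
            using elim frac_weight_nonneg[of t s] by (simp add: ennreal_mult'[symmetric])
        qed
        also have "\<dots> = ennreal (y ^ Suc k) * (\<integral>\<^sup>+s. ennreal (s powr (real k * \<beta>) * frac_weight t s) \<partial>lborel)"
          by (rule nn_integral_cmult) measurable
        also have "(\<integral>\<^sup>+s. ennreal (s powr (real k * \<beta>) * frac_weight t s) \<partial>lborel) = ennreal c"
          using cw frac_weight_nonneg
          by (subst nn_integral_eq_integral) (auto simp: has_bochner_integral_iff)
        finally show ?case .
      qed
    qed
    also have "\<dots> = ennreal (fact (Suc k) / Gamma (1 + real (Suc k) * \<beta>)) * ennreal c"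
      by (subst nn_integral_multc) (simp_all only: nn_inverse_law_moment, measurable)
    also have "\<dots> = ennreal (fact (Suc k) / Gamma (1 + real (Suc k) * \<beta>) * c)"
      using c0 by (simp only: ennreal_mult'' )
    also have "fact (Suc k) / Gamma (1 + real (Suc k) * \<beta>) * c = m k"
    proof -
      have e: "1 + real (Suc k) * \<beta> = 1 + (\<beta> + real k * \<beta>)" by (simp add: algebra_simps)
      have "\<beta> + real k * \<beta> \<notin> \<int>\<^sub>\<le>\<^sub>0" using kb by (auto dest: nonpos_Ints_nonpos)
      from Gamma_plus1[OF this] have "Gamma (1 + real (Suc k) * \<beta>) = (\<beta> + real k * \<beta>) * Gamma (\<beta> + real k * \<beta>)"
        unfolding e by (simp add: add.commute)
      moreover have e2: "\<beta> + real k * \<beta> = \<beta> * real (Suc k)" by (simp add: algebra_simps)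
      moreover have "Gamma (\<beta> * real (Suc k)) \<noteq> 0" using Gamma_real_pos[OF kb] unfolding e2 by linarith
      moreover have "(t powr \<beta>) ^ k = t powr (real k * \<beta>)"
      proof -
        have "(t powr \<beta>) ^ k = (t powr \<beta>) powr real k" using t by (simp add: powr_realpow)
        thus ?thesis by (simp add: powr_powr mult.commute)
      qed
      ultimately show ?thesis
        using beta_pos t unfolding c_def m_def
        by (simp add: rl_kernel_def del: of_nat_Suc)
    qed
    finally show ?thesis .
  qed
  \<comment> \<open>The moment of order 0 is the total mass, so the image is a probability
    measure.\<close>
  have "emeasure ?A (space ?A) = 1"
    using nnA[of 0] by (simp add: m_def)
  hence pA: "prob_space ?A" by (rule prob_spaceI)
  have rA: "real_distribution ?A"
    using pA by (simp add: real_distribution_def real_distribution_axioms_def)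
  have rB: "real_distribution ?B"
    by (intro I.real_distribution_distr) simp
  have posA: "AE z in ?A. 0 \<le> z"
  proof -
    have "AE p in frac_measure t. 0 \<le> snd p powr \<beta> * fst p"
      unfolding frac_measure_def
      by (subst AE_density) (auto intro!: AE_I2 simp: max_def zero_less_mult_iff split: if_splits)
    thus ?thesis by (subst AE_distr_iff) (auto simp: frac_measure_def)
  qed
  have posB: "AE z in ?B. 0 \<le> z"
    using inverse_law_pos by (subst AE_distr_iff) (auto elim!: eventually_mono)
  show ?thesis
  proof (rule stieltjes_moments_unique[OF rA rB posA posB])
    fix k
    show "has_bochner_integral ?A (\<lambda>y. y ^ k) (m k)"
    proof (rule has_bochner_integral_nn_integral)
      show "AE y in ?A. 0 \<le> y ^ k" using posA by eventually_elim simp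
    qed (use nnA m0 in auto)
    have "has_bochner_integral inverse_law (\<lambda>y. (t powr \<beta>) ^ k * y ^ k) (m k)"
      unfolding m_def by (intro has_bochner_integral_mult_right inverse_law_moment)
    thus "has_bochner_integral ?B (\<lambda>y. y ^ k) (m k)"
      by (simp add: has_bochner_integral_iff integrable_distr_eq integral_distr power_mult_distrib)
  next
    fix x :: real assume "0 \<le> x"
    hence "summable (\<lambda>k. (x * t powr \<beta>) ^ k / Gamma (1 + real k / real \<nu>))"
      using nu by (intro summable_power_over_Gamma) auto
    thus "summable (\<lambda>k. x ^ k * m k / fact k)"
      by (simp add: m_def beta power_mult_distrib)
  qed
qed

lemma nn_frac_identity:
  assumes t: "0 < t" and [measurable]: "h \<in> borel_measurable borel"
  shows "(\<integral>\<^sup>+y. (\<integral>\<^sup>+s. ennreal (max 0 y * frac_weight t s) * h (s powr \<beta> * y) \<partial>lborel) \<partial>inverse_law)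
    = (\<integral>\<^sup>+y. h (t powr \<beta> * y) \<partial>inverse_law)"
proof -
  have "(\<integral>\<^sup>+z. h z \<partial>distr inverse_law borel (\<lambda>y. t powr \<beta> * y)) = (\<integral>\<^sup>+y. h (t powr \<beta> * y) \<partial>inverse_law)"
    by (subst nn_integral_distr) simp_all
  thus ?thesis
    by (simp add: nn_integral_frac_measure[symmetric] distr_frac_measure[OF t])
qed

text \<open>The fractional identity at t = 1 improves integrability: it expresses the moment of
  order -a as the moment of order 1 - a times an integral in s that is finite for a < 1, and
  nonnegative orders are already controlled.\<close>

lemma inverse_law_negative_moment:
  assumes a: "0 \<le> a" "a < 1"
  shows "integrable inverse_law (\<lambda>y. y powr - a)"
proof -
  have ab: "0 < \<beta> + - a * \<beta>" using a beta_pos by (simp add: algebra_simps)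
  obtain c where cw: "has_bochner_integral lborel (\<lambda>s. s powr (- a * \<beta>) * frac_weight 1 s) c"
    using frac_weight_powr[OF ab] by blast
  have "(\<integral>\<^sup>+y. ennreal (y powr - a) \<partial>inverse_law)
      = (\<integral>\<^sup>+y. (\<integral>\<^sup>+s. ennreal (max 0 y * frac_weight 1 s) * ennreal ((s powr \<beta> * y) powr - a) \<partial>lborel) \<partial>inverse_law)"
    using nn_frac_identity[of 1 "\<lambda>y. ennreal (y powr - a)"] by simp
  also have "\<dots> \<le> (\<integral>\<^sup>+y. ennreal (1 + y) * ennreal c \<partial>inverse_law)"
  proof (rule nn_integral_mono_AE)
    show "AE y in inverse_law. (\<integral>\<^sup>+s. ennreal (max 0 y * frac_weight 1 s) * ennreal ((s powr \<beta> * y) powr - a) \<partial>lborel)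
        \<le> ennreal (1 + y) * ennreal c"
      using inverse_law_pos
    proof eventually_elim
      case (elim y)
      have ya: "y powr (1 - a) \<le> 1 + y"
      proof (cases "y \<le> 1")
        case True
        thus ?thesis using elim a powr_le1[of "1 - a" y] by simp
      next
        case False
        hence "y powr (1 - a) \<le> y powr 1" using a by (intro powr_mono) auto
        thus ?thesis using elim by simp
      qed
      have "(\<integral>\<^sup>+s. ennreal (max 0 y * frac_weight 1 s) * ennreal ((s powr \<beta> * y) powr - a) \<partial>lborel)
          = (\<integral>\<^sup>+s. ennreal (y powr (1 - a)) * ennreal (s powr (- a * \<beta>) * frac_weight 1 s) \<partial>lborel)"
      proof (intro nn_integral_cong)
        fix s
        have "y powr (1 - a) = y * y powr - a" using elim by (simp add: powr_diff powr_minus divide_inverse)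
        hence "max 0 y * frac_weight 1 s * (s powr \<beta> * y) powr - a
            = y powr (1 - a) * (s powr (- a * \<beta>) * frac_weight 1 s)"
          using elim by (simp add: powr_mult powr_powr mult_ac)
        thus "ennreal (max 0 y * frac_weight 1 s) * ennreal ((s powr \<beta> * y) powr - a)
           = ennreal (y powr (1 - a)) * ennreal (s powr (- a * \<beta>) * frac_weight 1 s)"
          using elim frac_weight_nonneg[of 1 s] by (simp add: ennreal_mult'[symmetric])
      qed
      also have "\<dots> = ennreal (y powr (1 - a)) * (\<integral>\<^sup>+s. ennreal (s powr (- a * \<beta>) * frac_weight 1 s) \<partial>lborel)"
        by (rule nn_integral_cmult) measurable
      also have "(\<integral>\<^sup>+s. ennreal (s powr (- a * \<beta>) * frac_weight 1 s) \<partial>lborel) = ennreal c"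
        using cw frac_weight_nonneg
        by (subst nn_integral_eq_integral) (auto simp: has_bochner_integral_iff)
      also have "ennreal (y powr (1 - a)) * ennreal c \<le> ennreal (1 + y) * ennreal c"
        using ya by (intro mult_right_mono ennreal_leI) auto
      finally show ?case .
    qed
  qed
  also have "\<dots> = (\<integral>\<^sup>+y. ennreal (1 + y) \<partial>inverse_law) * ennreal c"
    by (rule nn_integral_multc) simp
  also have "\<dots> < \<infinity>"
  proof -
    have "integrable inverse_law (\<lambda>y. 1 + y ^ 1)"
      by (intro Bochner_Integration.integrable_add inverse_law_moment_integrable) simp
    hence "(\<integral>\<^sup>+y. ennreal (1 + y) \<partial>inverse_law) = ennreal (\<integral>y. 1 + y \<partial>inverse_law)"
      using inverse_law_pos by (intro nn_integral_eq_integral) (auto elim!: eventually_mono)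
    thus ?thesis by (simp add: ennreal_mult_less_top)
  qed
  finally show ?thesis by (intro integrableI_bounded) auto
qed

text \<open>The signed form of \<open>nn_frac_identity\<close>. Equality of the two laws also
  transfers integrability from the right side to the double integral, so Fubini applies.\<close>

lemma frac_identity:
  assumes t: "0 < t" and [measurable]: "h \<in> borel_measurable borel"
    and int: "integrable inverse_law (\<lambda>y. h (t powr \<beta> * y))"
  shows "integrable lborel (\<lambda>s. \<integral>y. max 0 y * frac_weight t s * h (s powr \<beta> * y) \<partial>inverse_law)"
    and "(\<integral>s. (\<integral>y. max 0 y * frac_weight t s * h (s powr \<beta> * y) \<partial>inverse_law) \<partial>lborel)
      = (\<integral>y. h (t powr \<beta> * y) \<partial>inverse_law)"
proof -
  interpret P: pair_sigma_finite inverse_law "lborel :: real measure" by unfold_locales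
  have w0: "0 \<le> max 0 y * frac_weight t s" for y s using frac_weight_nonneg by simp
  have "integrable (distr inverse_law borel (\<lambda>y. t powr \<beta> * y)) h"
    using int by (simp add: integrable_distr_eq)
  hence "integrable (frac_measure t) (\<lambda>p. h (snd p powr \<beta> * fst p))"
    by (simp add: distr_frac_measure[OF t, symmetric] integrable_distr_eq frac_measure_def)
  hence F: "integrable (inverse_law \<Otimes>\<^sub>M lborel) (\<lambda>(y, s). max 0 y * frac_weight t s * h (s powr \<beta> * y))"
    unfolding frac_measure_def
    by (subst (asm) integrable_density) (auto simp: w0 case_prod_unfold intro!: AE_I2)
  show "integrable lborel (\<lambda>s. \<integral>y. max 0 y * frac_weight t s * h (s powr \<beta> * y) \<partial>inverse_law)"
    by (rule P.integrable_snd[OF F])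
  have "(\<integral>y. h (t powr \<beta> * y) \<partial>inverse_law) = (\<integral>z. h z \<partial>distr inverse_law borel (\<lambda>y. t powr \<beta> * y))"
    by (simp add: integral_distr)
  also have "\<dots> = (\<integral>p. h (snd p powr \<beta> * fst p) \<partial>frac_measure t)"
    by (simp add: distr_frac_measure[OF t, symmetric] integral_distr frac_measure_def)
  also have "\<dots> = (\<integral>p. max 0 (fst p) * frac_weight t (snd p) * h (snd p powr \<beta> * fst p) \<partial>(inverse_law \<Otimes>\<^sub>M lborel))"
    unfolding frac_measure_def by (subst integral_density) (auto simp: w0 intro!: AE_I2)
  also have "\<dots> = (\<integral>s. (\<integral>y. max 0 y * frac_weight t s * h (s powr \<beta> * y) \<partial>inverse_law) \<partial>lborel)"
    using P.integral_snd[OF F] by (simp add: case_prod_unfold)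
  finally show "(\<integral>s. (\<integral>y. max 0 y * frac_weight t s * h (s powr \<beta> * y) \<partial>inverse_law) \<partial>lborel)
      = (\<integral>y. h (t powr \<beta> * y) \<partial>inverse_law)" by simp
qed

end

section \<open>Caputo derivatives of functions of the inverse process\<close>

lemma powr_le_one_plus:
  fixes y c :: real
  assumes "0 < y" "0 \<le> c" "c \<le> real n"
  shows "y powr c \<le> 1 + y ^ n"
proof (cases "y \<le> 1")
  case True
  have "y powr c \<le> 1" using True assms by (intro powr_le1) auto
  thus ?thesis using assms by (intro order_trans[OF _ le_add_same_cancel1[THEN iffD2]]) auto
next
  case False
  have "y powr c \<le> y powr real n" using False assms by (intro powr_mono) auto
  thus ?thesis using assms by (simp add: powr_realpow)
qed

context subordinator
begin

text \<open>The expectation of \<phi> at the inverse process at time s, by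
  \<open>distr_inverse\<close>.\<close>

definition subordinate :: "(real \<Rightarrow> real) \<Rightarrow> real \<Rightarrow> real" where
  "subordinate \<phi> s = (\<integral>y. \<phi> (s powr \<beta> * y) \<partial>inverse_law)"

lemma inverse_law_powr_integrable:
  assumes "-1 < c"
  shows "integrable inverse_law (\<lambda>y. y powr c)"
proof (cases "c < 0")
  case True
  thus ?thesis using inverse_law_negative_moment[of "- c"] assms by simp
next
  case False
  obtain n :: nat where n: "c \<le> real n" using real_arch_simple by blast
  show ?thesis
  proof (rule Bochner_Integration.integrable_bound[of _ "\<lambda>y. 1 + y ^ n"])
    show "integrable inverse_law (\<lambda>y. 1 + y ^ n)"
      by (intro Bochner_Integration.integrable_add inverse_law_moment_integrable) simp
    show "AE y in inverse_law. norm (y powr c) \<le> norm (1 + y ^ n)"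
      using inverse_law_pos by eventually_elim (use powr_le_one_plus[OF _ _ n] False in auto)
  qed simp
qed

lemma subordinate_dominated:
  assumes a: "0 \<le> a" "a < 1" and m: "\<phi> \<in> borel_measurable borel" and "0 < s"
    and b: "\<And>r. 0 < r \<Longrightarrow> \<bar>\<phi> r\<bar> \<le> C * (r powr - a + r ^ n)"
  shows "integrable inverse_law (\<lambda>y. \<phi> (s powr \<beta> * y))"
proof -
  show ?thesis
  proof (rule Bochner_Integration.integrable_bound[of _ "\<lambda>y. C * ((s powr \<beta>) powr - a * y powr - a + (s powr \<beta>) ^ n * y ^ n)"])
    show "integrable inverse_law (\<lambda>y. C * ((s powr \<beta>) powr - a * y powr - a + (s powr \<beta>) ^ n * y ^ n))"
      using a by (intro integrable_mult_right Bochner_Integration.integrable_add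
        inverse_law_powr_integrable inverse_law_moment_integrable) auto
    show "AE y in inverse_law. norm (\<phi> (s powr \<beta> * y)) \<le> norm (C * ((s powr \<beta>) powr - a * y powr - a + (s powr \<beta>) ^ n * y ^ n))"
      using inverse_law_pos
    proof eventually_elim
      case (elim y)
      have "0 < s powr \<beta> * y" using elim \<open>0 < s\<close> by simp
      from b[OF this] elim show ?case by (simp add: powr_mult power_mult_distrib)
    qed
    show "(\<lambda>y. \<phi> (s powr \<beta> * y)) \<in> borel_measurable inverse_law" using m by simp
  qed
qed

text \<open>Although \<phi>' may blow up like r^(-a) at 0, the inner derivative contributes a factor
  y. The integrand is of order y^(1-a) near 0 and polynomial at infinity, locally uniformly in s >
  0.\<close>

lemma subordinate_deriv:
  assumes a: "0 \<le> a" "a < 1"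
    and m: "\<phi> \<in> borel_measurable borel" "\<phi>' \<in> borel_measurable borel"
    and der: "\<And>r. 0 < r \<Longrightarrow> (\<phi> has_real_derivative \<phi>' r) (at r)"
    and b: "\<And>r. 0 < r \<Longrightarrow> \<bar>\<phi> r\<bar> \<le> C * (1 + r ^ n)"
    and b': "\<And>r. 0 < r \<Longrightarrow> \<bar>\<phi>' r\<bar> \<le> C * (r powr - a + r ^ n)"
    and c: "continuous_on {0<..} \<phi>'"
  defines "D \<equiv> \<lambda>s. \<integral>y. \<phi>' (s powr \<beta> * y) * (\<beta> * s powr (\<beta> - 1) * y) \<partial>inverse_law"
  shows "0 < s \<Longrightarrow> (subordinate \<phi> has_real_derivative D s) (at s)"
    and "continuous_on {0<..} D"
proof -
  note [measurable] = m
  have C0: "0 \<le> C" using b[of 1] by auto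
  \<comment> \<open>The part of the bound that depends on s; continuous on (0, \<infinity>), hence
    bounded on [s/2, 2s].\<close>
  define q where "q = (\<lambda>s. C * \<beta> * ((s powr \<beta>) powr - a * s powr (\<beta> - 1) + (s powr \<beta>) ^ n * s powr (\<beta> - 1)))"
  \<comment> \<open>The polynomial dominates both y^(1-a) <= 1 + y and y^(n+1), and all its moments
    are finite.\<close>
  define w where "w = (\<lambda>K y. K * (2 + y ^ 1 + y ^ Suc n) :: real)"
  have w_int: "integrable inverse_law (w K)" for K
    unfolding w_def by (intro integrable_mult_right Bochner_Integration.integrable_add inverse_law_moment_integrable) simp
  have bound: "\<exists>K. \<forall>r y. s/2 < r \<longrightarrow> r < 2 * s \<longrightarrow> 0 < y \<longrightarrow>
      \<bar>\<phi>' (r powr \<beta> * y) * (\<beta> * r powr (\<beta> - 1) * y)\<bar> \<le> w K y" if s: "0 < s" for s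
  proof -
    have "continuous_on {s / 2 .. 2 * s} q"
      unfolding q_def using s by (intro continuous_intros) auto
    hence "compact (q ` {s / 2 .. 2 * s})" by (intro compact_continuous_image) auto
    then obtain K where K: "\<And>r. r \<in> {s / 2 .. 2 * s} \<Longrightarrow> \<bar>q r\<bar> \<le> K"
      by (force dest!: compact_imp_bounded simp: bounded_iff)
    have "\<bar>\<phi>' (r powr \<beta> * y) * (\<beta> * r powr (\<beta> - 1) * y)\<bar> \<le> w K y"
      if r: "s/2 < r" "r < 2 * s" and y: "0 < y" for r y
    proof -
      have r0: "0 < r" using r s by simp
      define P where "P = (r powr \<beta>) powr - a"
      define Q where "Q = (r powr \<beta>) ^ n"
      have PQ: "0 \<le> P" "0 \<le> Q" by (auto simp: P_def Q_def)
      have ya: "y powr - a * y \<le> 2 + y + y ^ Suc n"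
      proof -
        have "y powr - a * y = y powr (1 - a)" using y by (simp add: powr_diff powr_minus divide_inverse)
        also have "\<dots> \<le> 1 + y ^ 1" using a y by (intro powr_le_one_plus) auto
        also have "\<dots> \<le> 2 + y + y ^ Suc n" using y by simp
        finally show ?thesis .
      qed
      have yn: "y ^ n * y \<le> 2 + y + y ^ Suc n" using y by simp
      have "\<bar>\<phi>' (r powr \<beta> * y)\<bar> \<le> C * (P * y powr - a + Q * y ^ n)"
        using b'[of "r powr \<beta> * y"] r0 y by (simp add: powr_mult power_mult_distrib P_def Q_def)
      hence "\<bar>\<phi>' (r powr \<beta> * y)\<bar> * (\<beta> * r powr (\<beta> - 1) * y) \<le> C * (P * y powr - a + Q * y ^ n) * (\<beta> * r powr (\<beta> - 1) * y)"
        using beta_pos y by (intro mult_right_mono) auto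
      also have "\<dots> = C * \<beta> * r powr (\<beta> - 1) * (P * (y powr - a * y) + Q * (y ^ n * y))"
        by (simp add: algebra_simps)
      also have "\<dots> \<le> C * \<beta> * r powr (\<beta> - 1) * (P * (2 + y + y ^ Suc n) + Q * (2 + y + y ^ Suc n))"
        using C0 beta_pos PQ by (intro mult_left_mono add_mono ya yn) auto
      also have "\<dots> = q r * (2 + y ^ 1 + y ^ Suc n)"
        by (simp add: q_def P_def Q_def algebra_simps)
      also have "\<dots> \<le> K * (2 + y ^ 1 + y ^ Suc n)"
        using K[of r] r y by (intro mult_right_mono) auto
      finally show ?thesis using beta_pos y r0 by (simp add: w_def abs_mult)
    qed
    thus ?thesis by blast
  qed
  show "(subordinate \<phi> has_real_derivative D s) (at s)" if s: "0 < s" for s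
  proof -
    obtain K where K: "\<forall>r y. s/2 < r \<longrightarrow> r < 2 * s \<longrightarrow> 0 < y \<longrightarrow>
      \<bar>\<phi>' (r powr \<beta> * y) * (\<beta> * r powr (\<beta> - 1) * y)\<bar> \<le> w K y" using bound[OF s] by blast
    show ?thesis
      unfolding D_def subordinate_def[abs_def]
    proof (rule has_derivative_integral_AE[where a = "s/2" and b = "2 * s" and w = "w K"])
      fix r assume r: "s/2 < r" "r < 2 * s"
      hence r0: "0 < r" using s by simp
      show "integrable inverse_law (\<lambda>y. \<phi> (r powr \<beta> * y))"
        by (rule subordinate_dominated[of 0 _ _ C n]) (use b r0 m in auto)
    next
      show "AE y in inverse_law. \<forall>r>s/2. r < 2 * s \<longrightarrow>
          ((\<lambda>r. \<phi> (r powr \<beta> * y)) has_real_derivative \<phi>' (r powr \<beta> * y) * (\<beta> * r powr (\<beta> - 1) * y)) (at r) \<and>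
          \<bar>\<phi>' (r powr \<beta> * y) * (\<beta> * r powr (\<beta> - 1) * y)\<bar> \<le> w K y"
        using inverse_law_pos
      proof eventually_elim
        case (elim y)
        show ?case
        proof (intro allI impI conjI)
          fix r assume r: "s/2 < r" "r < 2 * s"
          hence r0: "0 < r" using s by simp
          show "\<bar>\<phi>' (r powr \<beta> * y) * (\<beta> * r powr (\<beta> - 1) * y)\<bar> \<le> w K y" using K r elim by blast
          have "((\<lambda>r. r powr \<beta> * y) has_real_derivative \<beta> * r powr (\<beta> - 1) * y) (at r)"
            using r0 by (auto intro!: derivative_eq_intros)
          moreover have "(\<phi> has_real_derivative \<phi>' (r powr \<beta> * y)) (at (r powr \<beta> * y))"
            using r0 elim by (intro der) simp
          ultimately show "((\<lambda>r. \<phi> (r powr \<beta> * y)) has_real_derivative \<phi>' (r powr \<beta> * y) * (\<beta> * r powr (\<beta> - 1) * y)) (at r)"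
            by (rule DERIV_chain2[rotated])
        qed
      qed
    qed (use s w_int in auto)
  qed
  show "continuous_on {0<..} D"
    unfolding continuous_on_eq_continuous_at[OF open_greaterThan]
  proof
    fix s :: real assume "s \<in> {0<..}"
    hence s: "0 < s" by simp
    obtain K where K: "\<forall>r y. s/2 < r \<longrightarrow> r < 2 * s \<longrightarrow> 0 < y \<longrightarrow>
      \<bar>\<phi>' (r powr \<beta> * y) * (\<beta> * r powr (\<beta> - 1) * y)\<bar> \<le> w K y" using bound[OF s] by blast
    have "(D \<longlongrightarrow> D s) (at s within {s / 2 <..< 2 * s})"
      unfolding D_def
    proof (rule integral_tendsto_within[where w = "w K"])
      show "AE y in inverse_law. \<bar>\<phi>' (r powr \<beta> * y) * (\<beta> * r powr (\<beta> - 1) * y)\<bar> \<le> w K y"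
        if "r \<in> {s / 2 <..< 2 * s}" for r
        using inverse_law_pos by eventually_elim (use K that in auto)
      show "AE y in inverse_law. ((\<lambda>r. \<phi>' (r powr \<beta> * y) * (\<beta> * r powr (\<beta> - 1) * y)) \<longlongrightarrow>
          \<phi>' (s powr \<beta> * y) * (\<beta> * s powr (\<beta> - 1) * y)) (at s within {s / 2 <..< 2 * s})"
        using inverse_law_pos
      proof eventually_elim
        case (elim y)
        have "continuous_on {0<..} (\<lambda>r. \<phi>' (r powr \<beta> * y) * (\<beta> * r powr (\<beta> - 1) * y))"
          using elim by (intro continuous_intros continuous_on_compose2[OF c]) auto
        hence "isCont (\<lambda>r. \<phi>' (r powr \<beta> * y) * (\<beta> * r powr (\<beta> - 1) * y)) s"
          using s by (simp add: continuous_on_eq_continuous_at)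
        thus ?case unfolding isCont_def by (rule tendsto_within_subset) simp
      qed
    qed (use w_int in auto)
    moreover have "at s within {s / 2 <..< 2 * s} = at s"
      using s by (intro at_within_open) auto
    ultimately show "isCont D s" by (simp add: isCont_def)
  qed
qed

text \<open>Inserting the derivative of the average into the Caputo integral yields exactly the
  weight y \<open>frac_weight t s\<close> in front of \<phi>', and \<open>frac_identity\<close> with
  h = \<phi>' collapses it to the average of \<phi>' at time t. The exponent a < 1 is what keeps
  that average finite.\<close>

lemma caputo_subordinate:
  assumes a: "0 \<le> a" "a < 1"
    and m: "\<phi> \<in> borel_measurable borel" "\<phi>' \<in> borel_measurable borel"
    and der: "\<And>r. 0 < r \<Longrightarrow> (\<phi> has_real_derivative \<phi>' r) (at r)"
    and b: "\<And>r. 0 < r \<Longrightarrow> \<bar>\<phi> r\<bar> \<le> C * (1 + r ^ n)"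
    and b': "\<And>r. 0 < r \<Longrightarrow> \<bar>\<phi>' r\<bar> \<le> C * (r powr - a + r ^ n)"
    and c: "continuous_on {0<..} \<phi>'"
  shows "caputo_diff \<beta> (subordinate \<phi>)"
    and "0 < t \<Longrightarrow> caputo \<beta> (subordinate \<phi>) t = subordinate \<phi>' t"
proof -
  note [measurable] = m
  define D where "D = (\<lambda>s. \<integral>y. \<phi>' (s powr \<beta> * y) * (\<beta> * s powr (\<beta> - 1) * y) \<partial>inverse_law)"
  have sd1: "(subordinate \<phi> has_real_derivative D s) (at s)" if "0 < s" for s
    unfolding D_def by (rule subordinate_deriv(1)[OF a m _ _ _ c that]) (use der b b' in auto)
  have sd2: "continuous_on {0<..} D"
    unfolding D_def by (rule subordinate_deriv(2)[OF a m _ _ _ c]) (use der b b' in auto)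
  have dv: "deriv (subordinate \<phi>) s = D s" if "0 < s" for s
    using sd1[OF that] by (rule DERIV_imp_deriv)
  have eq: "(\<integral>y. max 0 y * frac_weight t s * \<phi>' (s powr \<beta> * y) \<partial>inverse_law)
      = indicator {0<..} s * deriv (subordinate \<phi>) s * rl_kernel (1 - \<beta>) (t - s)" for s t
  proof (cases "0 < s")
    case False
    thus ?thesis by (simp add: frac_weight_def rl_kernel_def)
  next
    case True
    have G: "0 < Gamma \<beta>" using beta_pos by (rule Gamma_real_pos)
    have fw: "frac_weight t s = \<beta> * s powr (\<beta> - 1) * rl_kernel (1 - \<beta>) (t - s)"
      using True G by (simp add: frac_weight_def Gamma_one_plus_beta rl_kernel_def)
    have "(\<integral>y. max 0 y * frac_weight t s * \<phi>' (s powr \<beta> * y) \<partial>inverse_law)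
      = (\<integral>y. rl_kernel (1 - \<beta>) (t - s) * (\<phi>' (s powr \<beta> * y) * (\<beta> * s powr (\<beta> - 1) * y)) \<partial>inverse_law)"
    proof (rule integral_cong_AE)
      show "AE y in inverse_law. max 0 y * frac_weight t s * \<phi>' (s powr \<beta> * y) =
         rl_kernel (1 - \<beta>) (t - s) * (\<phi>' (s powr \<beta> * y) * (\<beta> * s powr (\<beta> - 1) * y))"
        using inverse_law_pos by eventually_elim (simp add: fw mult_ac)
    qed auto
    also have "\<dots> = rl_kernel (1 - \<beta>) (t - s) * D s" unfolding D_def by (rule integral_mult_right_zero)
    finally show ?thesis using True dv[OF True] by simp
  qed
  have int: "integrable inverse_law (\<lambda>y. \<phi>' (t powr \<beta> * y))" if "0 < t" for t
    by (rule subordinate_dominated[OF a m(2) that]) (rule b')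
  note fi = frac_identity[OF _ m(2), unfolded eq]
  show "caputo_diff \<beta> (subordinate \<phi>)"
    unfolding caputo_diff_def
  proof (intro conjI allI impI)
    show "subordinate \<phi> field_differentiable at t" if "0 < t" for t
      using sd1[OF that] by (auto simp: field_differentiable_def)
    show "continuous_on {0<..} (deriv (subordinate \<phi>))"
      using sd2 by (subst continuous_on_cong[OF refl dv]) auto
    fix t :: real assume t: "0 < t"
    have "integrable lborel (\<lambda>s. Gamma (1 - \<beta>) * (indicator {0<..} s * deriv (subordinate \<phi>) s * rl_kernel (1 - \<beta>) (t - s)))"
      by (intro integrable_mult_right fi(1)[OF t int[OF t]])
    moreover have "Gamma (1 - \<beta>) * (indicator {0<..} s * deriv (subordinate \<phi>) s * rl_kernel (1 - \<beta>) (t - s))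
        = indicator {0<..<t} s * (deriv (subordinate \<phi>) s / (t - s) powr \<beta>)" for s
    proof -
      have "Gamma (1 - \<beta>) \<noteq> 0" using Gamma_real_pos[of "1 - \<beta>"] beta_less_1 by linarith
      thus ?thesis by (auto simp: rl_kernel_def indicator_def powr_minus_divide)
    qed
    ultimately show "set_integrable lborel {0<..<t} (\<lambda>s. deriv (subordinate \<phi>) s / (t - s) powr \<beta>)"
      by (simp add: set_integrable_def)
  qed
  show "caputo \<beta> (subordinate \<phi>) t = subordinate \<phi>' t" if "0 < t"
    using fi(2)[OF that int[OF that]] unfolding caputo_eq_rl_integral rl_integral_def subordinate_def .
qed

end

section \<open>Gaussian smoothing\<close>

lemma measurable_vec_nth [measurable (raw)]:
  fixes f :: "'a \<Rightarrow> real^'d::finite"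
  assumes "f \<in> borel_measurable M"
  shows "(\<lambda>x. f x $ i) \<in> borel_measurable M"
proof -
  have "(\<lambda>z::real^'d. z $ i) \<in> borel_measurable borel"
    by (intro borel_measurable_continuous_onI continuous_intros)
  from measurable_compose[OF assms this] show ?thesis .
qed

lemma measurable_vec_lambda [measurable (raw)]:
  fixes f :: "'a \<Rightarrow> 'd::finite \<Rightarrow> real"
  assumes "\<And>i. (\<lambda>x. f x i) \<in> borel_measurable M"
  shows "(\<lambda>x. \<chi> i. f x i) \<in> borel_measurable M"
proof (rule borel_measurable_euclidean_space[THEN iffD2], rule ballI)
  fix b :: "real^'d" assume "b \<in> Basis"
  then obtain i where "b = axis i 1" by (auto simp: Basis_vec_def)
  thus "(\<lambda>x. (\<chi> i. f x i) \<bullet> b) \<in> borel_measurable M" using assms[of i] by (simp add: inner_axis)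
qed

section \<open>The standard Gaussian measure\<close>

definition gauss_density :: "real^'d::finite \<Rightarrow> real" where
  "gauss_density z = (1 / sqrt (2 * pi)) ^ CARD('d) * exp (- ((norm z)\<^sup>2 / 2))"

definition gauss :: "(real^'d::finite) measure" where
  "gauss = density lborel (\<lambda>z. ennreal (gauss_density z))"

lemma gauss_density_pos: "0 < gauss_density z"
  unfolding gauss_density_def by simp

lemma gauss_density_nonneg [simp]: "0 \<le> gauss_density z"
  by (rule less_imp_le[OF gauss_density_pos])

lemma gauss_density_measurable [measurable]: "gauss_density \<in> borel_measurable borel"
  unfolding gauss_density_def by measurable

lemma sets_gauss [simp, measurable_cong]: "sets gauss = sets borel"
  by (simp add: gauss_def)

lemma space_gauss [simp]: "space gauss = UNIV"
  by (simp add: gauss_def)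

lemma gauss_density_prod:
  "gauss_density (z :: real^'d::finite) = (\<Prod>i\<in>UNIV. std_normal_density (z $ i))"
proof -
  have "(norm z)\<^sup>2 = (\<Sum>i\<in>UNIV. (z $ i)\<^sup>2)"
    by (simp add: norm_vec_def L2_set_def sum_nonneg)
  hence "exp (- ((norm z)\<^sup>2 / 2)) = (\<Prod>i\<in>UNIV. exp (- ((z $ i)\<^sup>2 / 2)))"
    by (simp add: exp_sum[symmetric] sum_divide_distrib sum_negf)
  thus ?thesis
    by (simp add: gauss_density_def normal_density_def prod_dividef power_one_over)
qed

text \<open>Lebesgue measure is determined by the volumes of boxes, and the coordinate map carries
  products of intervals to boxes.\<close>

lemma lborel_vec:
  "(lborel :: (real^'d::finite) measure) = distr (\<Pi>\<^sub>M i\<in>(UNIV :: 'd set). lborel) borel (\<lambda>f. \<chi> i. f i)"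
proof (rule lborel_eqI)
  interpret product_sigma_finite "\<lambda>_::'d. lborel :: real measure" by standard
  fix l u :: "real^'d" assume lu: "\<And>b. b \<in> Basis \<Longrightarrow> l \<bullet> b \<le> u \<bullet> b"
  have le: "l $ i \<le> u $ i" for i using lu[of "axis i 1"] by (simp add: inner_axis axis_in_Basis_iff)
  have "emeasure (distr (\<Pi>\<^sub>M i\<in>(UNIV :: 'd set). lborel) borel (\<lambda>f. \<chi> i. f i)) (box l u)
     = emeasure (\<Pi>\<^sub>M i\<in>(UNIV :: 'd set). lborel) (\<Pi>\<^sub>E i\<in>UNIV. {l $ i<..<u $ i})"
    by (subst emeasure_distr) (auto simp: mem_box_cart space_PiM PiE_def Pi_def intro!: arg_cong[where f = "emeasure _"])
  also have "\<dots> = (\<Prod>i\<in>UNIV. ennreal (u $ i - l $ i))"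
    using le by (subst emeasure_PiM) auto
  also have "\<dots> = ennreal (\<Prod>i\<in>UNIV. (u - l) \<bullet> axis i 1)"
    using le by (subst prod_ennreal) (auto simp: inner_axis)
  also have "(\<Prod>i\<in>(UNIV :: 'd set). (u - l) \<bullet> axis i 1) = (\<Prod>b\<in>Basis. (u - l) \<bullet> b)"
  proof -
    have B: "(Basis :: (real^'d) set) = range (\<lambda>i::'d. axis i (1::real))" by (auto simp: Basis_vec_def)
    have "inj (\<lambda>i::'d. axis i (1::real))" by (auto simp: inj_on_def axis_eq_axis)
    from prod.reindex[OF this, of "\<lambda>b. (u - l) \<bullet> b"] show ?thesis by (simp only: B comp_def)
  qed
  finally show "emeasure (distr (\<Pi>\<^sub>M i\<in>(UNIV :: 'd set). lborel) borel (\<lambda>f. \<chi> i. f i)) (box l u)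
     = ennreal (\<Prod>b\<in>Basis. (u - l) \<bullet> b)" .
qed simp

text \<open>The density is convenient for translations and dilations; the product form is what
  independent coordinates of the sheet deliver. Both descriptions are used.\<close>

lemma gauss_eq_distr_PiM:
  "(gauss :: (real^'d::finite) measure)
     = distr (\<Pi>\<^sub>M i\<in>(UNIV :: 'd set). density lborel (\<lambda>x. ennreal (std_normal_density x))) borel (\<lambda>f. \<chi> i. f i)"
proof -
  interpret L: product_sigma_finite "\<lambda>_::'d. lborel :: real measure" by standard
  interpret N: prob_space "density lborel (\<lambda>x. ennreal (std_normal_density x))"
    by (rule prob_space_normal_density) simp
  interpret P: product_sigma_finite "\<lambda>_::'d. density lborel (\<lambda>x. ennreal (std_normal_density x))" ..
  let ?D = "\<lambda>f::'d \<Rightarrow> real. \<Prod>i\<in>UNIV. ennreal (std_normal_density (f i))"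
  have "density (\<Pi>\<^sub>M i\<in>(UNIV :: 'd set). lborel) ?D
      = (\<Pi>\<^sub>M i\<in>(UNIV :: 'd set). density lborel (\<lambda>x. ennreal (std_normal_density x)))"
  proof (rule P.PiM_eqI)
    show "sets (density (\<Pi>\<^sub>M i\<in>(UNIV :: 'd set). lborel) ?D)
      = sets (\<Pi>\<^sub>M i\<in>(UNIV :: 'd set). density lborel (\<lambda>x. ennreal (std_normal_density x)))"
      by (simp cong: sets_PiM_cong)
    fix A :: "'d \<Rightarrow> real set" assume A: "\<And>i. i \<in> UNIV \<Longrightarrow> A i \<in> sets (density lborel (\<lambda>x. ennreal (std_normal_density x)))"
    hence [measurable]: "A i \<in> sets borel" for i by simp
    have "emeasure (density (\<Pi>\<^sub>M i\<in>(UNIV :: 'd set). lborel) ?D) (Pi\<^sub>E UNIV A)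
        = (\<integral>\<^sup>+f. ?D f * indicator (Pi\<^sub>E UNIV A) f \<partial>(\<Pi>\<^sub>M i\<in>(UNIV :: 'd set). lborel))"
      by (subst emeasure_density) (auto intro!: sets_PiM_I_finite)
    also have "\<dots> = (\<integral>\<^sup>+f. (\<Prod>i\<in>UNIV. ennreal (std_normal_density (f i)) * indicator (A i) (f i)) \<partial>(\<Pi>\<^sub>M i\<in>(UNIV :: 'd set). lborel))"
    proof (intro nn_integral_cong)
      fix f :: "'d \<Rightarrow> real"
      have "indicator (Pi\<^sub>E UNIV A) f = (\<Prod>i\<in>UNIV. indicator (A i) (f i) :: ennreal)"
        by (auto simp: indicator_def PiE_def Pi_def prod_eq_1_iff)
      thus "?D f * indicator (Pi\<^sub>E UNIV A) f = (\<Prod>i\<in>UNIV. ennreal (std_normal_density (f i)) * indicator (A i) (f i))"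
        by (simp add: prod.distrib)
    qed
    also have "\<dots> = (\<Prod>i\<in>(UNIV::'d set). \<integral>\<^sup>+x. ennreal (std_normal_density x) * indicator (A i) x \<partial>lborel)"
      by (rule L.product_nn_integral_prod) auto
    also have "\<dots> = (\<Prod>i\<in>UNIV. emeasure (density lborel (\<lambda>x. ennreal (std_normal_density x))) (A i))"
      by (intro prod.cong refl) (simp add: emeasure_density)
    finally show "emeasure (density (\<Pi>\<^sub>M i\<in>(UNIV :: 'd set). lborel) ?D) (Pi\<^sub>E UNIV A)
      = (\<Prod>i\<in>UNIV. emeasure (density lborel (\<lambda>x. ennreal (std_normal_density x))) (A i))" .
  qed simp
  moreover have "?D = (\<lambda>f. ennreal (gauss_density (\<chi> i. f i)))"
    by (simp add: gauss_density_prod prod_ennreal)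
  ultimately show ?thesis
    unfolding gauss_def by (subst lborel_vec, subst density_distr) (auto simp: )
qed

lemma prob_space_gauss: "prob_space gauss"
proof -
  interpret N: prob_space "density lborel (\<lambda>x. ennreal (std_normal_density x))"
    by (rule prob_space_normal_density) simp
  show ?thesis
    unfolding gauss_eq_distr_PiM
    by (intro prob_space.prob_space_distr prob_space_PiM N.prob_space_axioms) measurable
qed

lemma integral_gauss:
  "f \<in> borel_measurable borel \<Longrightarrow> (\<integral>z. f z \<partial>gauss) = (\<integral>z. gauss_density z * f z \<partial>lborel)" for f :: "real^'d::finite \<Rightarrow> real"
  unfolding gauss_def by (subst integral_density) auto

lemma integrable_gauss_iff:
  "f \<in> borel_measurable borel \<Longrightarrow> integrable gauss f \<longleftrightarrow> integrable lborel (\<lambda>z. gauss_density z * f z)"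
  for f :: "real^'d::finite \<Rightarrow> real"
  unfolding gauss_def by (subst integrable_density) auto

text \<open>This ratio and the one for translations below move the dependence of an average on
  variance and centre away from the averaged function, which may lack derivatives, into an explicit
  smooth factor.\<close>

lemma gauss_density_scale:
  "gauss_density (r *\<^sub>R z) = gauss_density z * exp ((1 - r\<^sup>2) * (norm z)\<^sup>2 / 2)"
  by (simp add: gauss_density_def exp_add[symmetric] power_mult_distrib field_simps)

lemma gauss_density_shift:
  fixes z :: "real^'d::finite"
  shows "gauss_density (z - a *\<^sub>R axis j 1) = gauss_density z * exp (a * z $ j - a\<^sup>2 / 2)"
proof -
  have "(norm (z - a *\<^sub>R axis j 1))\<^sup>2 = (norm z)\<^sup>2 - 2 * a * z $ j + a\<^sup>2"
    unfolding power2_norm_eq_inner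
    by (simp add: inner_diff_left inner_diff_right inner_axis inner_axis' power2_eq_square algebra_simps)
  thus ?thesis
    by (simp add: gauss_density_def exp_add[symmetric] field_simps)
qed

lemma lborel_integral_scale:
  fixes F :: "real^'d::finite \<Rightarrow> real"
  assumes [measurable]: "F \<in> borel_measurable borel" and r: "0 < r"
  shows "(\<integral>z. F z \<partial>lborel) = r ^ CARD('d) * (\<integral>z. F (r *\<^sub>R z) \<partial>lborel)"
proof -
  have "(\<integral>z. F z \<partial>lborel) = (\<integral>z. F z \<partial>density (distr lborel borel (\<lambda>x. 0 + r *\<^sub>R x)) (\<lambda>_. ennreal (\<bar>r\<bar> ^ DIM(real^'d))))"
    using lborel_affine[of r "0 :: real^'d"] r by (simp add: ennreal_power)
  also have "\<dots> = r ^ CARD('d) * (\<integral>z. F (r *\<^sub>R z) \<partial>lborel)"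
    using r by (subst integral_density) (auto simp: integral_distr)
  finally show ?thesis .
qed

text \<open>The total mass 1, rewritten after a dilation by r = sqrt(1 - 2a), shows that z \<mapsto>
  \<open>gauss_density (r *\<^sub>R z)\<close> is integrable; its ratio to the density is the
  exponential in question.\<close>

lemma gauss_exp_integrable:
  assumes a: "a < 1/2"
  shows "integrable (gauss :: (real^'d::finite) measure) (\<lambda>z. exp (a * (norm z)\<^sup>2))"
proof -
  interpret prob_space "gauss :: (real^'d) measure" by (rule prob_space_gauss)
  define r where "r = sqrt (1 - 2 * a)"
  have r: "0 < r" "r\<^sup>2 = 1 - 2 * a" using a by (auto simp: r_def)
  have "(\<integral>\<^sup>+z. ennreal (gauss_density z) \<partial>(lborel :: (real^'d) measure)) = 1"
    using emeasure_space_1 by (simp add: gauss_def emeasure_density)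
  moreover have "(\<integral>\<^sup>+z. ennreal (gauss_density z) \<partial>(lborel :: (real^'d) measure))
     = (\<integral>\<^sup>+z. ennreal (gauss_density z) \<partial>density (distr lborel borel (\<lambda>x::real^'d. 0 + r *\<^sub>R x)) (\<lambda>_. ennreal (\<bar>r\<bar> ^ DIM(real^'d))))"
    using lborel_affine[of r "0 :: real^'d"] r by (simp add: ennreal_power)
  moreover have "\<dots> = ennreal (r ^ CARD('d)) * (\<integral>\<^sup>+z. ennreal (gauss_density (r *\<^sub>R z)) \<partial>(lborel :: (real^'d) measure))"
    using r by (subst nn_integral_density) (auto simp: nn_integral_distr nn_integral_cmult)
  ultimately have "ennreal (r ^ CARD('d)) * (\<integral>\<^sup>+z. ennreal (gauss_density (r *\<^sub>R z)) \<partial>(lborel :: (real^'d) measure)) = 1"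
    by simp
  hence "(\<integral>\<^sup>+z. ennreal (gauss_density (r *\<^sub>R z)) \<partial>(lborel :: (real^'d) measure)) < \<infinity>"
    using r by (auto simp: less_top[symmetric] ennreal_mult_eq_top_iff ennreal_top_mult)
  hence "integrable (lborel :: (real^'d) measure) (\<lambda>z. gauss_density (r *\<^sub>R z))"
    by (intro integrableI_bounded) auto
  moreover have "gauss_density (r *\<^sub>R z) = gauss_density z * exp (a * (norm z)\<^sup>2)" for z :: "real^'d"
    unfolding gauss_density_scale r(2) by simp
  ultimately show ?thesis by (simp add: integrable_gauss_iff)
qed

text \<open>From 1 + r <= exp r the left side is at most exp((p + c) r), and completing the square
  bounds the exponent by (p + c)^2/(4a) + a r^2.\<close>

lemma power_exp_le_exp_square:
  fixes r c a :: real
  assumes "0 \<le> r" "0 < a"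
  shows "(1 + r) ^ p * exp (c * r) \<le> exp ((real p + c)\<^sup>2 / (4 * a)) * exp (a * r\<^sup>2)"
proof -
  have "(1 + r) ^ p \<le> exp r ^ p" using assms by (intro power_mono exp_ge_add_one_self) auto
  hence "(1 + r) ^ p * exp (c * r) \<le> exp (real p * r) * exp (c * r)"
    by (intro mult_right_mono) (auto simp: exp_of_nat_mult)
  also have "\<dots> = exp ((real p + c) * r)" by (simp add: exp_add[symmetric] algebra_simps)
  also have "(real p + c) * r \<le> (real p + c)\<^sup>2 / (4 * a) + a * r\<^sup>2"
  proof -
    have "0 \<le> (real p + c - 2 * a * r)\<^sup>2" by simp
    hence "4 * a * ((real p + c) * r) \<le> (real p + c)\<^sup>2 + 4 * a * (a * r\<^sup>2)"
      by (simp add: power2_eq_square algebra_simps)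
    thus ?thesis using assms by (simp add: field_simps)
  qed
  finally show ?thesis by (simp add: exp_add)
qed

lemma gauss_integrable:
  fixes f :: "real^'d::finite \<Rightarrow> real"
  assumes m: "f \<in> borel_measurable borel" and a: "a < 1/2"
    and b: "\<And>z. \<bar>f z\<bar> \<le> C * ((1 + norm z) ^ p * exp (c * norm z) * exp (a * (norm z)\<^sup>2))"
  shows "integrable gauss f"
proof -
  \<comment> \<open>Half of the gap between a and 1/2: enough to absorb the polynomial and the
    linear exponential while the total exponent stays below 1/2.\<close>
  define e where "e = (1/2 - a) / 2"
  have e: "0 < e" "e + a < 1/2" using a by (auto simp: e_def field_simps)
  define K where "K = exp ((real p + c)\<^sup>2 / (4 * e))"
  have C0: "0 \<le> C"
  proof -
    have "0 \<le> C * ((1 + norm (0::real^'d)) ^ p * exp (c * norm (0::real^'d)) * exp (a * (norm (0::real^'d))\<^sup>2))"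
      using b[of 0] abs_ge_zero order_trans by blast
    thus ?thesis by simp
  qed
  show ?thesis
  proof (rule Bochner_Integration.integrable_bound[of _ "\<lambda>z. C * K * exp ((e + a) * (norm z)\<^sup>2)"])
    show "integrable gauss (\<lambda>z::real^'d. C * K * exp ((e + a) * (norm z)\<^sup>2))"
      using e by (intro integrable_mult_right gauss_exp_integrable)
    show "AE z in (gauss :: (real^'d) measure). norm (f z) \<le> norm (C * K * exp ((e + a) * (norm z)\<^sup>2))"
    proof (rule AE_I2)
      fix z :: "real^'d"
      have "(1 + norm z) ^ p * exp (c * norm z) * exp (a * (norm z)\<^sup>2) \<le> (K * exp (e * (norm z)\<^sup>2)) * exp (a * (norm z)\<^sup>2)"
        unfolding K_def using e by (intro mult_right_mono power_exp_le_exp_square) auto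
      hence "\<bar>f z\<bar> \<le> C * ((K * exp (e * (norm z)\<^sup>2)) * exp (a * (norm z)\<^sup>2))"
        using b[of z] C0 by (meson mult_left_mono order_trans)
      thus "norm (f z) \<le> norm (C * K * exp ((e + a) * (norm z)\<^sup>2))"
        using C0 by (simp add: K_def exp_add algebra_simps)
    qed
  qed (use m in simp)
qed

lemma continuous_on_integral_dominated:
  fixes F :: "'b::metric_space \<Rightarrow> 'a \<Rightarrow> real"
  assumes m: "\<And>y. y \<in> S \<Longrightarrow> F y \<in> borel_measurable M"
    and c: "AE \<omega> in M. continuous_on S (\<lambda>y. F y \<omega>)"
    and d: "\<And>y0. y0 \<in> S \<Longrightarrow> \<exists>e>0. \<exists>w. integrable M w \<and>
      (\<forall>y\<in>S. dist y y0 < e \<longrightarrow> (AE \<omega> in M. \<bar>F y \<omega>\<bar> \<le> w \<omega>))"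
  shows "continuous_on S (\<lambda>y. integral\<^sup>L M (F y))"
  unfolding continuous_on_def
proof
  fix y0 assume y0: "y0 \<in> S"
  obtain e w where e: "0 < e" "integrable M w"
    "\<And>y. y \<in> S \<Longrightarrow> dist y y0 < e \<Longrightarrow> AE \<omega> in M. \<bar>F y \<omega>\<bar> \<le> w \<omega>" using d[OF y0] by blast
  have "((\<lambda>y. integral\<^sup>L M (F y)) \<longlongrightarrow> integral\<^sup>L M (F y0)) (at y0 within (S \<inter> ball y0 e))"
  proof (rule integral_tendsto_within[OF _ _ e(2)])
    show "AE \<omega> in M. ((\<lambda>y. F y \<omega>) \<longlongrightarrow> F y0 \<omega>) (at y0 within (S \<inter> ball y0 e))"
      using c
    proof eventually_elim
      case (elim \<omega>)
      hence "((\<lambda>y. F y \<omega>) \<longlongrightarrow> F y0 \<omega>) (at y0 within S)" using y0 by (auto simp: continuous_on_def)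
      thus ?case by (rule tendsto_within_subset) auto
    qed
  qed (use m y0 e(3) in \<open>auto simp: dist_commute\<close>)
  moreover have "at y0 within (S \<inter> ball y0 e) = at y0 within S"
    using e by (intro at_within_nhd[of _ "ball y0 e"]) auto
  ultimately show "((\<lambda>y. integral\<^sup>L M (F y)) \<longlongrightarrow> integral\<^sup>L M (F y0)) (at y0 within S)" by simp
qed

section \<open>Gaussian averages with polynomial weights\<close>

definition poly_growth :: "(real^'d::finite \<Rightarrow> real) \<Rightarrow> bool" where
  "poly_growth g \<longleftrightarrow> continuous_on UNIV g \<and> (\<exists>C p. \<forall>x. \<bar>g x\<bar> \<le> C * (1 + norm x) ^ p)"

lemma poly_growth_measurable: "poly_growth g \<Longrightarrow> g \<in> borel_measurable borel"
  unfolding poly_growth_def by (auto intro: borel_measurable_continuous_onI)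

text \<open>The estimate 1 + |x + s z| <= (1 + |x| + s)(1 + |z|) separates the parameters from the
  integration variable, so one polynomial in z dominates on bounded parameter sets.\<close>

lemma poly_growth_bound:
  fixes g :: "real^'d::finite \<Rightarrow> real"
  assumes "poly_growth g"
  obtains C p where "0 \<le> C"
    "\<And>x z s. 0 \<le> s \<Longrightarrow> \<bar>g (x + s *\<^sub>R z)\<bar> \<le> C * ((1 + norm x + s) ^ p * (1 + norm z) ^ p)"
proof -
  obtain C p where C: "\<And>x. \<bar>g x\<bar> \<le> C * (1 + norm x) ^ p" using assms by (auto simp: poly_growth_def)
  have C0: "0 \<le> C" using C[of 0] by (auto intro: order_trans[OF abs_ge_zero])
  have "\<bar>g (x + s *\<^sub>R z)\<bar> \<le> C * ((1 + norm x + s) ^ p * (1 + norm z) ^ p)" if s: "0 \<le> s" for x z s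
  proof -
    have "norm (x + s *\<^sub>R z) \<le> norm x + s * norm z" using norm_triangle_ineq[of x "s *\<^sub>R z"] s by simp
    moreover have "(1 + norm x + s) * (1 + norm z) = 1 + norm x + s * norm z + s + norm z + norm x * norm z"
      by (simp add: algebra_simps)
    moreover have "0 \<le> norm x * norm z" by simp
    ultimately have "1 + norm (x + s *\<^sub>R z) \<le> (1 + norm x + s) * (1 + norm z)" using s norm_ge_zero[of z] by linarith
    hence "(1 + norm (x + s *\<^sub>R z)) ^ p \<le> ((1 + norm x + s) * (1 + norm z)) ^ p"
      by (intro power_mono) auto
    hence "C * (1 + norm (x + s *\<^sub>R z)) ^ p \<le> C * ((1 + norm x + s) * (1 + norm z)) ^ p"
      using C0 by (rule mult_left_mono)
    thus ?thesis using C[of "x + s *\<^sub>R z"] by (simp add: power_mult_distrib)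
  qed
  with C0 show ?thesis by (rule that)
qed

lemma poly_growth_integrable:
  fixes g :: "real^'d::finite \<Rightarrow> real"
  assumes g: "poly_growth g" and [measurable]: "q \<in> borel_measurable borel"
    and q: "\<And>z. \<bar>q z\<bar> \<le> D * ((1 + norm z) ^ m * exp (c * norm z) * exp (a * (norm z)\<^sup>2))" and a: "a < 1/2"
    and s: "0 \<le> s"
  shows "integrable gauss (\<lambda>z. g (x + s *\<^sub>R z) * q z)"
proof -
  note [measurable] = poly_growth_measurable[OF g]
  obtain C p where C: "0 \<le> C"
    "\<And>x z s. 0 \<le> s \<Longrightarrow> \<bar>g (x + s *\<^sub>R z)\<bar> \<le> C * ((1 + norm x + s) ^ p * (1 + norm z) ^ p)"
    using poly_growth_bound[OF g] by blast
  show ?thesis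
  proof (rule gauss_integrable[where C = "C * (1 + norm x + s) ^ p * D" and p = "p + m" and c = c and a = a])
    fix z :: "real^'d"
    have "\<bar>g (x + s *\<^sub>R z) * q z\<bar> \<le> (C * ((1 + norm x + s) ^ p * (1 + norm z) ^ p)) *
        (D * ((1 + norm z) ^ m * exp (c * norm z) * exp (a * (norm z)\<^sup>2)))"
      unfolding abs_mult using C s q[of z] by (intro mult_mono) auto
    thus "\<bar>g (x + s *\<^sub>R z) * q z\<bar> \<le> C * (1 + norm x + s) ^ p * D * ((1 + norm z) ^ (p + m) * exp (c * norm z) * exp (a * (norm z)\<^sup>2))"
      by (simp add: power_add mult_ac)
  qed (use a in measurable)
qed

text \<open>The heat flow of g at variance \<sigma> when q = 1. A nontrivial q is the Hermite-type
  polynomial left behind by derivatives that fall on the Gaussian kernel.\<close>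

definition heat_avg :: "(real^'d::finite \<Rightarrow> real) \<Rightarrow> (real^'d \<Rightarrow> real) \<Rightarrow> real \<Rightarrow> real^'d \<Rightarrow> real" where
  "heat_avg q g \<sigma> x = (\<integral>z. g (x + sqrt \<sigma> *\<^sub>R z) * q z \<partial>gauss)"

definition poly_weight :: "(real^'d::finite \<Rightarrow> real) \<Rightarrow> bool" where
  "poly_weight q \<longleftrightarrow> q \<in> borel_measurable borel \<and> (\<exists>D m. \<forall>z. \<bar>q z\<bar> \<le> D * (1 + norm z) ^ m)"

lemma poly_weight_integrable:
  assumes "poly_growth g" "poly_weight q" "0 \<le> s"
  shows "integrable gauss (\<lambda>z. g (x + s *\<^sub>R z) * q z)"
proof -
  obtain D m where "\<And>z. \<bar>q z\<bar> \<le> D * (1 + norm z) ^ m" using assms by (auto simp: poly_weight_def)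
  thus ?thesis using assms
    by (intro poly_growth_integrable[where c = 0 and a = 0]) (auto simp: poly_weight_def)
qed

lemma poly_weight_const: "poly_weight (\<lambda>_. c)"
  unfolding poly_weight_def by (auto intro!: exI[of _ "\<bar>c\<bar>"] exI[of _ "0::nat"])

lemma poly_weight_quadratic: "poly_weight (\<lambda>z. (b + c * z $ i) * z $ j - d)"
  unfolding poly_weight_def
proof (intro conjI exI allI)
  fix z :: "real^'a"
  have "\<bar>b + c * z $ i\<bar> \<le> \<bar>b\<bar> * 1 + \<bar>c\<bar> * norm z"
    using component_le_norm_cart[of z i] by (auto simp: abs_mult intro!: order_trans[OF abs_triangle_ineq] add_mono mult_left_mono)
  also have "\<dots> \<le> (\<bar>b\<bar> + \<bar>c\<bar>) * (1 + norm z)" by (simp add: algebra_simps)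
  finally have 1: "\<bar>b + c * z $ i\<bar> \<le> (\<bar>b\<bar> + \<bar>c\<bar>) * (1 + norm z)" .
  have "\<bar>(b + c * z $ i) * z $ j - d\<bar> \<le> \<bar>b + c * z $ i\<bar> * \<bar>z $ j\<bar> + \<bar>d\<bar>"
    by (metis abs_mult abs_triangle_ineq4)
  also have "\<dots> \<le> ((\<bar>b\<bar> + \<bar>c\<bar>) * (1 + norm z)) * (1 + norm z) + \<bar>d\<bar> * ((1 + norm z) * (1 + norm z))"
  proof (intro add_mono mult_mono 1)
    have "1 * 1 \<le> (1 + norm z) * (1 + norm z)" by (intro mult_mono) auto
    from mult_left_mono[OF this, of "\<bar>d\<bar>"]
    show "\<bar>d\<bar> \<le> \<bar>d\<bar> * ((1 + norm z) * (1 + norm z))" by simp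
    show "\<bar>z $ j\<bar> \<le> 1 + norm z" using component_le_norm_cart[of z j] by simp
  qed auto
  finally show "\<bar>(b + c * z $ i) * z $ j - d\<bar> \<le> (\<bar>b\<bar> + \<bar>c\<bar> + \<bar>d\<bar>) * (1 + norm z) ^ 2"
    by (simp add: power2_eq_square algebra_simps)
qed measurable

lemma heat_avg_continuous:
  fixes g :: "real^'d::finite \<Rightarrow> real"
  assumes g: "poly_growth g" and q: "poly_weight q"
  shows "continuous_on ({0..} \<times> UNIV) (\<lambda>(\<sigma>, x). heat_avg q g \<sigma> x)"
proof -
  have [measurable]: "g \<in> borel_measurable borel" "q \<in> borel_measurable borel"
    using poly_growth_measurable[OF g] q by (auto simp: poly_weight_def)
  have gc: "continuous_on UNIV g" using g by (simp add: poly_growth_def)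
  obtain C p where C: "0 \<le> C"
    "\<And>x z s. 0 \<le> s \<Longrightarrow> \<bar>g (x + s *\<^sub>R z)\<bar> \<le> C * ((1 + norm x + s) ^ p * (1 + norm z) ^ p)"
    using poly_growth_bound[OF g] by blast
  obtain D m where D: "\<And>z. \<bar>q z\<bar> \<le> D * (1 + norm z) ^ m" using q by (auto simp: poly_weight_def)
  have "continuous_on ({0..} \<times> UNIV) (\<lambda>y. \<integral>z. g (snd y + sqrt (fst y) *\<^sub>R z) * q z \<partial>gauss)"
  proof (rule continuous_on_integral_dominated)
    show "AE z in gauss. continuous_on ({0..} \<times> UNIV) (\<lambda>y. g (snd y + sqrt (fst y) *\<^sub>R z) * q z)"
      by (intro AE_I2 continuous_intros continuous_on_compose2[OF gc]) auto
    fix y0 :: "real \<times> (real^'d)" assume "y0 \<in> {0..} \<times> UNIV"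
    define R where "R = 1 + (norm (snd y0) + 1) + sqrt (fst y0 + 1)"
    let ?w = "\<lambda>z. C * R ^ p * D * (1 + norm z) ^ (p + m)"
    have "integrable gauss ?w"
    proof (rule gauss_integrable[where C = "\<bar>C * R ^ p * D\<bar>" and p = "p + m" and c = 0 and a = 0])
    qed (auto simp: abs_mult)
    moreover have "\<bar>g (snd y + sqrt (fst y) *\<^sub>R z) * q z\<bar> \<le> ?w z"
      if y: "y \<in> {0..} \<times> UNIV" "dist y y0 < 1" for y z
    proof -
      have "dist (snd y) (snd y0) < 1" "dist (fst y) (fst y0) < 1"
        using y(2) dist_snd_le[of y y0] dist_fst_le[of y y0] by auto
      hence "norm (snd y) \<le> norm (snd y0) + 1" "fst y \<le> fst y0 + 1"
        using norm_triangle_sub[of "snd y" "snd y0"] by (auto simp: dist_norm dist_real_def)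
      moreover from this have "sqrt (fst y) \<le> sqrt (fst y0 + 1)" by simp
      ultimately have "1 + norm (snd y) + sqrt (fst y) \<le> R" unfolding R_def by linarith
      hence "(1 + norm (snd y) + sqrt (fst y)) ^ p \<le> R ^ p" using y by (intro power_mono) auto
      hence "C * ((1 + norm (snd y) + sqrt (fst y)) ^ p * (1 + norm z) ^ p) \<le> C * (R ^ p * (1 + norm z) ^ p)"
        using C by (intro mult_left_mono mult_right_mono) auto
      hence "\<bar>g (snd y + sqrt (fst y) *\<^sub>R z)\<bar> \<le> C * (R ^ p * (1 + norm z) ^ p)"
        using C(2)[of "sqrt (fst y)" "snd y" z] y by auto
      hence "\<bar>g (snd y + sqrt (fst y) *\<^sub>R z) * q z\<bar> \<le> C * (R ^ p * (1 + norm z) ^ p) * (D * (1 + norm z) ^ m)"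
        unfolding abs_mult using D[of z] by (intro mult_mono) auto
      thus ?thesis by (simp add: power_add mult_ac)
    qed
    ultimately show "\<exists>e>0. \<exists>w. integrable gauss w \<and>
       (\<forall>y\<in>{0..} \<times> UNIV. dist y y0 < e \<longrightarrow> (AE z in gauss. \<bar>g (snd y + sqrt (fst y) *\<^sub>R z) * q z\<bar> \<le> w z))"
      by (intro exI[of _ 1] conjI exI[of _ ?w]) auto
  qed measurable
  thus ?thesis by (simp add: heat_avg_def case_prod_unfold)
qed

lemma heat_avg_bound:
  fixes g :: "real^'d::finite \<Rightarrow> real"
  assumes g: "poly_growth g" and q: "poly_weight q"
  shows "\<exists>C\<ge>0. \<exists>p. \<forall>\<sigma>\<ge>0. \<forall>x. \<bar>heat_avg q g \<sigma> x\<bar> \<le> C * (1 + norm x + sqrt \<sigma>) ^ p"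
proof -
  obtain C p where C: "0 \<le> C"
    "\<And>x z s. 0 \<le> s \<Longrightarrow> \<bar>g (x + s *\<^sub>R z)\<bar> \<le> C * ((1 + norm x + s) ^ p * (1 + norm z) ^ p)"
    using poly_growth_bound[OF g] by blast
  obtain D m where D: "\<And>z. \<bar>q z\<bar> \<le> D * (1 + norm z) ^ m" using q by (auto simp: poly_weight_def)
  have D0: "0 \<le> D" using D[of 0] by (auto intro: order_trans[OF abs_ge_zero])
  define K where "K = (\<integral>z. (1 + norm z) ^ (p + m) \<partial>(gauss :: (real^'d) measure))"
  have wi: "integrable gauss (\<lambda>z::real^'d. (1 + norm z) ^ (p + m))"
    by (rule gauss_integrable[where C = 1 and p = "p + m" and c = 0 and a = 0]) auto
  have K0: "0 \<le> K" unfolding K_def by (intro integral_nonneg_AE) auto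
  have "\<bar>heat_avg q g \<sigma> x\<bar> \<le> C * D * K * (1 + norm x + sqrt \<sigma>) ^ p" if s: "0 \<le> \<sigma>" for \<sigma> x
  proof -
    have "\<bar>heat_avg q g \<sigma> x\<bar> \<le> (\<integral>z. \<bar>g (x + sqrt \<sigma> *\<^sub>R z) * q z\<bar> \<partial>gauss)"
      unfolding heat_avg_def by (rule integral_abs_bound)
    also have "\<dots> \<le> (\<integral>z. (C * D * (1 + norm x + sqrt \<sigma>) ^ p) * (1 + norm z) ^ (p + m) \<partial>(gauss :: (real^'d) measure))"
    proof (rule integral_mono)
      show "integrable gauss (\<lambda>z. \<bar>g (x + sqrt \<sigma> *\<^sub>R z) * q z\<bar>)"
        using poly_weight_integrable[OF g q, of "sqrt \<sigma>" x] s by (intro integrable_abs) auto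
      show "integrable gauss (\<lambda>z::real^'d. (C * D * (1 + norm x + sqrt \<sigma>) ^ p) * (1 + norm z) ^ (p + m))"
        by (intro integrable_mult_right wi)
      fix z
      have "\<bar>g (x + sqrt \<sigma> *\<^sub>R z) * q z\<bar> \<le> (C * ((1 + norm x + sqrt \<sigma>) ^ p * (1 + norm z) ^ p)) * (D * (1 + norm z) ^ m)"
        unfolding abs_mult using C s D[of z] by (intro mult_mono) auto
      thus "\<bar>g (x + sqrt \<sigma> *\<^sub>R z) * q z\<bar> \<le> (C * D * (1 + norm x + sqrt \<sigma>) ^ p) * (1 + norm z) ^ (p + m)"
        by (simp add: power_add mult_ac)
    qed
    finally show ?thesis by (simp add: K_def mult_ac)
  qed
  thus ?thesis using C(1) D0 K0 by (intro exI[of _ "C * D * K"]) auto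
qed

text \<open>Gaussian integration by parts: shifting x by h is undone by translating z by h / sqrt
  \<sigma>, so only the density ratio and the weight are differentiated. Affine weights suffice for
  two steps: the constant 1 gives the first derivative and its weight z_i the second, where the
  subtracted Kronecker term comes from differentiating the weight.\<close>

lemma heat_avg_shift_deriv:
  fixes g :: "real^'d::finite \<Rightarrow> real"
  assumes g: "poly_growth g" and \<sigma>: "0 < \<sigma>"
  shows "((\<lambda>h. heat_avg (\<lambda>z. b + c * z $ i) g \<sigma> (x + h *\<^sub>R axis j 1)) has_real_derivative
    heat_avg (\<lambda>z. (b + c * z $ i) * z $ j - c * axis j 1 $ i) g \<sigma> x / sqrt \<sigma>) (at 0)"
proof -
  note [measurable] = poly_growth_measurable[OF g]
  define s where "s = sqrt \<sigma>"
  let ?g = "\<lambda>z. g (x + s *\<^sub>R z)"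
  have s: "0 < s" using \<sigma> by (simp add: s_def)
  define \<delta> :: real where "\<delta> = axis j 1 $ i"
  have \<delta>: "\<bar>\<delta>\<bar> \<le> 1" by (simp add: \<delta>_def axis_def)
  \<comment> \<open>The translated weight times the density ratio; Q' is its derivative in the
    translation parameter a.\<close>
  define Q where "Q = (\<lambda>a z. (b + c * (z $ i - a * \<delta>)) * exp (a * z $ j - a\<^sup>2 / 2))"
  define Q' where "Q' = (\<lambda>a z. ((b + c * (z $ i - a * \<delta>)) * (z $ j - a) - c * \<delta>) * exp (a * z $ j - a\<^sup>2 / 2))"
  have [measurable]: "Q a \<in> borel_measurable borel" "Q' a \<in> borel_measurable borel" for a
    unfolding Q_def Q'_def by measurable
  have shift: "heat_avg (\<lambda>z. b + c * z $ i) g \<sigma> (x + h *\<^sub>R axis j 1) = (\<integral>z. ?g z * Q (h / s) z \<partial>gauss)" for h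
  proof -
    define a where "a = h / s"
    define F where "F = (\<lambda>z. gauss_density (z - a *\<^sub>R axis j 1) * (?g z * (b + c * (z $ i - a * \<delta>))))"
    have [measurable]: "F \<in> borel_measurable borel" unfolding F_def by measurable
    have xs: "x + h *\<^sub>R axis j 1 + s *\<^sub>R z = x + s *\<^sub>R (z + a *\<^sub>R axis j 1)" for z
      using s by (simp add: a_def algebra_simps)
    have "heat_avg (\<lambda>z. b + c * z $ i) g \<sigma> (x + h *\<^sub>R axis j 1)
        = (\<integral>z. gauss_density z * (g (x + h *\<^sub>R axis j 1 + s *\<^sub>R z) * (b + c * z $ i)) \<partial>lborel)"
      unfolding heat_avg_def s_def[symmetric] by (rule integral_gauss) measurable
    also have "\<dots> = (\<integral>z. F (a *\<^sub>R axis j 1 + z) \<partial>lborel)"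
      by (intro Bochner_Integration.integral_cong refl)
        (simp add: F_def xs \<delta>_def add.commute[of "a *\<^sub>R axis j 1"])
    also have "\<dots> = (\<integral>z. F z \<partial>distr lborel borel ((+) (a *\<^sub>R axis j 1)))"
      by (subst integral_distr) auto
    also have "\<dots> = (\<integral>z. F z \<partial>lborel)" by (simp only: lborel_distr_plus)
    also have "\<dots> = (\<integral>z. gauss_density z * (?g z * Q a z) \<partial>lborel)"
      by (intro Bochner_Integration.integral_cong refl) (simp add: F_def Q_def gauss_density_shift)
    also have "\<dots> = (\<integral>z. ?g z * Q a z \<partial>gauss)"
      by (rule integral_gauss[symmetric]) measurable
    finally show ?thesis by (simp add: a_def)
  qed
  obtain C p where C: "0 \<le> C"
    "\<And>x z s. 0 \<le> s \<Longrightarrow> \<bar>g (x + s *\<^sub>R z)\<bar> \<le> C * ((1 + norm x + s) ^ p * (1 + norm z) ^ p)"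
    using poly_growth_bound[OF g] by blast
  define R where "R = C * (1 + norm x + s) ^ p"
  define B where "B = \<bar>b\<bar> + 2 * \<bar>c\<bar>"
  have lin: "\<bar>b + c * (z $ i - a * \<delta>)\<bar> \<le> (\<bar>b\<bar> + \<bar>c\<bar>) * (1 + norm z)"
    and expb: "exp (a * z $ j - a\<^sup>2 / 2) \<le> exp (1 * norm z)" if "\<bar>a\<bar> < 1" for a z
  proof -
    have "\<bar>z $ i - a * \<delta>\<bar> \<le> \<bar>z $ i\<bar> + \<bar>a\<bar> * \<bar>\<delta>\<bar>" by (metis abs_mult abs_triangle_ineq4)
    also have "\<dots> \<le> norm z + 1 * 1"
      using that \<delta> component_le_norm_cart[of z i] by (intro add_mono mult_mono) auto
    finally have *: "\<bar>z $ i - a * \<delta>\<bar> \<le> norm z + 1" by simp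
    have "\<bar>b + c * (z $ i - a * \<delta>)\<bar> \<le> \<bar>b\<bar> + \<bar>c\<bar> * \<bar>z $ i - a * \<delta>\<bar>" by (metis abs_mult abs_triangle_ineq)
    also have "\<dots> \<le> \<bar>b\<bar> * (1 + norm z) + \<bar>c\<bar> * (1 + norm z)"
      using * by (intro add_mono mult_left_mono) (auto simp: mult_le_cancel_left1)
    finally show "\<bar>b + c * (z $ i - a * \<delta>)\<bar> \<le> (\<bar>b\<bar> + \<bar>c\<bar>) * (1 + norm z)" by (simp add: algebra_simps)
    have "a * z $ j \<le> \<bar>a\<bar> * \<bar>z $ j\<bar>" by (metis abs_ge_self abs_mult)
    also have "\<dots> \<le> 1 * norm z" using that component_le_norm_cart[of z j] by (intro mult_mono) auto
    finally have "a * z $ j - a\<^sup>2 / 2 \<le> 1 * norm z" using zero_le_power2[of a] by linarith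
    thus "exp (a * z $ j - a\<^sup>2 / 2) \<le> exp (1 * norm z)" by (simp only: exp_le_cancel_iff)
  qed
  have Qb: "\<bar>Q a z\<bar> \<le> B * ((1 + norm z) ^ 1 * exp (1 * norm z) * exp (0 * (norm z)\<^sup>2))" if "\<bar>a\<bar> < 1" for a z
  proof -
    have "\<bar>Q a z\<bar> \<le> ((\<bar>b\<bar> + \<bar>c\<bar>) * (1 + norm z)) * exp (1 * norm z)"
      unfolding Q_def abs_mult using lin[OF that] expb[OF that] by (intro mult_mono) auto
    also have "\<dots> \<le> (B * (1 + norm z)) * exp (1 * norm z)"
      by (intro mult_right_mono) (auto simp: B_def)
    finally show ?thesis by (simp add: mult.assoc)
  qed
  have Q'b: "\<bar>Q' a z\<bar> \<le> B * ((1 + norm z)\<^sup>2 * exp (1 * norm z))" if a: "\<bar>a\<bar> < 1" for a z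
  proof -
    have zj: "\<bar>z $ j - a\<bar> \<le> 1 + norm z" using a component_le_norm_cart[of z j] by linarith
    have "\<bar>(b + c * (z $ i - a * \<delta>)) * (z $ j - a) - c * \<delta>\<bar> \<le> \<bar>b + c * (z $ i - a * \<delta>)\<bar> * \<bar>z $ j - a\<bar> + \<bar>c\<bar> * \<bar>\<delta>\<bar>"
      by (metis abs_mult abs_triangle_ineq4)
    also have "\<dots> \<le> ((\<bar>b\<bar> + \<bar>c\<bar>) * (1 + norm z)) * (1 + norm z) + \<bar>c\<bar> * ((1 + norm z) * (1 + norm z))"
    proof (intro add_mono mult_mono lin[OF a] zj)
      have "1 * 1 \<le> (1 + norm z) * (1 + norm z)" by (intro mult_mono) auto
      thus "\<bar>\<delta>\<bar> \<le> (1 + norm z) * (1 + norm z)" using \<delta> by linarith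
    qed auto
    also have "\<dots> = B * (1 + norm z)\<^sup>2" by (simp add: B_def power2_eq_square algebra_simps)
    finally have "\<bar>(b + c * (z $ i - a * \<delta>)) * (z $ j - a) - c * \<delta>\<bar> \<le> B * (1 + norm z)\<^sup>2" .
    hence "\<bar>Q' a z\<bar> \<le> (B * (1 + norm z)\<^sup>2) * exp (1 * norm z)"
      unfolding Q'_def abs_mult using expb[OF a, of z] by (intro mult_mono) (auto simp: B_def)
    thus ?thesis by (simp add: mult.assoc)
  qed
  let ?w = "\<lambda>z::real^'d. R * (1 + norm z) ^ p * (B * ((1 + norm z)\<^sup>2 * exp (1 * norm z)))"
  have "((\<lambda>a. \<integral>z. ?g z * Q a z \<partial>gauss) has_real_derivative (\<integral>z. ?g z * Q' 0 z \<partial>gauss)) (at 0)"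
  proof (rule has_derivative_integral_AE[where a = "-1" and b = 1
        and w = ?w])
    show "integrable gauss (\<lambda>z. ?g z * Q a z)" if "- 1 < a" "a < 1" for a
      using Qb[of a] that s by (intro poly_growth_integrable[OF g, where a = 0 and c = 1 and m = 1 and D = B]) auto
    show "integrable gauss ?w"
      by (rule gauss_integrable[where C = "\<bar>R * B\<bar>" and p = "p + 2" and c = 1 and a = 0])
        (auto simp: abs_mult power_add power2_eq_square mult_ac)
    show "AE z in gauss. \<forall>a>- 1. a < 1 \<longrightarrow>
       ((\<lambda>a. ?g z * Q a z) has_real_derivative ?g z * Q' a z) (at a) \<and>
       \<bar>?g z * Q' a z\<bar> \<le> ?w z"
    proof (intro AE_I2 allI impI conjI)
      fix z a assume a: "- 1 < a" "a < (1::real)"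
      show "((\<lambda>a. ?g z * Q a z) has_real_derivative ?g z * Q' a z) (at a)"
        unfolding Q_def Q'_def
        by (auto intro!: derivative_eq_intros simp: algebra_simps)
      show "\<bar>?g z * Q' a z\<bar> \<le> ?w z"
        unfolding abs_mult
      proof (rule mult_mono)
        show "\<bar>?g z\<bar> \<le> R * (1 + norm z) ^ p"
          using C(2)[of s x z] s by (simp add: R_def mult_ac)
        show "\<bar>Q' a z\<bar> \<le> B * ((1 + norm z)\<^sup>2 * exp (1 * norm z))" using a by (intro Q'b) auto
      qed (use C s in \<open>auto simp: R_def\<close>)
    qed
  qed (use s in auto)
  moreover have "(\<integral>z. ?g z * Q' 0 z \<partial>gauss) = heat_avg (\<lambda>z. (b + c * z $ i) * z $ j - c * axis j 1 $ i) g \<sigma> x"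
    by (simp add: heat_avg_def Q'_def s_def \<delta>_def)
  ultimately have D: "((\<lambda>a. \<integral>z. ?g z * Q a z \<partial>gauss) has_real_derivative
      heat_avg (\<lambda>z. (b + c * z $ i) * z $ j - c * axis j 1 $ i) g \<sigma> x) (at (0 / s))" by simp
  have "((\<lambda>h. h / s) has_real_derivative 1 / s) (at 0)"
    using s by (auto intro!: derivative_eq_intros)
  from DERIV_chain2[OF D this] show ?thesis by (simp add: shift s_def)
qed

text \<open>Dilating z by sqrt(\<sigma>/r) moves the dependence on the variance r into the ratio w
  r, which is 1 at r = \<sigma> and has derivative (|z|^2 - d) / (2 \<sigma>) there.\<close>

lemma heat_avg_time_deriv:
  fixes g :: "real^'d::finite \<Rightarrow> real"
  assumes g: "poly_growth g" and \<sigma>: "0 < \<sigma>"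
  shows "((\<lambda>\<sigma>. heat_avg (\<lambda>_. 1) g \<sigma> x) has_real_derivative
    heat_avg (\<lambda>z. (norm z)\<^sup>2 - real CARD('d)) g \<sigma> x / (2 * \<sigma>)) (at \<sigma>)"
proof -
  note [measurable] = poly_growth_measurable[OF g]
  define s where "s = sqrt \<sigma>"
  let ?g = "\<lambda>z. g (x + s *\<^sub>R z)"
  define d where "d = real CARD('d)"
  have s: "0 < s" using \<sigma> by (simp add: s_def)
  define w where "w = (\<lambda>r z. (\<sigma> / r) powr (d / 2) * exp ((1 - \<sigma> / r) * (norm (z::real^'d))\<^sup>2 / 2))"
  define w' where "w' = (\<lambda>r z. w r z * ((\<sigma> / r * (norm z)\<^sup>2 - d) / (2 * r)))"
  have [measurable]: "w r \<in> borel_measurable borel" "w' r \<in> borel_measurable borel" for r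
    unfolding w_def w'_def by measurable
  have scale: "heat_avg (\<lambda>_. 1) g r x = (\<integral>z. ?g z * w r z \<partial>gauss)" if r: "0 < r" for r
  proof -
    define \<rho> where "\<rho> = sqrt (\<sigma> / r)"
    have \<rho>: "0 < \<rho>" "\<rho>\<^sup>2 = \<sigma> / r" using r \<sigma> by (simp_all add: \<rho>_def)
    have \<rho>3: "sqrt r * \<rho> = s" using r \<sigma> by (simp add: \<rho>_def s_def real_sqrt_divide)
    have "heat_avg (\<lambda>_. 1) g r x = (\<integral>z. gauss_density z * g (x + sqrt r *\<^sub>R z) \<partial>lborel)"
      unfolding heat_avg_def by (simp add: integral_gauss)
    also have "\<dots> = \<rho> ^ CARD('d) * (\<integral>z. gauss_density (\<rho> *\<^sub>R z) * g (x + sqrt r *\<^sub>R (\<rho> *\<^sub>R z)) \<partial>lborel)"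
      using \<rho> by (intro lborel_integral_scale) auto
    also have "\<dots> = (\<integral>z. gauss_density z * (?g z * w r z) \<partial>lborel)"
    proof -
      have "\<rho> ^ CARD('d) = (\<sigma> / r) powr (d / 2)"
        using \<rho>(1) \<sigma> r by (simp add: \<rho>_def powr_half_sqrt[symmetric] powr_realpow[symmetric] powr_powr d_def)
      thus ?thesis
        unfolding gauss_density_scale \<rho>(2) scaleR_scaleR \<rho>3 integral_mult_right_zero[symmetric]
        by (simp add: w_def mult_ac)
    qed
    also have "\<dots> = (\<integral>z. ?g z * w r z \<partial>gauss)"
      by (rule integral_gauss[symmetric]) measurable
    finally show ?thesis .
  qed
  obtain C p where C: "0 \<le> C"
    "\<And>x z s. 0 \<le> s \<Longrightarrow> \<bar>g (x + s *\<^sub>R z)\<bar> \<le> C * ((1 + norm x + s) ^ p * (1 + norm z) ^ p)"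
    using poly_growth_bound[OF g] by blast
  define R where "R = C * (1 + norm x + s) ^ p"
  define B where "B = 2 powr (d / 2)"
  have d0: "0 \<le> d" by (simp add: d_def)
  \<comment> \<open>For r between \<sigma>/2 and 3\<sigma>/2 one has 1 - \<sigma>/r <= 1/3, so the
    exponential grows at most with rate 1/6 < 1/2 and stays Gaussian integrable; the power is at
    most 2^(d/2).\<close>
  have wb: "\<bar>w r z\<bar> \<le> B * ((1 + norm z) ^ 0 * exp (0 * norm z) * exp ((1/6) * (norm z)\<^sup>2))"
    if r: "\<sigma> / 2 < r" "r < 3 * \<sigma> / 2" for r z
  proof -
    have r0: "0 < r" using r \<sigma> by simp
    have "\<sigma> / r \<le> 2" "1 - \<sigma> / r \<le> 1 / 3" using r \<sigma> r0 by (auto simp: field_simps)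
    hence "(\<sigma> / r) powr (d / 2) \<le> B"
      unfolding B_def using \<sigma> r0 d0 by (intro powr_mono2) auto
    moreover have "(1 - \<sigma> / r) * (norm z)\<^sup>2 \<le> (1/3) * (norm z)\<^sup>2"
      by (rule mult_right_mono[OF \<open>1 - \<sigma> / r \<le> 1 / 3\<close>]) simp
    from divide_right_mono[OF this, of 2]
    have "(1 - \<sigma> / r) * (norm z)\<^sup>2 / 2 \<le> (1/6) * (norm z)\<^sup>2" by simp
    ultimately have "(\<sigma> / r) powr (d / 2) * exp ((1 - \<sigma> / r) * (norm z)\<^sup>2 / 2) \<le> B * exp ((1/6) * (norm z)\<^sup>2)"
      by (intro mult_mono iffD2[OF exp_le_cancel_iff]) (auto simp: B_def)
    thus ?thesis by (simp add: w_def abs_mult)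
  qed
  let ?w = "\<lambda>z::real^'d. R * (1 + norm z) ^ p * ((B * exp ((1/6) * (norm z)\<^sup>2)) * ((2 + d) / \<sigma> * (1 + norm z)\<^sup>2))"
  have "((\<lambda>r. \<integral>z. ?g z * w r z \<partial>gauss) has_real_derivative (\<integral>z. ?g z * w' \<sigma> z \<partial>gauss)) (at \<sigma>)"
  proof (rule has_derivative_integral_AE[where a = "\<sigma> / 2" and b = "3 * \<sigma> / 2"
        and w = ?w])
    show "integrable gauss (\<lambda>z. ?g z * w r z)" if "\<sigma> / 2 < r" "r < 3 * \<sigma> / 2" for r
      using wb[OF that] s by (intro poly_growth_integrable[OF g, where a = "1/6" and c = 0 and m = 0 and D = B]) auto
    show "integrable gauss ?w"
      by (rule gauss_integrable[where C = "\<bar>R * B * ((2 + d) / \<sigma>)\<bar>" and p = "p + 2" and c = 0 and a = "1/6"])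
        (auto simp: abs_mult power_add power2_eq_square mult_ac)
    show "AE z in gauss. \<forall>r>\<sigma> / 2. r < 3 * \<sigma> / 2 \<longrightarrow>
       ((\<lambda>r. ?g z * w r z) has_real_derivative ?g z * w' r z) (at r) \<and>
       \<bar>?g z * w' r z\<bar> \<le> ?w z"
    proof (intro AE_I2 allI impI conjI)
      fix z r assume r: "\<sigma> / 2 < r" "r < 3 * \<sigma> / 2"
      have r0: "0 < r" using r \<sigma> by simp
      have "((\<lambda>r. w r z) has_real_derivative w' r z) (at r)"
      proof -
        have q: "0 < \<sigma> / r" using r0 \<sigma> by simp
        have 1: "((\<lambda>r. \<sigma> / r) has_real_derivative - (\<sigma> / r\<^sup>2)) (at r)"
          using r0 by (auto intro!: derivative_eq_intros simp: power2_eq_square)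
        have 2: "((\<lambda>q. q powr (d / 2)) has_real_derivative d / 2 * (\<sigma> / r) powr (d / 2 - 1)) (at (\<sigma> / r))"
          using q by (rule has_real_derivative_powr)
        have 3: "((\<lambda>r. (\<sigma> / r) powr (d / 2)) has_real_derivative d / 2 * (\<sigma> / r) powr (d / 2 - 1) * - (\<sigma> / r\<^sup>2)) (at r)"
          by (rule DERIV_chain2[OF 2 1])
        have 4: "((\<lambda>r. exp ((1 - \<sigma> / r) * (norm z)\<^sup>2 / 2)) has_real_derivative
            exp ((1 - \<sigma> / r) * (norm z)\<^sup>2 / 2) * (\<sigma> / r\<^sup>2 * (norm z)\<^sup>2 / 2)) (at r)"
          using r0 by (auto intro!: derivative_eq_intros simp: power2_eq_square)
        have 5: "(\<sigma> / r) powr (d / 2) = (\<sigma> / r) powr (d / 2 - 1) * (\<sigma> / r)"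
          using q r0 \<sigma> powr_add[of "\<sigma> / r" "d / 2 - 1" 1] by simp
        show ?thesis
          unfolding w_def
          by (rule DERIV_cong[OF DERIV_mult[OF 3 4]])
            (use r0 \<sigma> in \<open>simp add: w'_def w_def 5 power2_eq_square field_simps\<close>)
      qed
      thus "((\<lambda>r. ?g z * w r z) has_real_derivative ?g z * w' r z) (at r)"
        by (rule DERIV_cmult)
      have w0: "\<bar>w r z\<bar> \<le> B * exp ((1/6) * (norm z)\<^sup>2)" using wb[OF r, of z] by simp
      have fr: "\<bar>(\<sigma> / r * (norm z)\<^sup>2 - d) / (2 * r)\<bar> \<le> (2 + d) / \<sigma> * (1 + norm z)\<^sup>2"
      proof -
        have q: "\<sigma> / r \<le> 2" "0 \<le> \<sigma> / r" using r \<sigma> r0 by (auto simp: field_simps)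
        have n1: "(norm z)\<^sup>2 \<le> (1 + norm z)\<^sup>2" "1 \<le> (1 + norm z)\<^sup>2" by (auto intro!: power_mono one_le_power)
        have "\<bar>\<sigma> / r * (norm z)\<^sup>2 - d\<bar> \<le> \<sigma> / r * (norm z)\<^sup>2 + d"
          using q d0 by (smt (verit) mult_nonneg_nonneg zero_le_power2)
        also have "\<dots> \<le> 2 * (1 + norm z)\<^sup>2 + d * (1 + norm z)\<^sup>2"
          using q d0 n1 by (intro add_mono mult_mono) (auto simp: mult_le_cancel_left1)
        also have "\<dots> = (2 + d) * (1 + norm z)\<^sup>2" by (simp add: algebra_simps)
        finally have 1: "\<bar>\<sigma> / r * (norm z)\<^sup>2 - d\<bar> \<le> (2 + d) * (1 + norm z)\<^sup>2" .
        have "\<bar>(\<sigma> / r * (norm z)\<^sup>2 - d) / (2 * r)\<bar> = \<bar>\<sigma> / r * (norm z)\<^sup>2 - d\<bar> / (2 * r)" using r0 by simp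
        also have "\<dots> \<le> (2 + d) * (1 + norm z)\<^sup>2 / \<sigma>"
          using 1 r \<sigma> d0 by (intro frac_le) auto
        finally show ?thesis by simp
      qed
      have "\<bar>w' r z\<bar> \<le> (B * exp ((1/6) * (norm z)\<^sup>2)) * ((2 + d) / \<sigma> * (1 + norm z)\<^sup>2)"
        unfolding w'_def abs_mult[of "w r z"] by (intro mult_mono w0 fr) (auto simp: B_def)
      moreover have "\<bar>?g z\<bar> \<le> R * (1 + norm z) ^ p"
        using C(2)[of s x z] s by (simp add: R_def mult_ac)
      ultimately show "\<bar>?g z * w' r z\<bar> \<le> ?w z"
        unfolding abs_mult by (intro mult_mono) (use C s in \<open>auto simp: R_def\<close>)
    qed
  qed (use \<sigma> in auto)
  moreover have "(\<integral>z. ?g z * w' \<sigma> z \<partial>gauss) = heat_avg (\<lambda>z. (norm z)\<^sup>2 - real CARD('d)) g \<sigma> x / (2 * \<sigma>)"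
    using \<sigma> by (simp add: heat_avg_def w'_def w_def s_def d_def)
  moreover have "eventually (\<lambda>r. (\<integral>z. ?g z * w r z \<partial>gauss) = heat_avg (\<lambda>_. 1) g r x) (nhds \<sigma>)"
  proof -
    have "eventually (\<lambda>r. r \<in> {0<..}) (nhds \<sigma>)" using \<sigma> by (intro eventually_nhds_in_open) auto
    thus ?thesis by eventually_elim (use scale in auto)
  qed
  ultimately show ?thesis by (subst (asm) DERIV_cong_ev[OF refl _ refl]) auto
qed

section \<open>Iterated partial derivatives and growth of the datum\<close>

definition pd_at :: "'d::finite \<Rightarrow> (real^'d \<Rightarrow> real) \<Rightarrow> real^'d \<Rightarrow> real \<Rightarrow> bool" where
  "pd_at i g x D \<longleftrightarrow> ((\<lambda>h. g (x + h *\<^sub>R axis i 1)) has_real_derivative D) (at 0)"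

lemma pd_at_pdx: "pd_at i g x D \<Longrightarrow> pdx i g x = D"
  unfolding pd_at_def pdx_def by (rule DERIV_imp_deriv)

lemma pd_at_iff:
  "(\<lambda>h. g (x + h *\<^sub>R axis i 1)) field_differentiable at 0 \<longleftrightarrow> pd_at i g x (pdx i g x)"
  unfolding pd_at_def pdx_def by (simp add: DERIV_deriv_iff_field_differentiable)

lemma pdxs_Nil [simp]: "pdxs [] g = g" and pdxs_Cons: "pdxs (i # is) g = pdx i (pdxs is g)"
  by (simp_all add: pdxs_def)

lemma pdxs_append: "pdxs (is @ js) g = pdxs is (pdxs js g)"
  by (simp add: pdxs_def)

lemma pdx_exist_iff: "pdx_exist m g \<longleftrightarrow> (\<forall>is i x. length is < m \<longrightarrow> pd_at i (pdxs is g) x (pdxs (i # is) g x))"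
  unfolding pdx_exist_def pd_at_iff pdxs_Cons ..

lemma pdx_existD: "pdx_exist m g \<Longrightarrow> length is < m \<Longrightarrow> pd_at i (pdxs is g) x (pdxs (i # is) g x)"
  by (simp add: pdx_exist_iff)

lemma pdx_exist_mono: "pdx_exist m g \<Longrightarrow> n \<le> m \<Longrightarrow> pdx_exist n g"
  by (simp add: pdx_exist_iff)

lemma pdx_exist_pdxs:
  fixes g :: "real^'d::finite \<Rightarrow> real"
  assumes g: "pdx_exist m g" and len: "length js + n \<le> m"
  shows "pdx_exist n (pdxs js g)"
proof -
  show ?thesis
    unfolding pdx_exist_iff
  proof (intro allI impI)
    fix "is" :: "'d list" and i x assume "length is < n"
    thus "pd_at i (pdxs is (pdxs js g)) x (pdxs (i # is) (pdxs js g) x)"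
      using pdx_existD[OF g, of "is @ js" i x] len by (simp add: pdxs_append pdxs_Cons)
  qed
qed

text \<open>Candidates B indexed by words of directions are guessed all at once; it then suffices
  that prepending a letter is one partial derivative. Words are read from the right, so the head is
  the last derivative taken.\<close>

lemma pdxs_eqI:
  assumes "\<And>is i x. length is < m \<Longrightarrow> pd_at i (B is) x (B (i # is) x)" and "B [] = g" and "length is \<le> m"
  shows "pdxs is g = B is"
  using assms(3)
proof (induction "is")
  case (Cons i "is")
  hence IH: "pdxs is g = B is" by simp
  have "pdx i (B is) x = B (i # is) x" for x
    using assms(1)[of "is" i x] Cons.prems by (intro pd_at_pdx) simp
  thus ?case by (auto simp: pdxs_Cons IH)
qed (simp add: assms(2))

lemma pdx_existI:
  assumes "\<And>is i x. length is < m \<Longrightarrow> pd_at i (B is) x (B (i # is) x)" and "B [] = g"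
  shows "pdx_exist m g"
  unfolding pdx_exist_iff using assms by (simp add: pdxs_eqI[where m = m and B = B])

lemma pd_at_sum:
  assumes "\<And>a. a \<in> A \<Longrightarrow> pd_at i (g a) x (D a)"
  shows "pd_at i (\<lambda>x. \<Sum>a\<in>A. c a * g a x) x (\<Sum>a\<in>A. c a * D a)"
  using assms unfolding pd_at_def by (intro DERIV_sum DERIV_cmult) auto

lemma
  assumes "\<And>a. a \<in> A \<Longrightarrow> pdx_exist m (g a)"
  shows pdx_exist_sum: "pdx_exist m (\<lambda>x. \<Sum>a\<in>A. c a * g a x)"
    and pdxs_sum: "length is \<le> m \<Longrightarrow> pdxs is (\<lambda>x. \<Sum>a\<in>A. c a * g a x) = (\<lambda>x. \<Sum>a\<in>A. c a * pdxs is (g a) x)"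
proof -
  let ?B = "\<lambda>is x. \<Sum>a\<in>A. c a * pdxs is (g a) x"
  have 1: "pd_at i (?B is) x (?B (i # is) x)" if "length is < m" for "is" i x
    using that assms by (intro pd_at_sum pdx_existD) auto
  show "pdx_exist m (\<lambda>x. \<Sum>a\<in>A. c a * g a x)" by (rule pdx_existI[where B = ?B, OF 1]) auto
  show "pdxs is (\<lambda>x. \<Sum>a\<in>A. c a * g a x) = ?B is" if "length is \<le> m"
    using pdxs_eqI[where B = ?B, OF 1 _ that] by simp
qed

lemma
  assumes "pdx_exist m g"
  shows pdx_exist_cmult: "pdx_exist m (\<lambda>x. c * g x)"
    and pdxs_cmult: "length is \<le> m \<Longrightarrow> pdxs is (\<lambda>x. c * g x) = (\<lambda>x. c * pdxs is g x)"
  using pdx_exist_sum[of "{()}" m "\<lambda>_. g" "\<lambda>_. c"] pdxs_sum[of "{()}" m "\<lambda>_. g" "is" "\<lambda>_. c"] assms by auto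

lemma laplacian_eq_pdxs: "laplacian g = (\<lambda>x. \<Sum>i\<in>UNIV. 1 * pdxs [i, i] g x)"
  by (auto simp: laplacian_def pdxs_def)

text \<open>The words along which the expanded k-th power of the Laplacian differentiates: every
  letter occurs doubled.\<close>

fun lap_words :: "nat \<Rightarrow> 'd::finite list set" where
  "lap_words 0 = {[]}"
| "lap_words (Suc k) = (\<lambda>(i, js). i # i # js) ` (UNIV \<times> lap_words k)"

lemma lap_words_finite: "finite (lap_words k)" and lap_words_length: "js \<in> lap_words k \<Longrightarrow> length js = 2 * k"
  by (induction k arbitrary: js) auto

lemma laplacian_power_eq:
  assumes "pdx_exist (2 * k) g"
  shows "(laplacian ^^ k) g = (\<lambda>x. \<Sum>js\<in>lap_words k. 1 * pdxs js g x)"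
  using assms
proof (induction k)
  case (Suc k)
  have ex: "pdx_exist 2 (pdxs js g)" if "js \<in> lap_words k" for js
    using Suc.prems lap_words_length[OF that] by (intro pdx_exist_pdxs) auto
  have "(laplacian ^^ Suc k) g = laplacian (\<lambda>x. \<Sum>js\<in>lap_words k. 1 * pdxs js g x)"
    using Suc.IH pdx_exist_mono[OF Suc.prems] by simp
  also have "\<dots> = (\<lambda>x. \<Sum>i\<in>UNIV. \<Sum>js\<in>lap_words k. pdxs (i # i # js) g x)"
  proof -
    have "pdxs [i, i] (\<lambda>x. \<Sum>js\<in>lap_words k. 1 * pdxs js g x)
        = (\<lambda>x. \<Sum>js\<in>lap_words k. 1 * pdxs [i, i] (pdxs js g) x)" for i
      by (rule pdxs_sum[where m = 2, OF ex]) auto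
    thus ?thesis by (simp only: laplacian_eq_pdxs pdxs_append[symmetric] append_Cons append_Nil mult_1)
  qed
  also have "\<dots> = (\<lambda>x. \<Sum>js\<in>lap_words (Suc k). 1 * pdxs js g x)"
  proof
    fix x
    have "inj_on (\<lambda>(i, js). i # i # js) (UNIV \<times> lap_words k)" by (auto simp: inj_on_def)
    from sum.reindex[OF this, of "\<lambda>js. pdxs js g x"]
    show "(\<Sum>i\<in>UNIV. \<Sum>js\<in>lap_words k. pdxs (i # i # js) g x) = (\<Sum>js\<in>lap_words (Suc k). 1 * pdxs js g x)"
      by (simp add: sum.cartesian_product case_prod_unfold comp_def)
  qed
  finally show ?case .
qed simp

lemma
  assumes "pdx_exist (2 * k + m) g"
  shows pdx_exist_laplacian_power: "pdx_exist m ((laplacian ^^ k) g)"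
    and pdxs_laplacian_power: "length is \<le> m \<Longrightarrow>
      pdxs is ((laplacian ^^ k) g) = (\<lambda>x. \<Sum>js\<in>lap_words k. 1 * pdxs (is @ js) g x)"
proof -
  have eq: "(laplacian ^^ k) g = (\<lambda>x. \<Sum>js\<in>lap_words k. 1 * pdxs js g x)"
    using assms by (intro laplacian_power_eq pdx_exist_mono[OF assms]) simp
  have ex: "pdx_exist m (pdxs js g)" if "js \<in> lap_words k" for js
    using lap_words_length[OF that] by (intro pdx_exist_pdxs[OF assms]) simp
  show "pdx_exist m ((laplacian ^^ k) g)" unfolding eq by (intro pdx_exist_sum ex)
  show "length is \<le> m \<Longrightarrow> pdxs is ((laplacian ^^ k) g) = (\<lambda>x. \<Sum>js\<in>lap_words k. 1 * pdxs (is @ js) g x)"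
    unfolding eq by (subst pdxs_sum[OF ex]) (auto simp: pdxs_append)
qed

lemma pd_at_shift:
  assumes "pd_at i g (x + h *\<^sub>R axis i 1) D"
  shows "((\<lambda>h. g (x + h *\<^sub>R axis i 1)) has_real_derivative D) (at h)"
proof -
  have "((\<lambda>k. g (x + h *\<^sub>R axis i 1 + k *\<^sub>R axis i 1)) has_real_derivative D) (at 0)"
    using assms by (simp add: pd_at_def)
  hence "((\<lambda>k. g (x + (h + k) *\<^sub>R axis i 1)) has_real_derivative D) (at 0)"
    by (simp add: scaleR_add_left add.assoc)
  thus ?thesis using DERIV_at_within_shift[of "\<lambda>h. g (x + h *\<^sub>R axis i 1)" D h 0 UNIV] by simp
qed

text \<open>With partial derivatives only, the path from y to x changes one coordinate at a time. It
  stays in the box spanned by the two points, which is where B bounds the partials.\<close>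

lemma coordinatewise_lipschitz:
  fixes g :: "real^'d::finite \<Rightarrow> real"
  assumes d: "\<And>i x. pd_at i g x (g' i x)"
    and B: "\<And>i w. (\<And>k. min (x $ k) (y $ k) \<le> w $ k \<and> w $ k \<le> max (x $ k) (y $ k)) \<Longrightarrow> \<bar>g' i w\<bar> \<le> B"
  shows "\<bar>g x - g y\<bar> \<le> B * (\<Sum>i\<in>UNIV. \<bar>x $ i - y $ i\<bar>)"
proof -
  \<comment> \<open>The corner with the coordinates in S taken from x and the others from y.\<close>
  define p where "p = (\<lambda>S. \<chi> i. if i \<in> S then x $ i else y $ i)"
  have "\<bar>g (p S) - g y\<bar> \<le> B * (\<Sum>i\<in>S. \<bar>x $ i - y $ i\<bar>)" for S
    using finite[of S]
  proof (induction S rule: finite_induct)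
    case empty
    have "p {} = y" by (simp add: p_def vec_eq_iff)
    thus ?case by simp
  next
    case (insert i S)
    define q where "q = (\<lambda>h. p S + h *\<^sub>R axis i 1)"
    define l where "l = x $ i - y $ i"
    have q: "q 0 = p S" "q l = p (insert i S)"
      using insert.hyps by (auto simp: q_def p_def l_def vec_eq_iff axis_def)
    have "norm (g (q l) - g (q 0)) \<le> B * norm (l - 0)"
    proof (rule field_differentiable_bound[of "closed_segment 0 l" "\<lambda>h. g (q h)" "\<lambda>h. g' i (q h)"])
      fix h assume h: "h \<in> closed_segment 0 l"
      show "((\<lambda>h. g (q h)) has_real_derivative g' i (q h)) (at h within closed_segment 0 l)"
        unfolding q_def by (rule has_field_derivative_at_within[OF pd_at_shift[OF d]])
      have "min (x $ k) (y $ k) \<le> q h $ k \<and> q h $ k \<le> max (x $ k) (y $ k)" for k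
        using h insert.hyps
        by (auto simp: q_def p_def l_def axis_def closed_segment_eq_real_ivl split: if_splits)
      thus "norm (g' i (q h)) \<le> B" using B by simp
    qed auto
    hence "\<bar>g (p (insert i S)) - g (p S)\<bar> \<le> B * \<bar>l\<bar>" by (simp add: q)
    hence "\<bar>g (p (insert i S)) - g (p S)\<bar> \<le> B * \<bar>x $ i - y $ i\<bar>" by (simp only: l_def)
    thus ?case using insert by (simp add: algebra_simps)
  qed
  from this[of UNIV] show ?thesis by (simp add: p_def)
qed

text \<open>The coordinatewise Lipschitz estimate with a constant growing polynomially in |x| + |y|
  gives continuity as x approaches y, and growth one degree higher when y = 0.\<close>

lemma poly_growth_from_partials:
  fixes g :: "real^'d::finite \<Rightarrow> real"
  assumes d: "\<And>i x. pd_at i g x (g' i x)" and pg: "\<And>i. poly_growth (g' i)"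
  shows "poly_growth g"
proof -
  have "\<forall>i. \<exists>C p. \<forall>x. \<bar>g' i x\<bar> \<le> C * (1 + norm x) ^ p" using pg by (auto simp: poly_growth_def)
  then obtain C p where Cp: "\<And>i x. \<bar>g' i x\<bar> \<le> C i * (1 + norm x) ^ p i" by metis
  \<comment> \<open>Summing constants and exponents gives one polynomial bound for all
    directions.\<close>
  define C' where "C' = (\<Sum>i\<in>UNIV. C i)"
  define p' where "p' = (\<Sum>i\<in>UNIV. p i)"
  have C0: "0 \<le> C i" for i using Cp[of i 0] by (auto intro: order_trans[OF abs_ge_zero])
  have C'0: "0 \<le> C'" unfolding C'_def by (intro sum_nonneg C0)
  have b: "\<bar>g' i x\<bar> \<le> C' * (1 + norm x) ^ p'" for i x
  proof -
    have "C i * (1 + norm x) ^ p i \<le> C' * (1 + norm x) ^ p'"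
      unfolding C'_def p'_def
      by (intro mult_mono power_increasing member_le_sum C0 sum_nonneg) auto
    thus ?thesis using Cp[of i x] by simp
  qed
  define d where "d = real CARD('d)"
  have d1: "1 \<le> d" by (simp add: d_def Suc_leI)
  have lip: "\<bar>g x - g y\<bar> \<le> (C' * (1 + d * (norm x + norm y)) ^ p') * (\<Sum>i\<in>UNIV. \<bar>x $ i - y $ i\<bar>)" for x y
  proof (rule coordinatewise_lipschitz[OF d])
    fix i w assume w: "\<And>k. min (x $ k) (y $ k) \<le> w $ k \<and> w $ k \<le> max (x $ k) (y $ k)"
    have "norm w \<le> (\<Sum>k\<in>UNIV. \<bar>w $ k\<bar>)" by (rule norm_le_l1_cart)
    also have "\<dots> \<le> (\<Sum>k\<in>(UNIV::'d set). norm x + norm y)"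
    proof (rule sum_mono)
      fix k
      have "\<bar>w $ k\<bar> \<le> \<bar>x $ k\<bar> + \<bar>y $ k\<bar>" using w[of k] by (auto simp: min_def max_def split: if_splits)
      thus "\<bar>w $ k\<bar> \<le> norm x + norm y" using component_le_norm_cart[of x k] component_le_norm_cart[of y k] by linarith
    qed
    also have "\<dots> = d * (norm x + norm y)" by (simp add: d_def)
    finally have "C' * (1 + norm w) ^ p' \<le> C' * (1 + d * (norm x + norm y)) ^ p'"
      using C'0 by (intro mult_left_mono power_mono) auto
    thus "\<bar>g' i w\<bar> \<le> C' * (1 + d * (norm x + norm y)) ^ p'" using b[of i w] by linarith
  qed
  have l1: "(\<Sum>i\<in>UNIV. \<bar>x $ i - y $ i\<bar>) \<le> d * norm (x - y)" for x y :: "real^'d"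
  proof -
    have "(\<Sum>i\<in>UNIV. \<bar>x $ i - y $ i\<bar>) \<le> (\<Sum>i\<in>(UNIV::'d set). norm (x - y))"
      by (intro sum_mono) (metis component_le_norm_cart vector_minus_component)
    thus ?thesis by (simp add: d_def)
  qed
  have "continuous_on UNIV g"
    unfolding continuous_on_def
  proof
    fix y :: "real^'d"
    let ?K = "\<lambda>x. (C' * (1 + d * (norm x + norm y)) ^ p') * (d * norm (x - y))"
    have "norm (g x - g y) \<le> ?K x" for x
      unfolding real_norm_def by (rule order_trans[OF lip mult_left_mono[OF l1]]) (use C'0 d1 in simp)
    hence "\<forall>\<^sub>F x in at y within UNIV. norm (g x - g y) \<le> ?K x" by (rule always_eventually[OF allI])
    moreover have "(?K \<longlongrightarrow> ?K y) (at y within UNIV)" by (intro tendsto_intros)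
    hence "(?K \<longlongrightarrow> 0) (at y within UNIV)" by simp
    ultimately have "((\<lambda>x. g x - g y) \<longlongrightarrow> 0) (at y within UNIV)" by (rule Lim_null_comparison)
    thus "(g \<longlongrightarrow> g y) (at y within UNIV)" by (simp add: LIM_zero_iff)
  qed
  moreover have "\<bar>g x\<bar> \<le> (\<bar>g 0\<bar> + C' * d ^ p' * d) * (1 + norm x) ^ Suc p'" for x
  proof -
    have "1 + d * norm x \<le> d * (1 + norm x)" using d1 by (simp add: algebra_simps)
    hence "(1 + d * norm x) ^ p' \<le> (d * (1 + norm x)) ^ p'" using d1 by (intro power_mono) auto
    hence 1: "C' * (1 + d * norm x) ^ p' \<le> C' * (d ^ p' * (1 + norm x) ^ p')"
      using C'0 by (intro mult_left_mono) (auto simp: power_mult_distrib)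
    have "\<bar>g x - g 0\<bar> \<le> (C' * (1 + d * (norm x + norm (0::real^'d))) ^ p') * (d * norm (x - 0))"
      by (rule order_trans[OF lip mult_left_mono[OF l1]]) (use C'0 d1 in simp)
    also have "\<dots> = (C' * (1 + d * norm x) ^ p') * (d * norm x)" by simp
    also have "\<dots> \<le> (C' * (d ^ p' * (1 + norm x) ^ p')) * (d * (1 + norm x))"
      using C'0 d1 by (intro mult_mono[OF 1]) auto
    finally have "\<bar>g x - g 0\<bar> \<le> (C' * (d ^ p' * (1 + norm x) ^ p')) * (d * (1 + norm x))" .
    moreover have "\<bar>g 0\<bar> * 1 \<le> \<bar>g 0\<bar> * (1 + norm x) ^ Suc p'" by (intro mult_left_mono one_le_power) auto
    ultimately show ?thesis by (simp add: algebra_simps)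
  qed
  ultimately show ?thesis unfolding poly_growth_def by blast
qed

text \<open>Only the top derivatives are assumed bounded and Hoelder, so the induction descends from
  them: n counts how many derivatives are missing from order m.\<close>

lemma bounded_holder_poly_growth:
  fixes f :: "real^'d::finite \<Rightarrow> real"
  assumes f: "bounded_holder_derivs m \<alpha> f" and \<alpha>: "0 < \<alpha>" and len: "length is \<le> m"
  shows "poly_growth (pdxs is f)"
proof -
  have ex: "pdx_exist m f" using f by (simp add: bounded_holder_derivs_def)
  have "poly_growth (pdxs is f)" if "length is = m - n" "n \<le> m" for n "is"
    using that
  proof (induction n arbitrary: "is")
    case 0
    hence len: "length is = m" by simp
    have "bounded (range (pdxs is f))" using f len by (simp add: bounded_holder_derivs_def)
    then obtain B where B: "\<And>x. \<bar>pdxs is f x\<bar> \<le> B" by (auto simp: bounded_iff)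
    have "\<exists>C. \<forall>x y. \<bar>pdxs is f x - pdxs is f y\<bar> \<le> C * dist x y powr \<alpha>"
      using f len unfolding bounded_holder_derivs_def by blast
    then obtain C where C: "\<And>x y. \<bar>pdxs is f x - pdxs is f y\<bar> \<le> C * dist x y powr \<alpha>" by blast
    have "continuous_on UNIV (pdxs is f)"
      unfolding continuous_on_def
    proof
      fix y :: "real^'d"
      have "((\<lambda>x. C * dist x y powr \<alpha>) \<longlongrightarrow> C * dist y y powr \<alpha>) (at y within UNIV)"
        using \<alpha> by (intro tendsto_intros tendsto_powr') auto
      hence "((\<lambda>x. C * dist x y powr \<alpha>) \<longlongrightarrow> 0) (at y within UNIV)" by simp
      moreover have "\<forall>\<^sub>F x in at y within UNIV. norm (pdxs is f x - pdxs is f y) \<le> C * dist x y powr \<alpha>"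
        using C by (intro always_eventually) simp
      ultimately have "((\<lambda>x. pdxs is f x - pdxs is f y) \<longlongrightarrow> 0) (at y within UNIV)"
        by (rule Lim_null_comparison[rotated])
      thus "(pdxs is f \<longlongrightarrow> pdxs is f y) (at y within UNIV)" by (simp add: LIM_zero_iff)
    qed
    thus ?case unfolding poly_growth_def using B by (auto intro!: exI[of _ B] exI[of _ "0::nat"])
  next
    case (Suc n)
    show ?case
    proof (rule poly_growth_from_partials)
      show "pd_at i (pdxs is f) x (pdxs (i # is) f x)" for i x
        using Suc.prems by (intro pdx_existD[OF ex]) auto
      show "poly_growth (pdxs (i # is) f)" for i using Suc.prems by (intro Suc.IH) auto
    qed
  qed
  from this[of "is" "m - length is"] len show ?thesis by simp
qed

section \<open>Functions with an integrable singularity at variance 0\<close>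

abbreviation heat :: "(real^'d::finite \<Rightarrow> real) \<Rightarrow> real \<Rightarrow> real^'d \<Rightarrow> real" where
  "heat \<equiv> heat_avg (\<lambda>_. 1)"

abbreviation tame_bnd :: "real \<Rightarrow> real \<Rightarrow> nat \<Rightarrow> real \<Rightarrow> real^'d::finite \<Rightarrow> real" where
  "tame_bnd C a p \<sigma> x \<equiv> C * ((1 + \<sigma> powr - a) * (1 + norm x + \<sigma>) ^ p)"

text \<open>The class that can be averaged over random clocks: blow-up of order at most a as
  \<sigma> tends to 0 and polynomial growth otherwise. Orders a < 1 are the ones the inverse stable
  law integrates.\<close>

definition tame :: "real \<Rightarrow> (real \<Rightarrow> real^'d::finite \<Rightarrow> real) \<Rightarrow> bool" where
  "tame a G \<longleftrightarrow> continuous_on ({0<..} \<times> UNIV) (\<lambda>(\<sigma>, x). G \<sigma> x) \<and>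
     (\<exists>C\<ge>0. \<exists>p. \<forall>\<sigma>>0. \<forall>x. \<bar>G \<sigma> x\<bar> \<le> tame_bnd C a p \<sigma> x)"

lemma tameI:
  assumes "continuous_on ({0<..} \<times> UNIV) (\<lambda>(\<sigma>, x). G \<sigma> x)" "0 \<le> C"
    and "\<And>\<sigma> x. 0 < \<sigma> \<Longrightarrow> \<bar>G \<sigma> x\<bar> \<le> tame_bnd C a p \<sigma> x"
  shows "tame a G"
  unfolding tame_def using assms by (intro conjI exI[of _ C] exI[of _ p]) auto

lemma tame_cong:
  assumes "tame a G" "\<And>\<sigma> x. 0 < \<sigma> \<Longrightarrow> G \<sigma> x = G' \<sigma> x"
  shows "tame a G'"
proof -
  have "continuous_on ({0<..} \<times> UNIV) (\<lambda>(\<sigma>, x). G' \<sigma> x)"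
    using assms unfolding tame_def
    by (subst continuous_on_cong[where g = "\<lambda>(\<sigma>, x). G \<sigma> x"]) auto
  thus ?thesis using assms unfolding tame_def by metis
qed

lemma tame_mono:
  assumes G: "tame a G" and ab: "a \<le> b" "0 \<le> a"
  shows "tame b G"
proof -
  obtain C p where C: "0 \<le> C" "\<And>\<sigma> x. 0 < \<sigma> \<Longrightarrow> \<bar>G \<sigma> x\<bar> \<le> tame_bnd C a p \<sigma> x"
    using G by (auto simp: tame_def)
  have "\<bar>G \<sigma> x\<bar> \<le> 2 * C * ((1 + \<sigma> powr - b) * (1 + norm x + \<sigma>) ^ p)" if s: "0 < \<sigma>" for \<sigma> x
  proof -
    have "\<sigma> powr - a \<le> 1 + \<sigma> powr - b"
    proof (cases "\<sigma> \<le> 1")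
      case True
      hence "\<sigma> powr - a \<le> \<sigma> powr - b" using s ab by (intro powr_mono') auto
      thus ?thesis by simp
    next
      case False
      hence "\<sigma> powr - a \<le> \<sigma> powr 0" using ab by (intro powr_mono) auto
      also have "\<dots> \<le> 1 + \<sigma> powr - b" using s by simp
      finally show ?thesis .
    qed
    moreover have "1 + A \<le> 2 * (1 + B)" if "A \<le> 1 + B" "0 \<le> B" for A B :: real using that by simp
    ultimately have "1 + \<sigma> powr - a \<le> 2 * (1 + \<sigma> powr - b)" using powr_ge_zero by blast
    hence "tame_bnd C a p \<sigma> x \<le> C * ((2 * (1 + \<sigma> powr - b)) * (1 + norm x + \<sigma>) ^ p)"
      using C(1) s by (intro mult_left_mono mult_right_mono) auto
    from order_trans[OF C(2)[OF s] this] show ?thesis by (simp only: mult_ac)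
  qed
  thus ?thesis using G C(1) by (intro tameI[of _ "2 * C"]) (auto simp: tame_def)
qed

lemma tame_add_cmult:
  assumes F: "tame a F" and G: "tame a G"
  shows "tame a (\<lambda>\<sigma> x. c * F \<sigma> x + G \<sigma> x)"
proof -
  obtain C p where C: "0 \<le> C" "\<And>\<sigma> x. 0 < \<sigma> \<Longrightarrow> \<bar>F \<sigma> x\<bar> \<le> tame_bnd C a p \<sigma> x"
    using F by (auto simp: tame_def)
  obtain D q where D: "0 \<le> D" "\<And>\<sigma> x. 0 < \<sigma> \<Longrightarrow> \<bar>G \<sigma> x\<bar> \<le> D * ((1 + \<sigma> powr - a) * (1 + norm x + \<sigma>) ^ q)"
    using G by (auto simp: tame_def)
  have "\<bar>c * F \<sigma> x + G \<sigma> x\<bar> \<le> (\<bar>c\<bar> * C + D) * ((1 + \<sigma> powr - a) * (1 + norm x + \<sigma>) ^ (p + q))" if s: "0 < \<sigma>" for \<sigma> x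
  proof -
    let ?P = "\<lambda>p. (1 + \<sigma> powr - a) * (1 + norm x + \<sigma>) ^ p"
    have P: "?P p \<le> ?P (p + q)" "?P q \<le> ?P (p + q)"
      using s by (auto intro!: mult_left_mono power_increasing)
    have "\<bar>c * F \<sigma> x + G \<sigma> x\<bar> \<le> \<bar>c\<bar> * \<bar>F \<sigma> x\<bar> + \<bar>G \<sigma> x\<bar>" by (metis abs_mult abs_triangle_ineq)
    also have "\<dots> \<le> \<bar>c\<bar> * (C * ?P (p + q)) + D * ?P (p + q)"
      by (intro add_mono mult_left_mono order_trans[OF C(2)[OF s] mult_left_mono[OF P(1) C(1)]]
          order_trans[OF D(2)[OF s] mult_left_mono[OF P(2) D(1)]]) auto
    finally show ?thesis by (simp add: algebra_simps)
  qed
  moreover have "continuous_on ({0<..} \<times> UNIV) (\<lambda>(\<sigma>, x). c * F \<sigma> x + G \<sigma> x)"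
    using F G by (auto simp: tame_def case_prod_unfold intro!: continuous_intros)
  moreover have "0 \<le> \<bar>c\<bar> * C + D" using C D by simp
  ultimately show ?thesis by (intro tameI)
qed

lemma tame_zero: "tame a (\<lambda>_ _. 0)"
  unfolding tame_def by (auto simp: case_prod_unfold intro!: exI[of _ "0::real"])

lemma tame_sum:
  assumes "finite A" "\<And>i. i \<in> A \<Longrightarrow> tame a (F i)"
  shows "tame a (\<lambda>\<sigma> x. \<Sum>i\<in>A. c * F i \<sigma> x)"
  using assms
proof (induction A rule: finite_induct)
  case (insert i A)
  thus ?case using tame_add_cmult[of a "F i" "\<lambda>\<sigma> x. \<Sum>i\<in>A. c * F i \<sigma> x" c] by simp
qed (simp add: tame_zero)

lemma tame_heat_avg:
  assumes g: "poly_growth g" and q: "poly_weight q"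
  shows "tame 0 (heat_avg q g)"
proof -
  obtain C p where C: "0 \<le> C" "\<And>\<sigma> x. 0 \<le> \<sigma> \<Longrightarrow> \<bar>heat_avg q g \<sigma> x\<bar> \<le> C * (1 + norm x + sqrt \<sigma>) ^ p"
    using heat_avg_bound[OF g q] by auto
  have "\<bar>heat_avg q g \<sigma> x\<bar> \<le> C * 2 ^ p * ((1 + \<sigma> powr - 0) * (1 + norm x + \<sigma>) ^ p)" if s: "0 < \<sigma>" for \<sigma> x
  proof -
    have "sqrt \<sigma> \<le> 1 + \<sigma>" using arith_geo_mean_sqrt[of 1 \<sigma>] s by simp
    moreover have "1 + n + r \<le> 2 * (1 + n + t)" if "r \<le> 1 + t" "0 < t" "0 \<le> n" for n r t :: real
      using that by simp
    ultimately have "1 + norm x + sqrt \<sigma> \<le> 2 * (1 + norm x + \<sigma>)" using s norm_ge_zero[of x] by blast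
    hence "(1 + norm x + sqrt \<sigma>) ^ p \<le> (2 * (1 + norm x + \<sigma>)) ^ p" using s by (intro power_mono) auto
    also have "\<dots> = 1 * (2 ^ p * (1 + norm x + \<sigma>) ^ p)" by (simp only: power_mult_distrib mult_1)
    also have "\<dots> \<le> (1 + \<sigma> powr - 0) * (2 ^ p * (1 + norm x + \<sigma>) ^ p)" using s by (intro mult_right_mono) auto
    finally have "C * (1 + norm x + sqrt \<sigma>) ^ p \<le> C * ((1 + \<sigma> powr - 0) * (2 ^ p * (1 + norm x + \<sigma>) ^ p))"
      using C(1) by (rule mult_left_mono)
    thus ?thesis using C(2)[of \<sigma> x] s by (simp add: mult_ac)
  qed
  moreover have "continuous_on ({0<..} \<times> UNIV) (\<lambda>(\<sigma>, x). heat_avg q g \<sigma> x)"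
    by (rule continuous_on_subset[OF heat_avg_continuous[OF g q]]) auto
  moreover have "0 \<le> C * 2 ^ p" using C by simp
  ultimately show ?thesis by (intro tameI)
qed

lemma poly_growth_const: "poly_growth (\<lambda>_::real^'d::finite. c)"
  unfolding poly_growth_def by (auto intro!: exI[of _ "\<bar>c\<bar>"] exI[of _ "0::nat"])

text \<open>The average of an affine weight against the constant function 1 does not depend on x, so
  its derivative, which is this mean, is 0.\<close>

lemma gauss_quadratic_mean:
  "(\<integral>z. (b + c * z $ i) * z $ j - c * axis j 1 $ i \<partial>(gauss :: (real^'d::finite) measure)) = 0"
proof -
  have "((\<lambda>h. heat_avg (\<lambda>z. b + c * z $ i) (\<lambda>_. 1) 1 (0 + h *\<^sub>R axis j 1)) has_real_derivative
    heat_avg (\<lambda>z. (b + c * z $ i) * z $ j - c * axis j 1 $ i) (\<lambda>_. 1) 1 (0::real^'d) / sqrt 1) (at 0)"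
    by (intro heat_avg_shift_deriv poly_growth_const) simp
  moreover have "(\<lambda>h. heat_avg (\<lambda>z. b + c * z $ i) (\<lambda>_. 1) 1 (0 + h *\<^sub>R axis j 1 :: real^'d)) = (\<lambda>h. \<integral>z. b + c * (z::real^'d) $ i \<partial>gauss)"
    by (simp add: heat_avg_def)
  ultimately have "((\<lambda>h::real. \<integral>z. b + c * (z::real^'d) $ i \<partial>gauss) has_real_derivative
    heat_avg (\<lambda>z. (b + c * z $ i) * z $ j - c * axis j 1 $ i) (\<lambda>_. 1) 1 (0::real^'d) / sqrt 1) (at 0)"
    by simp
  from DERIV_unique[OF this DERIV_const] show ?thesis by (simp add: heat_avg_def)
qed

text \<open>As q has mean 0, the value g x may be subtracted under the integral. The increment of g
  is then at most C \<sigma>^(\<alpha>/2) |z|^\<alpha>, which is the gain over a merely continuous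
  g.\<close>

lemma holder_heat_avg_bound:
  fixes g :: "real^'d::finite \<Rightarrow> real"
  assumes g: "poly_growth g" and q: "poly_weight q" and q0: "(\<integral>z. q z \<partial>gauss) = 0"
    and h: "\<And>x y. \<bar>g x - g y\<bar> \<le> C * dist x y powr \<alpha>" and \<alpha>: "0 < \<alpha>" "\<alpha> \<le> 1"
  shows "\<exists>K\<ge>0. \<forall>\<sigma>>0. \<forall>x. \<bar>heat_avg q g \<sigma> x\<bar> \<le> K * \<sigma> powr (\<alpha> / 2)"
proof -
  interpret prob_space "gauss :: (real^'d) measure" by (rule prob_space_gauss)
  have [measurable]: "g \<in> borel_measurable borel" "q \<in> borel_measurable borel"
    using poly_growth_measurable[OF g] q by (auto simp: poly_weight_def)
  obtain D m where D: "\<And>z. \<bar>q z\<bar> \<le> D * (1 + norm z) ^ m" using q by (auto simp: poly_weight_def)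
  have qi: "integrable gauss q"
    using poly_weight_integrable[OF poly_growth_const[of 1] q, of 0] by simp
  have C0: "0 \<le> C"
  proof -
    have "0 \<le> C * dist (axis undefined 1 :: real^'d) 0 powr \<alpha>" using h[of "axis undefined 1" 0] by (auto intro: order_trans[OF abs_ge_zero])
    thus ?thesis by simp
  qed
  have wi: "integrable gauss (\<lambda>z. (1 + norm z) * \<bar>q z\<bar>)"
  proof (rule gauss_integrable[where C = D and p = "Suc m" and c = 0 and a = 0])
    fix z :: "real^'d"
    have "(1 + norm z) * \<bar>q z\<bar> \<le> (1 + norm z) * (D * (1 + norm z) ^ m)" by (intro mult_left_mono D) auto
    thus "\<bar>(1 + norm z) * \<bar>q z\<bar>\<bar> \<le> D * ((1 + norm z) ^ Suc m * exp (0 * norm z) * exp (0 * (norm z)\<^sup>2))"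
      by (simp add: abs_mult mult_ac)
  qed auto
  define K where "K = C * (\<integral>z. (1 + norm z) * \<bar>q z\<bar> \<partial>gauss)"
  have K0: "0 \<le> K" unfolding K_def using C0 by (intro mult_nonneg_nonneg integral_nonneg_AE) auto
  have "\<bar>heat_avg q g \<sigma> x\<bar> \<le> K * \<sigma> powr (\<alpha> / 2)" if s: "0 < \<sigma>" for \<sigma> x
  proof -
    have i1: "integrable gauss (\<lambda>z. g (x + sqrt \<sigma> *\<^sub>R z) * q z)"
      using s by (intro poly_weight_integrable g q) auto
    have "heat_avg q g \<sigma> x = (\<integral>z. g (x + sqrt \<sigma> *\<^sub>R z) * q z - g x * q z \<partial>gauss)"
      unfolding heat_avg_def using i1 qi q0 by simp
    hence "\<bar>heat_avg q g \<sigma> x\<bar> \<le> (\<integral>z. \<bar>g (x + sqrt \<sigma> *\<^sub>R z) * q z - g x * q z\<bar> \<partial>gauss)"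
      by (simp add: integral_abs_bound)
    also have "\<dots> \<le> (\<integral>z. (C * \<sigma> powr (\<alpha> / 2)) * ((1 + norm z) * \<bar>q z\<bar>) \<partial>gauss)"
    proof (rule integral_mono)
      show "integrable gauss (\<lambda>z. \<bar>g (x + sqrt \<sigma> *\<^sub>R z) * q z - g x * q z\<bar>)" using i1 qi by auto
      show "integrable gauss (\<lambda>z. (C * \<sigma> powr (\<alpha> / 2)) * ((1 + norm z) * \<bar>q z\<bar>))" by (intro integrable_mult_right wi)
      fix z
      have "dist (x + sqrt \<sigma> *\<^sub>R z) x powr \<alpha> = \<sigma> powr (\<alpha> / 2) * norm z powr \<alpha>"
        using s by (simp add: dist_norm powr_mult powr_half_sqrt[symmetric] powr_powr)
      also have "norm z powr \<alpha> \<le> 1 + norm z"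
      proof (cases "norm z = 0")
        case False
        thus ?thesis using powr_le_one_plus[of "norm z" \<alpha> 1] \<alpha> by simp
      qed simp
      finally have "C * dist (x + sqrt \<sigma> *\<^sub>R z) x powr \<alpha> \<le> C * (\<sigma> powr (\<alpha> / 2) * (1 + norm z))"
        using C0 by (simp add: mult_left_mono)
      hence "\<bar>g (x + sqrt \<sigma> *\<^sub>R z) - g x\<bar> \<le> C * (\<sigma> powr (\<alpha> / 2) * (1 + norm z))"
        using h[of "x + sqrt \<sigma> *\<^sub>R z" x] by linarith
      hence "\<bar>g (x + sqrt \<sigma> *\<^sub>R z) - g x\<bar> * \<bar>q z\<bar> \<le> C * (\<sigma> powr (\<alpha> / 2) * (1 + norm z)) * \<bar>q z\<bar>"
        by (rule mult_right_mono) simp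
      thus "\<bar>g (x + sqrt \<sigma> *\<^sub>R z) * q z - g x * q z\<bar> \<le> (C * \<sigma> powr (\<alpha> / 2)) * ((1 + norm z) * \<bar>q z\<bar>)"
        unfolding left_diff_distrib[symmetric] abs_mult by (simp add: mult_ac)
    qed
    finally show ?thesis unfolding integral_mult_right_zero K_def by (simp only: mult_ac)
  qed
  thus ?thesis using K0 by blast
qed

lemma poly_weight_quadratic': "poly_weight (\<lambda>z. (b + c * z $ i) * z $ j - c * axis j 1 $ i)"
  by (rule poly_weight_quadratic)

text \<open>The exponent e is the power of \<sigma> paid for derivatives on the kernel: 1/2 for one,
  1 for two. For \<sigma> <= 1 the Hoelder gain leaves \<sigma>^(\<alpha>/2 - e), at worst order 1 -
  \<alpha>/2 < 1; for \<sigma> > 1 the division only helps.\<close>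

lemma tame_smoothed:
  assumes g: "poly_growth g" and h: "\<And>x y. \<bar>g x - g y\<bar> \<le> C * dist x y powr \<alpha>" and \<alpha>: "0 < \<alpha>" "\<alpha> \<le> 1"
    and e: "0 < e" "e \<le> 1"
  shows "tame (1 - \<alpha> / 2) (\<lambda>\<sigma> x. heat_avg (\<lambda>z. (b + c * z $ i) * z $ j - c * axis j 1 $ i) g \<sigma> x / \<sigma> powr e)"
proof -
  let ?q = "\<lambda>z. (b + c * z $ i) * z $ j - c * axis j 1 $ i"
  obtain K where K: "0 \<le> K" "\<And>\<sigma> x. 0 < \<sigma> \<Longrightarrow> \<bar>heat_avg ?q g \<sigma> x\<bar> \<le> K * \<sigma> powr (\<alpha> / 2)"
    using holder_heat_avg_bound[OF g poly_weight_quadratic' gauss_quadratic_mean h \<alpha>] by blast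
  note t0 = tame_heat_avg[OF g poly_weight_quadratic', of b c i j]
  obtain C' p where C: "0 \<le> C'" "\<And>\<sigma> x. 0 < \<sigma> \<Longrightarrow> \<bar>heat_avg ?q g \<sigma> x\<bar> \<le> C' * ((1 + \<sigma> powr - 0) * (1 + norm x + \<sigma>) ^ p)"
    using t0 by (auto simp: tame_def)
  have "\<bar>heat_avg ?q g \<sigma> x / \<sigma> powr e\<bar> \<le> (K + 2 * C') * ((1 + \<sigma> powr - (1 - \<alpha> / 2)) * (1 + norm x + \<sigma>) ^ p)"
    if s: "0 < \<sigma>" for \<sigma> x
  proof (cases "\<sigma> \<le> 1")
    case True
    have "\<bar>heat_avg ?q g \<sigma> x / \<sigma> powr e\<bar> \<le> K * \<sigma> powr (\<alpha> / 2) / \<sigma> powr e"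
      using K(2)[OF s, of x] s by (simp add: divide_right_mono)
    also have "\<dots> = K * \<sigma> powr (\<alpha> / 2 - e)" by (simp add: powr_diff)
    also have "\<dots> \<le> K * \<sigma> powr - (1 - \<alpha> / 2)" using K(1) s True e by (intro mult_left_mono powr_mono') auto
    also have "\<dots> \<le> (K + 2 * C') * ((1 + \<sigma> powr - (1 - \<alpha> / 2)) * (1 + norm x + \<sigma>) ^ p)"
    proof (intro mult_mono)
      have "\<sigma> powr - (1 - \<alpha> / 2) * 1 \<le> (1 + \<sigma> powr - (1 - \<alpha> / 2)) * (1 + norm x + \<sigma>) ^ p"
        using s by (intro mult_mono one_le_power) auto
      thus "\<sigma> powr - (1 - \<alpha> / 2) \<le> (1 + \<sigma> powr - (1 - \<alpha> / 2)) * (1 + norm x + \<sigma>) ^ p" by simp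
    qed (use K C in auto)
    finally show ?thesis .
  next
    case False
    hence "1 \<le> \<sigma> powr e" using e by (intro ge_one_powr_ge_zero) auto
    hence "\<bar>heat_avg ?q g \<sigma> x\<bar> / \<sigma> powr e \<le> \<bar>heat_avg ?q g \<sigma> x\<bar> / 1" by (intro divide_left_mono) auto
    also have "\<dots> \<le> 2 * C' * (1 * (1 + norm x + \<sigma>) ^ p)" using C(2)[OF s, of x] s by simp
    also have "\<dots> \<le> (K + 2 * C') * ((1 + \<sigma> powr - (1 - \<alpha> / 2)) * (1 + norm x + \<sigma>) ^ p)"
      using K C s by (intro mult_mono) auto
    finally show ?thesis by simp
  qed
  moreover have "continuous_on ({0<..} \<times> UNIV) (\<lambda>(\<sigma>, x). heat_avg ?q g \<sigma> x / \<sigma> powr e)"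
    using t0 by (auto simp: tame_def case_prod_unfold intro!: continuous_intros)
  moreover have "0 \<le> K + 2 * C'" using K C by simp
  ultimately show ?thesis by (intro tameI)
qed

lemma pd_at_heat:
  assumes d: "\<And>x. pd_at i g x (g' x)" and g: "poly_growth g" and g': "poly_growth g'" and s: "0 \<le> \<sigma>"
  shows "pd_at i (heat g \<sigma>) x (heat g' \<sigma> x)"
proof -
  note [measurable] = poly_growth_measurable[OF g] poly_growth_measurable[OF g']
  obtain C p where C: "0 \<le> C"
    "\<And>x z s. 0 \<le> s \<Longrightarrow> \<bar>g' (x + s *\<^sub>R z)\<bar> \<le> C * ((1 + norm x + s) ^ p * (1 + norm z) ^ p)"
    using poly_growth_bound[OF g'] by blast
  let ?w = "\<lambda>z. C * ((1 + (norm x + 1) + sqrt \<sigma>) ^ p * (1 + norm z) ^ p)"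
  have "((\<lambda>h. \<integral>z. g (x + h *\<^sub>R axis i 1 + sqrt \<sigma> *\<^sub>R z) * 1 \<partial>gauss) has_real_derivative
      (\<integral>z. g' (x + 0 *\<^sub>R axis i 1 + sqrt \<sigma> *\<^sub>R z) * 1 \<partial>gauss)) (at 0)"
  proof (rule has_derivative_integral_AE[where a = "-1" and b = 1 and w = ?w])
    show "integrable gauss (\<lambda>z. g (x + h *\<^sub>R axis i 1 + sqrt \<sigma> *\<^sub>R z) * 1)" for h
      using s by (intro poly_weight_integrable g poly_weight_const) auto
    show "integrable gauss ?w"
      by (rule gauss_integrable[where C = "C * (1 + (norm x + 1) + sqrt \<sigma>) ^ p" and p = p and c = 0 and a = 0])
        (use C(1) s in \<open>auto simp: abs_mult mult.assoc\<close>)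
    show "AE z in gauss. \<forall>h>- 1. h < 1 \<longrightarrow>
       ((\<lambda>h. g (x + h *\<^sub>R axis i 1 + sqrt \<sigma> *\<^sub>R z) * 1) has_real_derivative g' (x + h *\<^sub>R axis i 1 + sqrt \<sigma> *\<^sub>R z) * 1) (at h) \<and>
       \<bar>g' (x + h *\<^sub>R axis i 1 + sqrt \<sigma> *\<^sub>R z) * 1\<bar> \<le> ?w z"
    proof (intro AE_I2 allI impI conjI)
      fix z h assume h: "- 1 < h" "h < (1::real)"
      have "((\<lambda>h. g ((x + sqrt \<sigma> *\<^sub>R z) + h *\<^sub>R axis i 1)) has_real_derivative g' ((x + sqrt \<sigma> *\<^sub>R z) + h *\<^sub>R axis i 1)) (at h)"
        by (rule pd_at_shift[OF d])
      thus "((\<lambda>h. g (x + h *\<^sub>R axis i 1 + sqrt \<sigma> *\<^sub>R z) * 1) has_real_derivative g' (x + h *\<^sub>R axis i 1 + sqrt \<sigma> *\<^sub>R z) * 1) (at h)"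
        by (simp add: add_ac)
      have "norm (x + h *\<^sub>R axis i 1) \<le> norm x + 1"
        using norm_triangle_ineq[of x "h *\<^sub>R axis i 1"] h by simp
      hence "(1 + norm (x + h *\<^sub>R axis i 1) + sqrt \<sigma>) ^ p \<le> (1 + (norm x + 1) + sqrt \<sigma>) ^ p"
        using s by (intro power_mono) auto
      hence "C * ((1 + norm (x + h *\<^sub>R axis i 1) + sqrt \<sigma>) ^ p * (1 + norm z) ^ p) \<le> ?w z"
        using C(1) by (intro mult_left_mono mult_right_mono) auto
      thus "\<bar>g' (x + h *\<^sub>R axis i 1 + sqrt \<sigma> *\<^sub>R z) * 1\<bar> \<le> ?w z"
        using C(2)[of "sqrt \<sigma>" "x + h *\<^sub>R axis i 1" z] s by simp
    qed
  qed auto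
  thus ?thesis by (simp add: pd_at_def heat_avg_def)
qed

lemma heat_zero: "heat g 0 x = g x"
proof -
  interpret prob_space "gauss :: (real^'a) measure" by (rule prob_space_gauss)
  have "prob UNIV = 1" using prob_space by simp
  thus ?thesis by (simp add: heat_avg_def)
qed

text \<open>The heat equation, with all derivatives on the kernel: the second-order weights z_i^2 -
  1 add up to |z|^2 - d, the weight of the variance derivative.\<close>

lemma heat_time_deriv:
  fixes g :: "real^'d::finite \<Rightarrow> real"
  assumes g: "poly_growth g" and \<sigma>: "0 < \<sigma>"
  shows "((\<lambda>\<sigma>. heat g \<sigma> x) has_real_derivative 1/2 * laplacian (heat g \<sigma>) x) (at \<sigma>)"
proof -
  have 1: "pdx i (heat g \<sigma>) = (\<lambda>x. heat_avg (\<lambda>z. 0 + 1 * z $ i) g \<sigma> x / sqrt \<sigma>)" for i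
    using heat_avg_shift_deriv[OF g \<sigma>, of 1 0 i _ i]
    by (auto simp: pd_at_def intro!: pd_at_pdx)
  have 2: "pdx i (pdx i (heat g \<sigma>)) x = heat_avg (\<lambda>z. (0 + 1 * z $ i) * z $ i - 1 * axis i 1 $ i) g \<sigma> x / sqrt \<sigma> / sqrt \<sigma>" for i x
    unfolding 1 by (rule pd_at_pdx, unfold pd_at_def) (rule DERIV_cdivide[OF heat_avg_shift_deriv[OF g \<sigma>]])
  have int: "integrable gauss (\<lambda>z. g (x + sqrt \<sigma> *\<^sub>R z) * ((0 + 1 * z $ i) * z $ i - 1 * axis i 1 $ i))" for i
    using \<sigma> by (intro poly_weight_integrable[OF g poly_weight_quadratic']) simp
  have "laplacian (heat g \<sigma>) x = (\<Sum>i\<in>UNIV. heat_avg (\<lambda>z. (0 + 1 * z $ i) * z $ i - 1 * axis i 1 $ i) g \<sigma> x / \<sigma>)"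
    unfolding laplacian_def 2 using \<sigma> by simp
  also have "\<dots> = (\<integral>z. (\<Sum>i\<in>UNIV. g (x + sqrt \<sigma> *\<^sub>R z) * ((0 + 1 * z $ i) * z $ i - 1 * axis i 1 $ i)) \<partial>gauss) / \<sigma>"
    unfolding heat_avg_def sum_divide_distrib[symmetric]
    by (subst Bochner_Integration.integral_sum[OF int]) (rule refl)
  also have "(\<lambda>z. \<Sum>i\<in>UNIV. g (x + sqrt \<sigma> *\<^sub>R z) * ((0 + 1 * z $ i) * z $ i - 1 * axis i 1 $ i))
     = (\<lambda>z. g (x + sqrt \<sigma> *\<^sub>R z) * ((norm z)\<^sup>2 - real CARD('d)))"
    by (simp add: sum_distrib_left[symmetric] sum_subtractf power2_norm_eq_inner inner_vec_def)
  finally have "laplacian (heat g \<sigma>) x = heat_avg (\<lambda>z. (norm z)\<^sup>2 - real CARD('d)) g \<sigma> x / \<sigma>"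
    by (simp only: heat_avg_def[of "\<lambda>z. (norm z)\<^sup>2 - real CARD('d)"])
  thus ?thesis using heat_avg_time_deriv[OF g \<sigma>, of x] by simp
qed

lemma poly_growth_add_cmult:
  assumes "poly_growth g" "poly_growth h"
  shows "poly_growth (\<lambda>x. c * g x + h x)"
proof -
  obtain C p where C: "0 \<le> C" "\<And>x z s. 0 \<le> s \<Longrightarrow> \<bar>g (x + s *\<^sub>R z)\<bar> \<le> C * ((1 + norm x + s) ^ p * (1 + norm z) ^ p)"
    using poly_growth_bound[OF assms(1)] by blast
  obtain D q where D: "0 \<le> D" "\<And>x z s. 0 \<le> s \<Longrightarrow> \<bar>h (x + s *\<^sub>R z)\<bar> \<le> D * ((1 + norm x + s) ^ q * (1 + norm z) ^ q)"
    using poly_growth_bound[OF assms(2)] by blast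
  have "\<bar>c * g x + h x\<bar> \<le> (\<bar>c\<bar> * C + D) * (1 + norm x) ^ (p + q)" for x
  proof -
    let ?P = "\<lambda>p. (1 + norm x) ^ p"
    have P: "?P p \<le> ?P (p + q)" "?P q \<le> ?P (p + q)" by (auto intro!: power_increasing)
    have g: "\<bar>g x\<bar> \<le> C * ?P p" and h: "\<bar>h x\<bar> \<le> D * ?P q" using C(2)[of 0 x 0] D(2)[of 0 x 0] by auto
    have "\<bar>c * g x + h x\<bar> \<le> \<bar>c\<bar> * \<bar>g x\<bar> + \<bar>h x\<bar>" by (metis abs_mult abs_triangle_ineq)
    also have "\<dots> \<le> \<bar>c\<bar> * (C * ?P (p + q)) + D * ?P (p + q)"
      by (intro add_mono mult_left_mono order_trans[OF g mult_left_mono[OF P(1) C(1)]]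
          order_trans[OF h mult_left_mono[OF P(2) D(1)]]) auto
    finally show ?thesis by (simp add: algebra_simps)
  qed
  moreover have "continuous_on UNIV (\<lambda>x. c * g x + h x)"
    using assms by (auto simp: poly_growth_def intro!: continuous_intros)
  ultimately show ?thesis unfolding poly_growth_def by (intro conjI exI[of _ "\<bar>c\<bar> * C + D"] exI[of _ "p + q"]) auto
qed

lemma poly_growth_sum:
  assumes "finite A" "\<And>a. a \<in> A \<Longrightarrow> poly_growth (g a)"
  shows "poly_growth (\<lambda>x. \<Sum>a\<in>A. c * g a x)"
  using assms
proof (induction A rule: finite_induct)
  case (insert a A)
  thus ?case using poly_growth_add_cmult[of "g a" "\<lambda>x. \<Sum>a\<in>A. c * g a x" c] by simp
qed (simp add: poly_growth_const)

lemma heat_sum: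
  assumes "\<And>a. a \<in> A \<Longrightarrow> poly_growth (g a)" "0 \<le> \<sigma>"
  shows "heat (\<lambda>x. \<Sum>a\<in>A. c * g a x) \<sigma> x = (\<Sum>a\<in>A. c * heat (g a) \<sigma> x)"
proof -
  have "integrable gauss (\<lambda>z. c * (g a (x + sqrt \<sigma> *\<^sub>R z) * 1))" if "a \<in> A" for a
    using assms that by (intro integrable_mult_right poly_weight_integrable poly_weight_const) auto
  from Bochner_Integration.integral_sum[OF this]
  show ?thesis by (simp add: heat_avg_def)
qed

section \<open>Derivatives of the heat flow up to order 2\<nu>\<close>

locale holder_data =
  fixes \<nu> :: nat and \<alpha> :: real and f :: "real^'d::finite \<Rightarrow> real"
  assumes nu2: "2 \<le> \<nu>" and alpha: "0 < \<alpha>" "\<alpha> \<le> 1" and f: "bounded_holder_derivs (2 * \<nu> - 2) \<alpha> f"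
begin

lemma f_exist: "pdx_exist (2 * \<nu> - 2) f"
  using f by (simp add: bounded_holder_derivs_def)

lemma f_poly_growth: "length is \<le> 2 * \<nu> - 2 \<Longrightarrow> poly_growth (pdxs is f)"
  by (rule bounded_holder_poly_growth[OF f alpha(1)])

text \<open>Up to order 2\<nu> - 2 the derivatives fall on f. For one or two more, the leading
  letters of the word, which are the derivatives taken last, fall on the kernel. The weights keep
  the shape (b + c z_i) z_j - c \<delta> so that \<open>heat_avg_shift_deriv\<close> and
  \<open>tame_smoothed\<close> apply literally.\<close>

definition heat_pd :: "'d list \<Rightarrow> real \<Rightarrow> real^'d \<Rightarrow> real" where
  "heat_pd is \<sigma> x =
    (if length is \<le> 2 * \<nu> - 2 then heat (pdxs is f) \<sigma> x
     else if length is = 2 * \<nu> - 1 then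
       heat_avg (\<lambda>z. (1 + 0 * z $ hd is) * z $ hd is - 0 * axis (hd is) 1 $ hd is) (pdxs (tl is) f) \<sigma> x / \<sigma> powr (1 / 2)
     else heat_avg (\<lambda>z. (0 + 1 * z $ hd (tl is)) * z $ hd is - 1 * axis (hd is) 1 $ hd (tl is)) (pdxs (tl (tl is)) f) \<sigma> x / \<sigma> powr 1)"

lemma pd_at_heat_pd:
  assumes \<sigma>: "0 < \<sigma>" and len: "length is < 2 * \<nu>"
  shows "pd_at i (heat_pd is \<sigma>) x (heat_pd (i # is) \<sigma> x)"
proof -
  consider "length is < 2 * \<nu> - 2" | "length is = 2 * \<nu> - 2" | "length is = 2 * \<nu> - 1" using len by linarith
  thus ?thesis
  proof cases
    case 1
    have "pd_at i (heat (pdxs is f) \<sigma>) x (heat (pdxs (i # is) f) \<sigma> x)"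
      using 1 \<sigma> by (intro pd_at_heat pdx_existD[OF f_exist] f_poly_growth) auto
    thus ?thesis using 1 by (simp add: heat_pd_def[abs_def])
  next
    case 2
    have "pd_at i (heat_avg (\<lambda>z. 1 + 0 * z $ i) (pdxs is f) \<sigma>) x
        (heat_avg (\<lambda>z. (1 + 0 * z $ i) * z $ i - 0 * axis i 1 $ i) (pdxs is f) \<sigma> x / sqrt \<sigma>)"
      unfolding pd_at_def using 2 by (intro heat_avg_shift_deriv \<sigma> f_poly_growth) simp
    moreover have "Suc (2 * \<nu> - 2) = 2 * \<nu> - Suc 0" using nu2 by simp
    ultimately show ?thesis using 2 \<sigma> nu2 by (simp add: heat_pd_def[abs_def] powr_half_sqrt)
  next
    case 3
    then obtain i' js where "is": "is = i' # js" "length js = 2 * \<nu> - 2" using nu2 by (cases "is") auto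
    have "pd_at i (\<lambda>x. heat_avg (\<lambda>z. 0 + 1 * z $ i') (pdxs js f) \<sigma> x / sqrt \<sigma>) x
        (heat_avg (\<lambda>z. (0 + 1 * z $ i') * z $ i - 1 * axis i 1 $ i') (pdxs js f) \<sigma> x / sqrt \<sigma> / sqrt \<sigma>)"
      unfolding pd_at_def using "is" by (intro DERIV_cdivide heat_avg_shift_deriv \<sigma> f_poly_growth) simp
    moreover have "a / sqrt \<sigma> / sqrt \<sigma> = a / \<sigma> powr 1" for a using \<sigma> by simp
    moreover have "Suc (2 * \<nu> - 2) = 2 * \<nu> - Suc 0" "Suc (Suc (2 * \<nu> - 2)) \<noteq> 2 * \<nu> - Suc 0" "\<not> 2 * \<nu> \<le> 2 * \<nu> - 2" using nu2 by auto
    ultimately show ?thesis using "is" \<sigma> nu2 by (simp add: heat_pd_def[abs_def] powr_half_sqrt)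
  qed
qed

lemma tame_heat_pd:
  assumes "length is \<le> 2 * \<nu>"
  shows "tame (1 - \<alpha> / 2) (heat_pd is)"
    and "length is \<le> 2 * \<nu> - 2 \<Longrightarrow> tame 0 (heat_pd is)"
proof -
  show 0: "tame 0 (heat_pd is)" if "length is \<le> 2 * \<nu> - 2"
    using tame_heat_avg[OF f_poly_growth[OF that] poly_weight_const[of 1]] that by (simp add: heat_pd_def[abs_def])
  have h: "\<exists>C. \<forall>x y. \<bar>pdxs js f x - pdxs js f y\<bar> \<le> C * dist x y powr \<alpha>" if "length js = 2 * \<nu> - 2" for js
    using f that unfolding bounded_holder_derivs_def by blast
  consider "length is \<le> 2 * \<nu> - 2" | "length is = 2 * \<nu> - 1" | "length is = 2 * \<nu>" using assms by linarith
  thus "tame (1 - \<alpha> / 2) (heat_pd is)"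
  proof cases
    case 1
    thus ?thesis using alpha by (intro tame_mono[OF 0]) auto
  next
    case 2
    hence "length (tl is) = 2 * \<nu> - 2" by simp
    then obtain C where C: "\<And>x y. \<bar>pdxs (tl is) f x - pdxs (tl is) f y\<bar> \<le> C * dist x y powr \<alpha>" using h by blast
    have "tame (1 - \<alpha> / 2) (\<lambda>\<sigma> x. heat_avg (\<lambda>z. (1 + 0 * z $ hd is) * z $ hd is - 0 * axis (hd is) 1 $ hd is) (pdxs (tl is) f) \<sigma> x / \<sigma> powr (1 / 2))"
      by (rule tame_smoothed[OF f_poly_growth C alpha]) (use 2 in auto)
    moreover have "\<not> 2 * \<nu> - 1 \<le> 2 * \<nu> - 2" using nu2 by simp
    ultimately show ?thesis using 2 unfolding heat_pd_def[abs_def] by (simp only: if_False if_True refl)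
  next
    case 3
    hence "length (tl (tl is)) = 2 * \<nu> - 2" by simp
    then obtain C where C: "\<And>x y. \<bar>pdxs (tl (tl is)) f x - pdxs (tl (tl is)) f y\<bar> \<le> C * dist x y powr \<alpha>" using h by blast
    have "tame (1 - \<alpha> / 2) (\<lambda>\<sigma> x. heat_avg (\<lambda>z. (0 + 1 * z $ hd (tl is)) * z $ hd is - 1 * axis (hd is) 1 $ hd (tl is)) (pdxs (tl (tl is)) f) \<sigma> x / \<sigma> powr 1)"
      by (rule tame_smoothed[OF f_poly_growth C alpha]) (use 3 in auto)
    moreover have "\<not> 2 * \<nu> \<le> 2 * \<nu> - 2" "2 * \<nu> \<noteq> 2 * \<nu> - 1" using nu2 by auto
    ultimately show ?thesis using 3 unfolding heat_pd_def[abs_def] by (simp only: if_False if_True refl)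
  qed
qed

lemma heat_pd_Nil: "heat_pd [] \<sigma> = heat f \<sigma>"
  by (simp add: heat_pd_def[abs_def])

lemma heat_exist: "0 < \<sigma> \<Longrightarrow> pdx_exist (2 * \<nu>) (heat f \<sigma>)"
  by (rule pdx_existI[where B = "\<lambda>is. heat_pd is \<sigma>"]) (auto intro: pd_at_heat_pd simp: heat_pd_Nil)

lemma pdxs_heat: "0 < \<sigma> \<Longrightarrow> length is \<le> 2 * \<nu> \<Longrightarrow> pdxs is (heat f \<sigma>) = heat_pd is \<sigma>"
  by (rule pdxs_eqI[where B = "\<lambda>is. heat_pd is \<sigma>" and m = "2 * \<nu>"]) (auto intro: pd_at_heat_pd simp: heat_pd_Nil)

text \<open>The k-th power of \<Delta>/2 applied to the heat flow; with this normalisation a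
  derivative in \<sigma> just raises k by one.\<close>

definition lap_heat :: "nat \<Rightarrow> real \<Rightarrow> real^'d \<Rightarrow> real" where
  "lap_heat k \<sigma> = (\<lambda>x. 1 / 2 ^ k * (laplacian ^^ k) (heat f \<sigma>) x)"

lemma
  assumes "0 < \<sigma>" "2 * k + n \<le> 2 * \<nu>"
  shows lap_heat_exist: "pdx_exist n (lap_heat k \<sigma>)"
    and pdxs_lap_heat: "length is \<le> n \<Longrightarrow>
      pdxs is (lap_heat k \<sigma>) = (\<lambda>x. \<Sum>js\<in>lap_words k. 1 / 2 ^ k * heat_pd (is @ js) \<sigma> x)"
proof -
  have ex: "pdx_exist (2 * k + n) (heat f \<sigma>)" by (rule pdx_exist_mono[OF heat_exist[OF assms(1)] assms(2)])
  note e = pdx_exist_laplacian_power[OF ex]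
  show "pdx_exist n (lap_heat k \<sigma>)" unfolding lap_heat_def by (rule pdx_exist_cmult[OF e])
  assume len: "length is \<le> n"
  have "pdxs is (lap_heat k \<sigma>) = (\<lambda>x. 1 / 2 ^ k * (\<Sum>js\<in>lap_words k. 1 * pdxs (is @ js) (heat f \<sigma>) x))"
    unfolding lap_heat_def pdxs_cmult[OF e len] pdxs_laplacian_power[OF ex len] ..
  also have "\<dots> = (\<lambda>x. \<Sum>js\<in>lap_words k. 1 / 2 ^ k * heat_pd (is @ js) \<sigma> x)"
  proof
    fix x
    have "pdxs (is @ js) (heat f \<sigma>) = heat_pd (is @ js) \<sigma>" if "js \<in> lap_words k" for js
      using that lap_words_length[OF that] len assms by (intro pdxs_heat) auto
    thus "1 / 2 ^ k * (\<Sum>js\<in>lap_words k. 1 * pdxs (is @ js) (heat f \<sigma>) x) = (\<Sum>js\<in>lap_words k. 1 / 2 ^ k * heat_pd (is @ js) \<sigma> x)"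
      unfolding sum_distrib_left by (intro sum.cong) auto
  qed
  finally show "pdxs is (lap_heat k \<sigma>) = (\<lambda>x. \<Sum>js\<in>lap_words k. 1 / 2 ^ k * heat_pd (is @ js) \<sigma> x)" .
qed

lemma tame_lap_heat:
  assumes "2 * k + length is \<le> 2 * \<nu>"
  shows "tame (1 - \<alpha> / 2) (\<lambda>\<sigma>. pdxs is (lap_heat k \<sigma>))"
    and "2 * k + length is \<le> 2 * \<nu> - 2 \<Longrightarrow> tame 0 (\<lambda>\<sigma>. pdxs is (lap_heat k \<sigma>))"
proof -
  have eq: "(\<Sum>js\<in>lap_words k. 1 / 2 ^ k * heat_pd (is @ js) \<sigma> x) = pdxs is (lap_heat k \<sigma>) x" if "0 < \<sigma>" for \<sigma> x
    by (subst pdxs_lap_heat[OF that assms]) auto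
  have "tame (1 - \<alpha> / 2) (\<lambda>\<sigma> x. \<Sum>js\<in>lap_words k. 1 / 2 ^ k * heat_pd (is @ js) \<sigma> x)"
    using assms by (intro tame_sum lap_words_finite tame_heat_pd) (auto simp: lap_words_length)
  thus "tame (1 - \<alpha> / 2) (\<lambda>\<sigma>. pdxs is (lap_heat k \<sigma>))" by (rule tame_cong) (rule eq)
  assume 2: "2 * k + length is \<le> 2 * \<nu> - 2"
  have "tame 0 (\<lambda>\<sigma> x. \<Sum>js\<in>lap_words k. 1 / 2 ^ k * heat_pd (is @ js) \<sigma> x)"
    using 2 by (intro tame_sum lap_words_finite tame_heat_pd) (auto simp: lap_words_length)
  thus "tame 0 (\<lambda>\<sigma>. pdxs is (lap_heat k \<sigma>))" by (rule tame_cong) (rule eq)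
qed

definition lap_datum :: "nat \<Rightarrow> real^'d \<Rightarrow> real" where
  "lap_datum k = (\<lambda>x. 1 / 2 ^ k * (laplacian ^^ k) f x)"

lemma lap_datum_eq:
  assumes "k < \<nu>"
  shows "lap_datum k = (\<lambda>x. \<Sum>js\<in>lap_words k. 1 / 2 ^ k * pdxs js f x)"
proof -
  have "pdx_exist (2 * k) f" using assms by (intro pdx_exist_mono[OF f_exist]) simp
  from laplacian_power_eq[OF this] show ?thesis by (simp add: lap_datum_def sum_distrib_left)
qed

lemma lap_datum_poly_growth: "k < \<nu> \<Longrightarrow> poly_growth (lap_datum k)"
  unfolding lap_datum_eq by (intro poly_growth_sum lap_words_finite f_poly_growth) (auto simp: lap_words_length)

text \<open>The Laplacian commutes with the heat flow as long as 2k <= 2\<nu> - 2 derivatives can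
  fall on f.\<close>

lemma lap_heat_eq_heat:
  assumes "0 < \<sigma>" "k < \<nu>"
  shows "lap_heat k \<sigma> = heat (lap_datum k) \<sigma>"
proof
  fix x
  have "lap_heat k \<sigma> x = (\<Sum>js\<in>lap_words k. 1 / 2 ^ k * heat_pd js \<sigma> x)"
    using pdxs_lap_heat[of \<sigma> k 0 "[]"] assms by simp
  also have "\<dots> = (\<Sum>js\<in>lap_words k. 1 / 2 ^ k * heat (pdxs js f) \<sigma> x)"
    using assms by (intro sum.cong refl) (auto simp: heat_pd_def lap_words_length)
  also have "\<dots> = heat (lap_datum k) \<sigma> x"
    unfolding lap_datum_eq[OF assms(2)]
    using assms by (intro heat_sum[symmetric] f_poly_growth) (auto simp: lap_words_length)
  finally show "lap_heat k \<sigma> x = heat (lap_datum k) \<sigma> x" .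
qed

lemma laplacian_lap_heat:
  assumes "0 < \<sigma>" "k < \<nu>"
  shows "laplacian (lap_heat k \<sigma>) = (\<lambda>x. 2 * lap_heat (Suc k) \<sigma> x)"
proof -
  have "pdx_exist (2 * k + 2) (heat f \<sigma>)" using assms by (intro pdx_exist_mono[OF heat_exist]) auto
  note e = pdx_exist_laplacian_power[OF this]
  have "pdxs [i, i] (\<lambda>x. 1 / 2 ^ k * (laplacian ^^ k) (heat f \<sigma>) x)
      = (\<lambda>x. 1 / 2 ^ k * pdxs [i, i] ((laplacian ^^ k) (heat f \<sigma>)) x)" for i
    by (rule pdxs_cmult[OF e]) simp
  thus ?thesis
    unfolding lap_heat_def laplacian_eq_pdxs by (simp add: sum_divide_distrib[symmetric])
qed

text \<open>For k < \<nu> the function is itself the heat flow of \<open>lap_datum k\<close>, so the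
  heat equation applies. At k = \<nu> - 1 this reaches \<open>lap_heat \<nu>\<close>, where \<Delta>
  acts on the smoothed function.\<close>

lemma lap_heat_time_deriv:
  assumes "0 < \<sigma>" "k < \<nu>"
  shows "((\<lambda>\<sigma>. lap_heat k \<sigma> x) has_real_derivative lap_heat (Suc k) \<sigma> x) (at \<sigma>)"
proof -
  have "((\<lambda>\<sigma>. heat (lap_datum k) \<sigma> x) has_real_derivative 1/2 * laplacian (heat (lap_datum k) \<sigma>) x) (at \<sigma>)"
    by (intro heat_time_deriv lap_datum_poly_growth assms)
  moreover have "1/2 * laplacian (heat (lap_datum k) \<sigma>) x = lap_heat (Suc k) \<sigma> x"
    using laplacian_lap_heat[OF assms] lap_heat_eq_heat[OF assms] by simp
  ultimately have "((\<lambda>\<sigma>. heat (lap_datum k) \<sigma> x) has_real_derivative lap_heat (Suc k) \<sigma> x) (at \<sigma>)" by simp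
  thus ?thesis by (rule DERIV_cong_pos[OF _ assms(1)]) (use lap_heat_eq_heat assms in auto)
qed

lemma lap_heat_continuous_0:
  assumes "k < \<nu>"
  shows "continuous_on {0..} (\<lambda>\<sigma>. heat (lap_datum k) \<sigma> x)"
  by (rule continuous_on_compose2[OF heat_avg_continuous[OF lap_datum_poly_growth[OF assms] poly_weight_const],
        of _ "\<lambda>\<sigma>. (\<sigma>, x)", simplified]) (auto intro!: continuous_intros)

end

section \<open>The joint law of the clocks and the time-changed sheet\<close>

abbreviation std_normal :: "real measure" where
  "std_normal \<equiv> density lborel (\<lambda>x. ennreal (std_normal_density x))"

lemma prob_space_std_normal: "prob_space std_normal"
  by (rule prob_space_normal_density) simp

lemma distr_const:
  assumes "prob_space M" "prob_space N"
  shows "distr M borel (\<lambda>_. c :: real) = distr N borel (\<lambda>_. c)"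
proof (rule measure_eqI)
  fix A assume "A \<in> sets (distr M borel (\<lambda>_. c))"
  thus "emeasure (distr M borel (\<lambda>_. c)) A = emeasure (distr N borel (\<lambda>_. c)) A"
    using prob_space.emeasure_space_1[OF assms(1)] prob_space.emeasure_space_1[OF assms(2)]
    by (cases "c \<in> A") (simp_all add: emeasure_distr)
qed simp

text \<open>Variance 0 has no density and is encoded by an almost sure value; describing the law as
  that of sqrt v times a standard normal variable unites both cases.\<close>

lemma centered_gaussian_distr:
  assumes M: "prob_space M" and X: "X \<in> borel_measurable M" and v: "0 \<le> v" and g: "centered_gaussian M X v"
  shows "distr M borel X = distr std_normal borel (\<lambda>x. sqrt v * x)"
proof (cases "v = 0")
  case True
  hence "AE \<omega> in M. X \<omega> = 0" using g by (simp add: centered_gaussian_def)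
  hence "distr M borel X = distr M borel (\<lambda>_. 0)" using X by (intro distr_cong_AE) auto
  also have "\<dots> = distr std_normal borel (\<lambda>_. 0)" by (rule distr_const[OF M prob_space_std_normal])
  finally show ?thesis by (simp add: True)
next
  case False
  interpret N: prob_space std_normal by (rule prob_space_std_normal)
  have sv: "0 < sqrt v" using v False by simp
  have "distributed M lborel X (normal_density 0 (sqrt v))" using g False by (simp add: centered_gaussian_def)
  hence 1: "distr M lborel X = density lborel (normal_density 0 (sqrt v))" by (rule distributed_distr_eq_density)
  have "distributed std_normal lborel (\<lambda>x. x) std_normal_density"
    unfolding distributed_def by (auto simp: distr_id2)
  from N.normal_density_affine[OF this _ , of "sqrt v" 0] sv
  have "distributed std_normal lborel (\<lambda>x. 0 + sqrt v * x) (normal_density 0 (sqrt v))" by simp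
  hence 2: "distr std_normal lborel (\<lambda>x. 0 + sqrt v * x) = density lborel (normal_density 0 (sqrt v))"
    by (rule distributed_distr_eq_density)
  have "distr M borel X = distr M lborel X" by (intro distr_cong) auto
  also have "\<dots> = distr std_normal lborel (\<lambda>x. 0 + sqrt v * x)" by (simp only: 1 2)
  also have "\<dots> = distr std_normal borel (\<lambda>x. sqrt v * x)" by (intro distr_cong) auto
  finally show ?thesis .
qed

lemma (in prob_space) process_events_indep_vars:
  assumes ind: "indep_sets (\<lambda>i. process_events M T (X i)) UNIV" and t: "\<And>i. t i \<in> T"
    and m: "\<And>i. X i (t i) \<in> borel_measurable M"
  shows "indep_vars (\<lambda>_. borel) (\<lambda>i. X i (t i)) (UNIV :: 'i set)"
  unfolding indep_vars_def2
proof (intro conjI ballI)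
  show "indep_sets (\<lambda>i. {X i (t i) -` A \<inter> space M |A. A \<in> sets borel}) UNIV"
    by (rule indep_sets_mono_sets[OF ind])
      (use t in \<open>auto simp: process_events_def intro!: sigma_sets.Basic\<close>)
qed (use m in auto)

lemma distr_PiM_componentwise:
  fixes g :: "'i::finite \<Rightarrow> 'b \<Rightarrow> real"
  assumes N: "\<And>i. prob_space (N i)" and g [measurable]: "\<And>i. g i \<in> borel_measurable (N i)"
  shows "distr (Pi\<^sub>M UNIV N) (\<Pi>\<^sub>M i\<in>UNIV. borel) (\<lambda>y i. g i (y i)) = (\<Pi>\<^sub>M i\<in>UNIV. distr (N i) borel (g i))"
proof -
  interpret N: product_prob_space N
    by (intro product_prob_spaceI N)
  interpret D: product_prob_space "\<lambda>i. distr (N i) borel (g i)"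
    by (intro product_prob_spaceI prob_space.prob_space_distr N g)
  have gm: "(\<lambda>y i. g i (y i)) \<in> measurable (Pi\<^sub>M UNIV N) (\<Pi>\<^sub>M i\<in>(UNIV::'i set). borel)"
    by (rule measurable_PiM_single') (auto simp: space_PiM)
  show ?thesis
  proof (rule D.PiM_eqI)
    show "sets (distr (Pi\<^sub>M UNIV N) (\<Pi>\<^sub>M i\<in>UNIV. borel) (\<lambda>y i. g i (y i))) = sets (\<Pi>\<^sub>M i\<in>UNIV. distr (N i) borel (g i))"
      by (simp cong: sets_PiM_cong)
    fix A assume "\<And>i. i \<in> UNIV \<Longrightarrow> A i \<in> sets (distr (N i) borel (g i))"
    hence A: "A i \<in> sets borel" for i by simp
    have "emeasure (distr (Pi\<^sub>M UNIV N) (\<Pi>\<^sub>M i\<in>UNIV. borel) (\<lambda>y i. g i (y i))) (Pi\<^sub>E UNIV A)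
       = emeasure (Pi\<^sub>M UNIV N) (\<Pi>\<^sub>E i\<in>UNIV. g i -` A i \<inter> space (N i))"
    proof -
      have "(\<lambda>y i. g i (y i)) -` (Pi\<^sub>E UNIV A) \<inter> space (Pi\<^sub>M UNIV N) = (\<Pi>\<^sub>E i\<in>UNIV. g i -` A i \<inter> space (N i))"
        by (auto simp: space_PiM PiE_def Pi_def)
      moreover have "Pi\<^sub>E UNIV A \<in> sets (\<Pi>\<^sub>M i\<in>(UNIV::'i set). borel)"
        by (rule sets_PiM_I_finite) (auto simp: A)
      ultimately show ?thesis by (simp add: emeasure_distr[OF gm])
    qed
    also have "\<dots> = (\<Prod>i\<in>UNIV. emeasure (N i) (g i -` A i \<inter> space (N i)))"
      using A by (intro N.emeasure_PiM) (auto intro: measurable_sets[OF g])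
    also have "\<dots> = (\<Prod>i\<in>UNIV. emeasure (distr (N i) borel (g i)) (A i))"
      using A by (intro prod.cong refl) (simp add: emeasure_distr)
    finally show "emeasure (distr (Pi\<^sub>M UNIV N) (\<Pi>\<^sub>M i\<in>UNIV. borel) (\<lambda>y i. g i (y i))) (Pi\<^sub>E UNIV A)
      = (\<Prod>i\<in>UNIV. emeasure (distr (N i) borel (g i)) (A i))" .
  qed simp
qed

locale isl_process = subordinator M \<nu> \<beta> L for M :: "'w measure" and \<nu> \<beta> L +
  fixes W :: "real^'n::finite \<Rightarrow> 'w \<Rightarrow> real^'d::finite" and Ls :: "'n \<Rightarrow> real \<Rightarrow> 'w \<Rightarrow> real"
  assumes isl: "isl_sheet M \<beta> W Ls"
begin

lemma Ls_subordinator: "subordinator M \<nu> \<beta> (Ls i)"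
  using isl nu beta by (unfold_locales) (auto simp: isl_sheet_def)

text \<open>The subordinator L that defines the moments is given separately from the clocks. All
  have the same Laplace transform, hence the same law at time 1 and the same
  \<open>inverse_law\<close>.\<close>

lemma Ls_inverse_law: "subordinator.inverse_law M \<beta> (Ls i) = inverse_law"
proof -
  interpret S: subordinator M \<nu> \<beta> "Ls i" by (rule Ls_subordinator)
  have [measurable]: "Ls i 1 \<in> borel_measurable M" "L 1 \<in> borel_measurable M"
    by (simp_all add: S.L_measurable L_measurable)
  have "distr M borel (Ls i 1) = distr M borel (L 1)"
  proof (rule distr_L_unique)
    show "AE \<omega> in M. 0 \<le> Ls i 1 \<omega>" by (auto intro!: AE_I2 S.L_nonneg)
    show "(\<integral>\<omega>. exp (- (real n * Ls i 1 \<omega>)) \<partial>M) = exp (- (1 * real n powr \<beta>))" for n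
      by (rule S.L_laplace) auto
  qed auto
  moreover have "S.inverse_law = distr (distr M borel (Ls i 1)) borel (\<lambda>x. x powr - \<beta>)"
    unfolding S.inverse_law_def by (subst distr_distr) (auto simp: comp_def)
  moreover have "inverse_law = distr (distr M borel (L 1)) borel (\<lambda>x. x powr - \<beta>)"
    unfolding inverse_law_def by (subst distr_distr) (auto simp: comp_def)
  ultimately show ?thesis by simp
qed

lemma Lam_measurable [measurable]: "inverse_process (Ls i) t \<in> borel_measurable M"
  by (rule subordinator.inverse_measurable[OF Ls_subordinator])

lemma Lam_nonneg: "\<omega> \<in> space M \<Longrightarrow> 0 \<le> inverse_process (Ls i) t \<omega>"
  by (rule subordinator.inverse_nonneg[OF Ls_subordinator])

lemma Lam_distr: "0 \<le> t \<Longrightarrow> distr M borel (inverse_process (Ls i) t) = distr inverse_law borel (\<lambda>y. t powr \<beta> * y)"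
  using subordinator.distr_inverse[OF Ls_subordinator, of t i] by (simp only: Ls_inverse_law)

definition Lam :: "real^'n \<Rightarrow> 'w \<Rightarrow> real^'n" where
  "Lam t \<omega> = (\<chi> i. inverse_process (Ls i) (t $ i) \<omega>)"

lemma Lam_vec_measurable [measurable]: "Lam t \<in> borel_measurable M"
  unfolding Lam_def[abs_def] by measurable

lemma Lam_orthant: "\<omega> \<in> space M \<Longrightarrow> Lam t \<omega> \<in> orthant"
  by (simp add: Lam_def orthant_def Lam_nonneg)

lemma all_indep: "indep_sets (\<lambda>c. case c of None \<Rightarrow> process_events M orthant W
           | Some i \<Rightarrow> process_events M {0..} (inverse_process (Ls i))) UNIV"
  using isl by (simp add: isl_sheet_def)

lemma Lam_indep:
  assumes "t \<in> orthant"
  shows "indep_vars (\<lambda>_. borel) (\<lambda>i. inverse_process (Ls i) (t $ i)) UNIV"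
proof (rule process_events_indep_vars)
  show "indep_sets (\<lambda>i. process_events M {0..} (inverse_process (Ls i))) UNIV"
  proof (rule indep_setsI)
    show "process_events M {0..} (inverse_process (Ls i)) \<subseteq> events" for i
      using bspec[OF conjunct1[OF all_indep[unfolded indep_sets_def]], of "Some i"] by simp
    fix A J assume J: "J \<noteq> {}" "finite J" "\<forall>j\<in>J. A j \<in> process_events M {0..} (inverse_process (Ls j))"
    define A' where "A' = (\<lambda>c. A (the c))"
    have "prob (\<Inter>c\<in>Some ` J. A' c) = (\<Prod>c\<in>Some ` J. prob (A' c))"
      using J by (intro indep_setsD[OF all_indep]) (auto simp: A'_def)
    thus "prob (\<Inter>j\<in>J. A j) = (\<Prod>j\<in>J. prob (A j))"
      by (simp add: A'_def prod.reindex)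
  qed
qed (use assms in \<open>auto simp: orthant_def\<close>)

lemma Lam_vec_distr:
  assumes t: "t \<in> orthant"
  shows "distr M borel (Lam t) = distr (\<Pi>\<^sub>M i\<in>UNIV. inverse_law) borel (\<lambda>y. \<chi> i. (t $ i) powr \<beta> * y i)"
proof -
  have "distr M (\<Pi>\<^sub>M i\<in>(UNIV :: 'n set). borel) (\<lambda>\<omega>. \<lambda>i\<in>UNIV. inverse_process (Ls i) (t $ i) \<omega>)
      = (\<Pi>\<^sub>M i\<in>UNIV. distr M borel (inverse_process (Ls i) (t $ i)))"
    using Lam_indep[OF t] by (subst (asm) indep_vars_iff_distr_eq_PiM) auto
  also have "\<dots> = (\<Pi>\<^sub>M i\<in>UNIV. distr inverse_law borel (\<lambda>y. (t $ i) powr \<beta> * y))"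
    using t by (intro PiM_cong refl Lam_distr) (auto simp: orthant_def)
  also have "\<dots> = distr (\<Pi>\<^sub>M i\<in>UNIV. inverse_law) (\<Pi>\<^sub>M i\<in>(UNIV :: 'n set). borel) (\<lambda>y i. (t $ i) powr \<beta> * y i)"
    by (rule distr_PiM_componentwise[symmetric]) (auto intro: I.prob_space_axioms)
  finally have eq: "distr M (\<Pi>\<^sub>M i\<in>(UNIV :: 'n set). borel) (\<lambda>\<omega> i. inverse_process (Ls i) (t $ i) \<omega>)
     = distr (\<Pi>\<^sub>M i\<in>UNIV. inverse_law) (\<Pi>\<^sub>M i\<in>(UNIV :: 'n set). borel) (\<lambda>y i. (t $ i) powr \<beta> * y i)" by (simp add: restrict_UNIV)
  have "distr M borel (Lam t) = distr (distr M (\<Pi>\<^sub>M i\<in>(UNIV :: 'n set). borel) (\<lambda>\<omega> i. inverse_process (Ls i) (t $ i) \<omega>)) borel (\<lambda>f. \<chi> i. f i)"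
    by (subst distr_distr) (auto simp: comp_def Lam_def[abs_def] intro!: measurable_PiM_single')
  also have "\<dots> = distr (\<Pi>\<^sub>M i\<in>UNIV. inverse_law) borel (\<lambda>y. \<chi> i. (t $ i) powr \<beta> * y i)"
    unfolding eq by (subst distr_distr) (auto simp: comp_def intro!: measurable_PiM_single')
  finally show ?thesis .
qed

text \<open>The random point \<omega> itself, seen through this algebra, plays the role of the whole
  sheet. This makes "the sheet" a single random element that can be independent of the clocks,
  although W and the clocks live on the same space.\<close>

definition sheet_algebra :: "'w measure" where
  "sheet_algebra = sigma (space M) {W t -` A \<inter> space M | t A. t \<in> orthant \<and> A \<in> sets borel}"

lemma sheet_algebra_sets: "sets sheet_algebra = process_events M orthant W"
  and sheet_algebra_space [simp]: "space sheet_algebra = space M"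
proof -
  have "{W t -` A \<inter> space M | t A. t \<in> orthant \<and> A \<in> sets borel} \<subseteq> Pow (space M)" by auto
  thus "sets sheet_algebra = process_events M orthant W" "space sheet_algebra = space M"
    unfolding sheet_algebra_def process_events_def by (simp_all add: sets_measure_of space_measure_of)
qed

lemma W_measurable: "t \<in> orthant \<Longrightarrow> W t \<in> borel_measurable sheet_algebra"
  by (rule measurableI) (auto simp: sheet_algebra_sets process_events_def intro!: sigma_sets.Basic)

lemma sheet_algebra_sub: "sets sheet_algebra \<subseteq> sets M"
  using bspec[OF conjunct1[OF all_indep[unfolded indep_sets_def]], of None] by (simp add: sheet_algebra_sets)

lemma id_measurable: "(\<lambda>\<omega>. \<omega>) \<in> measurable M sheet_algebra"
proof (rule measurableI)
  fix A assume A: "A \<in> sets sheet_algebra"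
  hence "A \<subseteq> space M" using sets.sets_into_space by fastforce
  hence "(\<lambda>\<omega>. \<omega>) -` A \<inter> space M = A" by auto
  thus "(\<lambda>\<omega>. \<omega>) -` A \<inter> space M \<in> sets M" using A sheet_algebra_sub by auto
qed simp

text \<open>The independent family indexed by \<open>None\<close> and \<open>Some i\<close> is
  grouped into two blocks, all clocks and the sheet. Independent generated algebras make the law of
  the pair (clocks, \<omega>) a product.\<close>

lemma Lam_sheet_distr:
  assumes t: "t \<in> orthant"
  shows "distr M (borel \<Otimes>\<^sub>M sheet_algebra) (\<lambda>\<omega>. (Lam t \<omega>, \<omega>))
    = distr M borel (Lam t) \<Otimes>\<^sub>M distr M sheet_algebra (\<lambda>\<omega>. \<omega>)"
proof -
  define E where "E = (\<lambda>c. case c of None \<Rightarrow> process_events M orthant W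
           | Some i \<Rightarrow> process_events M {0..} (inverse_process (Ls i)))"
  \<comment> \<open>\<open>True\<close> stands for the block of clocks, \<open>False\<close> for the
    sheet, in accordance with the two-valued index behind \<open>indep_set\<close>.\<close>
  define I :: "bool \<Rightarrow> 'n option set" where "I = (\<lambda>b. if b then range Some else {None})"
  define S where "S = (\<lambda>b. sigma_sets (space M) (\<Union>c\<in>I b. E c))"
  have sub: "E c \<subseteq> Pow (space M)" for c
    unfolding E_def process_events_def by (auto split: option.splits dest: sigma_sets_into_sp[rotated])
  have "(\<Union>b. I b) = UNIV" by (auto simp: I_def) (metis not_None_eq rangeI)
  hence "indep_sets E (\<Union>b\<in>UNIV. I b)" using all_indep by (simp add: E_def)
  hence indep: "indep_sets S UNIV"
    unfolding S_def
  proof (rule indep_sets_collect_sigma)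
    show "Int_stable (E c)" for c
    proof -
      have "sigma_algebra (space M) (E c)"
        unfolding E_def process_events_def by (auto split: option.splits intro!: sigma_algebra_sigma_sets)
      then interpret sa: sigma_algebra "space M" "E c" .
      show ?thesis by (auto simp: Int_stable_def)
    qed
    show "disjoint_family_on I UNIV" by (auto simp: disjoint_family_on_def I_def)
  qed
  define X where "X = sigma (space M) (\<Union>c\<in>I True. E c)"
  have Xs: "sets X = S True" "space X = space M"
  proof -
    have "(\<Union>c\<in>I True. E c) \<subseteq> Pow (space M)" using sub by blast
    thus "sets X = S True" "space X = space M" unfolding X_def S_def by (simp_all add: sets_measure_of space_measure_of)
  qed
  have "inverse_process (Ls i) (t $ i) \<in> borel_measurable X" for i
  proof (rule measurableI)
    fix A :: "real set" assume A: "A \<in> sets borel"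
    have "inverse_process (Ls i) (t $ i) -` A \<inter> space M \<in> E (Some i)"
      unfolding E_def process_events_def using A t by (auto simp: orthant_def intro!: sigma_sets.Basic)
    thus "inverse_process (Ls i) (t $ i) -` A \<inter> space X \<in> sets X"
      unfolding Xs S_def by (intro sigma_sets.Basic) (auto simp: I_def)
  qed simp
  hence LX: "Lam t \<in> borel_measurable X" unfolding Lam_def[abs_def] by measurable
  have "indep_set (sigma_sets (space M) {Lam t -` A \<inter> space M |A. A \<in> sets borel})
     (sigma_sets (space M) {(\<lambda>\<omega>. \<omega>) -` A \<inter> space M |A. A \<in> sets sheet_algebra})"
    unfolding indep_set_def
  proof (rule indep_sets_mono_sets[OF indep])
    fix b :: bool
    have 1: "sigma_sets (space M) {Lam t -` A \<inter> space M |A. A \<in> sets borel} \<subseteq> S True"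
      unfolding S_def
    proof (rule sigma_sets_mono, safe)
      fix A :: "(real^'n) set" assume "A \<in> sets borel"
      from measurable_sets[OF LX this] show "Lam t -` A \<inter> space M \<in> sigma_sets (space M) (\<Union>c\<in>I True. E c)"
        by (simp add: Xs S_def)
    qed
    have 2: "sigma_sets (space M) {(\<lambda>\<omega>. \<omega>) -` A \<inter> space M |A. A \<in> sets sheet_algebra} \<subseteq> S False"
      unfolding S_def
    proof (rule sigma_sets_mono, safe)
      fix A assume A: "A \<in> sets sheet_algebra"
      hence "A \<subseteq> space M" using sets.sets_into_space by fastforce
      hence "(\<lambda>\<omega>. \<omega>) -` A \<inter> space M = A" by auto
      thus "(\<lambda>\<omega>. \<omega>) -` A \<inter> space M \<in> sigma_sets (space M) (\<Union>c\<in>I False. E c)"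
        using A by (intro sigma_sets.Basic) (auto simp: I_def E_def sheet_algebra_sets)
    qed
    from 1 2 show "(case b of True \<Rightarrow> sigma_sets (space M) {Lam t -` A \<inter> space M |A. A \<in> sets borel}
       | False \<Rightarrow> sigma_sets (space M) {(\<lambda>\<omega>. \<omega>) -` A \<inter> space M |A. A \<in> sets sheet_algebra}) \<subseteq> S b"
      by (cases b) simp_all
  qed
  note ind = indep_setD[OF this]
  interpret A: prob_space "distr M sheet_algebra (\<lambda>\<omega>. \<omega>)" by (rule prob_space_distr[OF id_measurable])
  interpret B: prob_space "distr M borel (Lam t)" by (rule prob_space_distr) simp
  note [measurable] = id_measurable
  show ?thesis
  proof (rule pair_measure_eqI[symmetric])
    fix A B assume "A \<in> sets (distr M borel (Lam t))" "B \<in> sets (distr M sheet_algebra (\<lambda>\<omega>. \<omega>))"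
    hence AB: "A \<in> sets borel" "B \<in> sets sheet_algebra" by auto
    hence AB' [measurable]: "A \<times> B \<in> sets (borel \<Otimes>\<^sub>M sheet_algebra)" by auto
    have eq: "(\<lambda>\<omega>. (Lam t \<omega>, \<omega>)) -` (A \<times> B) \<inter> space M = (Lam t -` A \<inter> space M) \<inter> ((\<lambda>\<omega>. \<omega>) -` B \<inter> space M)" by auto
    have "prob ((Lam t -` A \<inter> space M) \<inter> ((\<lambda>\<omega>. \<omega>) -` B \<inter> space M))
        = prob (Lam t -` A \<inter> space M) * prob ((\<lambda>\<omega>. \<omega>) -` B \<inter> space M)"
      using AB by (intro ind sigma_sets.Basic) auto
    moreover have "emeasure (distr M (borel \<Otimes>\<^sub>M sheet_algebra) (\<lambda>\<omega>. (Lam t \<omega>, \<omega>))) (A \<times> B)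
       = emeasure M ((Lam t -` A \<inter> space M) \<inter> ((\<lambda>\<omega>. \<omega>) -` B \<inter> space M))"
      unfolding eq[symmetric] by (rule emeasure_distr) (use AB' in auto)
    moreover have "emeasure (distr M borel (Lam t)) A = emeasure M (Lam t -` A \<inter> space M)"
      using AB by (intro emeasure_distr) auto
    moreover have "emeasure (distr M sheet_algebra (\<lambda>\<omega>. \<omega>)) B = emeasure M ((\<lambda>\<omega>. \<omega>) -` B \<inter> space M)"
      using AB by (intro emeasure_distr id_measurable)
    ultimately show "emeasure (distr M borel (Lam t)) A * emeasure (distr M sheet_algebra (\<lambda>\<omega>. \<omega>)) B
      = emeasure (distr M (borel \<Otimes>\<^sub>M sheet_algebra) (\<lambda>\<omega>. (Lam t \<omega>, \<omega>))) (A \<times> B)"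
      by (simp add: emeasure_eq_measure ennreal_mult)
  qed (auto intro: A.sigma_finite_measure_axioms B.sigma_finite_measure_axioms cong: sets_pair_measure_cong)
qed

lemma W_continuous:
  assumes "\<omega> \<in> space M"
  shows "continuous_on orthant (\<lambda>t. W t \<omega>)"
proof -
  have "continuous_on orthant (\<lambda>t. W t \<omega> $ k)" for k
    using isl assms by (auto simp: isl_sheet_def brownian_sheet_vec_def brownian_sheet_def)
  hence "continuous_on orthant (\<lambda>t. \<chi> k. W t \<omega> $ k)" by (rule continuous_on_vec_lambda)
  thus ?thesis by simp
qed

text \<open>Rounding the times down to the grid of mesh 1/(k+1) gives countably many sheet
  variables, hence measurable maps, and continuity of the paths passes to the limit. Clipping at 0
  is needed because W is controlled only on the orthant.\<close>

lemma W_joint_measurable: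
  "(\<lambda>p. W (\<chi> i. max 0 (fst p $ i)) (snd p)) \<in> borel_measurable (borel \<Otimes>\<^sub>M sheet_algebra)"
proof -
  define ix where "ix = (\<lambda>(k::nat) (p :: (real^'n) \<times> 'w) i. \<lfloor>real (Suc k) * max 0 (fst p $ i)\<rfloor>)"
  define node where "node = (\<lambda>(k::nat) (c :: 'n \<Rightarrow> int). (\<chi> i. max 0 (real_of_int (c i) / real (Suc k))) :: real^'n)"
  have node_orthant: "node k c \<in> orthant" for k c by (simp add: node_def orthant_def)
  have ixm: "ix k \<in> measurable (borel \<Otimes>\<^sub>M sheet_algebra) (count_space UNIV)" for k
  proof (subst measurable_count_space_eq2_countable, safe)
    fix a :: "'n \<Rightarrow> int"
    have "ix k -` {a} \<inter> space (borel \<Otimes>\<^sub>M sheet_algebra)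
       = {p \<in> space (borel \<Otimes>\<^sub>M sheet_algebra). \<forall>i\<in>UNIV. \<lfloor>real (Suc k) * max 0 (fst p $ i)\<rfloor> = a i}"
      by (auto simp: ix_def)
    also have "\<dots> \<in> sets (borel \<Otimes>\<^sub>M sheet_algebra)"
      by measurable
    finally show "ix k -` {a} \<inter> space (borel \<Otimes>\<^sub>M sheet_algebra) \<in> sets (borel \<Otimes>\<^sub>M sheet_algebra)" .
  qed auto
  have approx: "(\<lambda>p. W (node k (ix k p)) (snd p)) \<in> borel_measurable (borel \<Otimes>\<^sub>M sheet_algebra)" for k
  proof (rule measurable_compose_countable'[OF _ ixm])
    show "(\<lambda>p. W (node k c) (snd p)) \<in> borel_measurable (borel \<Otimes>\<^sub>M sheet_algebra)" for c
      by (rule measurable_compose[OF measurable_snd W_measurable[OF node_orthant]])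
  qed simp
  show ?thesis
  proof (rule borel_measurable_LIMSEQ_metric[OF approx])
    fix p :: "(real^'n) \<times> 'w" assume p: "p \<in> space (borel \<Otimes>\<^sub>M sheet_algebra)"
    hence \<omega>: "snd p \<in> space M" by (auto simp: space_pair_measure)
    let ?l = "\<chi> i. max 0 (fst p $ i)"
    have "(\<lambda>k. node k (ix k p)) \<longlonglongrightarrow> ?l"
    proof (rule vec_tendstoI)
      fix i
      define c where "c = max 0 (fst p $ i)"
      have c: "0 \<le> c" by (simp add: c_def)
      have eq: "node k (ix k p) $ i = real_of_int \<lfloor>real (Suc k) * c\<rfloor> / real (Suc k)" for k
        using c by (simp add: node_def ix_def c_def[symmetric])
      have "\<bar>node k (ix k p) $ i - c\<bar> \<le> 1 / real (Suc k)" for k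
      proof -
        have "\<bar>real_of_int \<lfloor>real (Suc k) * c\<rfloor> - real (Suc k) * c\<bar> \<le> 1" by linarith
        hence "\<bar>real_of_int \<lfloor>real (Suc k) * c\<rfloor> - real (Suc k) * c\<bar> / real (Suc k) \<le> 1 / real (Suc k)"
          by (intro divide_right_mono) auto
        moreover have "real_of_int \<lfloor>real (Suc k) * c\<rfloor> / real (Suc k) - c = (real_of_int \<lfloor>real (Suc k) * c\<rfloor> - real (Suc k) * c) / real (Suc k)"
          by (simp add: diff_divide_distrib del: of_nat_Suc)
        ultimately show ?thesis unfolding eq by (simp add: abs_divide del: of_nat_Suc)
      qed
      hence "(\<lambda>k. node k (ix k p) $ i - c) \<longlonglongrightarrow> 0"
        by (intro Lim_null_comparison[OF _ LIMSEQ_Suc[OF lim_1_over_n]] always_eventually) auto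
      thus "(\<lambda>k. node k (ix k p) $ i) \<longlonglongrightarrow> ?l $ i"
        by (simp add: LIM_zero_iff c_def)
    qed
    moreover have "?l \<in> orthant" by (simp add: orthant_def)
    ultimately show "(\<lambda>k. W (node k (ix k p)) (snd p)) \<longlonglongrightarrow> W ?l (snd p)"
      using W_continuous[OF \<omega>] node_orthant by (auto simp: continuous_on_sequentially comp_def)
  qed
qed

text \<open>The covariance on the diagonal is the product of the coordinates of t, and the space
  coordinates are independent; once the clocks are frozen this one-time marginal is all that
  enters.\<close>

lemma W_distr:
  assumes t: "t \<in> orthant"
  shows "distr M borel (W t) = distr gauss borel (\<lambda>z. sqrt (\<Prod>i\<in>UNIV. t $ i) *\<^sub>R z)"
proof -
  define v where "v = (\<Prod>i\<in>UNIV. t $ i)"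
  have v: "0 \<le> v" unfolding v_def using t by (intro prod_nonneg) (auto simp: orthant_def)
  have bs: "brownian_sheet M (\<lambda>t \<omega>. W t \<omega> $ k)" for k
    using isl by (simp add: isl_sheet_def brownian_sheet_vec_def)
  have Wm: "W t \<in> borel_measurable M"
    using measurable_compose[OF id_measurable W_measurable[OF t]] by simp
  have law: "distr M borel (\<lambda>\<omega>. W t \<omega> $ k) = distr std_normal borel (\<lambda>x. sqrt v * x)" for k
  proof (rule centered_gaussian_distr[OF prob_space_axioms _ v])
    have "centered_gaussian M (\<lambda>\<omega>. \<Sum>s\<in>{t}. 1 * (W s \<omega> $ k))
          (\<Sum>s\<in>{t}. \<Sum>r\<in>{t}. 1 * 1 * (\<Prod>i\<in>UNIV. min (s $ i) (r $ i)))"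
      using bs[of k] t unfolding brownian_sheet_def by (elim conjE allE[of _ "{t}"] allE[of _ "\<lambda>_. 1"]) auto
    thus "centered_gaussian M (\<lambda>\<omega>. W t \<omega> $ k) v" by (simp add: v_def)
  qed (use Wm in measurable)
  have "indep_vars (\<lambda>_. borel) (\<lambda>k \<omega>. W t \<omega> $ k) UNIV"
    using isl t Wm by (intro process_events_indep_vars[where T = orthant and X = "\<lambda>k t \<omega>. W t \<omega> $ k" and t = "\<lambda>_. t"])
      (auto simp: isl_sheet_def brownian_sheet_vec_def)
  hence "distr M (\<Pi>\<^sub>M k\<in>(UNIV :: 'd set). borel) (\<lambda>\<omega>. \<lambda>k\<in>UNIV. W t \<omega> $ k)
      = (\<Pi>\<^sub>M k\<in>UNIV. distr M borel (\<lambda>\<omega>. W t \<omega> $ k))"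
    using Wm by (subst (asm) indep_vars_iff_distr_eq_PiM) auto
  also have "\<dots> = (\<Pi>\<^sub>M k\<in>UNIV. distr std_normal borel (\<lambda>x. sqrt v * x))" by (simp only: law)
  also have "\<dots> = distr (\<Pi>\<^sub>M k\<in>UNIV. std_normal) (\<Pi>\<^sub>M k\<in>(UNIV :: 'd set). borel) (\<lambda>y k. sqrt v * y k)"
    by (rule distr_PiM_componentwise[symmetric]) (auto intro: prob_space_std_normal)
  finally have eq: "distr M (\<Pi>\<^sub>M k\<in>(UNIV :: 'd set). borel) (\<lambda>\<omega> k. W t \<omega> $ k)
      = distr (\<Pi>\<^sub>M k\<in>UNIV. std_normal) (\<Pi>\<^sub>M k\<in>(UNIV :: 'd set). borel) (\<lambda>y k. sqrt v * y k)" by (simp add: restrict_UNIV)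
  have "distr M borel (W t) = distr (distr M (\<Pi>\<^sub>M k\<in>(UNIV :: 'd set). borel) (\<lambda>\<omega> k. W t \<omega> $ k)) borel (\<lambda>f. \<chi> k. f k)"
    using Wm by (subst distr_distr) (auto simp: comp_def intro!: measurable_PiM_single')
  also have "\<dots> = distr (\<Pi>\<^sub>M k\<in>(UNIV :: 'd set). std_normal) borel (\<lambda>y. \<chi> k. sqrt v * y k)"
    unfolding eq by (subst distr_distr) (auto simp: comp_def intro!: measurable_PiM_single')
  also have "\<dots> = distr gauss borel (\<lambda>z. sqrt v *\<^sub>R z)"
    unfolding gauss_eq_distr_PiM by (subst distr_distr) (auto simp: comp_def vec_eq_iff intro!: distr_cong)
  finally show ?thesis by (simp add: v_def)
qed

text \<open>Conditioning on the clocks: under the product law their value \<tau> can be fixed while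
  W \<tau> is integrated. Nonnegative integrands come first because they need no
  integrability.\<close>

lemma sheet_nn_integral:
  assumes t: "t \<in> orthant" and h [measurable]: "h \<in> borel_measurable (borel \<Otimes>\<^sub>M borel)"
  shows "(\<integral>\<^sup>+\<omega>. h (Lam t \<omega>, W (Lam t \<omega>) \<omega>) \<partial>M)
    = (\<integral>\<^sup>+\<tau>. (\<integral>\<^sup>+z. h (\<tau>, sqrt (\<Prod>i\<in>UNIV. \<tau> $ i) *\<^sub>R z) \<partial>gauss) \<partial>distr M borel (Lam t))"
proof -
  define \<Phi> where "\<Phi> = (\<lambda>p. W (\<chi> i. max 0 (fst p $ i)) (snd p))"
  have [measurable]: "\<Phi> \<in> borel_measurable (borel \<Otimes>\<^sub>M sheet_algebra)" unfolding \<Phi>_def by (rule W_joint_measurable)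
  note [measurable] = id_measurable
  interpret A: prob_space "distr M sheet_algebra (\<lambda>\<omega>. \<omega>)" by (rule prob_space_distr[OF id_measurable])
  have clip: "(\<chi> i. max 0 (\<tau> $ i)) = \<tau>" if "\<tau> \<in> orthant" for \<tau> :: "real^'n"
    using that by (simp add: orthant_def vec_eq_iff)
  have "(\<integral>\<^sup>+\<omega>. h (Lam t \<omega>, W (Lam t \<omega>) \<omega>) \<partial>M) = (\<integral>\<^sup>+\<omega>. h (Lam t \<omega>, \<Phi> (Lam t \<omega>, \<omega>)) \<partial>M)"
    by (intro nn_integral_cong) (simp add: \<Phi>_def clip Lam_orthant)
  also have "\<dots> = (\<integral>\<^sup>+p. h (fst p, \<Phi> p) \<partial>distr M (borel \<Otimes>\<^sub>M sheet_algebra) (\<lambda>\<omega>. (Lam t \<omega>, \<omega>)))"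
    by (subst nn_integral_distr) auto
  also have "\<dots> = (\<integral>\<^sup>+\<tau>. (\<integral>\<^sup>+\<omega>. h (\<tau>, \<Phi> (\<tau>, \<omega>)) \<partial>distr M sheet_algebra (\<lambda>\<omega>. \<omega>)) \<partial>distr M borel (Lam t))"
    unfolding Lam_sheet_distr[OF t] by (subst A.nn_integral_fst[symmetric]) auto
  also have "\<dots> = (\<integral>\<^sup>+\<tau>. (\<integral>\<^sup>+z. h (\<tau>, sqrt (\<Prod>i\<in>UNIV. \<tau> $ i) *\<^sub>R z) \<partial>gauss) \<partial>distr M borel (Lam t))"
  proof (rule nn_integral_cong_AE)
    have om: "orthant \<in> sets (borel :: (real^'n) measure)"
    proof -
      have "orthant = {t :: real^'n. \<forall>i\<in>UNIV. 0 \<le> t $ i}" by (simp add: orthant_def)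
      also have "\<dots> \<in> sets borel" by measurable
      finally show ?thesis .
    qed
    have "AE \<tau> in distr M borel (Lam t). \<tau> \<in> orthant"
      using om by (subst AE_distr_iff) (auto intro!: AE_I2 Lam_orthant)
    thus "AE \<tau> in distr M borel (Lam t). (\<integral>\<^sup>+\<omega>. h (\<tau>, \<Phi> (\<tau>, \<omega>)) \<partial>distr M sheet_algebra (\<lambda>\<omega>. \<omega>))
        = (\<integral>\<^sup>+z. h (\<tau>, sqrt (\<Prod>i\<in>UNIV. \<tau> $ i) *\<^sub>R z) \<partial>gauss)"
    proof eventually_elim
      case (elim \<tau>)
      have Wm: "W \<tau> \<in> borel_measurable M"
        using measurable_compose[OF id_measurable W_measurable[OF elim]] by simp
      note [measurable] = W_measurable[OF elim]
      have "(\<integral>\<^sup>+\<omega>. h (\<tau>, \<Phi> (\<tau>, \<omega>)) \<partial>distr M sheet_algebra (\<lambda>\<omega>. \<omega>)) = (\<integral>\<^sup>+\<omega>. h (\<tau>, W \<tau> \<omega>) \<partial>M)"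
        by (subst nn_integral_distr) (auto simp: \<Phi>_def clip[OF elim])
      also have "\<dots> = (\<integral>\<^sup>+w. h (\<tau>, w) \<partial>distr M borel (W \<tau>))"
        using Wm by (subst nn_integral_distr) auto
      also have "\<dots> = (\<integral>\<^sup>+z. h (\<tau>, sqrt (\<Prod>i\<in>UNIV. \<tau> $ i) *\<^sub>R z) \<partial>gauss)"
        unfolding W_distr[OF elim] by (subst nn_integral_distr) auto
      finally show ?case .
    qed
  qed
  finally show ?thesis .
qed

end

section \<open>Averages over the random clocks\<close>

text \<open>Binomial expansion of the last factor leaves powers of w with exponents k + i and k + i
  - a, all above -1.\<close>

lemma powr_weight_integrable:
  fixes N :: "real measure"
  assumes [measurable_cong]: "sets N = sets borel" and pos: "AE w in N. 0 < w"
    and int: "\<And>c. -1 < c \<Longrightarrow> integrable N (\<lambda>w. w powr c)" and a: "a < 1"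
  shows "integrable N (\<lambda>w. w ^ k * (1 + w powr - a) * (1 + w) ^ p)"
proof -
  let ?F = "\<lambda>w::real. \<Sum>i\<le>p. real (p choose i) * (w powr real (k + i) + w powr (real (k + i) - a))"
  have "integrable N ?F"
    using a by (intro Bochner_Integration.integrable_sum integrable_mult_right Bochner_Integration.integrable_add int) auto
  moreover have "AE w in N. ?F w = w ^ k * (1 + w powr - a) * (1 + w) ^ p"
    using pos
  proof eventually_elim
    case (elim w)
    have eq: "w powr real (k + i) + w powr (real (k + i) - a) = w ^ k * (1 + w powr - a) * w ^ i" for i
    proof -
      have "w powr (real (k + i) + - a) = w ^ (k + i) * w powr - a" using elim by (simp only: powr_add powr_realpow)
      moreover have "w powr real (k + i) = w ^ (k + i)" using elim by (simp only: powr_realpow)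
      ultimately show ?thesis by (simp add: power_add algebra_simps)
    qed
    have "(1 + w) ^ p = (\<Sum>i\<le>p. real (p choose i) * w ^ i)"
      using binomial_ring[of w 1 p] by (simp add: add.commute)
    thus ?case unfolding eq by (simp only: sum_distrib_left mult_ac)
  qed
  ultimately show ?thesis
    by (subst integrable_cong_AE[where g = ?F]) (auto elim: eventually_mono)
qed

lemma (in pair_sigma_finite) integrable_product:
  fixes F :: "'a \<Rightarrow> real" and H :: "'b \<Rightarrow> real"
  assumes F: "integrable M1 F" and H: "integrable M2 H"
  shows "integrable (M1 \<Otimes>\<^sub>M M2) (\<lambda>p. F (fst p) * H (snd p))"
proof (rule Fubini_integrable)
  have [measurable]: "F \<in> borel_measurable M1" "H \<in> borel_measurable M2" using F H by auto
  show "(\<lambda>p. F (fst p) * H (snd p)) \<in> borel_measurable (M1 \<Otimes>\<^sub>M M2)" by measurable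
  show "integrable M1 (\<lambda>x. \<integral>y. norm (F (fst (x, y)) * H (snd (x, y))) \<partial>M2)"
    using F by (simp add: abs_mult)
  show "AE x in M1. integrable M2 (\<lambda>y. F (fst (x, y)) * H (snd (x, y)))"
    using H by simp
qed

text \<open>Tameness says nothing about \<sigma> <= 0; the cutoff yields a function measurable in
  all real \<sigma>, and the random arguments are positive almost surely.\<close>

definition cutoff :: "(real \<Rightarrow> real^'d::finite \<Rightarrow> real) \<Rightarrow> real \<Rightarrow> real^'d \<Rightarrow> real" where
  "cutoff G \<sigma> x = (if 0 < \<sigma> then G \<sigma> x else 0)"

lemma cutoff_pos [simp]: "0 < \<sigma> \<Longrightarrow> cutoff G \<sigma> x = G \<sigma> x"
  by (simp add: cutoff_def)

lemma tame_continuous_compose: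
  assumes G: "tame a G" and "continuous_on S s" "continuous_on S X" and pos: "\<And>y. y \<in> S \<Longrightarrow> 0 < s y"
  shows "continuous_on S (\<lambda>y. G (s y) (X y))"
proof -
  have c: "continuous_on ({0<..} \<times> UNIV) (\<lambda>(\<sigma>, x). G \<sigma> x)" using G by (simp add: tame_def)
  have "continuous_on S ((\<lambda>(\<sigma>, x). G \<sigma> x) \<circ> (\<lambda>y. (s y, X y)))"
    by (rule continuous_on_compose[OF continuous_on_Pair[OF assms(2,3)] continuous_on_subset[OF c]]) (use pos in auto)
  thus ?thesis by (simp add: comp_def)
qed

lemma tame_cutoff_measurable:
  assumes "tame a G"
  shows "(\<lambda>\<sigma>. cutoff G \<sigma> x) \<in> borel_measurable borel"
proof -
  have "continuous_on {0<..} (\<lambda>\<sigma>. G \<sigma> x)"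
    by (rule tame_continuous_compose[OF assms]) (auto intro!: continuous_intros)
  hence "(\<lambda>\<sigma>. indicat_real {0<..} \<sigma> *\<^sub>R G \<sigma> x) \<in> borel_measurable borel"
    by (intro borel_measurable_continuous_on_indicator) auto
  moreover have "(\<lambda>\<sigma>. indicat_real {0<..} \<sigma> *\<^sub>R G \<sigma> x) = (\<lambda>\<sigma>. cutoff G \<sigma> x)" by (auto simp: cutoff_def)
  ultimately show ?thesis by simp
qed

text \<open>The inequality 1 + ABD <= (1 + A)(1 + B)(1 + D) for nonnegative numbers splits the
  singular factor between s, w and y, and the growth factor splits likewise. The result is a
  constant in the parameters times one function of (w, y), so a single integrable weight serves for
  a whole compact range.\<close>

lemma tame_weight_bound:
  assumes G: "\<And>\<sigma> x. 0 < \<sigma> \<Longrightarrow> \<bar>G \<sigma> x\<bar> \<le> tame_bnd C a p \<sigma> x" and C: "0 \<le> C" and a: "0 \<le> a"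
    and b: "0 < l" "l \<le> s" "s \<le> h" "0 \<le> \<theta>" "\<theta> \<le> h" "norm x \<le> R" and w: "0 < w" "0 < y"
  shows "\<bar>(\<theta> * w) ^ k * G (s * (w * y)) x\<bar> \<le> (h ^ k * C * (1 + l powr - a) * (1 + R + h) ^ p) *
    ((w ^ k * (1 + w powr - a) * (1 + w) ^ p) * (y ^ 0 * (1 + y powr - a) * (1 + y) ^ p))"
proof -
  have s: "0 < s" and h: "0 < h" and R: "0 \<le> R" using b norm_ge_zero[of x] by linarith+
  have 1: "(\<theta> * w) ^ k \<le> h ^ k * w ^ k"
    unfolding power_mult_distrib using b w by (intro mult_right_mono power_mono) auto
  have 2: "1 + (s * (w * y)) powr - a \<le> (1 + l powr - a) * ((1 + w powr - a) * (1 + y powr - a))"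
  proof -
    have "s powr - a \<le> l powr - a" using b a by (intro powr_mono2') auto
    hence "(s * (w * y)) powr - a \<le> l powr - a * (w powr - a * y powr - a)"
      using s w by (simp add: powr_mult mult_right_mono)
    moreover have "1 + A * (B * D) \<le> (1 + A) * ((1 + B) * (1 + D))" if "0 \<le> A" "0 \<le> B" "0 \<le> D" for A B D :: real
      using that by (simp add: algebra_simps)
    ultimately show ?thesis by (meson add_left_mono order_trans powr_ge_zero)
  qed
  have 3: "(1 + norm x + s * (w * y)) ^ p \<le> (1 + R + h) ^ p * ((1 + w) ^ p * (1 + y) ^ p)"
  proof -
    have wy: "0 \<le> w * y" using w by simp
    have "1 + norm x + s * (w * y) \<le> 1 + R + h * (w * y)"
      using b w by (intro add_mono mult_right_mono) auto
    also have "\<dots> \<le> (1 + R + h) * (1 + w * y)"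
      using R h mult_nonneg_nonneg[OF R wy] wy by (simp add: algebra_simps)
    also have "\<dots> \<le> (1 + R + h) * ((1 + w) * (1 + y))"
      using R h w by (intro mult_left_mono) (auto simp: algebra_simps)
    finally have "(1 + norm x + s * (w * y)) ^ p \<le> ((1 + R + h) * ((1 + w) * (1 + y))) ^ p"
      using s wy by (intro power_mono) auto
    thus ?thesis by (simp only: power_mult_distrib)
  qed
  have "\<bar>(\<theta> * w) ^ k * G (s * (w * y)) x\<bar> = (\<theta> * w) ^ k * \<bar>G (s * (w * y)) x\<bar>"
    using b w by (simp add: abs_mult)
  also have "\<dots> \<le> (\<theta> * w) ^ k * (C * ((1 + (s * (w * y)) powr - a) * (1 + norm x + s * (w * y)) ^ p))"
    using b w s by (intro mult_left_mono G) auto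
  also have "\<dots> \<le> (h ^ k * w ^ k) * (C * (((1 + l powr - a) * ((1 + w powr - a) * (1 + y powr - a))) *
      ((1 + R + h) ^ p * ((1 + w) ^ p * (1 + y) ^ p))))"
    using b w s h C by (intro mult_mono 1 2 3 mult_left_mono mult_nonneg_nonneg zero_le_power add_nonneg_nonneg) auto
  finally show ?thesis by (simp only: mult_ac power_0 mult_1)
qed

lemma add_power_le:
  fixes R r :: real
  assumes "0 \<le> R" "0 \<le> r"
  shows "(1 + R + r) ^ p \<le> (1 + R) ^ p * (1 + r) ^ p"
  unfolding power_mult_distrib[symmetric] using assms by (intro power_mono) (auto simp: algebra_simps)

abbreviation bnd :: "nat \<Rightarrow> real \<Rightarrow> nat \<Rightarrow> real \<Rightarrow> real \<Rightarrow> real \<Rightarrow> real \<Rightarrow> real" where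
  "bnd k C p a l h R \<equiv> h ^ k * C * (1 + l powr - a) * (1 + R + h) ^ p"

section \<open>Averages over the j-th clock and the product of the others\<close>

locale mixing = subordinator M \<nu> \<beta> L for M :: "'w measure" and \<nu> \<beta> L +
  fixes \<rho> :: "real measure"
  assumes rho: "real_distribution \<rho>" and rho_pos: "AE w in \<rho>. 0 < w"
    and rho_powr: "\<And>c. -1 < c \<Longrightarrow> integrable \<rho> (\<lambda>w. w powr c)"
begin

abbreviation mix :: "(real \<times> real) measure" where "mix \<equiv> \<rho> \<Otimes>\<^sub>M inverse_law"

abbreviation mixture :: "nat \<Rightarrow> (real \<Rightarrow> real^'d::finite \<Rightarrow> real) \<Rightarrow> real \<Rightarrow> real \<Rightarrow> real^'d \<Rightarrow> real \<times> real \<Rightarrow> real" where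
  "mixture k G \<theta> \<tau> x q \<equiv> (\<theta> * fst q) ^ k * cutoff G (\<theta> * \<tau> * (fst q * snd q)) x"

abbreviation slice :: "nat \<Rightarrow> (real \<Rightarrow> real^'d::finite \<Rightarrow> real) \<Rightarrow> real \<Rightarrow> real^'d \<Rightarrow> real \<Rightarrow> real \<Rightarrow> real" where
  "slice k G \<theta> x r w \<equiv> (\<theta> * w) ^ k * cutoff G (\<theta> * r * w) x"

text \<open>The common form of the sheet functionals: \<open>fst q\<close> stands for the product of
  the normalised clocks other than the j-th, \<open>snd q\<close> for the j-th one, \<theta> and
  \<tau> carry the times, and k counts the factors of the other clocks.\<close>

definition avg :: "nat \<Rightarrow> (real \<Rightarrow> real^'d::finite \<Rightarrow> real) \<Rightarrow> real \<Rightarrow> real \<Rightarrow> real^'d \<Rightarrow> real" where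
  "avg k G \<theta> \<tau> x = (\<integral>p. mixture k G \<theta> \<tau> x p \<partial>mix)"

sublocale R: real_distribution \<rho> by (rule rho)
sublocale P: pair_prob_space \<rho> inverse_law ..

lemma mix_pos: "AE p in mix. 0 < fst p \<and> 0 < snd p"
proof (rule P.AE_pair_measure)
  show "{p \<in> space mix. 0 < fst p \<and> 0 < snd p} \<in> sets mix" by measurable
  show "AE w in \<rho>. AE y in inverse_law. 0 < fst (w, y) \<and> 0 < snd (w, y)"
    using rho_pos by eventually_elim (use inverse_law_pos in auto)
qed

definition weight :: "nat \<Rightarrow> real \<Rightarrow> nat \<Rightarrow> real \<times> real \<Rightarrow> real" where
  "weight k a p q = (fst q ^ k * (1 + fst q powr - a) * (1 + fst q) ^ p) * (snd q ^ 0 * (1 + snd q powr - a) * (1 + snd q) ^ p)"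

lemma weight_integrable: "a < 1 \<Longrightarrow> integrable mix (weight k a p)"
  unfolding weight_def
  by (intro P.integrable_product powr_weight_integrable rho_pos inverse_law_pos rho_powr inverse_law_powr_integrable) auto

lemma avg_measurable:
  assumes "tame a G"
  shows "(\<lambda>p. mixture k G \<theta> \<tau> x p) \<in> borel_measurable mix"
proof -
  note [measurable] = tame_cutoff_measurable[OF assms]
  show ?thesis by measurable
qed

abbreviation mix_bound :: "nat \<Rightarrow> (real \<Rightarrow> real^'d::finite \<Rightarrow> real) \<Rightarrow> real \<Rightarrow> real \<Rightarrow> nat \<Rightarrow> real \<Rightarrow> real \<Rightarrow> real \<Rightarrow> bool" where
  "mix_bound k G a C p l h R \<equiv> AE q in mix. \<forall>\<theta> \<tau> x. l \<le> \<theta> * \<tau> \<longrightarrow> \<theta> * \<tau> \<le> h \<longrightarrow> 0 \<le> \<theta> \<longrightarrow> \<theta> \<le> h \<longrightarrow> norm x \<le> R \<longrightarrow>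
    \<bar>mixture k G \<theta> \<tau> x q\<bar> \<le> bnd k C p a l h R * weight k a p q"

text \<open>The exceptional null set is chosen before the parameters, since differentiation under
  the integral needs the bound for a whole interval of parameters at once.\<close>

lemma avg_dominated:
  assumes G: "tame a G" and a: "0 \<le> a"
  obtains C p where "0 \<le> C" "\<And>l h R. 0 < l \<Longrightarrow> 0 \<le> R \<Longrightarrow> mix_bound k G a C p l h R"
proof -
  obtain C p where C: "0 \<le> C" "\<And>\<sigma> x. 0 < \<sigma> \<Longrightarrow> \<bar>G \<sigma> x\<bar> \<le> tame_bnd C a p \<sigma> x"
    using G by (auto simp: tame_def)
  show ?thesis
  proof (rule that[OF C(1)])
    fix l h R :: real assume l: "0 < l" "0 \<le> R"
    show "mix_bound k G a C p l h R"
      using mix_pos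
    proof (eventually_elim, intro allI impI)
      fix q :: "real \<times> real" and \<theta> \<tau> :: real and x :: "real^'a"
      assume *: "0 < fst q \<and> 0 < snd q" "l \<le> \<theta> * \<tau>" "\<theta> * \<tau> \<le> h" "0 \<le> \<theta>" "\<theta> \<le> h" "norm x \<le> R"
      hence "0 < \<theta> * \<tau>" using l by linarith
      hence 0: "0 < \<theta> * \<tau> * (fst q * snd q)" using * by simp
      show "\<bar>mixture k G \<theta> \<tau> x q\<bar> \<le> bnd k C p a l h R * weight k a p q"
        unfolding weight_def cutoff_pos[OF 0] using * by (intro tame_weight_bound[OF C(2) C(1) a l(1)]) auto
    qed
  qed
qed

lemma avg_integrable:
  assumes G: "tame a G" and a: "0 \<le> a" "a < 1" and pos: "0 < \<theta>" "0 < \<tau>"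
  shows "integrable mix (\<lambda>p. mixture k G \<theta> \<tau> x p)"
proof -
  obtain C p where C: "0 \<le> C" "\<And>l h R. 0 < l \<Longrightarrow> 0 \<le> R \<Longrightarrow> mix_bound k G a C p l h R"
    by (rule avg_dominated[OF G a(1), of k]) blast
  show ?thesis
  proof (rule Bochner_Integration.integrable_bound)
    show "integrable mix (\<lambda>q. bnd k C p a (\<theta> * \<tau>) (max \<theta> (\<theta> * \<tau>)) (norm x) * weight k a p q)"
      by (intro integrable_mult_right weight_integrable a)
    show "AE q in mix. norm (mixture k G \<theta> \<tau> x q)
      \<le> norm (bnd k C p a (\<theta> * \<tau>) (max \<theta> (\<theta> * \<tau>)) (norm x) * weight k a p q)"
      using C(2)[of "\<theta> * \<tau>" "norm x" "max \<theta> (\<theta> * \<tau>)"] pos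
      by (auto elim!: eventually_mono intro: order_trans[OF _ abs_ge_self])
  qed (rule avg_measurable[OF G])
qed

lemma avg_continuous:
  fixes G :: "real \<Rightarrow> real^'d::finite \<Rightarrow> real"
  assumes G: "tame a G" and a: "0 \<le> a" "a < 1"
  shows "continuous_on ({0<..} \<times> {0<..} \<times> UNIV) (\<lambda>(\<theta>, \<tau>, x). avg k G \<theta> \<tau> x)"
proof -
  obtain C p where C: "0 \<le> C" "\<And>l h R. 0 < l \<Longrightarrow> 0 \<le> R \<Longrightarrow> mix_bound k G a C p l h R"
    by (rule avg_dominated[OF G a(1), of k]) blast
  let ?S = "({0<..} \<times> {0<..} \<times> UNIV) :: (real \<times> real \<times> (real^'d)) set"
  let ?F = "\<lambda>y q. (fst y * fst q) ^ k * cutoff G (fst y * fst (snd y) * (fst q * snd q)) (snd (snd y))"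
  have "continuous_on ?S (\<lambda>y. integral\<^sup>L mix (?F y))"
  proof (rule continuous_on_integral_dominated)
    show "?F y \<in> borel_measurable mix" for y by (rule avg_measurable[OF G])
    show "AE q in mix. continuous_on ?S (\<lambda>y. ?F y q)"
      using mix_pos
    proof eventually_elim
      case (elim q)
      have "continuous_on ?S (\<lambda>y. (fst y * fst q) ^ k * G (fst y * fst (snd y) * (fst q * snd q)) (snd (snd y)))"
        using elim by (intro continuous_on_mult continuous_on_power continuous_on_fst continuous_on_snd continuous_on_id
            continuous_on_const tame_continuous_compose[OF G]) auto
      moreover have "(fst y * fst q) ^ k * G (fst y * fst (snd y) * (fst q * snd q)) (snd (snd y)) = ?F y q" if "y \<in> ?S" for y
      proof -
        have "0 < fst y * fst (snd y)" using that by (cases y) auto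
        hence "0 < fst y * fst (snd y) * (fst q * snd q)" using elim by simp
        thus ?thesis by (simp only: cutoff_pos)
      qed
      ultimately show ?case by (rule continuous_on_eq)
    qed
  next
    fix y0 :: "real \<times> real \<times> (real^'d)" assume y0: "y0 \<in> ?S"
    define t0 where "t0 = fst y0" define s0 where "s0 = fst (snd y0)"
    have pos: "0 < t0" "0 < s0" using y0 by (auto simp: t0_def s0_def)
    define e where "e = min (t0 / 2) (s0 / 2)"
    have e: "0 < e" "e \<le> t0 / 2" "e \<le> s0 / 2" using pos by (auto simp: e_def)
    define h where "h = max (2 * t0) (4 * t0 * s0)"
    let ?w = "\<lambda>q. (h ^ k * C * (1 + (t0 * s0 / 4) powr - a) * (1 + (norm (snd (snd y0)) + e) + h) ^ p) * weight k a p q"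
    show "\<exists>e>0. \<exists>w. integrable mix w \<and> (\<forall>y\<in>?S. dist y y0 < e \<longrightarrow> (AE q in mix. \<bar>?F y q\<bar> \<le> w q))"
    proof (intro exI[of _ e] exI[of _ ?w] conjI ballI impI e)
      show "integrable mix ?w" by (intro integrable_mult_right weight_integrable a)
      fix y :: "real \<times> real \<times> (real^'d)" assume y: "y \<in> ?S" "dist y y0 < e"
      have d: "dist (fst y) t0 < e" "dist (fst (snd y)) s0 < e" "dist (snd (snd y)) (snd (snd y0)) < e"
        using y(2) dist_fst_le[of y y0] dist_snd_le[of y y0] dist_fst_le[of "snd y" "snd y0"] dist_snd_le[of "snd y" "snd y0"]
        by (auto simp: t0_def s0_def)
      hence b: "t0 / 2 \<le> fst y" "fst y \<le> 2 * t0" "s0 / 2 \<le> fst (snd y)" "fst (snd y) \<le> 2 * s0"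
        using e unfolding dist_real_def by linarith+
      have "t0 / 2 * (s0 / 2) \<le> fst y * fst (snd y)" "fst y * fst (snd y) \<le> (2 * t0) * (2 * s0)"
        by (rule mult_mono[OF b(1) b(3)] mult_mono[OF b(2) b(4)]; use b pos in linarith)+
      hence c: "t0 * s0 / 4 \<le> fst y * fst (snd y)" "fst y * fst (snd y) \<le> h" "fst y \<le> h" "0 \<le> fst y"
        unfolding h_def le_max_iff_disj using b pos by (linarith | simp add: mult_ac)+
      have "norm (snd (snd y)) \<le> norm (snd (snd y0)) + e"
        using d(3) norm_triangle_sub[of "snd (snd y)" "snd (snd y0)"] by (simp add: dist_norm)
      with c show "AE q in mix. \<bar>?F y q\<bar> \<le> ?w q"
        using C(2)[of "t0 * s0 / 4" "norm (snd (snd y0)) + e" h] pos e by (auto elim!: eventually_mono)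
    qed
  qed
  thus ?thesis by (simp add: avg_def[abs_def] case_prod_unfold)
qed

lemma avg_pd_at:
  fixes G G' :: "real \<Rightarrow> real^'d::finite \<Rightarrow> real"
  assumes G: "tame a G" and G': "tame a G'" and a: "0 \<le> a" "a < 1" and pos: "0 < \<theta>" "0 < \<tau>"
    and der: "\<And>\<sigma> x. 0 < \<sigma> \<Longrightarrow> pd_at i (G \<sigma>) x (G' \<sigma> x)"
  shows "pd_at i (avg k G \<theta> \<tau>) x (avg k G' \<theta> \<tau> x)"
proof -
  obtain C p where C: "0 \<le> C" "\<And>l h R. 0 < l \<Longrightarrow> 0 \<le> R \<Longrightarrow> mix_bound k G' a C p l h R"
    by (rule avg_dominated[OF G' a(1), of k]) blast
  let ?h = "max \<theta> (\<theta> * \<tau>)" and ?X = "\<lambda>h. x + h *\<^sub>R axis i (1::real)"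
  let ?w = "\<lambda>q. (?h ^ k * C * (1 + (\<theta> * \<tau>) powr - a) * (1 + (norm x + 1) + ?h) ^ p) * weight k a p q"
  have "((\<lambda>h. integral\<^sup>L mix (\<lambda>q. mixture k G \<theta> \<tau> (?X h) q)) has_real_derivative
    integral\<^sup>L mix (\<lambda>q. mixture k G' \<theta> \<tau> (?X 0) q)) (at 0)"
  proof (rule has_derivative_integral_AE[where a = "-1" and b = 1 and w = ?w and f' = "\<lambda>h q. mixture k G' \<theta> \<tau> (?X h) q"])
    show "integrable mix (\<lambda>q. mixture k G \<theta> \<tau> (?X h) q)" for h
      by (rule avg_integrable[OF G a pos])
    show "(\<lambda>q. mixture k G' \<theta> \<tau> (?X 0) q) \<in> borel_measurable mix"
      by (rule avg_measurable[OF G'])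
    show "integrable mix ?w" by (intro integrable_mult_right weight_integrable a)
    have "AE q in mix. \<forall>\<theta>' \<tau>' x'. \<theta> * \<tau> \<le> \<theta>' * \<tau>' \<longrightarrow> \<theta>' * \<tau>' \<le> ?h \<longrightarrow> 0 \<le> \<theta>' \<longrightarrow> \<theta>' \<le> ?h \<longrightarrow> norm x' \<le> norm x + 1 \<longrightarrow>
      \<bar>mixture k G' \<theta>' \<tau>' x' q\<bar> \<le> ?w q"
      using pos by (intro C(2)) auto
    with mix_pos show "AE q in mix. \<forall>h. - 1 < h \<longrightarrow> h < 1 \<longrightarrow>
      ((\<lambda>h. mixture k G \<theta> \<tau> (?X h) q) has_real_derivative
         mixture k G' \<theta> \<tau> (?X h) q) (at h) \<and>
      \<bar>mixture k G' \<theta> \<tau> (?X h) q\<bar> \<le> ?w q"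
    proof (eventually_elim, intro allI impI conjI)
      fix q :: "real \<times> real" and h :: real
      assume q: "0 < fst q \<and> 0 < snd q" and h: "- 1 < h" "h < 1" and B: "\<forall>\<theta>' \<tau>' x'. \<theta> * \<tau> \<le> \<theta>' * \<tau>' \<longrightarrow> \<theta>' * \<tau>' \<le> ?h \<longrightarrow> 0 \<le> \<theta>' \<longrightarrow> \<theta>' \<le> ?h \<longrightarrow> norm x' \<le> norm x + 1 \<longrightarrow>
        \<bar>mixture k G' \<theta>' \<tau>' x' q\<bar> \<le> ?w q"
      have s: "0 < \<theta> * \<tau> * (fst q * snd q)" using pos q by simp
      show "((\<lambda>h. mixture k G \<theta> \<tau> (?X h) q) has_real_derivative
         mixture k G' \<theta> \<tau> (?X h) q) (at h)"
        unfolding cutoff_pos[OF s] by (intro DERIV_cmult pd_at_shift der s)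
      have "norm (?X h) \<le> norm x + norm (h *\<^sub>R axis i (1::real))" by (rule norm_triangle_ineq)
      also have "\<dots> \<le> norm x + 1" using h by simp
      finally show "\<bar>mixture k G' \<theta> \<tau> (?X h) q\<bar> \<le> ?w q"
        using B pos by simp
    qed
  qed auto
  thus ?thesis by (simp add: pd_at_def avg_def)
qed

text \<open>The average over the other clocks with the normalised j-th clock frozen: the function of
  r to which the one-dimensional subordination result is applied.\<close>

definition profile :: "nat \<Rightarrow> (real \<Rightarrow> real^'d::finite \<Rightarrow> real) \<Rightarrow> real \<Rightarrow> real^'d \<Rightarrow> real \<Rightarrow> real" where
  "profile k G \<theta> x r = (\<integral>w. slice k G \<theta> x r w \<partial>\<rho>)"

lemma profile_integrand_measurable:
  assumes "tame a G"
  shows "(\<lambda>w. slice k G \<theta> x r w) \<in> borel_measurable \<rho>"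
proof -
  note [measurable] = tame_cutoff_measurable[OF assms]
  show ?thesis by measurable
qed

lemma weight_fst_integrable: "a < 1 \<Longrightarrow> integrable \<rho> (\<lambda>w. weight k a p (w, 1))"
  unfolding weight_def fst_conv snd_conv
  by (intro integrable_mult_left powr_weight_integrable rho_pos rho_powr) auto

abbreviation rho_bound :: "nat \<Rightarrow> (real \<Rightarrow> real^'d::finite \<Rightarrow> real) \<Rightarrow> real \<Rightarrow> real \<Rightarrow> real^'d \<Rightarrow> real \<Rightarrow> nat \<Rightarrow> real \<Rightarrow> real \<Rightarrow> bool" where
  "rho_bound k G a \<theta> x C p l h \<equiv> AE w in \<rho>. 0 < w \<and> (\<forall>r. l \<le> r \<longrightarrow> r \<le> h \<longrightarrow>
    \<bar>slice k G \<theta> x r w\<bar> \<le> bnd k C p a (\<theta> * l) (\<theta> * (1 + h)) (norm x) * weight k a p (w, 1))"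

lemma profile_dominated:
  assumes G: "tame a G" and a: "0 \<le> a" and \<theta>: "0 < \<theta>"
  obtains C p where "0 \<le> C" "\<And>l h. 0 < l \<Longrightarrow> rho_bound k G a \<theta> x C p l h"
proof -
  obtain C p where C: "0 \<le> C" "\<And>\<sigma> x. 0 < \<sigma> \<Longrightarrow> \<bar>G \<sigma> x\<bar> \<le> tame_bnd C a p \<sigma> x"
    using G by (auto simp: tame_def)
  show ?thesis
  proof (rule that[OF C(1)])
    fix l h :: real assume l: "0 < l"
    show "rho_bound k G a \<theta> x C p l h"
      using rho_pos
    proof (eventually_elim, intro conjI allI impI)
      fix w r :: real
      assume w: "0 < w" and r: "l \<le> r" "r \<le> h"
      have 0: "0 < \<theta> * r * w" using w r l \<theta> by simp
      have "\<bar>(\<theta> * w) ^ k * G (\<theta> * r * (w * 1)) x\<bar> \<le> bnd k C p a (\<theta> * l) (\<theta> * (1 + h)) (norm x) *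
        ((w ^ k * (1 + w powr - a) * (1 + w) ^ p) * (1 ^ 0 * (1 + 1 powr - a) * (1 + 1) ^ p))"
        by (rule tame_weight_bound[OF C(2) C(1) a]) (use l r w \<theta> in auto)
      thus "\<bar>slice k G \<theta> x r w\<bar> \<le> bnd k C p a (\<theta> * l) (\<theta> * (1 + h)) (norm x) * weight k a p (w, 1)"
        unfolding cutoff_pos[OF 0] weight_def fst_conv snd_conv by (simp only: mult_1_right)
    qed
  qed
qed

lemma profile_integrable:
  assumes G: "tame a G" and a: "0 \<le> a" "a < 1" and pos: "0 < \<theta>" "0 < r"
  shows "integrable \<rho> (\<lambda>w. slice k G \<theta> x r w)"
proof -
  obtain C p where C: "0 \<le> C" "\<And>l h. 0 < l \<Longrightarrow> rho_bound k G a \<theta> x C p l h"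
    by (rule profile_dominated[OF G a(1) pos(1), of k x]) blast
  show ?thesis
  proof (rule Bochner_Integration.integrable_bound)
    show "integrable \<rho> (\<lambda>w. bnd k C p a (\<theta> * r) (\<theta> * (1 + r)) (norm x) * weight k a p (w, 1))"
      by (intro integrable_mult_right weight_fst_integrable a)
    show "AE w in \<rho>. norm (slice k G \<theta> x r w)
      \<le> norm (bnd k C p a (\<theta> * r) (\<theta> * (1 + r)) (norm x) * weight k a p (w, 1))"
      by (rule eventually_mono[OF C(2)[OF pos(2), of r]]) (auto intro: order_trans[OF _ abs_ge_self])
  qed (rule profile_integrand_measurable[OF G])
qed

lemma profile_bound:
  assumes G: "tame a G" and a: "0 \<le> a" "a < 1" and \<theta>: "0 < \<theta>"
  shows "\<exists>K\<ge>0. \<exists>m. \<forall>r>0. \<bar>profile k G \<theta> x r\<bar> \<le> K * ((1 + r) ^ m * (1 + r powr - a))"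
proof -
  obtain C p where C: "0 \<le> C" "\<And>l h. 0 < l \<Longrightarrow> rho_bound k G a \<theta> x C p l h"
    by (rule profile_dominated[OF G a(1) \<theta>, of k x]) blast
  define J where "J = (\<integral>w. weight k a p (w, 1) \<partial>\<rho>)"
  have J: "0 \<le> J" unfolding J_def
    using rho_pos by (intro integral_nonneg_AE) (auto elim!: eventually_mono simp: weight_def)
  define K where "K = \<theta> ^ k * C * (1 + \<theta> powr - a) * ((1 + norm x) ^ p * (1 + \<theta>) ^ p) * J"
  have "\<bar>profile k G \<theta> x r\<bar> \<le> K * ((1 + r) ^ (k + p) * (1 + r powr - a))" if r: "0 < r" for r
  proof -
    let ?c = "(\<theta> * (1 + r)) ^ k * C * (1 + (\<theta> * r) powr - a) * (1 + norm x + \<theta> * (1 + r)) ^ p"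
    have "\<bar>profile k G \<theta> x r\<bar> \<le> (\<integral>w. \<bar>slice k G \<theta> x r w\<bar> \<partial>\<rho>)"
      unfolding profile_def by (rule integral_abs_bound)
    also have "\<dots> \<le> (\<integral>w. ?c * weight k a p (w, 1) \<partial>\<rho>)"
      by (intro integral_mono_AE integrable_abs profile_integrable[OF G a \<theta> r] integrable_mult_right weight_fst_integrable a)
        (rule eventually_mono[OF C(2)[OF r, of r]], auto)
    also have "\<dots> = ?c * J" by (simp add: J_def)
    also have "\<dots> \<le> (\<theta> ^ k * (1 + r) ^ k * C * ((1 + \<theta> powr - a) * (1 + r powr - a)) * ((1 + norm x) ^ p * ((1 + \<theta>) ^ p * (1 + r) ^ p))) * J"
    proof -
      have 1: "1 + (\<theta> * r) powr - a \<le> (1 + \<theta> powr - a) * (1 + r powr - a)"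
        using \<theta> r by (simp add: powr_mult algebra_simps)
      have "1 + \<theta> * (1 + r) \<le> (1 + \<theta>) * (1 + r)" using r by (simp add: algebra_simps)
      hence "(1 + \<theta> * (1 + r)) ^ p \<le> (1 + \<theta>) ^ p * (1 + r) ^ p"
        unfolding power_mult_distrib[symmetric] using \<theta> r by (intro power_mono) auto
      hence "(1 + norm x) ^ p * (1 + \<theta> * (1 + r)) ^ p \<le> (1 + norm x) ^ p * ((1 + \<theta>) ^ p * (1 + r) ^ p)"
        by (intro mult_left_mono) auto
      hence 2: "(1 + norm x + \<theta> * (1 + r)) ^ p \<le> (1 + norm x) ^ p * ((1 + \<theta>) ^ p * (1 + r) ^ p)"
        using add_power_le[of "norm x" "\<theta> * (1 + r)" p] \<theta> r by (auto intro: order_trans)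
      show ?thesis
        unfolding power_mult_distrib[of \<theta>]
        using J C(1) \<theta> r by (intro mult_right_mono mult_mono 1 2 order_refl mult_nonneg_nonneg zero_le_power add_nonneg_nonneg) auto
    qed
    also have "\<dots> = K * ((1 + r) ^ (k + p) * (1 + r powr - a))" unfolding K_def power_add by (simp only: mult_ac)
    finally show ?thesis .
  qed
  moreover have "0 \<le> K" unfolding K_def using C(1) \<theta> J by (intro mult_nonneg_nonneg zero_le_power add_nonneg_nonneg) auto
  ultimately show ?thesis by blast
qed

lemma profile_continuous:
  assumes G: "tame a G" and a: "0 \<le> a" "a < 1" and \<theta>: "0 < \<theta>"
  shows "continuous_on {0<..} (profile k G \<theta> x)"
  unfolding profile_def[abs_def]
proof (rule continuous_on_integral_dominated)
  obtain C p where C: "0 \<le> C" "\<And>l h. 0 < l \<Longrightarrow> rho_bound k G a \<theta> x C p l h"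
    by (rule profile_dominated[OF G a(1) \<theta>, of k x]) blast
  show "(\<lambda>w. slice k G \<theta> x r w) \<in> borel_measurable \<rho>" for r
    by (rule profile_integrand_measurable[OF G])
  show "AE w in \<rho>. continuous_on {0<..} (\<lambda>r. slice k G \<theta> x r w)"
    using rho_pos
  proof eventually_elim
    case (elim w)
    have "continuous_on {0<..} (\<lambda>r. (\<theta> * w) ^ k * G (\<theta> * r * w) x)"
      using elim \<theta> by (intro continuous_on_mult continuous_on_const continuous_on_id tame_continuous_compose[OF G]) auto
    moreover have "(\<theta> * w) ^ k * G (\<theta> * r * w) x = slice k G \<theta> x r w" if "r \<in> {0<..}" for r
      using that elim \<theta> by simp
    ultimately show ?case by (rule continuous_on_eq)
  qed
  fix r0 :: real assume r0: "r0 \<in> {0<..}"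
  let ?w = "\<lambda>w. bnd k C p a (\<theta> * (r0 / 2)) (\<theta> * (1 + 2 * r0)) (norm x) * weight k a p (w, 1)"
  show "\<exists>e>0. \<exists>w. integrable \<rho> w \<and> (\<forall>r\<in>{0<..}. dist r r0 < e \<longrightarrow> (AE \<omega> in \<rho>. \<bar>slice k G \<theta> x r \<omega>\<bar> \<le> w \<omega>))"
  proof (intro exI[of _ "r0 / 2"] exI[of _ ?w] conjI ballI impI)
    show "integrable \<rho> ?w" by (intro integrable_mult_right weight_fst_integrable a)
    fix r assume "dist r r0 < r0 / 2"
    moreover have "0 < r0" using r0 by simp
    ultimately have "r0 / 2 \<le> r" "r \<le> 2 * r0" unfolding dist_real_def by linarith+
    thus "AE w in \<rho>. \<bar>slice k G \<theta> x r w\<bar> \<le> ?w w"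
      using r0 by (intro eventually_mono[OF C(2)[of "r0 / 2" "2 * r0"]]) auto
  qed (use r0 in auto)
qed

text \<open>The inner derivative of \<theta> r w in r is \<theta> w, so each derivative adds one
  factor of the other clocks. This is the mechanism that links the functionals with different
  powers.\<close>

lemma profile_deriv:
  assumes G: "tame a G" and G': "tame a G'" and a: "0 \<le> a" "a < 1" and \<theta>: "0 < \<theta>" and r: "0 < r"
    and der: "\<And>\<sigma>. 0 < \<sigma> \<Longrightarrow> ((\<lambda>\<sigma>. G \<sigma> x) has_real_derivative G' \<sigma> x) (at \<sigma>)"
  shows "(profile k G \<theta> x has_real_derivative profile (Suc k) G' \<theta> x r) (at r)"
proof -
  obtain C p where C: "0 \<le> C" "\<And>l h. 0 < l \<Longrightarrow> rho_bound (Suc k) G' a \<theta> x C p l h"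
    by (rule profile_dominated[OF G' a(1) \<theta>, of "Suc k" x]) blast
  let ?w = "\<lambda>w. bnd (Suc k) C p a (\<theta> * (r / 2)) (\<theta> * (1 + 2 * r)) (norm x) * weight (Suc k) a p (w, 1)"
  show ?thesis
    unfolding profile_def[abs_def]
  proof (rule has_derivative_integral_AE[where a = "r / 2" and b = "2 * r" and w = ?w and f' = "\<lambda>r w. slice (Suc k) G' \<theta> x r w"])
  show "integrable \<rho> ?w" by (intro integrable_mult_right weight_fst_integrable a)
  show "integrable \<rho> (\<lambda>w. slice k G \<theta> x s w)" if "r / 2 < s" for s
    using that r by (intro profile_integrable[OF G a \<theta>]) auto
  show "(\<lambda>w. slice (Suc k) G' \<theta> x r w) \<in> borel_measurable \<rho>"
    by (rule profile_integrand_measurable[OF G'])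
  have "0 < r / 2" using r by simp
  from C(2)[OF this, of "2 * r"]
  show "AE w in \<rho>. \<forall>s. r / 2 < s \<longrightarrow> s < 2 * r \<longrightarrow>
      ((\<lambda>s. slice k G \<theta> x s w) has_real_derivative slice (Suc k) G' \<theta> x s w) (at s) \<and>
      \<bar>slice (Suc k) G' \<theta> x s w\<bar> \<le> ?w w"
  proof (eventually_elim, intro allI impI conjI)
    fix w s :: real
    assume *: "0 < w \<and> (\<forall>s. r / 2 \<le> s \<longrightarrow> s \<le> 2 * r \<longrightarrow> \<bar>slice (Suc k) G' \<theta> x s w\<bar> \<le> ?w w)"
      and s: "r / 2 < s" "s < 2 * r"
    show "\<bar>slice (Suc k) G' \<theta> x s w\<bar> \<le> ?w w" using * s by simp
    have s0: "0 < s" using s r by simp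
    have pos: "0 < \<theta> * s * w" using * s0 \<theta> by simp
    have "((\<lambda>s. \<theta> * s * w) has_real_derivative \<theta> * w) (at s)" by (auto intro!: derivative_eq_intros)
    from DERIV_cmult[OF DERIV_chain2[OF der[OF pos] this], of "(\<theta> * w) ^ k"]
    have "((\<lambda>s. (\<theta> * w) ^ k * G (\<theta> * s * w) x) has_real_derivative slice (Suc k) G' \<theta> x s w) (at s)"
      unfolding cutoff_pos[OF pos] by (simp only: power_Suc mult_ac)
    thus "((\<lambda>s. slice k G \<theta> x s w) has_real_derivative slice (Suc k) G' \<theta> x s w) (at s)"
      by (rule DERIV_cong_pos[OF _ s0]) (use * \<theta> in simp)
  qed
  qed (use r in auto)
qed

lemma avg_eq_subordinate:
  assumes G: "tame a G" and a: "0 \<le> a" "a < 1" and \<theta>: "0 < \<theta>" and s: "0 < s"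
  shows "avg k G \<theta> (s powr \<beta>) x = subordinate (\<lambda>r. indicat_real {0<..} r *\<^sub>R profile k G \<theta> x r) s"
proof -
  let ?F = "\<lambda>w y. (\<theta> * w) ^ k * cutoff G (\<theta> * s powr \<beta> * (w * y)) x"
  have int: "integrable mix (case_prod ?F)"
    using avg_integrable[OF G a \<theta>, of "s powr \<beta>" k x] s by (simp add: case_prod_unfold)
  have m: "case_prod ?F \<in> borel_measurable mix" using int by (rule borel_measurable_integrable)
  note [measurable] = profile_integrand_measurable[OF G]
  have "avg k G \<theta> (s powr \<beta>) x = (\<integral>y. (\<integral>w. ?F w y \<partial>\<rho>) \<partial>inverse_law)"
    unfolding P.integral_snd[OF int] by (simp add: avg_def case_prod_unfold)
  also have "\<dots> = (\<integral>y. indicat_real {0<..} (s powr \<beta> * y) *\<^sub>R profile k G \<theta> x (s powr \<beta> * y) \<partial>inverse_law)"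
  proof (rule integral_cong_AE)
    show "(\<lambda>y. \<integral>w. ?F w y \<partial>\<rho>) \<in> borel_measurable inverse_law"
      using P.integrable_snd[OF int] by (rule borel_measurable_integrable)
    have "(\<lambda>r. indicat_real {0<..} r *\<^sub>R profile k G \<theta> x r) \<in> borel_measurable borel"
      by (intro borel_measurable_continuous_on_indicator profile_continuous[OF G a \<theta>]) auto
    thus "(\<lambda>y. indicat_real {0<..} (s powr \<beta> * y) *\<^sub>R profile k G \<theta> x (s powr \<beta> * y)) \<in> borel_measurable inverse_law"
      by measurable
    show "AE y in inverse_law. (\<integral>w. ?F w y \<partial>\<rho>) = indicat_real {0<..} (s powr \<beta> * y) *\<^sub>R profile k G \<theta> x (s powr \<beta> * y)"
      using inverse_law_pos by eventually_elim (use s in \<open>simp add: profile_def mult_ac\<close>)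
  qed
  finally show ?thesis by (simp add: subordinate_def)
qed

lemma one_plus_power_le:
  fixes r a :: real
  assumes "0 < r" "0 \<le> a" "m \<le> n"
  shows "(1 + r) ^ m * (1 + r powr - a) \<le> 2 ^ Suc n * (r powr - a + r ^ n)"
proof (cases "r \<le> 1")
  case True
  have "r powr 0 \<le> r powr - a" using True assms by (intro powr_mono') auto
  hence p: "1 \<le> r powr - a" using assms by simp
  have "(1 + r) ^ m \<le> 2 ^ m" using True assms by (intro power_mono) auto
  also have "\<dots> \<le> 2 ^ n" using assms by (intro power_increasing) auto
  finally have "(1 + r) ^ m \<le> 2 ^ n" .
  moreover have "1 + r powr - a \<le> 2 * (r powr - a + r ^ n)" 
  proof -
    have "1 + A \<le> 2 * (A + B)" if "1 \<le> A" "0 \<le> B" for A B :: real using that by simp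
    thus ?thesis using p zero_le_power[OF less_imp_le[OF assms(1)], of n] by blast
  qed
  ultimately have "(1 + r) ^ m * (1 + r powr - a) \<le> 2 ^ n * (2 * (r powr - a + r ^ n))"
    using assms by (intro mult_mono) auto
  thus ?thesis by (simp only: power_Suc mult_ac)
next
  case False
  hence "r powr - a \<le> r powr 0" using assms by (intro powr_mono) auto
  hence p: "r powr - a \<le> 1" using assms by simp
  have "(1 + r) ^ m \<le> (1 + r) ^ n" using assms by (intro power_increasing) auto
  also have "\<dots> \<le> (2 * r) ^ n" using False by (intro power_mono) auto
  finally have "(1 + r) ^ m * (1 + r powr - a) \<le> (2 * r) ^ n * 2"
    using p assms by (intro mult_mono) auto
  also have "\<dots> = 2 ^ Suc n * r ^ n" by (simp add: power_mult_distrib)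
  also have "\<dots> \<le> 2 ^ Suc n * (r powr - a + r ^ n)" by simp
  finally show ?thesis .
qed

text \<open>An average is the subordination of its profile, so its Caputo derivative is the
  subordination of the profile's derivative, which has one more clock factor and G' in place of G. G
  must be bounded near 0, G' may have an integrable singularity.\<close>

lemma
  assumes G: "tame 0 G" and G': "tame a G'" and a: "0 \<le> a" "a < 1" and \<theta>: "0 < \<theta>"
    and der: "\<And>\<sigma>. 0 < \<sigma> \<Longrightarrow> ((\<lambda>\<sigma>. G \<sigma> x) has_real_derivative G' \<sigma> x) (at \<sigma>)"
  shows caputo_diff_avg: "caputo_diff \<beta> (\<lambda>s. avg k G \<theta> (s powr \<beta>) x)"
    and caputo_avg: "0 < t \<Longrightarrow> caputo \<beta> (\<lambda>s. avg k G \<theta> (s powr \<beta>) x) t = avg (Suc k) G' \<theta> (t powr \<beta>) x"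
proof -
  have Ga: "tame a G" by (rule tame_mono[OF G a(1)]) simp
  let ?\<phi> = "\<lambda>r. indicat_real {0<..} r *\<^sub>R profile k G \<theta> x r" and ?\<phi>' = "\<lambda>r. indicat_real {0<..} r *\<^sub>R profile (Suc k) G' \<theta> x r"
  obtain K m where K: "0 \<le> K" "\<And>r. 0 < r \<Longrightarrow> \<bar>profile k G \<theta> x r\<bar> \<le> K * ((1 + r) ^ m * (1 + r powr - 0))"
    using profile_bound[OF G _ _ \<theta>, of k x] by auto
  obtain K' m' where K': "0 \<le> K'" "\<And>r. 0 < r \<Longrightarrow> \<bar>profile (Suc k) G' \<theta> x r\<bar> \<le> K' * ((1 + r) ^ m' * (1 + r powr - a))"
    using profile_bound[OF G' a \<theta>, of "Suc k" x] by blast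
  define n where "n = m + m'"
  have b: "\<bar>?\<phi> r\<bar> \<le> ((K + K') * 2 ^ Suc n) * (1 + r ^ n)" if r: "0 < r" for r
  proof -
    have "\<bar>?\<phi> r\<bar> \<le> K * ((1 + r) ^ m * (1 + r powr - 0))" using K(2)[OF r] r by simp
    also have "\<dots> \<le> (K + K') * (2 ^ Suc n * (r powr - 0 + r ^ n))"
      using K(1) K'(1) r by (intro mult_mono one_plus_power_le) (auto simp: n_def)
    finally show ?thesis using r by (simp add: mult.assoc)
  qed
  have b': "\<bar>?\<phi>' r\<bar> \<le> ((K + K') * 2 ^ Suc n) * (r powr - a + r ^ n)" if r: "0 < r" for r
  proof -
    have "\<bar>?\<phi>' r\<bar> \<le> K' * ((1 + r) ^ m' * (1 + r powr - a))" using K'(2)[OF r] r by simp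
    also have "\<dots> \<le> (K + K') * (2 ^ Suc n * (r powr - a + r ^ n))"
      using K(1) K'(1) r a by (intro mult_mono one_plus_power_le) (auto simp: n_def)
    finally show ?thesis by (simp add: mult.assoc)
  qed
  have m: "?\<phi> \<in> borel_measurable borel" "?\<phi>' \<in> borel_measurable borel"
    by (intro borel_measurable_continuous_on_indicator profile_continuous[OF Ga a \<theta>] profile_continuous[OF G' a \<theta>]; simp)+
  have c: "continuous_on {0<..} ?\<phi>'"
    by (rule continuous_on_eq[OF profile_continuous[OF G' a \<theta>, of "Suc k" x]]) simp
  have d: "(?\<phi> has_real_derivative ?\<phi>' r) (at r)" if r: "0 < r" for r
  proof (rule DERIV_cong_pos[OF _ r])
    show "(profile k G \<theta> x has_real_derivative ?\<phi>' r) (at r)"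
      using profile_deriv[OF Ga G' a \<theta> r der, of k] r by simp
  qed simp
  note cs = caputo_subordinate[OF a m d b b' c]
  have eq: "avg k G \<theta> (s powr \<beta>) x = subordinate ?\<phi> s" if "0 < s" for s
    by (rule avg_eq_subordinate[OF Ga a \<theta> that])
  show "caputo_diff \<beta> (\<lambda>s. avg k G \<theta> (s powr \<beta>) x)"
  proof -
    have "caputo_diff \<beta> (\<lambda>s. avg k G \<theta> (s powr \<beta>) x) \<longleftrightarrow> caputo_diff \<beta> (subordinate ?\<phi>)" by (rule caputo_diff_cong) (rule eq)
    moreover have "caputo_diff \<beta> (subordinate ?\<phi>)" by (intro cs(1))
    ultimately show ?thesis by simp
  qed
  show "caputo \<beta> (\<lambda>s. avg k G \<theta> (s powr \<beta>) x) t = avg (Suc k) G' \<theta> (t powr \<beta>) x" if "0 < t"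
  proof -
    have "caputo \<beta> (subordinate ?\<phi>) t = subordinate ?\<phi>' t" using that by (intro cs(2))
    moreover have "caputo \<beta> (\<lambda>s. avg k G \<theta> (s powr \<beta>) x) = caputo \<beta> (subordinate ?\<phi>)" by (rule caputo_cong) (rule eq)
    ultimately show ?thesis by (simp only: avg_eq_subordinate[OF G' a \<theta> that])
  qed
qed

lemma integral_mix_power: "(\<integral>q. (\<theta> * fst q) ^ k * g \<partial>mix) = \<theta> ^ k * (\<integral>w. w ^ k \<partial>\<rho>) * g"
proof -
  have "integrable \<rho> (\<lambda>w. w powr real k)" by (rule rho_powr) simp
  moreover have "AE w in \<rho>. w powr real k = w ^ k" using rho_pos by eventually_elim (rule powr_realpow)
  ultimately have i: "integrable \<rho> (\<lambda>w. w ^ k)"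
    by (subst integrable_cong_AE[where g = "\<lambda>w. w powr real k"]) (auto elim: eventually_mono)
  have "integrable mix (\<lambda>q. (\<theta> * fst q) ^ k * g)"
    using P.integrable_product[OF integrable_mult_left[OF integrable_mult_right[OF i, of "\<theta> ^ k"], of g], of "\<lambda>_. 1"]
    by (simp add: power_mult_distrib)
  from P.integral_fst'[OF this, symmetric] show ?thesis
    by (simp add: power_mult_distrib I.prob_space[simplified])
qed

text \<open>For fixed clocks the argument of G decreases to 0 with \<tau>, so only the power of
  \<theta> w remains in the limit. Order 0 of tameness provides one dominating function for all
  \<tau> < 1.\<close>

lemma avg_tendsto_0:
  assumes G: "tame 0 G" and \<theta>: "0 < \<theta>" and lim: "((\<lambda>\<sigma>. G \<sigma> x) \<longlongrightarrow> g) (at_right 0)"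
  shows "((\<lambda>\<tau>. avg k G \<theta> \<tau> x) \<longlongrightarrow> \<theta> ^ k * (\<integral>w. w ^ k \<partial>\<rho>) * g) (at_right 0)"
proof -
  obtain C p where C: "0 \<le> C" "\<And>\<sigma> x. 0 < \<sigma> \<Longrightarrow> \<bar>G \<sigma> x\<bar> \<le> C * ((1 + \<sigma> powr - 0) * (1 + norm x + \<sigma>) ^ p)"
    using G by (auto simp: tame_def)
  have "((\<lambda>\<tau>. avg k G \<theta> \<tau> x) \<longlongrightarrow> (\<integral>q. (\<theta> * fst q) ^ k * g \<partial>mix)) (at 0 within {0<..<1})"
    unfolding avg_def
  proof (rule integral_tendsto_within)
    let ?w = "\<lambda>q. (\<theta> ^ k * C * 2 * (1 + norm x + \<theta>) ^ p) * weight k 0 p q"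
    show "integrable mix ?w" by (intro integrable_mult_right weight_integrable) simp
    show "(\<lambda>p. mixture k G \<theta> \<tau> x p) \<in> borel_measurable mix" for \<tau>
      by (rule avg_measurable[OF G])
    show "(\<lambda>q. (\<theta> * fst q) ^ k * g) \<in> borel_measurable mix" by measurable
    show "AE q in mix. \<bar>mixture k G \<theta> \<tau> x q\<bar> \<le> ?w q" if \<tau>: "\<tau> \<in> {0<..<1}" for \<tau>
      using mix_pos
    proof eventually_elim
      case (elim q)
      have s: "0 < \<theta> * \<tau> * (fst q * snd q)" using elim \<theta> \<tau> by simp
      have t: "0 < \<theta> * \<tau>" "\<theta> * \<tau> \<le> \<theta>" using \<theta> \<tau> by auto
      have "\<bar>(\<theta> * fst q) ^ k * G (\<theta> * \<tau> * (fst q * snd q)) x\<bar> \<le> (\<theta> ^ k * C * (1 + (\<theta> * \<tau>) powr - 0) * (1 + norm x + \<theta>) ^ p) *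
        ((fst q ^ k * (1 + fst q powr - 0) * (1 + fst q) ^ p) * (snd q ^ 0 * (1 + snd q powr - 0) * (1 + snd q) ^ p))"
        by (rule tame_weight_bound[OF C(2) C(1)]) (use elim \<theta> t in auto)
      moreover have "1 + (\<theta> * \<tau>) powr - 0 = 2" using \<theta> \<tau> by auto
      ultimately show ?case unfolding cutoff_pos[OF s] weight_def by simp
    qed
    show "AE q in mix. ((\<lambda>\<tau>. mixture k G \<theta> \<tau> x q) \<longlongrightarrow> (\<theta> * fst q) ^ k * g) (at 0 within {0<..<1})"
      using mix_pos
    proof eventually_elim
      case (elim q)
      have c: "0 < \<theta> * (fst q * snd q)" using elim \<theta> by simp
      have f: "filterlim (\<lambda>\<tau>. \<theta> * \<tau> * (fst q * snd q)) (at_right 0) (at 0 within {0<..<1})"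
        unfolding filterlim_at
      proof
        show "\<forall>\<^sub>F \<tau> in at 0 within {0<..<1}. \<theta> * \<tau> * (fst q * snd q) \<in> {0<..} \<and> \<theta> * \<tau> * (fst q * snd q) \<noteq> 0"
          using elim \<theta> by (auto simp: eventually_at_filter)
        have "((\<lambda>\<tau>. \<theta> * \<tau> * (fst q * snd q)) \<longlongrightarrow> \<theta> * 0 * (fst q * snd q)) (at 0 within {0<..<1})"
          by (intro tendsto_intros)
        thus "((\<lambda>\<tau>. \<theta> * \<tau> * (fst q * snd q)) \<longlongrightarrow> 0) (at 0 within {0<..<1})" by simp
      qed
      have "((\<lambda>\<sigma>. cutoff G \<sigma> x) \<longlongrightarrow> g) (at_right 0)"
        using lim by (rule Lim_transform_eventually) (auto simp: eventually_at_filter)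
      from tendsto_mult[OF tendsto_const filterlim_compose[OF this f]] show ?case .
    qed
  qed
  moreover have "at 0 within {0<..<1} = at_right (0::real)"
    by (rule at_within_nhd[of _ "{..<1}"]) auto
  ultimately show ?thesis by (simp only: integral_mix_power)
qed

end

context subordinator
begin

section \<open>The law of the product of the other clocks\<close>

lemma product_inverse_law: "product_prob_space (\<lambda>_. inverse_law)"
  using real_distribution_inverse_law by (intro product_prob_spaceI) (simp add: real_distribution_def)

definition prod_law :: "'i set \<Rightarrow> real measure" where
  "prod_law I = distr (\<Pi>\<^sub>M i\<in>I. inverse_law) borel (\<lambda>y. \<Prod>i\<in>I. y i)"

lemma prod_law_measurable: "(\<lambda>y. \<Prod>i\<in>I. y i) \<in> borel_measurable (\<Pi>\<^sub>M i\<in>I. inverse_law)"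
proof -
  show ?thesis by measurable
qed

lemma real_distribution_prod_law: "real_distribution (prod_law I)"
proof -
  interpret product_prob_space "\<lambda>_. inverse_law" I by (rule product_inverse_law)
  show ?thesis unfolding prod_law_def by (intro real_distribution_distr prod_law_measurable)
qed

lemma prod_law_pos:
  assumes "finite I"
  shows "AE w in prod_law I. 0 < w"
proof -
  interpret product_prob_space "\<lambda>_. inverse_law" I by (rule product_inverse_law)
  have "AE y in (\<Pi>\<^sub>M i\<in>I. inverse_law). 0 < y i" if "i \<in> I" for i
    using inverse_law_pos that
    by (subst (asm) PiM_component[symmetric, OF that]) (subst (asm) AE_distr_iff, auto)
  hence "AE y in (\<Pi>\<^sub>M i\<in>I. inverse_law). \<forall>i\<in>I. 0 < y i" using assms by (intro AE_finite_allI)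
  hence "AE y in (\<Pi>\<^sub>M i\<in>I. inverse_law). 0 < (\<Prod>i\<in>I. y i)"
    by eventually_elim (rule prod_pos, auto)
  thus ?thesis unfolding prod_law_def by (subst AE_distr_iff[OF prod_law_measurable]) auto
qed

lemma prod_law_powr:
  assumes "finite I" "-1 < c"
  shows "integrable (prod_law I) (\<lambda>w. w powr c)"
proof -
  interpret product_prob_space "\<lambda>_. inverse_law" I by (rule product_inverse_law)
  have "integrable (\<Pi>\<^sub>M i\<in>I. inverse_law) (\<lambda>y. \<Prod>i\<in>I. y i powr c)"
    using assms by (intro product_integrable_prod inverse_law_powr_integrable)
  thus ?thesis unfolding prod_law_def
    by (subst integrable_distr_eq[OF prod_law_measurable]) (auto simp: prod_powr_distrib)
qed

lemma prod_law_moment: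
  assumes "finite I"
  shows "(\<integral>w. w ^ k \<partial>prod_law I) = (\<integral>y. y ^ k \<partial>inverse_law) ^ card I"
proof -
  interpret product_prob_space "\<lambda>_. inverse_law" I by (rule product_inverse_law)
  have "(\<integral>w. w ^ k \<partial>prod_law I) = (\<integral>y. (\<Prod>i\<in>I. y i ^ k) \<partial>(\<Pi>\<^sub>M i\<in>I. inverse_law))"
    unfolding prod_law_def by (subst integral_distr[OF prod_law_measurable]) (auto simp: prod_power_distrib)
  also have "\<dots> = (\<Prod>i\<in>I. \<integral>y. y ^ k \<partial>inverse_law)"
    by (intro product_integral_prod assms inverse_law_moment_integrable)
  finally show ?thesis by simp
qed

lemma mixing_prod_law: "finite I \<Longrightarrow> mixing M \<nu> \<beta> L (prod_law I)"
  by (intro mixing.intro mixing_axioms.intro subordinator_axioms real_distribution_prod_law prod_law_pos prod_law_powr)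

text \<open>The j-th coordinate of the product space is split off and the remaining ones are pushed
  forward to their product.\<close>

lemma nn_integral_prod_law_insert:
  fixes h :: "real \<times> real \<Rightarrow> ennreal" and j :: "'i::finite"
  assumes [measurable]: "h \<in> borel_measurable (borel \<Otimes>\<^sub>M borel)"
  shows "(\<integral>\<^sup>+y. h (\<Prod>i\<in>UNIV - {j}. y i, y j) \<partial>(\<Pi>\<^sub>M i\<in>UNIV. inverse_law))
    = (\<integral>\<^sup>+q. h q \<partial>(prod_law (UNIV - {j}) \<Otimes>\<^sub>M inverse_law))"
proof -
  interpret product_prob_space "\<lambda>_. inverse_law" "UNIV :: 'i set" by (rule product_inverse_law)
  interpret R: real_distribution "prod_law (UNIV - {j})" by (rule real_distribution_prod_law)
  have ins: "insert j (UNIV - {j}) = (UNIV :: 'i set)" by auto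
  have [measurable]: "(\<lambda>y. h (\<Prod>i\<in>UNIV - {j}. y i, y j)) \<in> borel_measurable (\<Pi>\<^sub>M i\<in>insert j (UNIV - {j}). inverse_law)"
    by measurable
  note [measurable] = prod_law_measurable[of "UNIV - {j}"]
  have "(\<integral>\<^sup>+y. h (\<Prod>i\<in>UNIV - {j}. y i, y j) \<partial>(\<Pi>\<^sub>M i\<in>UNIV. inverse_law))
     = (\<integral>\<^sup>+x. (\<integral>\<^sup>+y. h (\<Prod>i\<in>UNIV - {j}. (x(j := y)) i, (x(j := y)) j) \<partial>inverse_law) \<partial>(\<Pi>\<^sub>M i\<in>UNIV - {j}. inverse_law))"
    using product_nn_integral_insert[of "UNIV - {j}" j "\<lambda>y. h (\<Prod>i\<in>UNIV - {j}. y i, y j)"] by (simp add: ins)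
  also have "\<dots> = (\<integral>\<^sup>+x. (\<integral>\<^sup>+y. h (\<Prod>i\<in>UNIV - {j}. x i, y) \<partial>inverse_law) \<partial>(\<Pi>\<^sub>M i\<in>UNIV - {j}. inverse_law))"
    by (intro nn_integral_cong arg_cong[where f = h] arg_cong2[where f = Pair] prod.cong) auto
  also have "\<dots> = (\<integral>\<^sup>+w. (\<integral>\<^sup>+y. h (w, y) \<partial>inverse_law) \<partial>prod_law (UNIV - {j}))"
    unfolding prod_law_def by (subst nn_integral_distr) auto
  also have "\<dots> = (\<integral>\<^sup>+q. h q \<partial>(prod_law (UNIV - {j}) \<Otimes>\<^sub>M inverse_law))"
    by (subst I.nn_integral_fst[symmetric]) auto
  finally show ?thesis .
qed

end

context isl_process
begin

section \<open>Sheet functionals as averages of the heat flow\<close>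

abbreviation rho :: "'n \<Rightarrow> real measure" where "rho j \<equiv> prod_law (UNIV - {j})"

definition tau :: "real^'n \<Rightarrow> 'n \<Rightarrow> real" where "tau t j = t $ j powr \<beta>"

definition theta :: "real^'n \<Rightarrow> 'n \<Rightarrow> real" where "theta t j = (\<Prod>i\<in>UNIV - {j}. t $ i powr \<beta>)"

lemma theta_nonneg: "0 \<le> theta t j"
  unfolding theta_def by (intro prod_nonneg) auto

lemma prod_UNIV_split: "(\<Prod>i\<in>UNIV. g i) = (\<Prod>i\<in>UNIV - {j}. g i) * (g j :: real)" for g :: "'n \<Rightarrow> real"
  by (subst prod.remove[of UNIV j]) (auto simp: mult.commute)

lemma sheet_measurable: "(\<lambda>\<omega>. W (Lam t \<omega>) \<omega>) \<in> borel_measurable M"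
proof -
  have "(\<lambda>\<omega>. (Lam t \<omega>, \<omega>)) \<in> measurable M (borel \<Otimes>\<^sub>M sheet_algebra)"
    by (intro measurable_Pair Lam_vec_measurable id_measurable)
  from measurable_compose[OF this W_joint_measurable]
  have "(\<lambda>\<omega>. W (\<chi> i. max 0 (Lam t \<omega> $ i)) \<omega>) \<in> borel_measurable M" by simp
  moreover have "W (\<chi> i. max 0 (Lam t \<omega> $ i)) \<omega> = W (Lam t \<omega>) \<omega>" if "\<omega> \<in> space M" for \<omega>
  proof -
    have "(\<chi> i. max 0 (Lam t \<omega> $ i)) = Lam t \<omega>"
      using Lam_orthant[OF that, of t] by (simp add: orthant_def vec_eq_iff)
    thus ?thesis by simp
  qed
  ultimately show ?thesis by (subst measurable_cong[where g = "\<lambda>\<omega>. W (\<chi> i. max 0 (Lam t \<omega> $ i)) \<omega>"]) auto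
qed

text \<open>Given the clocks, the sheet has variance equal to their product, which factors as
  \<theta> \<tau> times the product w y of the normalised clocks.\<close>

lemma sheet_law:
  fixes h :: "real \<times> (real^'d) \<Rightarrow> ennreal"
  assumes t: "t \<in> orthant" and [measurable]: "h \<in> borel_measurable (borel \<Otimes>\<^sub>M borel)"
  shows "(\<integral>\<^sup>+\<omega>. h (\<Prod>i\<in>UNIV - {j}. Lam t \<omega> $ i, W (Lam t \<omega>) \<omega>) \<partial>M)
    = (\<integral>\<^sup>+q. (\<integral>\<^sup>+z. h (theta t j * fst q, sqrt (theta t j * tau t j * (fst q * snd q)) *\<^sub>R z) \<partial>gauss) \<partial>(rho j \<Otimes>\<^sub>M inverse_law))"
proof -
  interpret G: prob_space "gauss :: (real^'d) measure" by (rule prob_space_gauss)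
  have [measurable]: "(\<lambda>y. \<chi> i. t $ i powr \<beta> * y i) \<in> borel_measurable (\<Pi>\<^sub>M i\<in>(UNIV::'n set). inverse_law)" by measurable
  have "(\<integral>\<^sup>+\<omega>. h (\<Prod>i\<in>UNIV - {j}. Lam t \<omega> $ i, W (Lam t \<omega>) \<omega>) \<partial>M)
    = (\<integral>\<^sup>+\<tau>. (\<integral>\<^sup>+z. h (\<Prod>i\<in>UNIV - {j}. \<tau> $ i, sqrt (\<Prod>i\<in>UNIV. \<tau> $ i) *\<^sub>R z) \<partial>gauss) \<partial>distr M borel (Lam t))"
    using sheet_nn_integral[OF t, of "\<lambda>(\<tau>, w). h (\<Prod>i\<in>UNIV - {j}. \<tau> $ i, w)"] by (simp add: case_prod_unfold)
  also have "\<dots> = (\<integral>\<^sup>+y. (\<integral>\<^sup>+z. h (\<Prod>i\<in>UNIV - {j}. t $ i powr \<beta> * y i, sqrt (\<Prod>i\<in>UNIV. t $ i powr \<beta> * y i) *\<^sub>R z) \<partial>gauss) \<partial>(\<Pi>\<^sub>M i\<in>UNIV. inverse_law))"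
    unfolding Lam_vec_distr[OF t] by (subst nn_integral_distr) auto
  also have "\<dots> = (\<integral>\<^sup>+y. (\<integral>\<^sup>+z. h (theta t j * (\<Prod>i\<in>UNIV - {j}. y i), sqrt (theta t j * tau t j * ((\<Prod>i\<in>UNIV - {j}. y i) * y j)) *\<^sub>R z) \<partial>gauss) \<partial>(\<Pi>\<^sub>M i\<in>UNIV. inverse_law))"
    unfolding prod_UNIV_split[of _ j] prod.distrib theta_def tau_def by (simp only: mult_ac)
  also have "\<dots> = (\<integral>\<^sup>+q. (\<integral>\<^sup>+z. h (theta t j * fst q, sqrt (theta t j * tau t j * (fst q * snd q)) *\<^sub>R z) \<partial>gauss) \<partial>(rho j \<Otimes>\<^sub>M inverse_law))"
    using nn_integral_prod_law_insert[of "\<lambda>q. \<integral>\<^sup>+z. h (theta t j * fst q, sqrt (theta t j * tau t j * (fst q * snd q)) *\<^sub>R z) \<partial>gauss" j] by simp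
  finally show ?thesis .
qed

lemma sheet_distr:
  assumes t: "t \<in> orthant"
  shows "distr M (borel \<Otimes>\<^sub>M borel) (\<lambda>\<omega>. (\<Prod>i\<in>UNIV - {j}. Lam t \<omega> $ i, W (Lam t \<omega>) \<omega>))
    = distr ((rho j \<Otimes>\<^sub>M inverse_law) \<Otimes>\<^sub>M (gauss :: (real^'d) measure)) (borel \<Otimes>\<^sub>M borel)
       (\<lambda>(q, z). (theta t j * fst q, sqrt (theta t j * tau t j * (fst q * snd q)) *\<^sub>R z))" (is "?A = ?B")
proof (rule measure_eqI)
  interpret G: prob_space "gauss :: (real^'d) measure" by (rule prob_space_gauss)
  interpret R: real_distribution "rho j" by (rule real_distribution_prod_law)
  note [measurable] = sheet_measurable
  show "sets ?A = sets ?B" by simp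
  fix X assume "X \<in> sets ?A"
  hence X [measurable]: "X \<in> sets (borel \<Otimes>\<^sub>M borel)" by simp
  have "emeasure ?A X = (\<integral>\<^sup>+p. indicator X p \<partial>?A)" using X by simp
  also have "\<dots> = (\<integral>\<^sup>+\<omega>. indicator X (\<Prod>i\<in>UNIV - {j}. Lam t \<omega> $ i, W (Lam t \<omega>) \<omega>) \<partial>M)"
    by (subst nn_integral_distr) auto
  also have "\<dots> = (\<integral>\<^sup>+q. (\<integral>\<^sup>+z. indicator X (theta t j * fst q, sqrt (theta t j * tau t j * (fst q * snd q)) *\<^sub>R z) \<partial>gauss) \<partial>(rho j \<Otimes>\<^sub>M inverse_law))"
    by (rule sheet_law[OF t]) measurable
  also have "\<dots> = (\<integral>\<^sup>+p. indicator X ((\<lambda>(q, z). (theta t j * fst q, sqrt (theta t j * tau t j * (fst q * snd q)) *\<^sub>R z)) p) \<partial>((rho j \<Otimes>\<^sub>M inverse_law) \<Otimes>\<^sub>M gauss))"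
    by (subst G.nn_integral_fst[symmetric]) (auto simp: case_prod_unfold)
  also have "\<dots> = (\<integral>\<^sup>+p. indicator X p \<partial>?B)"
    by (subst nn_integral_distr) auto
  also have "\<dots> = emeasure ?B X" using X by simp
  finally show "emeasure ?A X = emeasure ?B X" .
qed

text \<open>Integrating out the Gaussian variable first produces the heat flow. The work lies in the
  absolute integrability for Fubini, obtained from moments of the clocks via sqrt S <= 1 +
  S.\<close>

lemma isl_expectation:
  fixes g :: "real^'d \<Rightarrow> real"
  assumes t: "t \<in> orthant" and g: "poly_growth g"
  shows "(\<integral>\<omega>. (\<Prod>i\<in>UNIV - {j}. inverse_process (Ls i) (t $ i) \<omega>) ^ k * g (levy_time_sheet W Ls x t \<omega>) \<partial>M)
    = (\<integral>q. (theta t j * fst q) ^ k * heat g (theta t j * tau t j * (fst q * snd q)) x \<partial>(rho j \<Otimes>\<^sub>M inverse_law))"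
proof -
  interpret X: mixing M \<nu> \<beta> L "rho j" by (rule mixing_prod_law) simp
  interpret G: prob_space "gauss :: (real^'d) measure" by (rule prob_space_gauss)
  interpret XG: pair_prob_space "X.mix" "gauss :: (real^'d) measure" ..
  note [measurable] = sheet_measurable poly_growth_measurable[OF g]
  let ?\<theta> = "theta t j" and ?c = "theta t j * tau t j"
  let ?F = "\<lambda>q z. (?\<theta> * fst q) ^ k * g (x + sqrt (?c * (fst q * snd q)) *\<^sub>R z)"
  have c: "0 \<le> ?c" using theta_nonneg[of t j] by (simp add: tau_def)
  obtain C p where C: "0 \<le> C" "\<And>x z s. 0 \<le> s \<Longrightarrow> \<bar>g (x + s *\<^sub>R z)\<bar> \<le> C * ((1 + norm x + s) ^ p * (1 + norm z) ^ p)"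
    using poly_growth_bound[OF g] by blast
  have int: "integrable (X.mix \<Otimes>\<^sub>M gauss) (\<lambda>p. ?F (fst p) (snd p))"
  proof (rule Bochner_Integration.integrable_bound)
    have "poly_growth (\<lambda>z::real^'d. (1 + norm z) ^ p)"
      unfolding poly_growth_def by (intro conjI continuous_intros exI[of _ 1] exI[of _ p]) auto
    from poly_weight_integrable[OF this poly_weight_const[of 1], of 1 0]
    have gi: "integrable gauss (\<lambda>z::real^'d. (1 + norm z) ^ p)" by simp
    have wi: "integrable (X.mix \<Otimes>\<^sub>M gauss) (\<lambda>q. X.weight k 0 p (fst q) * (1 + norm (snd q :: real^'d)) ^ p)"
      using XG.integrable_product[OF X.weight_integrable[of 0 k p] gi]
      by simp
    thus "integrable (X.mix \<Otimes>\<^sub>M gauss) (\<lambda>q. (?\<theta> ^ k * C * (2 + norm x + ?c) ^ p) * (X.weight k 0 p (fst q) * (1 + norm (snd q :: real^'d)) ^ p))"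
      by (rule integrable_mult_right)
    show Fm: "(\<lambda>p. ?F (fst p) (snd p)) \<in> borel_measurable (X.mix \<Otimes>\<^sub>M gauss)" by measurable
    define Q where "Q = (\<lambda>r :: (real \<times> real) \<times> (real^'d). \<bar>?F (fst r) (snd r)\<bar> \<le> (?\<theta> ^ k * C * (2 + norm x + ?c) ^ p) * (X.weight k 0 p (fst r) * (1 + norm (snd r)) ^ p))"
    have "AE q in X.mix. AE z in gauss. Q (q, z)"
      using X.mix_pos
    proof (eventually_elim, intro AE_I2)
      fix q :: "real \<times> real" and z :: "real^'d"
      assume q: "0 < fst q \<and> 0 < snd q"
      define w where "w = fst q" define y where "y = snd q"
      have wy: "0 < w" "0 < y" "0 < w * y" using q by (auto simp: w_def y_def)
      have "sqrt (?c * (w * y)) \<le> 1 + ?c * (w * y)"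
      proof -
        have S: "0 \<le> ?c * (w * y)" using c wy by simp
        have "s \<le> 1 + S" if "s \<le> (1 + S) / 2" "0 \<le> S" for s S :: real using that by simp
        thus ?thesis using arith_geo_mean_sqrt[OF zero_le_one S] S by simp
      qed
      hence "1 + norm x + sqrt (?c * (w * y)) \<le> 2 + norm x + ?c * (w * y)" by simp
      also have "\<dots> \<le> (2 + norm x + ?c) * (1 + w * y)"
        using c wy by (simp add: algebra_simps)
      also have "\<dots> \<le> (2 + norm x + ?c) * ((1 + w) * (1 + y))"
        using c wy by (intro mult_left_mono) (auto simp: algebra_simps)
      finally have 1: "(1 + norm x + sqrt (?c * (w * y))) ^ p \<le> ((2 + norm x + ?c) * ((1 + w) * (1 + y))) ^ p"
        using c wy by (intro power_mono) auto
      have "\<bar>?F q z\<bar> = (?\<theta> * w) ^ k * \<bar>g (x + sqrt (?c * (w * y)) *\<^sub>R z)\<bar>"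
        using theta_nonneg[of t j] wy by (simp add: abs_mult w_def y_def)
      also have "\<dots> \<le> (?\<theta> * w) ^ k * (C * (((2 + norm x + ?c) * ((1 + w) * (1 + y))) ^ p * (1 + norm z) ^ p))"
        using theta_nonneg[of t j] wy c
        by (intro mult_left_mono order_trans[OF C(2)] mult_right_mono 1 C(1)) auto
      \<comment> \<open>The factor 4 matches \<open>weight\<close> at a = 0, where both terms 1 +
        w^0 and 1 + y^0 equal 2.\<close>
      also have "\<dots> \<le> (?\<theta> * w) ^ k * (C * (((2 + norm x + ?c) * ((1 + w) * (1 + y))) ^ p * (1 + norm z) ^ p)) * (2 * 2)"
      proof -
        have "0 \<le> (?\<theta> * w) ^ k * (C * (((2 + norm x + ?c) * ((1 + w) * (1 + y))) ^ p * (1 + norm z) ^ p))"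
        proof -
          have "0 \<le> 2 + norm x + ?c" using c by simp
          thus ?thesis using theta_nonneg[of t j] wy C(1) by (intro mult_nonneg_nonneg zero_le_power) auto
        qed
        moreover have "X \<le> X * (2 * 2)" if "0 \<le> X" for X :: real using that by simp
        ultimately show ?thesis by blast
      qed
      also have "\<dots> = (?\<theta> ^ k * C * (2 + norm x + ?c) ^ p) * (X.weight k 0 p q * (1 + norm z) ^ p)"
        using wy by (simp add: X.weight_def power_mult_distrib w_def[symmetric] y_def[symmetric])
      finally show "Q (q, z)" unfolding Q_def fst_conv snd_conv .
    qed
    moreover have "{r \<in> space (X.mix \<Otimes>\<^sub>M gauss). Q r} \<in> sets (X.mix \<Otimes>\<^sub>M gauss)"
      unfolding Q_def
      by (intro borel_measurable_le borel_measurable_abs Fm borel_measurable_times[OF borel_measurable_const] borel_measurable_integrable wi)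
    ultimately have "AE r in X.mix \<Otimes>\<^sub>M gauss. Q r" by (intro XG.AE_pair_measure[where P = Q])
    thus "AE r in X.mix \<Otimes>\<^sub>M (gauss :: (real^'d) measure). norm (?F (fst r) (snd r)) \<le> norm ((?\<theta> ^ k * C * (2 + norm x + ?c) ^ p) * (X.weight k 0 p (fst r) * (1 + norm (snd r)) ^ p))"
    proof eventually_elim
      case (elim r)
      thus ?case unfolding real_norm_def Q_def by (rule order_trans[OF _ abs_ge_self])
    qed
  qed
  have [measurable]: "(\<lambda>(q, z). (theta t j * fst q, sqrt (theta t j * tau t j * (fst q * snd q)) *\<^sub>R z))
    \<in> measurable (X.mix \<Otimes>\<^sub>M (gauss :: (real^'d) measure)) (borel \<Otimes>\<^sub>M borel)" by measurable
  have "(\<integral>\<omega>. (\<Prod>i\<in>UNIV - {j}. inverse_process (Ls i) (t $ i) \<omega>) ^ k * g (levy_time_sheet W Ls x t \<omega>) \<partial>M)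
     = (\<integral>\<omega>. (\<Prod>i\<in>UNIV - {j}. Lam t \<omega> $ i) ^ k * g (x + W (Lam t \<omega>) \<omega>) \<partial>M)"
    by (simp add: Lam_def levy_time_sheet_def add.commute)
  also have "\<dots> = (\<integral>p. fst p ^ k * g (x + snd p) \<partial>distr M (borel \<Otimes>\<^sub>M borel) (\<lambda>\<omega>. (\<Prod>i\<in>UNIV - {j}. Lam t \<omega> $ i, W (Lam t \<omega>) \<omega>)))"
    by (subst integral_distr) auto
  also have "\<dots> = (\<integral>p. ?F (fst p) (snd p) \<partial>(X.mix \<Otimes>\<^sub>M gauss))"
    unfolding sheet_distr[OF t] by (subst integral_distr) (auto simp: case_prod_unfold)
  also have "\<dots> = (\<integral>q. (\<integral>z. ?F q z \<partial>gauss) \<partial>X.mix)"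
    using XG.integral_fst'[OF int] by simp
  also have "\<dots> = (\<integral>q. (?\<theta> * fst q) ^ k * heat g (?c * (fst q * snd q)) x \<partial>X.mix)"
    by (simp add: heat_avg_def)
  finally show ?thesis .
qed

end

section \<open>Slices in one time variable\<close>

lemma upd_nth [simp]: "upd t j s $ i = (if i = j then s else t $ i)"
  by (simp add: upd_def)

lemma upd_upd [simp]: "upd (upd t j s) j r = upd t j r"
  by (simp add: vec_eq_iff)

lemma upd_self [simp]: "upd t j (t $ j) = t"
  by (simp add: vec_eq_iff)

lemma open_orthant_upd: "t \<in> open_orthant \<Longrightarrow> 0 < s \<Longrightarrow> upd t j s \<in> open_orthant"
  by (simp add: open_orthant_def)

lemma open_orthant_orthant: "t \<in> open_orthant \<Longrightarrow> t \<in> orthant"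
  by (simp add: open_orthant_def orthant_def less_imp_le)

lemma caputo_dt_iter: "(caputo_dt \<beta> j ^^ m) g t x = (caputo \<beta> ^^ m) (\<lambda>s. g (upd t j s) x) (t $ j)"
proof (induction m arbitrary: t)
  case (Suc m)
  have "(caputo_dt \<beta> j ^^ Suc m) g t x = caputo \<beta> (\<lambda>s. (caputo_dt \<beta> j ^^ m) g (upd t j s) x) (t $ j)"
    unfolding funpow.simps comp_def by (rule caputo_dt_def)
  thus ?case by (simp add: Suc.IH)
qed simp

lemma caputo_dt_iter_slice: "(\<lambda>s. (caputo_dt \<beta> j ^^ m) g (upd t j s) x) = (caputo \<beta> ^^ m) (\<lambda>s. g (upd t j s) x)"
  by (rule ext) (simp add: caputo_dt_iter)

lemma initial_datum_upd [simp]: "initial_datum E \<nu> f j k (upd t j s) x = initial_datum E \<nu> f j k t x"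
proof -
  have "(\<Prod>i\<in>UNIV - {j}. upd t j s $ i powr r) = (\<Prod>i\<in>UNIV - {j}. t $ i powr r)" for r
    by (intro prod.cong) auto
  thus ?thesis by (simp add: initial_datum_def)
qed

abbreviation datum_series ::
  "(real \<Rightarrow> real) \<Rightarrow> nat \<Rightarrow> (real^'d::finite \<Rightarrow> real) \<Rightarrow> 'n::finite \<Rightarrow> real^'n \<Rightarrow> real^'d \<Rightarrow> real" where
  "datum_series E \<nu> f j t x \<equiv> \<Sum>\<kappa>=1..\<nu> - 1. (laplacian ^^ \<kappa>) f x / 2 ^ \<kappa> * dt j (\<lambda>t _. M_fun E \<nu> \<kappa> t) t x"

text \<open>With e = (k+1)/\<nu> one has e / (k+1)! = 1 / (\<nu> k!), and the Gamma factor of the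
  datum cancels against that of the Taylor monomial. So the derivatives of the functions M in (P)
  are precisely the singular terms generated by the traces in (I).\<close>

lemma initial_datum_series:
  fixes t :: "real^'n::finite" and f :: "real^'d::finite \<Rightarrow> real"
  assumes \<nu>: "2 \<le> \<nu>" and \<beta>: "\<beta> = 1 / real \<nu>" and t: "t \<in> open_orthant"
  shows "datum_series E \<nu> f j t x
    = (\<Sum>k<\<nu> - 1. initial_datum E \<nu> f j (Suc k) t x * (t $ j powr (real (Suc k) * \<beta> - 1) / Gamma (real (Suc k) * \<beta>)))"
proof -
  have t0: "0 < t $ j" using t by (simp add: open_orthant_def)
  have term_eq: "(laplacian ^^ Suc k) f x / 2 ^ Suc k * dt j (\<lambda>t _. M_fun E \<nu> (Suc k) t) t x
     = initial_datum E \<nu> f j (Suc k) t x * (t $ j powr (real (Suc k) * \<beta> - 1) / Gamma (real (Suc k) * \<beta>))" for k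
  proof -
    define e where "e = real (Suc k) / real \<nu>"
    define P where "P = (\<Prod>i\<in>UNIV - {j}. t $ i powr e)"
    define c where "c = E (real (Suc k)) ^ CARD('n)"
    have e: "0 < e" "e = real (Suc k) * \<beta>" using \<nu> by (auto simp: e_def \<beta>)
    have M: "M_fun E \<nu> (Suc k) (upd t j s) = c / fact (Suc k) * (P * s powr e)" for s
    proof -
      have "(\<Prod>i\<in>UNIV. upd t j s $ i powr e) = upd t j s $ j powr e * (\<Prod>i\<in>UNIV - {j}. upd t j s $ i powr e)"
        by (rule prod.remove) auto
      also have "(\<Prod>i\<in>UNIV - {j}. upd t j s $ i powr e) = P" unfolding P_def by (intro prod.cong) auto
      finally have eq: "(\<Prod>i\<in>UNIV. upd t j s $ i powr e) = P * s powr e" by simp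
      show ?thesis unfolding M_fun_def e_def[symmetric] c_def[symmetric] eq ..
    qed
    have "((\<lambda>s. c / fact (Suc k) * (P * s powr e)) has_real_derivative c / fact (Suc k) * (P * (e * (t $ j) powr (e - 1)))) (at (t $ j))"
      using has_real_derivative_powr[OF t0, of e] by (intro DERIV_cmult)
    hence "dt j (\<lambda>t _. M_fun E \<nu> (Suc k) t) t x = c / fact (Suc k) * (P * (e * (t $ j) powr (e - 1)))"
      unfolding dt_def M by (rule DERIV_imp_deriv)
    moreover have "initial_datum E \<nu> f j (Suc k) t x = Gamma e * c * (laplacian ^^ Suc k) f x * P / (real \<nu> * 2 ^ Suc k * fact k)"
      by (simp add: initial_datum_def c_def e_def P_def del: of_nat_Suc funpow.simps power_Suc)
    moreover have "Gamma e \<noteq> 0" using Gamma_real_pos[OF e(1)] by simp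
    moreover have "e / fact (Suc k) = 1 / (real \<nu> * fact k)"
      unfolding e_def fact_Suc by (simp del: of_nat_Suc)
    ultimately show ?thesis
    proof -
      assume 1: "dt j (\<lambda>t _. M_fun E \<nu> (Suc k) t) t x = c / fact (Suc k) * (P * (e * (t $ j) powr (e - 1)))"
        and 2: "initial_datum E \<nu> f j (Suc k) t x = Gamma e * c * (laplacian ^^ Suc k) f x * P / (real \<nu> * 2 ^ Suc k * fact k)"
        and 3: "Gamma e \<noteq> 0" and 4: "e / fact (Suc k) = 1 / (real \<nu> * fact k)"
      define A where "A = (laplacian ^^ Suc k) f x"
      define T where "T = (t $ j) powr (e - 1)"
      have "A / 2 ^ Suc k * (c / fact (Suc k) * (P * (e * T))) = A * c * P * T / 2 ^ Suc k * (e / fact (Suc k))"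
        by simp
      also have "\<dots> = A * c * P * T / 2 ^ Suc k * (1 / (real \<nu> * fact k))" by (simp only: 4)
      also have "\<dots> = Gamma e * c * A * P / (real \<nu> * 2 ^ Suc k * fact k) * (T / Gamma e)"
        using 3 by (simp add: mult_ac del: power_Suc)
      finally show ?thesis unfolding 1 2 e(2)[symmetric] A_def T_def .
    qed
  qed
  have "datum_series E \<nu> f j t x
     = (\<Sum>k<\<nu> - 1. (laplacian ^^ Suc k) f x / 2 ^ Suc k * dt j (\<lambda>t _. M_fun E \<nu> (Suc k) t) t x)"
    by (rule sum.reindex_bij_witness[of _ Suc "\<lambda>k. k - 1"]) auto
  thus ?thesis by (simp only: term_eq)
qed

text \<open>The half-line equivalence with N = \<nu> - 1, for which N \<beta> = 1 - \<beta>, at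
  fixed x and fixed times other than t_j.\<close>

lemma slice_equivalence:
  fixes t :: "real^'n::finite" and f :: "real^'d::finite \<Rightarrow> real" and u :: "real^'n \<Rightarrow> real^'d \<Rightarrow> real"
  assumes \<nu>: "2 \<le> \<nu>" and \<beta>: "\<beta> = 1 / real \<nu>" and t: "t \<in> open_orthant"
    and u: "caputo_diff \<beta> (\<lambda>s. u (upd t j s) x)" and v: "caputo_diff_iter \<beta> (\<nu> - 1) v"
    and lim: "\<And>k. k < \<nu> - 1 \<Longrightarrow> ((caputo \<beta> ^^ k) v \<longlongrightarrow> initial_datum E \<nu> f j (Suc k) t x) (at_right 0)"
    and cont: "continuous_on {0<..} ((caputo \<beta> ^^ (\<nu> - 1)) v)"
  shows "(\<forall>s>0. caputo \<beta> (\<lambda>s. u (upd t j s) x) s = v s) \<longleftrightarrow>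
    (\<forall>s>0. dt j u (upd t j s) x =
      datum_series E \<nu> f j (upd t j s) x
      + (caputo \<beta> ^^ (\<nu> - 1)) v s)"
proof -
  have b: "0 < \<beta>" "\<beta> < 1" "real (\<nu> - 1) * \<beta> = 1 - \<beta>"
    using \<nu> by (auto simp: \<beta> of_nat_diff field_simps)
  have dt: "dt j u (upd t j s) x = deriv (\<lambda>s. u (upd t j s) x) s" for s by (simp add: dt_def)
  have "1 \<le> \<nu> - 1" using \<nu> by simp
  from caputo_eq_iff_deriv_eq[OF b(1,2) this b(3) u v lim cont]
  show ?thesis
    unfolding dt using initial_datum_series[OF \<nu> \<beta> open_orthant_upd[OF t], where j = j and f = f and x = x and E = E]
    by (auto cong: sum.cong)
qed

context subordinator
begin

lemma inverse_moment_eq: "inverse_moment M L (real k) = (\<integral>y. y ^ k \<partial>inverse_law)"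
proof -
  have [measurable]: "inverse_process L 1 \<in> borel_measurable M" by (rule inverse_measurable)
  have "inverse_moment M L (real k) = (\<integral>y. y powr real k \<partial>distr M borel (inverse_process L 1))"
    unfolding inverse_moment_def by (subst integral_distr) auto
  also have "distr M borel (inverse_process L 1) = distr inverse_law borel (\<lambda>y. y)"
    using distr_inverse[of 1] by simp
  also have "(\<integral>y. y powr real k \<partial>distr inverse_law borel (\<lambda>y. y)) = (\<integral>y. y powr real k \<partial>inverse_law)"
    by (subst integral_distr) auto
  also have "\<dots> = (\<integral>y. y ^ k \<partial>inverse_law)"
  proof (rule integral_cong_AE)
    show "AE y in inverse_law. y powr real k = y ^ k" using inverse_law_pos by eventually_elim (rule powr_realpow)
  qed auto
  finally show ?thesis .
qed

lemma inverse_moment_value: "inverse_moment M L (real k) = fact k / Gamma (1 + real k * \<beta>)"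
  using inverse_law_moment[of k] by (simp add: inverse_moment_eq has_bochner_integral_iff)

end

context mixing
begin

lemma avg_cmult:
  assumes "\<And>\<sigma>. 0 < \<sigma> \<Longrightarrow> G \<sigma> x = c * H \<sigma> x"
  shows "avg k G \<theta> \<tau> x = c * avg k H \<theta> \<tau> x"
proof -
  have "cutoff G \<sigma> x = c * cutoff H \<sigma> x" for \<sigma> using assms by (simp add: cutoff_def)
  thus ?thesis unfolding avg_def by (simp add: mult.left_commute)
qed

lemma avg_sum:
  assumes G: "\<And>b. b \<in> A \<Longrightarrow> tame a (G b)" and a: "0 \<le> a" "a < 1" and pos: "0 < \<theta>" "0 < \<tau>"
  shows "avg k (\<lambda>\<sigma> x. \<Sum>b\<in>A. c * G b \<sigma> x) \<theta> \<tau> x = (\<Sum>b\<in>A. c * avg k (G b) \<theta> \<tau> x)"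
proof -
  have cut: "cutoff (\<lambda>\<sigma> x. \<Sum>b\<in>A. c * G b \<sigma> x) \<sigma> x = (\<Sum>b\<in>A. c * cutoff (G b) \<sigma> x)" for \<sigma>
    by (simp add: cutoff_def)
  have "integrable mix (\<lambda>p. c * ((\<theta> * fst p) ^ k * cutoff (G b) (\<theta> * \<tau> * (fst p * snd p)) x))" if "b \<in> A" for b
    using that by (intro integrable_mult_right avg_integrable[OF G a pos])
  from Bochner_Integration.integral_sum[OF this]
  show ?thesis unfolding avg_def cut by (simp add: sum_distrib_left mult.left_commute)
qed

end

lemma heat_measurable:
  assumes "poly_growth g"
  shows "(\<lambda>\<sigma>. heat g \<sigma> x) \<in> borel_measurable borel"
proof -
  interpret G: prob_space "gauss :: (real^'a) measure" by (rule prob_space_gauss)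
  note [measurable] = poly_growth_measurable[OF assms]
  show ?thesis unfolding heat_avg_def by measurable
qed

context holder_data
begin

lemma exponent: "0 \<le> 1 - \<alpha> / 2" "1 - \<alpha> / 2 < 1"
  using alpha by auto

lemma tame_lap_heat_0: "k < \<nu> \<Longrightarrow> tame 0 (lap_heat k)"
  using tame_lap_heat(2)[of k "[]"] by simp

lemma tame_lap_heat_1: "k \<le> \<nu> \<Longrightarrow> tame (1 - \<alpha> / 2) (lap_heat k)"
  using tame_lap_heat(1)[of k "[]"] by simp

lemma lap_heat_tendsto:
  assumes "k < \<nu>"
  shows "((\<lambda>\<sigma>. lap_heat k \<sigma> x) \<longlongrightarrow> lap_datum k x) (at_right 0)"
proof -
  have "((\<lambda>\<sigma>. heat (lap_datum k) \<sigma> x) \<longlongrightarrow> heat (lap_datum k) 0 x) (at 0 within {0..})"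
    using lap_heat_continuous_0[OF assms, of x] by (auto simp: continuous_on_def)
  hence "((\<lambda>\<sigma>. heat (lap_datum k) \<sigma> x) \<longlongrightarrow> lap_datum k x) (at_right 0)"
    unfolding heat_zero by (rule tendsto_within_subset) auto
  thus ?thesis
    by (rule Lim_transform_eventually) (use lap_heat_eq_heat[OF _ assms] in \<open>auto simp: eventually_at_filter\<close>)
qed

lemma laplacian_power_lap_heat:
  assumes "0 < \<sigma>"
  shows "(laplacian ^^ \<nu>) (lap_heat 0 \<sigma>) = (\<lambda>x. 2 ^ \<nu> * lap_heat \<nu> \<sigma> x)"
  by (simp add: lap_heat_def)

end

section \<open>The sheet functionals satisfy the conditions and both systems\<close>

locale isl_data = isl_process M \<nu> \<beta> L W Ls + holder_data \<nu> \<alpha> f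
  for M :: "'w measure" and \<nu> \<beta> L and W :: "real^'n::finite \<Rightarrow> 'w \<Rightarrow> real^'d::finite" and Ls \<alpha> and f :: "real^'d \<Rightarrow> real" +
  fixes j :: 'n
begin

sublocale X: mixing M \<nu> \<beta> L "rho j" by (rule mixing_prod_law) simp

abbreviation \<theta> :: "real^'n \<Rightarrow> real" where "\<theta> t \<equiv> theta t j"

abbreviation E :: "real \<Rightarrow> real" where "E \<equiv> inverse_moment M L"

lemma rho_moment: "(\<integral>w. w ^ k \<partial>rho j) = E (real k) ^ (CARD('n) - 1)"
  by (simp add: prod_law_moment inverse_moment_eq card_Diff_singleton)

text \<open>The powers k = 0, 1, \<nu> give u, V and U, so continuity, Caputo derivatives and
  boundary values are established once for all three.\<close>

definition J :: "nat \<Rightarrow> real^'n \<Rightarrow> real^'d \<Rightarrow> real" where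
  "J k t x = (\<integral>\<omega>. (\<Prod>i\<in>UNIV - {j}. inverse_process (Ls i) (t $ i) \<omega>) ^ k * f (levy_time_sheet W Ls x t \<omega>) \<partial>M)"

lemma isl_J: "isl_u M W Ls f = J 0" "isl_U M W Ls f \<nu> j = J \<nu>" "isl_V M W Ls f j = J 1"
  by (simp_all add: fun_eq_iff isl_u_def isl_U_def isl_V_def J_def)

lemma f_growth: "poly_growth f"
  using f_poly_growth[of "[]"] by simp

lemma J_eq: "t \<in> orthant \<Longrightarrow> J k t x = (\<integral>q. (\<theta> t * fst q) ^ k * heat f (\<theta> t * tau t j * (fst q * snd q)) x \<partial>X.mix)"
  unfolding J_def by (rule isl_expectation[OF _ f_growth])

lemma J_avg:
  assumes t: "t \<in> orthant" "0 < \<theta> t" "0 < t $ j"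
  shows "J k t x = X.avg k (lap_heat 0) (\<theta> t) (t $ j powr \<beta>) x"
proof -
  have "J k t x = (\<integral>q. (\<theta> t * fst q) ^ k * heat f (\<theta> t * (t $ j powr \<beta>) * (fst q * snd q)) x \<partial>X.mix)"
    using J_eq[OF t(1)] by (simp add: tau_def)
  also have "\<dots> = X.avg k (lap_heat 0) (\<theta> t) (t $ j powr \<beta>) x"
    unfolding X.avg_def
  proof (rule integral_cong_AE)
    note [measurable] = heat_measurable[OF f_growth, of x]
    show "(\<lambda>q. (\<theta> t * fst q) ^ k * heat f (\<theta> t * (t $ j powr \<beta>) * (fst q * snd q)) x) \<in> borel_measurable X.mix"
      by measurable
    show "(\<lambda>q. (\<theta> t * fst q) ^ k * cutoff (lap_heat 0) (\<theta> t * (t $ j powr \<beta>) * (fst q * snd q)) x) \<in> borel_measurable X.mix"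
      using nu2 by (intro X.avg_measurable[OF tame_lap_heat_0]) simp
    show "AE q in X.mix. (\<theta> t * fst q) ^ k * heat f (\<theta> t * (t $ j powr \<beta>) * (fst q * snd q)) x
      = (\<theta> t * fst q) ^ k * cutoff (lap_heat 0) (\<theta> t * (t $ j powr \<beta>) * (fst q * snd q)) x"
      using X.mix_pos by eventually_elim (use t in \<open>simp add: lap_heat_def\<close>)
  qed
  finally show ?thesis .
qed

text \<open>At t_j = 0 the variance is 0 and the sheet sits at its starting point, so only the
  moment of the other clocks is left.\<close>

lemma J_boundary_j:
  assumes t: "t \<in> orthant" "t $ j = 0"
  shows "J k t x = f x * (\<theta> t ^ k * E (real k) ^ (CARD('n) - 1))"
proof -
  have "J k t x = (\<integral>q. (\<theta> t * fst q) ^ k * f x \<partial>X.mix)"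
    using t by (simp add: J_eq tau_def heat_zero)
  from this[unfolded X.integral_mix_power rho_moment] show ?thesis by (simp only: mult_ac)
qed

text \<open>A vanishing coordinate other than j makes \<theta> = 0, which kills both the variance
  and every positive power of the clock factor.\<close>

lemma J_boundary_other:
  assumes t: "t \<in> orthant" "i \<noteq> j" "t $ i = 0"
  shows "J k t x = (if k = 0 then f x else 0)"
proof -
  have "\<theta> t = 0" unfolding theta_def using t by (intro prod_zero) auto
  thus ?thesis using J_boundary_j J_eq[OF t(1), of k x] X.integral_mix_power[of 0 0 "f x"]
    by (auto simp: heat_zero X.P.prob_space)
qed

lemma theta_upd [simp]: "\<theta> (upd t j s) = \<theta> t"
  unfolding theta_def by (intro prod.cong) auto

lemma theta_pos: "t \<in> open_orthant \<Longrightarrow> 0 < \<theta> t"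
  unfolding theta_def
proof (intro prod_pos ballI)
  fix i assume "t \<in> open_orthant"
  hence "0 < t $ i" by (simp add: open_orthant_def)
  thus "0 < t $ i powr \<beta>" by simp
qed

lemma orthant_upd: "t \<in> orthant \<Longrightarrow> 0 \<le> s \<Longrightarrow> upd t j s \<in> orthant"
  by (simp add: orthant_def)

text \<open>Each Caputo derivative raises the clock power and the order of the heat derivative
  together. The function being differentiated is \<open>lap_heat l\<close> with l < \<nu>, still of
  order 0; its derivative has order at most 1 - \<alpha>/2. Thus exactly \<nu> derivatives are
  available.\<close>

lemma
  assumes t: "t \<in> orthant" "0 < \<theta> t" and m: "m \<le> \<nu>"
  shows J_caputo_iter: "0 < s \<Longrightarrow> (caputo \<beta> ^^ m) (\<lambda>s. J k (upd t j s) x) s = X.avg (k + m) (lap_heat m) (\<theta> t) (s powr \<beta>) x"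
    and J_caputo_diff_iter: "caputo_diff_iter \<beta> m (\<lambda>s. J k (upd t j s) x)"
proof -
  have eq: "(caputo \<beta> ^^ l) (\<lambda>s. J k (upd t j s) x) s = X.avg (k + l) (lap_heat l) (\<theta> t) (s powr \<beta>) x"
    if "0 < s" "l \<le> \<nu>" for l s
    using that
  proof (induction l arbitrary: s)
    case 0
    thus ?case using J_avg[of "upd t j s" k x] t orthant_upd[of t s] by simp
  next
    case (Suc l)
    hence l: "l < \<nu>" by simp
    have "(caputo \<beta> ^^ Suc l) (\<lambda>s. J k (upd t j s) x) s = caputo \<beta> ((caputo \<beta> ^^ l) (\<lambda>s. J k (upd t j s) x)) s" by simp
    also have "caputo \<beta> ((caputo \<beta> ^^ l) (\<lambda>s. J k (upd t j s) x)) = caputo \<beta> (\<lambda>s. X.avg (k + l) (lap_heat l) (\<theta> t) (s powr \<beta>) x)"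
      by (rule caputo_cong) (use Suc l in auto)
    also have "caputo \<beta> (\<lambda>s. X.avg (k + l) (lap_heat l) (\<theta> t) (s powr \<beta>) x) s = X.avg (Suc (k + l)) (lap_heat (Suc l)) (\<theta> t) (s powr \<beta>) x"
      using l Suc.prems by (intro X.caputo_avg[OF tame_lap_heat_0 tame_lap_heat_1 exponent t(2) lap_heat_time_deriv]) auto
    finally show ?case by simp
  qed
  show "0 < s \<Longrightarrow> (caputo \<beta> ^^ m) (\<lambda>s. J k (upd t j s) x) s = X.avg (k + m) (lap_heat m) (\<theta> t) (s powr \<beta>) x"
    by (rule eq[OF _ m])
  show "caputo_diff_iter \<beta> m (\<lambda>s. J k (upd t j s) x)"
    unfolding caputo_diff_iter_def
  proof (intro allI impI)
    fix l assume "l < m"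
    hence l: "l < \<nu>" using m by simp
    have "caputo_diff \<beta> ((caputo \<beta> ^^ l) (\<lambda>s. J k (upd t j s) x)) \<longleftrightarrow> caputo_diff \<beta> (\<lambda>s. X.avg (k + l) (lap_heat l) (\<theta> t) (s powr \<beta>) x)"
      by (rule caputo_diff_cong) (use eq l in auto)
    moreover have "caputo_diff \<beta> (\<lambda>s. X.avg (k + l) (lap_heat l) (\<theta> t) (s powr \<beta>) x)"
      using l by (intro X.caputo_diff_avg[OF tame_lap_heat_0 tame_lap_heat_1 exponent t(2) lap_heat_time_deriv]) auto
    ultimately show "caputo_diff \<beta> ((caputo \<beta> ^^ l) (\<lambda>s. J k (upd t j s) x))" by simp
  qed
qed

lemma
  assumes n: "2 * l + n \<le> 2 * \<nu>" and pos: "0 < \<theta>'" "0 < \<tau>"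
  shows avg_exist: "pdx_exist n (X.avg k (lap_heat l) \<theta>' \<tau>)"
    and pdxs_avg: "length is \<le> n \<Longrightarrow> pdxs is (X.avg k (lap_heat l) \<theta>' \<tau>) = X.avg k (\<lambda>\<sigma>. pdxs is (lap_heat l \<sigma>)) \<theta>' \<tau>"
proof -
  let ?B = "\<lambda>is. X.avg k (\<lambda>\<sigma>. pdxs is (lap_heat l \<sigma>)) \<theta>' \<tau>"
  have 1: "pd_at i (?B is) x (?B (i # is) x)" if len: "length is < n" for "is" i x
  proof (rule X.avg_pd_at[OF _ _ exponent pos])
    show "tame (1 - \<alpha> / 2) (\<lambda>\<sigma>. pdxs is (lap_heat l \<sigma>))" "tame (1 - \<alpha> / 2) (\<lambda>\<sigma>. pdxs (i # is) (lap_heat l \<sigma>))"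
      using len n by (intro tame_lap_heat(1); simp)+
    show "pd_at i (pdxs is (lap_heat l \<sigma>)) x (pdxs (i # is) (lap_heat l \<sigma>) x)" if "0 < \<sigma>" for \<sigma> x
      by (rule pdx_existD[OF lap_heat_exist[OF that n] len])
  qed
  show "pdx_exist n (X.avg k (lap_heat l) \<theta>' \<tau>)" by (rule pdx_existI[where B = ?B]) (use 1 in auto)
  show "pdxs is (X.avg k (lap_heat l) \<theta>' \<tau>) = ?B is" if "length is \<le> n"
    by (rule pdxs_eqI[where B = ?B and m = n]) (use 1 that in auto)
qed

lemma avg_jointly_continuous:
  fixes G :: "real \<Rightarrow> real^'d \<Rightarrow> real"
  assumes "tame (1 - \<alpha> / 2) G" and eq: "\<And>t x. t \<in> open_orthant \<Longrightarrow> g t x = X.avg k G (\<theta> t) (t $ j powr \<beta>) x"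
  shows "jointly_continuous open_orthant g"
  unfolding jointly_continuous_def
proof (rule continuous_on_eq)
  have c: "continuous_on (open_orthant \<times> (UNIV :: (real^'d) set)) (\<lambda>p. fst p $ i powr \<beta>)" for i :: 'n
    using beta_pos by (intro continuous_on_powr' continuous_intros) (auto simp: open_orthant_def less_imp_le)
  have "continuous_on (open_orthant \<times> UNIV) ((\<lambda>(\<theta>, \<tau>, x). X.avg k G \<theta> \<tau> x) \<circ> (\<lambda>p. (\<theta> (fst p), fst p $ j powr \<beta>, snd p)))"
  proof (rule continuous_on_compose)
    show "continuous_on (open_orthant \<times> UNIV) (\<lambda>p :: (real^'n) \<times> (real^'d). (\<theta> (fst p), fst p $ j powr \<beta>, snd p))"
      unfolding theta_def by (intro continuous_on_Pair continuous_on_prod c continuous_on_snd continuous_on_id)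
    show "continuous_on ((\<lambda>p. (\<theta> (fst p), fst p $ j powr \<beta>, snd p)) ` (open_orthant \<times> (UNIV :: (real^'d) set))) (\<lambda>(\<theta>, \<tau>, x). X.avg k G \<theta> \<tau> x)"
      by (rule continuous_on_subset[OF X.avg_continuous[OF assms(1) exponent]]) (auto simp: theta_pos, auto simp: open_orthant_def dest: spec[of _ j])
  qed
  thus "continuous_on (open_orthant \<times> UNIV) (\<lambda>p :: (real^'n) \<times> (real^'d). X.avg k G (\<theta> (fst p)) (fst p $ j powr \<beta>) (snd p))"
    by (simp add: comp_def)
qed (use eq in auto)

lemma avg_space_C:
  assumes n: "2 * l + n \<le> 2 * \<nu>" and eq: "\<And>t. t \<in> open_orthant \<Longrightarrow> g t = X.avg k (lap_heat l) (\<theta> t) (t $ j powr \<beta>)"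
  shows "space_C n open_orthant g"
  unfolding space_C_def
proof (intro conjI ballI allI impI)
  have pos: "0 < t $ j powr \<beta>" if "t \<in> open_orthant" for t
  proof -
    have "0 < t $ j" using that by (simp add: open_orthant_def)
    thus ?thesis by simp
  qed
  show "pdx_exist n (g t)" if "t \<in> open_orthant" for t
    unfolding eq[OF that] by (rule avg_exist[OF n theta_pos[OF that] pos[OF that]])
  show "jointly_continuous open_orthant (\<lambda>t. pdxs is (g t))" if "length is \<le> n" for "is"
  proof (rule avg_jointly_continuous)
    show "tame (1 - \<alpha> / 2) (\<lambda>\<sigma>. pdxs is (lap_heat l \<sigma>))" using that n by (intro tame_lap_heat(1)) simp
    show "pdxs is (g t) x = X.avg k (\<lambda>\<sigma>. pdxs is (lap_heat l \<sigma>)) (\<theta> t) (t $ j powr \<beta>) x" if t: "t \<in> open_orthant" for t x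
      unfolding eq[OF t] by (subst pdxs_avg[OF n theta_pos[OF t] pos[OF t] \<open>length is \<le> n\<close>]) simp
  qed
qed

lemma laplacian_power_avg:
  assumes n: "2 * l + 2 * m \<le> 2 * \<nu>" and pos: "0 < \<theta>'" "0 < \<tau>"
  shows "(laplacian ^^ m) (X.avg k (lap_heat l) \<theta>' \<tau>) x = X.avg k (\<lambda>\<sigma>. (laplacian ^^ m) (lap_heat l \<sigma>)) \<theta>' \<tau> x"
proof -
  have "(laplacian ^^ m) (X.avg k (lap_heat l) \<theta>' \<tau>) x = (\<Sum>js\<in>lap_words m. 1 * pdxs js (X.avg k (lap_heat l) \<theta>' \<tau>) x)"
    by (simp add: laplacian_power_eq[OF avg_exist[OF n pos]])
  also have "\<dots> = (\<Sum>js\<in>lap_words m. 1 * X.avg k (\<lambda>\<sigma>. pdxs js (lap_heat l \<sigma>)) \<theta>' \<tau> x)"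
    using n pos by (intro sum.cong refl) (simp add: pdxs_avg[where n = "2 * m"] lap_words_length)
  also have "\<dots> = X.avg k (\<lambda>\<sigma> x. \<Sum>js\<in>lap_words m. 1 * pdxs js (lap_heat l \<sigma>) x) \<theta>' \<tau> x"
    using n by (intro X.avg_sum[OF _ exponent pos, symmetric] tame_lap_heat(1)) (auto simp: lap_words_length)
  also have "\<dots> = 1 * X.avg k (\<lambda>\<sigma>. (laplacian ^^ m) (lap_heat l \<sigma>)) \<theta>' \<tau> x"
    by (rule X.avg_cmult) (simp add: laplacian_power_eq[OF lap_heat_exist[OF _ n]])
  finally show ?thesis by simp
qed

lemma laplacian_avg:
  assumes l: "l < \<nu>" and pos: "0 < \<theta>'" "0 < \<tau>"
  shows "laplacian (X.avg k (lap_heat l) \<theta>' \<tau>) x = 2 * X.avg k (lap_heat (Suc l)) \<theta>' \<tau> x"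
proof -
  have "laplacian (X.avg k (lap_heat l) \<theta>' \<tau>) x = X.avg k (\<lambda>\<sigma>. laplacian (lap_heat l \<sigma>)) \<theta>' \<tau> x"
    using laplacian_power_avg[of l 1 \<theta>' \<tau> k x] l pos by simp
  also have "\<dots> = 2 * X.avg k (lap_heat (Suc l)) \<theta>' \<tau> x"
    by (rule X.avg_cmult) (simp add: laplacian_lap_heat[OF _ l])
  finally show ?thesis .
qed

lemma J_open:
  assumes "t \<in> open_orthant"
  shows "J k t = X.avg k (lap_heat 0) (\<theta> t) (t $ j powr \<beta>)"
  using assms by (intro ext J_avg open_orthant_orthant theta_pos) (auto simp: open_orthant_def)

lemma laplacian_power_J:
  assumes t: "t \<in> open_orthant"
  shows "(laplacian ^^ \<nu>) (J \<nu> t) x = 2 ^ \<nu> * X.avg \<nu> (lap_heat \<nu>) (\<theta> t) (t $ j powr \<beta>) x"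
proof -
  have "0 < t $ j" using t by (simp add: open_orthant_def)
  hence p: "0 < \<theta> t" "0 < t $ j powr \<beta>" using t by (auto simp: theta_pos)
  have "(laplacian ^^ \<nu>) (J \<nu> t) x = X.avg \<nu> (\<lambda>\<sigma>. (laplacian ^^ \<nu>) (lap_heat 0 \<sigma>)) (\<theta> t) (t $ j powr \<beta>) x"
    unfolding J_open[OF t] by (rule laplacian_power_avg[OF _ p]) simp
  also have "\<dots> = 2 ^ \<nu> * X.avg \<nu> (lap_heat \<nu>) (\<theta> t) (t $ j powr \<beta>) x"
    by (rule X.avg_cmult) (simp add: laplacian_power_lap_heat)
  finally show ?thesis .
qed

lemma J_caputo_dt:
  assumes "t \<in> open_orthant" "m \<le> \<nu>"
  shows "(caputo_dt \<beta> j ^^ m) (J k) t = X.avg (k + m) (lap_heat m) (\<theta> t) (t $ j powr \<beta>)"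
proof
  fix x
  have "0 < t $ j" using assms by (simp add: open_orthant_def)
  thus "(caputo_dt \<beta> j ^^ m) (J k) t x = X.avg (k + m) (lap_heat m) (\<theta> t) (t $ j powr \<beta>) x"
    unfolding caputo_dt_iter by (rule J_caputo_iter[OF open_orthant_orthant[OF assms(1)] theta_pos[OF assms(1)] assms(2)])
qed

text \<open>Positivity of k matters at boundary times: \<open>0 powr 0\<close> is 0, whereas the
  power with exponent 0 on the left is 1.\<close>

lemma theta_power: "\<theta> t ^ k = (\<Prod>i\<in>UNIV - {j}. t $ i powr (real k / real \<nu>))" if "0 < k"
proof -
  have "(y powr \<beta>) ^ k = y powr (real k / real \<nu>)" for y
    using that exp_of_nat_mult[of k "\<beta> * ln y"] by (cases "y = 0") (auto simp: powr_def beta)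
  thus ?thesis unfolding theta_def prod_power_distrib by simp
qed

text \<open>Both sides of the linking equation are 2^\<nu> times the average with \<nu> clock
  factors and \<open>lap_heat \<nu>\<close>: V reaches it by \<nu> - 1 Caputo derivatives and one
  Laplacian, U by \<nu> Laplacians.\<close>

lemma cond_C_J: "cond_C \<beta> E \<nu> f j (J \<nu>) (J 1)"
  unfolding cond_C_def
proof (intro conjI ballI allI impI)
  show "space_C (2 * \<nu>) open_orthant (J \<nu>)"
    by (rule avg_space_C[where l = 0]) (auto simp: J_open)
  show "space_C 2 open_orthant ((caputo_dt \<beta> j ^^ (\<nu> - 1)) (J 1))"
    using nu2 by (intro avg_space_C[where l = "\<nu> - 1"]) (auto simp: J_caputo_dt)
  fix t :: "real^'n" and x
  {
    assume t: "t \<in> open_orthant"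
    show "caputo_diff_iter \<beta> (\<nu> - 1) (\<lambda>s. J 1 (upd t j s) x)"
      using t by (intro J_caputo_diff_iter) (auto simp: open_orthant_orthant theta_pos)
    have p: "0 < \<theta> t" "0 < t $ j powr \<beta>" using t by (auto simp: theta_pos open_orthant_def less_imp_neq[symmetric] dest: spec[of _ j])
    have "laplacian ((caputo_dt \<beta> j ^^ (\<nu> - 1)) (J 1) t) x = 2 * X.avg \<nu> (lap_heat \<nu>) (\<theta> t) (t $ j powr \<beta>) x"
      using laplacian_avg[OF _ p, of "\<nu> - 1" \<nu> x] nu2 t by (simp add: J_caputo_dt)
    moreover have "(2::real) ^ \<nu> = 2 ^ (\<nu> - 1) * 2" using nu2 by (cases \<nu>) auto
    ultimately show "2 ^ (\<nu> - 1) * laplacian ((caputo_dt \<beta> j ^^ (\<nu> - 1)) (J 1) t) x = (laplacian ^^ \<nu>) (J \<nu> t) x"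
      by (simp add: laplacian_power_J[OF t])
  }
  assume t: "t \<in> orthant"
  {
    assume tj: "t $ j = 0"
    have "(\<Prod>i\<in>UNIV - {j}. t $ i powr (real \<nu> / real \<nu>)) = (\<Prod>i\<in>UNIV - {j}. t $ i)"
      using nu2 t by (intro prod.cong) (auto simp: orthant_def)
    thus "J \<nu> t x = f x * N_fun E \<nu> j t"
      using nu2 J_boundary_j[OF t tj, of \<nu> x] by (simp add: N_fun_def theta_power)
    show "J 1 t x = f x * (\<Prod>i\<in>UNIV - {j}. E 1 * t $ i powr \<beta>)"
      using J_boundary_j[OF t tj, of 1 x] by (simp add: prod.distrib theta_def card_Diff_singleton)
  }
  assume "\<exists>i. i \<noteq> j \<and> t $ i = 0"
  thus "J 1 t x = 0" "J \<nu> t x = 0" using J_boundary_other[OF t] nu2 by auto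
qed

text \<open>Since E(k) = k! / Gamma(1 + k/\<nu>), the product Gamma(k/\<nu>) E(k) equals \<nu>
  (k-1)!. One of the n moment factors thus cancels with the prefactor, leaving the moment of the n -
  1 other clocks.\<close>

lemma initial_datum_eq:
  assumes k: "0 < k"
  shows "initial_datum E \<nu> f j k t x = \<theta> t ^ k * E (real k) ^ (CARD('n) - 1) * lap_datum k x"
proof -
  have g: "0 < Gamma (real k * \<beta>)" using k beta_pos by (intro Gamma_real_pos) simp
  have n0: "real k * \<beta> \<notin> \<int>\<^sub>\<le>\<^sub>0" 
  proof -
    have "0 < real k * \<beta>" using k beta_pos by simp
    thus ?thesis by (meson nonpos_Ints_nonpos not_le)
  qed
  have "Gamma (1 + real k * \<beta>) = real k * \<beta> * Gamma (real k * \<beta>)"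
    using Gamma_plus1[OF n0] by (simp add: add.commute)
  have "(fact k :: real) = real k * fact (k - 1)" using k by (rule fact_reduce)
  have e: "Gamma (real k / real \<nu>) * E (real k) / (real \<nu> * fact (k - 1)) = 1"
  proof -
    have "Gamma (real k / real \<nu>) \<noteq> 0" using g by (simp add: beta)
    thus ?thesis
      using \<open>Gamma (1 + real k * \<beta>) = real k * \<beta> * Gamma (real k * \<beta>)\<close> \<open>(fact k :: real) = real k * fact (k - 1)\<close> k nu2
      by (simp add: inverse_moment_value beta)
  qed
  have "E (real k) ^ CARD('n) = E (real k) * E (real k) ^ (CARD('n) - 1)"
    by (cases "CARD('n)") auto
  hence "initial_datum E \<nu> f j k t x = (Gamma (real k / real \<nu>) * E (real k) / (real \<nu> * fact (k - 1))) *
      (\<theta> t ^ k * E (real k) ^ (CARD('n) - 1) * lap_datum k x)"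
    using k by (simp add: initial_datum_def theta_power lap_datum_def mult_ac)
  thus ?thesis by (simp only: e mult_1)
qed

lemma J_caputo_tendsto:
  assumes t: "t \<in> orthant" "0 < \<theta> t" and k: "0 < k" "k < \<nu>"
  shows "((caputo \<beta> ^^ k) (\<lambda>s. J 0 (upd t j s) x) \<longlongrightarrow> initial_datum E \<nu> f j k t x) (at_right 0)"
proof -
  have lim: "((\<lambda>\<tau>. X.avg k (lap_heat k) (\<theta> t) \<tau> x) \<longlongrightarrow> initial_datum E \<nu> f j k t x) (at_right 0)"
    using X.avg_tendsto_0[OF tame_lap_heat_0[OF k(2)] t(2) lap_heat_tendsto[OF k(2)], of k x]
    by (simp add: initial_datum_eq[OF k(1)] rho_moment)
  have "filterlim (\<lambda>s. s powr \<beta>) (at_right 0) (at_right 0)"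
  proof -
    have "((\<lambda>s. s powr \<beta>) \<longlongrightarrow> 0 powr \<beta>) (at_right 0)"
      using beta_pos by (intro tendsto_powr' tendsto_intros) (auto simp: eventually_at_filter)
    thus ?thesis by (auto simp: filterlim_at eventually_at_filter)
  qed
  from filterlim_compose[OF lim this]
  show ?thesis
    by (rule Lim_transform_eventually) (use k t in \<open>auto simp: eventually_at_filter J_caputo_iter\<close>)
qed

lemma caputo_const: "caputo \<beta> (\<lambda>_. c) = (\<lambda>_. 0)"
  by (simp add: caputo_def fun_eq_iff set_lebesgue_integral_def)

lemma caputo_diff_const: "caputo_diff \<beta> (\<lambda>_. c)"
  by (simp add: caputo_diff_def set_integrable_def)

lemma caputo_iter_const: "(caputo \<beta> ^^ k) (\<lambda>_. c) = (\<lambda>_. if k = 0 then c else 0)"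
  by (induction k) (auto simp: caputo_const)

text \<open>The condition ranges over the closed orthant. If \<theta> > 0, the limits come from the
  averages at \<tau> = 0; otherwise the slice is constant at positive times and everything
  vanishes.\<close>

lemma cond_I_J: "cond_I \<beta> E \<nu> f j (J 0)"
  unfolding cond_I_def
proof (intro ballI allI)
  fix k and t :: "real^'n" and x
  assume k: "k \<in> {1..\<nu> - 1}" and t: "t \<in> orthant"
  show "caputo_diff_iter \<beta> k (\<lambda>s. J 0 (upd t j s) x) \<and>
    ((\<lambda>s. (caputo_dt \<beta> j ^^ k) (J 0) (upd t j s) x) \<longlongrightarrow> initial_datum E \<nu> f j k t x) (at_right 0)"
    unfolding caputo_dt_iter_slice
  proof (cases "0 < \<theta> t")
    case True
    thus "caputo_diff_iter \<beta> k (\<lambda>s. J 0 (upd t j s) x) \<and>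
      ((caputo \<beta> ^^ k) (\<lambda>s. J 0 (upd t j s) x) \<longlongrightarrow> initial_datum E \<nu> f j k t x) (at_right 0)"
      using k t by (intro conjI J_caputo_diff_iter J_caputo_tendsto) auto
  next
    case False
    hence th: "\<theta> t = 0" using theta_nonneg[of t j] by simp
    then obtain i where i: "i \<noteq> j" "t $ i = 0" unfolding theta_def by (auto simp: powr_eq_0_iff)
    \<comment> \<open>Only positive s are compared, which is all that the Caputo derivatives and the
      right limit see.\<close>
    have eq: "J 0 (upd t j s) x = f x" if "0 < s" for s
      using J_boundary_other[of "upd t j s" i 0 x] orthant_upd[OF t, of s] i that by simp
    have "(caputo \<beta> ^^ k) (\<lambda>s. J 0 (upd t j s) x) = (\<lambda>_. 0)"
      using caputo_iter_cong[where m = k, OF eq] k by (simp add: caputo_iter_const)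
    moreover have "caputo_diff_iter \<beta> k (\<lambda>s. J 0 (upd t j s) x)"
      using caputo_diff_iter_cong[where \<beta> = \<beta> and m = k, OF eq] by (simp add: caputo_diff_iter_def caputo_iter_const caputo_diff_const)
    moreover have "initial_datum E \<nu> f j k t x = 0" using k th by (simp add: initial_datum_eq)
    ultimately show "caputo_diff_iter \<beta> k (\<lambda>s. J 0 (upd t j s) x) \<and>
      ((caputo \<beta> ^^ k) (\<lambda>s. J 0 (upd t j s) x) \<longlongrightarrow> initial_datum E \<nu> f j k t x) (at_right 0)"
      by simp
  qed
qed

lemma J_orthant_boundary:
  assumes "t \<in> orthant_boundary"
  shows "J 0 t x = f x"
proof -
  obtain i where i: "t \<in> orthant" "t $ i = 0" using assms by (auto simp: orthant_boundary_def)
  show ?thesis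
  proof (cases "i = j")
    case True
    have "E (real 0) = 1" by (simp only: inverse_moment_value) simp
    thus ?thesis using True i J_boundary_j[of t 0 x] by simp
  next
    case False
    thus ?thesis using J_boundary_other[OF i(1) False i(2), of 0 x] by simp
  qed
qed

lemma J_caputo_eq_laplacian:
  assumes "t \<in> open_orthant"
  shows "caputo_dt \<beta> j (J 0) t x = 1/2 * laplacian (J 1 t) x"
proof -
  have p: "0 < \<theta> t" "0 < t $ j powr \<beta>" using assms by (auto simp: theta_pos open_orthant_def less_imp_neq[symmetric] dest: spec[of _ j])
  have "caputo_dt \<beta> j (J 0) t x = X.avg 1 (lap_heat 1) (\<theta> t) (t $ j powr \<beta>) x"
    using J_caputo_dt[OF assms, of 1 0] nu2 by simp
  thus ?thesis using laplacian_avg[OF _ p, of 0 1 x] nu2 by (simp add: J_open[OF assms])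
qed

lemma system_R_J: "system_R \<beta> E f j (J 0) (J 1)"
  unfolding system_R_def
proof (intro conjI ballI allI impI)
  show "space_C 2 open_orthant (J 1)"
    using nu2 by (intro avg_space_C[where l = 0]) (auto simp: J_open)
  fix t :: "real^'n" and x
  show "caputo_diff \<beta> (\<lambda>s. J 0 (upd t j s) x)" if "t \<in> open_orthant"
    using J_caputo_diff_iter[of t 1 0 x] that nu2 by (simp add: caputo_diff_iter_def open_orthant_orthant theta_pos)
  show "J 0 t x = f x" if "t \<in> orthant_boundary" by (rule J_orthant_boundary[OF that])
  show "J 1 t x = 0" if "t \<in> orthant" "\<exists>i. i \<noteq> j \<and> t $ i = 0" using cond_C_J that by (auto simp: cond_C_def)
  show "J 1 t x = (\<Prod>i\<in>UNIV - {j}. E 1 * t $ i powr \<beta>) * f x" if "t \<in> orthant" "t $ j = 0"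
    using cond_C_J that by (simp add: cond_C_def)
qed (rule J_caputo_eq_laplacian)

text \<open>Obtained from the Taylor argument with v the Caputo derivative of u itself: its iterated
  derivatives, traces and continuity are known from the averages, and its last derivative is
  recognised as the 2\<nu>-th order term in U. In this way no commutation of \<Delta> with Caputo
  derivatives of V is involved.\<close>

lemma system_P_J: "system_P E \<nu> f j (J 0) (J \<nu>)"
  unfolding system_P_def
proof (intro conjI ballI allI impI)
  show "space_C (2 * \<nu>) open_orthant (J \<nu>)" using cond_C_J by (simp add: cond_C_def)
  fix t :: "real^'n" and x
  show "J 0 t x = f x" if "t \<in> orthant_boundary" by (rule J_orthant_boundary[OF that])
  show "J \<nu> t x = 0" if "t \<in> orthant" "\<exists>i. i \<noteq> j \<and> t $ i = 0" using cond_C_J that by (auto simp: cond_C_def)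
  show "J \<nu> t x = f x * N_fun E \<nu> j t" if "t \<in> orthant" "t $ j = 0"
    using cond_C_J that by (simp add: cond_C_def)
  assume t: "t \<in> open_orthant"
  have t0: "0 < t $ j" using t by (simp add: open_orthant_def)
  let ?u = "\<lambda>s. J 0 (upd t j s) x"
  have it: "caputo_diff_iter \<beta> \<nu> ?u" using t by (intro J_caputo_diff_iter) (auto simp: open_orthant_orthant theta_pos)
  have u: "caputo_diff \<beta> ?u" using it nu2 unfolding caputo_diff_iter_def by (auto dest: spec[of _ 0])
  show "?u field_differentiable at (t $ j)" using u t0 by (simp add: caputo_diff_def)
  have sw: "(caputo \<beta> ^^ k) (caputo \<beta> ?u) = (caputo \<beta> ^^ Suc k) ?u" for k by (simp only: funpow_Suc_right comp_def)
  \<comment> \<open>In total \<nu> Caputo derivatives of u, that is \<nu> - 1 of v, give the average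
    with \<nu> clock factors and \<open>lap_heat \<nu>\<close>.\<close>
  have top: "(caputo \<beta> ^^ (\<nu> - 1)) (caputo \<beta> ?u) s = 1 / 2 ^ \<nu> * (laplacian ^^ \<nu>) (J \<nu> (upd t j s)) x" if s: "0 < s" for s
  proof -
    have "(caputo \<beta> ^^ (\<nu> - 1)) (caputo \<beta> ?u) s = X.avg \<nu> (lap_heat \<nu>) (\<theta> t) (s powr \<beta>) x"
      using J_caputo_iter[OF open_orthant_orthant[OF t] theta_pos[OF t] order_refl s, of 0 x] nu2 unfolding sw by simp
    thus ?thesis by (simp add: laplacian_power_J[OF open_orthant_upd[OF t s]])
  qed
  have "\<forall>s>0. dt j (J 0) (upd t j s) x =
      datum_series E \<nu> f j (upd t j s) x
      + (caputo \<beta> ^^ (\<nu> - 1)) (caputo \<beta> ?u) s"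
  proof (rule iffD1[OF slice_equivalence[where u = "J 0" and t = t and j = j and x = x and f = f and E = E and v = "caputo \<beta> ?u", OF nu2 beta t u]])
    show "caputo_diff_iter \<beta> (\<nu> - 1) (caputo \<beta> ?u)"
      unfolding caputo_diff_iter_def
    proof (intro allI impI)
      fix m assume "m < \<nu> - 1"
      hence "Suc m < \<nu>" by simp
      thus "caputo_diff \<beta> ((caputo \<beta> ^^ m) (caputo \<beta> ?u))" unfolding sw using it[unfolded caputo_diff_iter_def] by blast
    qed
    show "((caputo \<beta> ^^ k) (caputo \<beta> ?u) \<longlongrightarrow> initial_datum E \<nu> f j (Suc k) t x) (at_right 0)" if "k < \<nu> - 1" for k
      unfolding sw using that t by (intro J_caputo_tendsto) (auto simp: open_orthant_orthant theta_pos)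
    have "continuous_on {0<..} (\<lambda>s. X.avg \<nu> (lap_heat \<nu>) (\<theta> t) (s powr \<beta>) x)"

    proof -
      have "continuous_on {0<..} ((\<lambda>(\<theta>, \<tau>, x). X.avg \<nu> (lap_heat \<nu>) \<theta> \<tau> x) \<circ> (\<lambda>s. (\<theta> t, s powr \<beta>, x)))"
      proof (rule continuous_on_compose)
        show "continuous_on {0<..} (\<lambda>s. (\<theta> t, s powr \<beta>, x))"
          using beta_pos by (intro continuous_intros continuous_on_powr') auto
        show "continuous_on ((\<lambda>s. (\<theta> t, s powr \<beta>, x)) ` {0<..}) (\<lambda>(\<theta>, \<tau>, x). X.avg \<nu> (lap_heat \<nu>) \<theta> \<tau> x)"
          by (rule continuous_on_subset[OF X.avg_continuous[OF tame_lap_heat_1[OF order_refl] exponent]]) (auto simp: theta_pos[OF t])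
      qed
      thus ?thesis by (simp add: comp_def)
    qed
    moreover have "X.avg \<nu> (lap_heat \<nu>) (\<theta> t) (s powr \<beta>) x = (caputo \<beta> ^^ (\<nu> - 1)) (caputo \<beta> ?u) s" if "s \<in> {0<..}" for s
      using J_caputo_iter[OF open_orthant_orthant[OF t] theta_pos[OF t] order_refl, of s 0 x] that nu2 unfolding sw by simp
    ultimately show "continuous_on {0<..} ((caputo \<beta> ^^ (\<nu> - 1)) (caputo \<beta> ?u))" by (rule continuous_on_eq)
  qed simp
  from this[rule_format, OF t0] top[OF t0]
  show "dt j (J 0) t x = datum_series E \<nu> f j t x +
      1 / 2 ^ \<nu> * (laplacian ^^ \<nu>) (J \<nu> t) x" by simp
qed

end

section \<open>The two systems\<close>

lemma caputo_cmult_sum: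
  assumes g: "\<And>i. i \<in> A \<Longrightarrow> caputo_diff \<beta> (g i)"
  shows "caputo_diff \<beta> (\<lambda>s. \<Sum>i\<in>A. c * g i s)"
    and "0 < t \<Longrightarrow> caputo \<beta> (\<lambda>s. \<Sum>i\<in>A. c * g i s) t = (\<Sum>i\<in>A. c * caputo \<beta> (g i) t)"
proof -
  let ?S = "\<lambda>s. \<Sum>i\<in>A. c * g i s"
  have D: "(?S has_real_derivative (\<Sum>i\<in>A. c * deriv (g i) s)) (at s)" if "0 < s" for s
    using that g by (intro DERIV_sum DERIV_cmult caputo_diff_has_derivative)
  note d = DERIV_imp_deriv[OF D]
  have int: "integrable lborel (\<lambda>s. indicat_real {0<..<t} s *\<^sub>R (deriv (g i) s / (t - s) powr \<beta>))" if "0 < t" "i \<in> A" for t i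
    using g[OF that(2)] that(1) by (auto simp: caputo_diff_def set_integrable_def)
  have eq: "indicat_real {0<..<t} s *\<^sub>R (deriv ?S s / (t - s) powr \<beta>)
     = (\<Sum>i\<in>A. c * (indicat_real {0<..<t} s *\<^sub>R (deriv (g i) s / (t - s) powr \<beta>)))" for t s
    by (auto simp: indicator_def d sum_divide_distrib)
  show "caputo_diff \<beta> ?S"
    unfolding caputo_diff_def
  proof (intro conjI allI impI)
    show "?S field_differentiable at s" if "0 < s" for s
      using D[OF that] by (auto simp: field_differentiable_def)
    have "continuous_on {0<..} (\<lambda>s. \<Sum>i\<in>A. c * deriv (g i) s)"
      using g by (intro continuous_on_sum continuous_on_mult continuous_on_const caputo_diff_continuous)
    thus "continuous_on {0<..} (deriv ?S)" by (rule continuous_on_eq) (simp add: d)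
    show "set_integrable lborel {0<..<t} (\<lambda>s. deriv ?S s / (t - s) powr \<beta>)" if "0 < t" for t
      unfolding set_integrable_def eq using that by (intro Bochner_Integration.integrable_sum integrable_mult_right int)
  qed
  show "caputo \<beta> ?S t = (\<Sum>i\<in>A. c * caputo \<beta> (g i) t)" if "0 < t"
  proof -
    have "(\<integral>s. (\<Sum>i\<in>A. c * (indicat_real {0<..<t} s *\<^sub>R (deriv (g i) s / (t - s) powr \<beta>))) \<partial>lborel)
        = (\<Sum>i\<in>A. \<integral>s. c * (indicat_real {0<..<t} s *\<^sub>R (deriv (g i) s / (t - s) powr \<beta>)) \<partial>lborel)"
      using that by (intro Bochner_Integration.integral_sum integrable_mult_right int)
    thus ?thesis
      unfolding caputo_def set_lebesgue_integral_def eq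
      by (simp only: integral_mult_right_zero sum_distrib_left mult.left_commute)
  qed
qed

lemma
  assumes g: "\<And>i. i \<in> A \<Longrightarrow> caputo_diff_iter \<beta> N (g i)"
  shows caputo_diff_iter_cmult_sum: "caputo_diff_iter \<beta> N (\<lambda>s. \<Sum>i\<in>A. c * g i s)"
    and caputo_iter_cmult_sum: "k \<le> N \<Longrightarrow> 0 < t \<Longrightarrow>
      (caputo \<beta> ^^ k) (\<lambda>s. \<Sum>i\<in>A. c * g i s) t = (\<Sum>i\<in>A. c * (caputo \<beta> ^^ k) (g i) t)"
proof -
  have d: "caputo_diff \<beta> ((caputo \<beta> ^^ k) (g i))" if "i \<in> A" "k < N" for i k
    using g that by (simp add: caputo_diff_iter_def)
  have eq: "(caputo \<beta> ^^ k) (\<lambda>s. \<Sum>i\<in>A. c * g i s) t = (\<Sum>i\<in>A. c * (caputo \<beta> ^^ k) (g i) t)" if "k \<le> N" "0 < t" for k t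
    using that
  proof (induction k arbitrary: t)
    case (Suc k)
    have "caputo \<beta> ((caputo \<beta> ^^ k) (\<lambda>s. \<Sum>i\<in>A. c * g i s)) = caputo \<beta> (\<lambda>s. \<Sum>i\<in>A. c * (caputo \<beta> ^^ k) (g i) s)"
      by (rule caputo_cong) (use Suc in auto)
    moreover have "caputo \<beta> (\<lambda>s. \<Sum>i\<in>A. c * (caputo \<beta> ^^ k) (g i) s) t = (\<Sum>i\<in>A. c * caputo \<beta> ((caputo \<beta> ^^ k) (g i)) t)"
      using Suc.prems by (intro caputo_cmult_sum(2) d) auto
    ultimately show ?case by simp
  qed simp
  thus "k \<le> N \<Longrightarrow> 0 < t \<Longrightarrow> (caputo \<beta> ^^ k) (\<lambda>s. \<Sum>i\<in>A. c * g i s) t = (\<Sum>i\<in>A. c * (caputo \<beta> ^^ k) (g i) t)" .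
  show "caputo_diff_iter \<beta> N (\<lambda>s. \<Sum>i\<in>A. c * g i s)"
    unfolding caputo_diff_iter_def
  proof (intro allI impI)
    fix k assume k: "k < N"
    have "caputo_diff \<beta> ((caputo \<beta> ^^ k) (\<lambda>s. \<Sum>i\<in>A. c * g i s)) \<longleftrightarrow> caputo_diff \<beta> (\<lambda>s. \<Sum>i\<in>A. c * (caputo \<beta> ^^ k) (g i) s)"
      by (rule caputo_diff_cong) (use eq k in auto)
    thus "caputo_diff \<beta> ((caputo \<beta> ^^ k) (\<lambda>s. \<Sum>i\<in>A. c * g i s))"
      using caputo_cmult_sum(1)[of A \<beta> "\<lambda>i. (caputo \<beta> ^^ k) (g i)" c] d k by simp
  qed
qed

lemma top_order_iff: "2 ^ (\<nu> - 1) * a = b \<longleftrightarrow> 1 / 2 ^ \<nu> * b = 1/2 * (a::real)" if "2 \<le> (\<nu>::nat)"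
  using that by (cases \<nu>) (auto simp: field_simps)

lemma jointly_continuous_compose:
  assumes "jointly_continuous S g" "continuous_on A T" "continuous_on A X" "\<And>p. p \<in> A \<Longrightarrow> T p \<in> S"
  shows "continuous_on A (\<lambda>p. g (T p) (X p))"
proof -
  have "continuous_on A ((\<lambda>(t, x). g t x) \<circ> (\<lambda>p. (T p, X p)))"
    by (rule continuous_on_compose[OF continuous_on_Pair[OF assms(2,3)]
          continuous_on_subset[OF assms(1)[unfolded jointly_continuous_def]]]) (use assms(4) in auto)
  thus ?thesis by (simp add: comp_def)
qed

lemma continuous_on_upd: "continuous_on A s \<Longrightarrow> continuous_on A (\<lambda>p. upd t j (s p))"
  unfolding upd_def
proof (rule continuous_on_vec_lambda)
  fix i assume "continuous_on A s"
  thus "continuous_on A (\<lambda>p. if i = j then s p else t $ i)" by (cases "i = j") auto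
qed

section \<open>Commuting space derivatives with Caputo derivatives, and the equivalence of the
  systems\<close>

locale mixed_data =
  fixes \<nu> :: nat and \<beta> :: real and j :: "'n::finite" and V :: "real^'n \<Rightarrow> real^'d::finite \<Rightarrow> real"
  assumes nu2: "2 \<le> \<nu>" and beta: "\<beta> = 1 / real \<nu>" and mixed: "mixed_C \<beta> \<nu> j V"
begin

lemma beta_bounds: "0 < \<beta>" "\<beta> < 1"
  using nu2 by (auto simp: beta)

abbreviation CV :: "nat \<Rightarrow> real^'n \<Rightarrow> real^'d \<Rightarrow> real" where "CV k \<equiv> (caputo_dt \<beta> j ^^ k) V"
abbreviation CP :: "nat \<Rightarrow> 'd list \<Rightarrow> real^'n \<Rightarrow> real^'d \<Rightarrow> real" where "CP k is \<equiv> (caputo_dt \<beta> j ^^ k) (\<lambda>t. pdxs is (V t))"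

lemma CV_space_C: "k \<le> \<nu> - 1 \<Longrightarrow> space_C 2 open_orthant (CV k)"
  using mixed by (simp add: mixed_C_def)

lemma CV_exist: "k \<le> \<nu> - 1 \<Longrightarrow> t \<in> open_orthant \<Longrightarrow> pdx_exist 2 (CV k t)"
  using CV_space_C by (simp add: space_C_def)

lemma CV_continuous: "k \<le> \<nu> - 1 \<Longrightarrow> length is \<le> 2 \<Longrightarrow> jointly_continuous open_orthant (\<lambda>t. pdxs is (CV k t))"
  using CV_space_C by (simp add: space_C_def)

lemma CP_continuous: "k \<le> \<nu> - 1 \<Longrightarrow> length is \<le> 2 \<Longrightarrow> jointly_continuous open_orthant (CP k is)"
  using mixed by (simp add: mixed_C_def)

lemma CP_dt_continuous: "k < \<nu> - 1 \<Longrightarrow> length is \<le> 2 \<Longrightarrow> jointly_continuous open_orthant (dt j (CP k is))"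
  using mixed by (simp add: mixed_C_def)

lemma CP_caputo_diff_iter:
  "length is \<le> 2 \<Longrightarrow> t \<in> open_orthant \<Longrightarrow> caputo_diff_iter \<beta> (\<nu> - 1) (\<lambda>s. pdxs is (V (upd t j s)) x)"
  using mixed by (simp add: mixed_C_def)

lemma CP_caputo_diff:
  assumes "k < \<nu> - 1" "length is \<le> 2" "t \<in> open_orthant"
  shows "caputo_diff \<beta> (\<lambda>s. CP k is (upd t j s) x)"
  unfolding caputo_dt_iter_slice using CP_caputo_diff_iter[OF assms(2,3)] assms(1)
  by (simp add: caputo_diff_iter_def)

lemma CP_Suc: "CP (Suc k) is t x = rl_integral (1 - \<beta>) (deriv (\<lambda>s. CP k is (upd t j s) x)) (t $ j)"
  by (simp only: funpow.simps comp_def caputo_dt_def[of \<beta> j "CP k is"] caputo_eq_rl_integral)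

lemma CP_eq: "length is \<le> 2 \<Longrightarrow> k \<le> \<nu> - 1 \<Longrightarrow> t \<in> open_orthant \<Longrightarrow> CP k is t x = pdxs is (CV k t) x"
proof (induction "is" arbitrary: k t x)
  case (Cons i "is")
  hence len: "length is \<le> 2" "length is < 2" "length (i # is) \<le> 2" by auto
  note IH = Cons.IH[OF len(1)]
  show ?case
    using Cons.prems(2,3)
  proof (induction k arbitrary: t x)
    case (Suc k)
    hence k: "k < \<nu> - 1" "k \<le> \<nu> - 1" and t: "t \<in> open_orthant" by auto
    have t0: "0 < t $ j" using t by (simp add: open_orthant_def)
    let ?x = "\<lambda>y. x + y *\<^sub>R axis i (1::real)"
    have cx: "continuous_on A ?x" for A by (intro continuous_intros)
    define g where "g = (\<lambda>s y. CP k is (upd t j s) (?x y))"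
    define gx where "gx = (\<lambda>s y. CP k (i # is) (upd t j s) (?x y))"
    define gs where "gs = (\<lambda>s y. deriv (\<lambda>s. CP k is (upd t j s) (?x y)) s)"
    define gxs where "gxs = (\<lambda>s y. deriv (\<lambda>s. CP k (i # is) (upd t j s) (?x y)) s)"
    have gx_eq: "CP (Suc k) (i # is) t (?x y) = rl_integral (1 - \<beta>) (\<lambda>s. gxs s y) (t $ j)" for y
      unfolding CP_Suc gxs_def ..
    have g_eq: "pdxs is (CV (Suc k) t) (?x y) = rl_integral (1 - \<beta>) (\<lambda>s. gs s y) (t $ j)" for y
      unfolding IH[OF Suc.prems, symmetric] CP_Suc gs_def ..
    define D where "D = (\<lambda>y. pdxs (i # is) (CV (Suc k) t) (?x y))"
    \<comment> \<open>D differentiates the kernel integral in y, using the space regularity of the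
      Caputo derivative; the right side integrates the mixed derivative. Both are continuous in y by
      \<open>mixed_C\<close>, as the exchange requires.\<close>
    have "D 0 = rl_integral (1 - \<beta>) (\<lambda>s. gxs s 0) (t $ j)"
    proof (rule rl_integral_deriv_commute[where g = g and gx = gx and gs = gs])
      show "0 < 1 - \<beta>" using beta_bounds by simp
      show "(g s has_real_derivative gx s y) (at y)" if s: "0 < s" for s y
      proof -
        have t': "upd t j s \<in> open_orthant" by (rule open_orthant_upd[OF t s])
        have "pd_at i (pdxs is (CV k (upd t j s))) (?x y) (pdxs (i # is) (CV k (upd t j s)) (?x y))"
          by (rule pdx_existD[OF CV_exist[OF k(2) t'] len(2)])
        from pd_at_shift[OF this] show ?thesis
          unfolding g_def gx_def IH[OF k(2) t'] Suc.IH[OF k(2) t'] .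
      qed
      show "continuous_on UNIV (gx s)" if "0 < s" for s
        unfolding gx_def
        by (rule jointly_continuous_compose[OF CP_continuous[OF k(2) len(3)] continuous_on_const cx]) (rule open_orthant_upd[OF t that])
      show "((\<lambda>s. g s y) has_real_derivative gs s y) (at s)" if "0 < s" for s y
        unfolding g_def gs_def by (rule caputo_diff_has_derivative[OF CP_caputo_diff[OF k(1) len(1) t] that])
      show "((\<lambda>s. gx s y) has_real_derivative gxs s y) (at s)" if "0 < s" for s y
        unfolding gx_def gxs_def by (rule caputo_diff_has_derivative[OF CP_caputo_diff[OF k(1) len(3) t] that])
      show "continuous_on ({0<..} \<times> UNIV) (\<lambda>(s, y). gxs s y)"
      proof -
        have "gxs s y = dt j (CP k (i # is)) (upd t j s) (?x y)" for s y by (simp add: gxs_def dt_def)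
        moreover have "continuous_on ({0<..} \<times> UNIV) (\<lambda>p. dt j (CP k (i # is)) (upd t j (fst p)) (?x (snd p)))"
          by (intro jointly_continuous_compose[OF CP_dt_continuous[OF k(1) len(3)]] continuous_on_upd continuous_intros)
            (auto intro: open_orthant_upd[OF t])
        ultimately show ?thesis by (simp add: case_prod_unfold)
      qed
      show "integrable lborel (\<lambda>s. indicator {0<..} s * gs s y * rl_kernel (1 - \<beta>) (t $ j - s))" for y
        unfolding gs_def by (rule caputo_diff_kernel[OF beta_bounds(2) CP_caputo_diff[OF k(1) len(1) t] t0])
      show "integrable lborel (\<lambda>s. indicator {0<..} s * gxs s y * rl_kernel (1 - \<beta>) (t $ j - s))" for y
        unfolding gxs_def by (rule caputo_diff_kernel[OF beta_bounds(2) CP_caputo_diff[OF k(1) len(3) t] t0])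
      show "continuous_on UNIV (\<lambda>y. rl_integral (1 - \<beta>) (\<lambda>s. gxs s y) (t $ j))"
        unfolding gx_eq[symmetric]
        by (rule jointly_continuous_compose[OF CP_continuous[OF Suc.prems(1) len(3)] continuous_on_const cx]) (rule t)
      show "((\<lambda>y. rl_integral (1 - \<beta>) (\<lambda>s. gs s y) (t $ j)) has_real_derivative D y) (at y)" for y
        unfolding g_eq[symmetric] D_def
        by (rule pd_at_shift[OF pdx_existD[OF CV_exist[OF Suc.prems(1) t] len(2)]])
      show "continuous_on UNIV D"
        unfolding D_def
        by (rule jointly_continuous_compose[OF CV_continuous[OF Suc.prems(1) len(3)] continuous_on_const cx]) (rule t)
    qed
    thus ?case using gx_eq[of 0] by (simp add: D_def)
  qed simp
qed simp

text \<open>The right side of the fractional equation along a slice: the function v to which the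
  Taylor expansion is applied.\<close>

definition half_lap :: "real^'n \<Rightarrow> real^'d \<Rightarrow> real \<Rightarrow> real" where
  "half_lap t x s = 1/2 * laplacian (V (upd t j s)) x"

lemma half_lap_eq: "half_lap t x = (\<lambda>s. \<Sum>i\<in>UNIV. 1/2 * pdxs [i, i] (V (upd t j s)) x)"
  by (rule ext) (simp add: half_lap_def laplacian_eq_pdxs sum_distrib_left del: pdxs_Cons)

lemma half_lap_diff_iter: "t \<in> open_orthant \<Longrightarrow> caputo_diff_iter \<beta> (\<nu> - 1) (half_lap t x)"
  unfolding half_lap_eq by (intro caputo_diff_iter_cmult_sum CP_caputo_diff_iter) auto

lemma half_lap_iter:
  assumes t: "t \<in> open_orthant" and k: "k \<le> \<nu> - 1" and s: "0 < s"
  shows "(caputo \<beta> ^^ k) (half_lap t x) s = 1/2 * laplacian (CV k (upd t j s)) x"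
proof -
  have "(caputo \<beta> ^^ k) (half_lap t x) s = (\<Sum>i\<in>UNIV. 1/2 * (caputo \<beta> ^^ k) (\<lambda>s. pdxs [i, i] (V (upd t j s)) x) s)"
    unfolding half_lap_eq by (intro caputo_iter_cmult_sum[OF _ k s] CP_caputo_diff_iter t) simp
  also have "\<dots> = (\<Sum>i\<in>UNIV. 1/2 * CP k [i, i] (upd t j s) x)"
    by (intro sum.cong refl) (simp add: caputo_dt_iter)
  also have "\<dots> = (\<Sum>i\<in>UNIV. 1/2 * pdxs [i, i] (CV k (upd t j s)) x)"
    by (intro sum.cong refl arg_cong2[where f = "(*)"] CP_eq k open_orthant_upd[OF t s]) simp
  finally show ?thesis by (simp add: laplacian_eq_pdxs sum_distrib_left)
qed

lemma half_lap_continuous: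
  assumes t: "t \<in> open_orthant"
  shows "continuous_on {0<..} ((caputo \<beta> ^^ (\<nu> - 1)) (half_lap t x))"
proof (rule continuous_on_eq)
  show "continuous_on {0<..} (\<lambda>s. \<Sum>i\<in>UNIV. 1/2 * pdxs [i, i] (CV (\<nu> - 1) (upd t j s)) x)"
    by (intro continuous_on_sum continuous_on_mult continuous_on_const jointly_continuous_compose[OF CV_continuous]
        continuous_on_upd continuous_on_id) (auto intro: open_orthant_upd[OF t])
  show "(\<Sum>i\<in>UNIV. 1/2 * pdxs [i, i] (CV (\<nu> - 1) (upd t j s)) x) = (caputo \<beta> ^^ (\<nu> - 1)) (half_lap t x) s" if "s \<in> {0<..}" for s
    using that by (simp add: half_lap_iter[OF t] laplacian_eq_pdxs sum_distrib_left)
qed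

lemma slice_iff:
  fixes f :: "real^'d \<Rightarrow> real" and u :: "real^'n \<Rightarrow> real^'d \<Rightarrow> real"
  assumes t: "t \<in> open_orthant" and u: "caputo_diff \<beta> (\<lambda>s. u (upd t j s) x)"
    and lim: "\<And>k. k < \<nu> - 1 \<Longrightarrow> ((caputo \<beta> ^^ k) (half_lap t x) \<longlongrightarrow> initial_datum E \<nu> f j (Suc k) t x) (at_right 0)"
  shows "(\<forall>s>0. caputo_dt \<beta> j u (upd t j s) x = 1/2 * laplacian (V (upd t j s)) x) \<longleftrightarrow>
    (\<forall>s>0. dt j u (upd t j s) x =
      datum_series E \<nu> f j (upd t j s) x
      + 1/2 * laplacian (CV (\<nu> - 1) (upd t j s)) x)"
proof -
  have e1: "caputo_dt \<beta> j u (upd t j s) x = caputo \<beta> (\<lambda>s. u (upd t j s) x) s" for s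
    by (simp add: caputo_dt_def)
  have e2: "1/2 * laplacian (V (upd t j s)) x = half_lap t x s" for s by (simp add: half_lap_def)
  have e3: "(caputo \<beta> ^^ (\<nu> - 1)) (half_lap t x) s = 1/2 * laplacian (CV (\<nu> - 1) (upd t j s)) x" if "0 < s" for s
    by (rule half_lap_iter[OF t order_refl that])
  have "(\<forall>s>0. caputo \<beta> (\<lambda>s. u (upd t j s) x) s = half_lap t x s) \<longleftrightarrow>
    (\<forall>s>0. dt j u (upd t j s) x =
      datum_series E \<nu> f j (upd t j s) x
      + (caputo \<beta> ^^ (\<nu> - 1)) (half_lap t x) s)"
    by (rule slice_equivalence[where u = u and t = t and j = j and x = x and f = f and E = E and v = "half_lap t x", OF nu2 beta t u half_lap_diff_iter[OF t] lim half_lap_continuous[OF t]])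
  also have "\<dots> \<longleftrightarrow> (\<forall>s>0. dt j u (upd t j s) x =
      datum_series E \<nu> f j (upd t j s) x
      + 1/2 * laplacian (CV (\<nu> - 1) (upd t j s)) x)"
    by (intro all_cong arg_cong2[where f = "(=)"] arg_cong2[where f = "(+)"] refl e3)
  finally show ?thesis unfolding e1 e2 .
qed

text \<open>Under (R) this function is the Caputo derivative of u, so its k-th trace is the trace of
  order k + 1 of u, which (I) prescribes.\<close>

lemma datum_limits_R:
  assumes I: "cond_I \<beta> E \<nu> f j u" and R: "system_R \<beta> E f j u V" and t: "t \<in> open_orthant" and k: "k < \<nu> - 1"
  shows "((caputo \<beta> ^^ k) (half_lap t x) \<longlongrightarrow> initial_datum E \<nu> f j (Suc k) t x) (at_right 0)"
proof -
  have "Suc k \<in> {1..\<nu> - 1}" using k by simp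
  hence lim: "((\<lambda>s. (caputo_dt \<beta> j ^^ Suc k) u (upd t j s) x) \<longlongrightarrow> initial_datum E \<nu> f j (Suc k) t x) (at_right 0)"
    using I open_orthant_orthant[OF t] unfolding cond_I_def by blast
  have eq: "(caputo_dt \<beta> j ^^ Suc k) u (upd t j s) x = (caputo \<beta> ^^ k) (half_lap t x) s" if s: "0 < s" for s
  proof -
    have eq: "caputo \<beta> (\<lambda>s. u (upd t j s) x) s = half_lap t x s" if "0 < s" for s
    proof -
      have "caputo_dt \<beta> j u (upd t j s) x = 1/2 * laplacian (V (upd t j s)) x"
        using R open_orthant_upd[OF t that] unfolding system_R_def by blast
      thus ?thesis by (simp add: caputo_dt_def half_lap_def)
    qed
    have "(caputo_dt \<beta> j ^^ Suc k) u (upd t j s) x = (caputo \<beta> ^^ Suc k) (\<lambda>s. u (upd t j s) x) s"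
      by (simp only: caputo_dt_iter upd_upd upd_nth refl if_True)
    also have "\<dots> = (caputo \<beta> ^^ k) (caputo \<beta> (\<lambda>s. u (upd t j s) x)) s"
      by (simp only: funpow_Suc_right comp_def)
    also have "\<dots> = (caputo \<beta> ^^ k) (half_lap t x) s" by (rule caputo_iter_cong_pos[OF eq s])
    finally show ?thesis .
  qed
  have "eventually (\<lambda>s. (caputo_dt \<beta> j ^^ Suc k) u (upd t j s) x = (caputo \<beta> ^^ k) (half_lap t x) s) (at_right 0)"
    using eq by (simp only: eventually_at_filter greaterThan_iff) simp
  with lim show ?thesis by (rule Lim_transform_eventually)
qed

lemma caputo_diff_cond_I:
  assumes I: "cond_I \<beta> E \<nu> f j u" and t: "t \<in> open_orthant"
  shows "caputo_diff \<beta> (\<lambda>s. u (upd t j s) x)"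
proof -
  have "1 \<in> {1..\<nu> - 1}" using nu2 by simp
  hence "caputo_diff_iter \<beta> 1 (\<lambda>s. u (upd t j s) x)"
    using I open_orthant_orthant[OF t] unfolding cond_I_def by blast
  thus ?thesis by (simp add: caputo_diff_iter_def)
qed

lemma system_P_equation:
  assumes I: "cond_I \<beta> E \<nu> f j u" and R: "system_R \<beta> E f j u V" and t: "t \<in> open_orthant"
  shows "dt j u t x = datum_series E \<nu> f j t x
      + 1/2 * laplacian (CV (\<nu> - 1) t) x"
proof -
  have t0: "0 < t $ j" using t by (simp add: open_orthant_def)
  have "\<forall>s>0. caputo_dt \<beta> j u (upd t j s) x = 1/2 * laplacian (V (upd t j s)) x"
    using R open_orthant_upd[OF t] unfolding system_R_def by blast
  from iffD1[OF slice_iff[OF t caputo_diff_cond_I[OF I t] datum_limits_R[OF I R t]] this, rule_format, OF _ t0]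
  show ?thesis by simp
qed

lemma R_imp_P:
  assumes I: "cond_I \<beta> E \<nu> f j u" and C: "cond_C \<beta> E \<nu> f j U V" and R: "system_R \<beta> E f j u V"
  shows "system_P E \<nu> f j u U"
  unfolding system_P_def
proof (intro conjI ballI allI impI)
  fix t :: "real^'n" and x
  show "space_C (2 * \<nu>) open_orthant U" using C by (simp add: cond_C_def)
  show "u t x = f x" if "t \<in> orthant_boundary" using R that by (simp add: system_R_def)
  show "U t x = 0" if "t \<in> orthant" "\<exists>i. i \<noteq> j \<and> t $ i = 0" using C that by (simp add: cond_C_def)
  show "U t x = f x * N_fun E \<nu> j t" if "t \<in> orthant" "t $ j = 0" using C that by (simp add: cond_C_def)
  assume t: "t \<in> open_orthant"
  have t0: "0 < t $ j" using t by (simp add: open_orthant_def)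
  show "(\<lambda>s. u (upd t j s) x) field_differentiable at (t $ j)"
    using caputo_diff_cond_I[OF I t] t0 by (simp add: caputo_diff_def)
  have "1 / 2 ^ \<nu> * (laplacian ^^ \<nu>) (U t) x = 1/2 * laplacian (CV (\<nu> - 1) t) x"
    using C t unfolding cond_C_def top_order_iff[OF nu2] by blast
  thus "dt j u t x = datum_series E \<nu> f j t x +
      1 / 2 ^ \<nu> * (laplacian ^^ \<nu>) (U t) x"
    using system_P_equation[OF I R t, of x] by simp
qed

lemma RP_imp_C:
  assumes I: "cond_I \<beta> E \<nu> f j u" and R: "system_R \<beta> E f j u V" and P: "system_P E \<nu> f j u U"
  shows "cond_C \<beta> E \<nu> f j U V"
  unfolding cond_C_def
proof (intro conjI ballI allI impI)
  fix t :: "real^'n" and x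
  show "space_C (2 * \<nu>) open_orthant U" using P by (simp add: system_P_def)
  show "space_C 2 open_orthant (CV (\<nu> - 1))" by (rule CV_space_C) simp
  show "U t x = f x * N_fun E \<nu> j t" if "t \<in> orthant" "t $ j = 0" using P that by (simp add: system_P_def)
  show "V t x = f x * (\<Prod>i\<in>UNIV - {j}. E 1 * t $ i powr \<beta>)" if "t \<in> orthant" "t $ j = 0"
    using R that by (simp add: system_R_def)
  show "V t x = 0" if "t \<in> orthant" "\<exists>i. i \<noteq> j \<and> t $ i = 0" using R that by (simp add: system_R_def)
  show "U t x = 0" if "t \<in> orthant" "\<exists>i. i \<noteq> j \<and> t $ i = 0" using P that by (simp add: system_P_def)
  assume t: "t \<in> open_orthant"
  show "caputo_diff_iter \<beta> (\<nu> - 1) (\<lambda>s. V (upd t j s) x)"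
    using CP_caputo_diff_iter[of "[]" t x] t by simp
  show "2 ^ (\<nu> - 1) * laplacian (CV (\<nu> - 1) t) x = (laplacian ^^ \<nu>) (U t) x"
    unfolding top_order_iff[OF nu2] using system_P_equation[OF I R t, of x] P t by (simp add: system_P_def)
qed

text \<open>V has continuous second derivatives up to t_j = 0, where it is a multiple of f; so
  \<Delta> may be taken of the boundary value. The hypothesis on E 1 is the moment identity that
  turns the constant in the boundary value of V into the one in (I) for k = 1.\<close>

lemma laplacian_trace:
  assumes f: "pdx_exist 2 f" and C: "cond_C \<beta> E \<nu> f j U V" and E1: "Gamma (1 / real \<nu>) * E 1 / real \<nu> = 1"
    and t: "t \<in> open_orthant"
  shows "(half_lap t x \<longlongrightarrow> initial_datum E \<nu> f j 1 t x) (at_right 0)"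
proof -
  define c where "c = (\<Prod>i\<in>UNIV - {j}. E 1 * t $ i powr \<beta>)"
  have sp: "space_C 2 orthant V" using mixed by (simp add: mixed_C_def)
  have up: "upd t j s \<in> orthant" if "0 \<le> s" for s using open_orthant_orthant[OF t] that by (simp add: orthant_def)
  have "continuous_on {0..} (half_lap t x)"
    unfolding half_lap_eq
  proof (intro continuous_on_sum continuous_on_mult continuous_on_const)
    fix i
    have "jointly_continuous orthant (\<lambda>t. pdxs [i, i] (V t))" using sp by (simp add: space_C_def)
    thus "continuous_on {0..} (\<lambda>s. pdxs [i, i] (V (upd t j s)) x)"
      by (rule jointly_continuous_compose) (auto intro!: continuous_on_upd continuous_on_id up)
  qed
  hence "(half_lap t x \<longlongrightarrow> half_lap t x 0) (at 0 within {0..})" by (auto simp: continuous_on_def)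
  hence lim: "(half_lap t x \<longlongrightarrow> half_lap t x 0) (at_right 0)" by (rule tendsto_within_subset) auto
  have "V (upd t j 0) = (\<lambda>x. c * f x)"
  proof
    fix x
    have "V (upd t j 0) x = f x * (\<Prod>i\<in>UNIV - {j}. E 1 * upd t j 0 $ i powr \<beta>)"
      using C up[of 0] by (simp add: cond_C_def)
    also have "(\<Prod>i\<in>UNIV - {j}. E 1 * upd t j 0 $ i powr \<beta>) = c"
      unfolding c_def by (intro prod.cong) auto
    finally show "V (upd t j 0) x = c * f x" by simp
  qed
  hence "laplacian (V (upd t j 0)) x = c * laplacian f x"
    using pdxs_cmult[OF f, of _ c] by (simp add: laplacian_eq_pdxs sum_distrib_left)
  hence "half_lap t x 0 = 1/2 * (c * laplacian f x)" by (simp add: half_lap_def)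
  also have "\<dots> = initial_datum E \<nu> f j 1 t x"
  proof -
    have "c = E 1 ^ (CARD('n) - 1) * (\<Prod>i\<in>UNIV - {j}. t $ i powr (1 / real \<nu>))"
      by (simp add: c_def prod.distrib beta card_Diff_singleton)
    moreover have "E 1 ^ CARD('n) = E 1 * E 1 ^ (CARD('n) - 1)" by (cases "CARD('n)") auto
    ultimately have "initial_datum E \<nu> f j 1 t x = (Gamma (1 / real \<nu>) * E 1 / real \<nu>) * (1/2 * (c * laplacian f x))"
      by (simp add: initial_datum_def mult_ac)
    thus ?thesis unfolding E1 by simp
  qed
  finally show ?thesis using lim by simp
qed

text \<open>The equation for \<Delta>V/2 is not yet known, so its traces cannot be taken from u. The
  lowest follows from the boundary value of V, the higher ones are \<open>caputo_traces\<close>;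
  then the slice equivalence is read backwards.\<close>

lemma P_imp_R:
  assumes f: "pdx_exist 2 f" and E1: "Gamma (1 / real \<nu>) * E 1 / real \<nu> = 1"
    and I: "cond_I \<beta> E \<nu> f j u" and C: "cond_C \<beta> E \<nu> f j U V" and T: "caputo_traces \<beta> E \<nu> f j V"
    and P: "system_P E \<nu> f j u U"
  shows "system_R \<beta> E f j u V"
  unfolding system_R_def
proof (intro conjI ballI allI impI)
  fix t :: "real^'n" and x
  show "space_C 2 open_orthant V" using CV_space_C[of 0] by simp
  show "u t x = f x" if "t \<in> orthant_boundary" using P that by (simp add: system_P_def)
  show "V t x = (\<Prod>i\<in>UNIV - {j}. E 1 * t $ i powr \<beta>) * f x" if "t \<in> orthant" "t $ j = 0"
    using C that by (simp add: cond_C_def)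
  show "V t x = 0" if "t \<in> orthant" "\<exists>i. i \<noteq> j \<and> t $ i = 0" using C that by (simp add: cond_C_def)
  assume t: "t \<in> open_orthant"
  have t0: "0 < t $ j" using t by (simp add: open_orthant_def)
  show "caputo_diff \<beta> (\<lambda>s. u (upd t j s) x)" by (rule caputo_diff_cond_I[OF I t])
  have lim: "((caputo \<beta> ^^ k) (half_lap t x) \<longlongrightarrow> initial_datum E \<nu> f j (Suc k) t x) (at_right 0)" if k: "k < \<nu> - 1" for k
  proof (cases "k = 0")
    case True
    thus ?thesis using laplacian_trace[OF f C E1 t, of x] by simp
  next
    case False
    hence "1 \<le> k \<and> k + 2 \<le> \<nu>" using k by simp
    hence "((\<lambda>s. 1/2 * laplacian (CV k (upd t j s)) x) \<longlongrightarrow> initial_datum E \<nu> f j (k + 1) t x) (at_right 0)"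
      using T t unfolding caputo_traces_def by blast
    hence "((\<lambda>s. 1/2 * laplacian (CV k (upd t j s)) x) \<longlongrightarrow> initial_datum E \<nu> f j (Suc k) t x) (at_right 0)"
      by (simp only: Suc_eq_plus1)
    thus ?thesis
      by (rule Lim_transform_eventually) (use half_lap_iter[OF t, of k] k in \<open>auto simp: eventually_at_filter\<close>)
  qed
  have top: "1/2 * laplacian (CV (\<nu> - 1) t') x = 1 / 2 ^ \<nu> * (laplacian ^^ \<nu>) (U t') x" if t': "t' \<in> open_orthant" for t'
    by (rule sym) (use C t' in \<open>unfold cond_C_def top_order_iff[OF nu2], blast\<close>)
  have "\<forall>s>0. dt j u (upd t j s) x =
      datum_series E \<nu> f j (upd t j s) x
      + 1/2 * laplacian (CV (\<nu> - 1) (upd t j s)) x"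
  proof (intro allI impI)
    fix s :: real assume "0 < s"
    hence t': "upd t j s \<in> open_orthant" by (rule open_orthant_upd[OF t])
    hence "dt j u (upd t j s) x =
        datum_series E \<nu> f j (upd t j s) x
        + 1 / 2 ^ \<nu> * (laplacian ^^ \<nu>) (U (upd t j s)) x"
      using P unfolding system_P_def by blast
    thus "dt j u (upd t j s) x =
        datum_series E \<nu> f j (upd t j s) x
        + 1/2 * laplacian (CV (\<nu> - 1) (upd t j s)) x"
      unfolding top[OF t'] .
  qed
  from iffD2[OF slice_iff[OF t caputo_diff_cond_I[OF I t] lim] this, rule_format, OF _ t0]
  show "caputo_dt \<beta> j u t x = 1/2 * laplacian (V t) x" by simp
qed

end

section \<open>Assembly of the five statements\<close>

theorem theorem1p4:
  fixes \<nu> :: nat and \<alpha> \<beta> :: real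
    and f :: "real^'d::finite \<Rightarrow> real"
    and M :: "'w measure" and L :: "real \<Rightarrow> 'w \<Rightarrow> real"
    and E :: "real \<Rightarrow> real"
  assumes "2 \<le> \<nu>" and "\<beta> = 1 / real \<nu>"
    and "0 < \<alpha>" and "\<alpha> \<le> 1" and "bounded_holder_derivs (2 * \<nu> - 2) \<alpha> f"
    and "prob_space M" and "stable_subordinator M \<beta> L" and "E = inverse_moment M L"
  shows
    "\<comment> \<open>(1)\<close>
     (\<forall>(u :: real^'n::finite \<Rightarrow> real^'d \<Rightarrow> real) U V j.
        (\<forall>i. cond_I \<beta> E \<nu> f i u) \<and> mixed_C \<beta> \<nu> j V \<and> cond_C \<beta> E \<nu> f j U V \<longrightarrow>
        (system_R \<beta> E f j u V \<longrightarrow> system_P E \<nu> f j u U) \<and>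
        (caputo_traces \<beta> E \<nu> f j V \<longrightarrow> system_P E \<nu> f j u U \<longrightarrow> system_R \<beta> E f j u V)) \<and>
     \<comment> \<open>(2)\<close>
     (\<forall>(u :: real^'n \<Rightarrow> real^'d \<Rightarrow> real) U V j.
        (\<forall>i. cond_I \<beta> E \<nu> f i u) \<and> mixed_C \<beta> \<nu> j V \<and>
        system_R \<beta> E f j u V \<and> system_P E \<nu> f j u U \<longrightarrow>
        cond_C \<beta> E \<nu> f j U V) \<and>
     \<comment> \<open>(3)\<close>
     (\<forall>(u :: real^'n \<Rightarrow> real^'d \<Rightarrow> real) U V.
        (\<forall>j. cond_I \<beta> E \<nu> f j u) \<and> (\<forall>j. mixed_C \<beta> \<nu> j (V j)) \<longrightarrow>
        ((\<forall>j. cond_C \<beta> E \<nu> f j (U j) (V j)) \<longrightarrow>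
           ((\<forall>j. system_R \<beta> E f j u (V j)) \<longrightarrow> (\<forall>j. system_P E \<nu> f j u (U j))) \<and>
           ((\<forall>j. caputo_traces \<beta> E \<nu> f j (V j)) \<longrightarrow>
              (\<forall>j. system_P E \<nu> f j u (U j)) \<longrightarrow> (\<forall>j. system_R \<beta> E f j u (V j)))) \<and>
        ((\<forall>j. system_P E \<nu> f j u (U j)) \<and> (\<forall>j. system_R \<beta> E f j u (V j)) \<longrightarrow>
           (\<forall>j. cond_C \<beta> E \<nu> f j (U j) (V j)))) \<and>
     \<comment> \<open>(4)\<close>
     (\<forall>(W :: real^'n \<Rightarrow> 'w \<Rightarrow> real^'d) Ls. isl_sheet M \<beta> W Ls \<longrightarrow>
        (\<forall>j. cond_C \<beta> E \<nu> f j (isl_U M W Ls f \<nu> j) (isl_V M W Ls f j) \<and>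
             cond_I \<beta> E \<nu> f j (isl_u M W Ls f))) \<and>
     \<comment> \<open>(5)\<close>
     (\<forall>(W :: real^'n \<Rightarrow> 'w \<Rightarrow> real^'d) Ls j. CARD('n) = 1 \<and> isl_sheet M \<beta> W Ls \<longrightarrow>
        isl_u M W Ls f = isl_U M W Ls f \<nu> j \<and> isl_u M W Ls f = isl_V M W Ls f j \<and>
        cond_C \<beta> E \<nu> f j (isl_U M W Ls f \<nu> j) (isl_V M W Ls f j) \<and>
        cond_I \<beta> E \<nu> f j (isl_u M W Ls f) \<and>
        (system_R \<beta> E f j (isl_u M W Ls f) (isl_V M W Ls f j) \<longleftrightarrow>
         system_P E \<nu> f j (isl_u M W Ls f) (isl_U M W Ls f \<nu> j)))"
proof -
  interpret prob_space M by (rule assms(6))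
  interpret S: subordinator M \<nu> \<beta> L using assms by unfold_locales auto
  interpret D: holder_data \<nu> \<alpha> f using assms by unfold_locales auto
  note E = assms(8)
  have f2: "pdx_exist 2 f" using assms(1) by (intro pdx_exist_mono[OF D.f_exist]) simp
  \<comment> \<open>The first moment is 1 / Gamma(1 + \<beta>), and Gamma(1 + \<beta>) = \<beta>
    Gamma(\<beta>) with \<beta> = 1/\<nu>.\<close>
  have E1: "Gamma (1 / real \<nu>) * E 1 / real \<nu> = 1"
  proof -
    have "0 < Gamma (1 / real \<nu>)" using assms(1) by (intro Gamma_real_pos) simp
    hence "Gamma (1 / real \<nu>) \<noteq> 0" by (rule less_imp_neq[symmetric])
    moreover have "E 1 = 1 / Gamma (1 + \<beta>)" using S.inverse_moment_value[of 1] by (simp add: E)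
    moreover have "Gamma (1 + \<beta>) = Gamma (1 / real \<nu>) / real \<nu>" using S.Gamma_one_plus_beta assms(2) by simp
    ultimately show ?thesis using assms(1) by simp
  qed
  have mixed_data: "mixed_data \<nu> \<beta> j V" if "mixed_C \<beta> \<nu> j V" for V :: "real^'n \<Rightarrow> real^'d \<Rightarrow> real" and j
    using assms that by unfold_locales auto
  have RP: "system_P E \<nu> f j u U" if "cond_I \<beta> E \<nu> f j u" "mixed_C \<beta> \<nu> j V" "cond_C \<beta> E \<nu> f j U V" "system_R \<beta> E f j u V"
    for u :: "real^'n \<Rightarrow> real^'d \<Rightarrow> real" and U V j
    by (rule mixed_data.R_imp_P[OF mixed_data[OF that(2)] that(1,3,4)])
  have PR: "system_R \<beta> E f j u V" if "cond_I \<beta> E \<nu> f j u" "mixed_C \<beta> \<nu> j V" "cond_C \<beta> E \<nu> f j U V"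
    "caputo_traces \<beta> E \<nu> f j V" "system_P E \<nu> f j u U"
    for u :: "real^'n \<Rightarrow> real^'d \<Rightarrow> real" and U V j
    by (rule mixed_data.P_imp_R[OF mixed_data[OF that(2)] f2 E1 that(1,3,4,5)])
  have C: "cond_C \<beta> E \<nu> f j U V" if "cond_I \<beta> E \<nu> f j u" "mixed_C \<beta> \<nu> j V" "system_R \<beta> E f j u V" "system_P E \<nu> f j u U"
    for u :: "real^'n \<Rightarrow> real^'d \<Rightarrow> real" and U V j
    by (rule mixed_data.RP_imp_C[OF mixed_data[OF that(2)] that(1,3,4)])
  have isl: "isl_data M \<nu> \<beta> L W Ls \<alpha> f" if "isl_sheet M \<beta> W Ls" for W :: "real^'n \<Rightarrow> 'w \<Rightarrow> real^'d" and Ls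
    using that by unfold_locales
  have 4: "cond_C \<beta> E \<nu> f j (isl_U M W Ls f \<nu> j) (isl_V M W Ls f j)" "cond_I \<beta> E \<nu> f j (isl_u M W Ls f)"
    "system_R \<beta> E f j (isl_u M W Ls f) (isl_V M W Ls f j)" "system_P E \<nu> f j (isl_u M W Ls f) (isl_U M W Ls f \<nu> j)"
    if "isl_sheet M \<beta> W Ls" for W :: "real^'n \<Rightarrow> 'w \<Rightarrow> real^'d" and Ls j
  proof -
    interpret X: isl_data M \<nu> \<beta> L W Ls \<alpha> f j by (rule isl[OF that])
    show "cond_C \<beta> E \<nu> f j (isl_U M W Ls f \<nu> j) (isl_V M W Ls f j)" "cond_I \<beta> E \<nu> f j (isl_u M W Ls f)"
      "system_R \<beta> E f j (isl_u M W Ls f) (isl_V M W Ls f j)" "system_P E \<nu> f j (isl_u M W Ls f) (isl_U M W Ls f \<nu> j)"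
      unfolding E X.isl_J by (rule X.cond_C_J X.cond_I_J X.system_R_J X.system_P_J)+
  qed
  have 5: "isl_u M W Ls f = isl_U M W Ls f \<nu> j" "isl_u M W Ls f = isl_V M W Ls f j" if "CARD('n) = 1"
    for W :: "real^'n \<Rightarrow> 'w \<Rightarrow> real^'d" and Ls j
  proof -
    obtain a where "(UNIV :: 'n set) = {a}" using \<open>CARD('n) = 1\<close> card_1_singletonE by blast
    hence "i = j" for i :: 'n by (metis UNIV_I singletonD)
    hence e: "UNIV - {j} = {}" by auto
    \<comment> \<open>With a single index the products over i \<noteq> j are empty, so every clock
      factor is 1 and the three functionals coincide by definition.\<close>
    thus "isl_u M W Ls f = isl_U M W Ls f \<nu> j" "isl_u M W Ls f = isl_V M W Ls f j"
      unfolding fun_eq_iff isl_u_def isl_U_def isl_V_def e by simp_all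
  qed
  show ?thesis
  proof (intro conjI, goal_cases)
    case 1
    show ?case
    proof (intro allI impI, goal_cases)
      case (1 u U V j)
      thus ?case using RP[of j u V U] PR[of j u V U] by simp
    qed
  next
    case 2
    show ?case
    proof (intro allI impI, goal_cases)
      case (1 u U V j)
      thus ?case using C[of j u V U] by simp
    qed
  next
    case 3
    show ?case
    proof (intro allI impI, goal_cases)
      case (1 u U V)
      thus ?case
        using RP[of j u "V j" "U j" for j] PR[of j u "V j" "U j" for j] C[of j u "V j" "U j" for j] by simp
    qed
  \<comment> \<open>For the sheet with n = 1 both systems hold outright, and this is how the
    equivalence in (5) is settled.\<close>
  qed (intro allI impI conjI iffI; (elim conjE)?; (rule 4 5; assumption))+
qed

end
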